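(* Let $r\ge 2$ and let $C\subset\mathbb{P}^r$ be the rational normal curve of degree $r$. For every non-zero map $\mu:\mathcal{O}_{\mathbb{P}^1}^{r-1}(-r-2)\to\mathcal{O}_{\mathbb{P}^1}(-r-2)$, the double structure $X\subset\mathbb{P}^r$ on $C$ associated to $\mu$ (which has degree $2r$ and arithmetic genus $r+1$) is a non-degenerate arithmetically Cohen–Macaulay curve. Furthermore, if $\mu$ is general, then $X$ is arithmetically Gorenstein. If $\mu=(\alpha^{r-2},\alpha^{r-3}\beta,\dots,\beta^{r-2})$ for some $(\alpha,\beta)\in K^2\setminus\{(0,0)\}$, then $X$ is contained in a cone over a rational normal curve $C'\subset\mathbb{P}^{r-1}$.
   Context: $K$ is an algebraically closed field of characteristic $0$, $R=K[x_0,\dots,x_r]$, $\mathbb{P}^r=\operatorname{Proj}R$. Up to coordinates, $C\subset\mathbb{P}^r$ is defined by the $2\times 2$ minors $f_{pq}=x_{p-1}x_q-x_px_{q-1}$ ($1\le p<q\le r$) of $\begin{pmatrix} x_0 & x_1 & \cdots & x_{r-1} \\ x_1 & x_2 & \cdots & x_r \end{pmatrix}$, with the isomorphism $j:\mathbb{P}^1\to C$, $j(t:u)=(t^r:t^{r-1}u:\cdots:u^r)$. The pulled back conormal sheaf $j^*(\mathcal{I}_C/\mathcal{I}_C^2)$ is identified with $\mathcal{O}_{\mathbb{P}^1}^{r-1}(-r-2)$, with canonical basis $g_1,\dots,g_{r-1}$, so that the class of $f_{pq}$ is $\sum_{h=p}^{q-1}t^{r-h-1}u^{h-1}g_{p+q-1-h}$.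 A non-zero (hence surjective) map $\mu=(a_0,\dots,a_{r-2})$, $a_i\in K$, $\mu(g_i)=a_{i-1}$, corresponds to a surjection $\mathcal{I}_C/\mathcal{I}_C^2\to\mathcal{L}=j_*\mathcal{O}_{\mathbb{P}^1}(-r-2)$; the associated double structure $X$ on $C$ is the curve with ideal sheaf $\mathcal{I}_X$, $\mathcal{I}_C^2\subseteq\mathcal{I}_X\subseteq\mathcal{I}_C$, such that $\mathcal{I}_X/\mathcal{I}_C^2$ is the kernel of this surjection. "General" means for all $\mu$ in some non-empty Zariski open subset of the space of such maps. A curve $X$ is arithmetically Cohen–Macaulay (resp. arithmetically Gorenstein) if its homogeneous coordinate ring $R/I_X$ is Cohen–Macaulay (resp. Gorenstein); non-degenerate means not contained in a hyperplane. *)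

theory Defs
  imports
    "HOL-Library.Poly_Mapping"
    "HOL-Library.FuncSet"
    "HOL-Library.Extended_Nat"
    "HOL-Computational_Algebra.Polynomial"
    "HOL-Algebra.QuotRing"
    "HOL-Algebra.Ring_Divisibility"
begin

section \<open>Commutative algebra\<close>

subsection \<open>Localization\<close>

text \<open>Fractions \<open>a/s\<close> with \<open>a\<close> in the ring and \<open>s \<in> S\<close>, where \<open>a/s = b/t\<close> iff
  \<open>u (a t - b s) = 0\<close> for some \<open>u \<in> S\<close>.\<close>

definition frac_rel :: "('a, 'b) ring_scheme \<Rightarrow> 'a set \<Rightarrow> (('a \<times> 'a) \<times> ('a \<times> 'a)) set" where
  "frac_rel A S = {((a, s), (b, t)). a \<in> carrier A \<and> b \<in> carrier A \<and> s \<in> S \<and> t \<in> S \<and>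
     (\<exists>u\<in>S. u \<otimes>\<^bsub>A\<^esub> (a \<otimes>\<^bsub>A\<^esub> t) = u \<otimes>\<^bsub>A\<^esub> (b \<otimes>\<^bsub>A\<^esub> s))}"

definition fraction :: "('a, 'b) ring_scheme \<Rightarrow> 'a set \<Rightarrow> 'a \<Rightarrow> 'a \<Rightarrow> ('a \<times> 'a) set" where
  "fraction A S a s = frac_rel A S `` {(a, s)}"

definition localization :: "('a, 'b) ring_scheme \<Rightarrow> 'a set \<Rightarrow> ('a \<times> 'a) set ring" where
  "localization A S =
    \<lparr> carrier = (carrier A \<times> S) // frac_rel A S,
      mult = (\<lambda>X Y. \<Union>(a, s)\<in>X. \<Union>(b, t)\<in>Y. fraction A S (a \<otimes>\<^bsub>A\<^esub> b) (s \<otimes>\<^bsub>A\<^esub> t)),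
      one = fraction A S \<one>\<^bsub>A\<^esub> \<one>\<^bsub>A\<^esub>,
      zero = fraction A S \<zero>\<^bsub>A\<^esub> \<one>\<^bsub>A\<^esub>,
      add = (\<lambda>X Y. \<Union>(a, s)\<in>X. \<Union>(b, t)\<in>Y.
              fraction A S ((a \<otimes>\<^bsub>A\<^esub> t) \<oplus>\<^bsub>A\<^esub> (b \<otimes>\<^bsub>A\<^esub> s)) (s \<otimes>\<^bsub>A\<^esub> t)) \<rparr>"

subsection \<open>Dimension, depth, Cohen--Macaulay and Gorenstein rings\<close>

definition krull_dim :: "('a, 'b) ring_scheme \<Rightarrow> enat" where
  "krull_dim A = Sup {enat n | n. \<exists>P :: nat \<Rightarrow> 'a set.
     (\<forall>i\<le>n. primeideal (P i) A) \<and> (\<forall>i<n. P i \<subset> P (Suc i))}"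

definition local_ring :: "('a, 'b) ring_scheme \<Rightarrow> 'a set \<Rightarrow> bool" where
  "local_ring A M \<longleftrightarrow> cring A \<and> {J. maximalideal J A} = {M}"

text \<open>The condition that a regular sequence generates a proper ideal is automatic below, where
  its members lie in a maximal ideal.\<close>

definition regular_sequence :: "('a, 'b) ring_scheme \<Rightarrow> 'a list \<Rightarrow> bool" where
  "regular_sequence A xs \<longleftrightarrow> set xs \<subseteq> carrier A \<and>
     (\<forall>i<length xs. \<forall>y\<in>carrier A.
        xs ! i \<otimes>\<^bsub>A\<^esub> y \<in> Idl\<^bsub>A\<^esub> (set (take i xs)) \<longrightarrow> y \<in> Idl\<^bsub>A\<^esub> (set (take i xs)))"

definition depth :: "('a, 'b) ring_scheme \<Rightarrow> 'a set \<Rightarrow> enat" where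
  "depth A M = Sup {enat (length xs) | xs. set xs \<subseteq> M \<and> regular_sequence A xs}"

definition local_cohen_macaulay :: "('a, 'b) ring_scheme \<Rightarrow> bool" where
  "local_cohen_macaulay A \<longleftrightarrow> noetherian_ring A \<and>
     (\<exists>M. local_ring A M \<and> depth A M = krull_dim A)"

definition cohen_macaulay_ring :: "('a, 'b) ring_scheme \<Rightarrow> bool" where
  "cohen_macaulay_ring A \<longleftrightarrow> cring A \<and> noetherian_ring A \<and>
     (\<forall>M. maximalideal M A \<longrightarrow> local_cohen_macaulay (localization A (carrier A - M)))"

definition irreducible_ideal :: "'a set \<Rightarrow> ('a, 'b) ring_scheme \<Rightarrow> bool" where
  "irreducible_ideal Q A \<longleftrightarrow> ideal Q A \<and> Q \<noteq> carrier A \<and>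
     (\<forall>I J. ideal I A \<longrightarrow> ideal J A \<longrightarrow> Q = I \<inter> J \<longrightarrow> Q = I \<or> Q = J)"

definition system_of_parameters :: "('a, 'b) ring_scheme \<Rightarrow> 'a set \<Rightarrow> 'a list \<Rightarrow> bool" where
  "system_of_parameters A M xs \<longleftrightarrow> set xs \<subseteq> M \<and> enat (length xs) = krull_dim A \<and>
     (\<forall>x\<in>M. \<exists>n::nat. x [^]\<^bsub>A\<^esub> n \<in> Idl\<^bsub>A\<^esub> (set xs))"

text \<open>A Noetherian local ring is Gorenstein if it is Cohen--Macaulay and its parameter ideals
  are irreducible (Matsumura, Commutative Ring Theory, Section 18; Kunz, Introduction to
  Commutative Algebra and Algebraic Geometry, Chapter VI).\<close>

definition local_gorenstein :: "('a, 'b) ring_scheme \<Rightarrow> bool" where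
  "local_gorenstein A \<longleftrightarrow> local_cohen_macaulay A \<and>
     (\<forall>M xs. local_ring A M \<longrightarrow> system_of_parameters A M xs \<longrightarrow>
        irreducible_ideal (Idl\<^bsub>A\<^esub> (set xs)) A)"

definition gorenstein_ring :: "('a, 'b) ring_scheme \<Rightarrow> bool" where
  "gorenstein_ring A \<longleftrightarrow> cring A \<and> noetherian_ring A \<and>
     (\<forall>M. maximalideal M A \<longrightarrow> local_gorenstein (localization A (carrier A - M)))"

section \<open>Polynomial rings\<close>

type_synonym 'k mpol = "(nat \<Rightarrow>\<^sub>0 nat) \<Rightarrow>\<^sub>0 'k"

definition Const :: "'k::zero \<Rightarrow> 'k mpol" where
  "Const c = Poly_Mapping.single 0 c"

definition X :: "nat \<Rightarrow> 'k::zero_neq_one mpol" where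
  "X i = Poly_Mapping.single (Poly_Mapping.single i 1) 1"

definition mon_deg :: "(nat \<Rightarrow>\<^sub>0 nat) \<Rightarrow> nat" where
  "mon_deg m = (\<Sum>i\<in>Poly_Mapping.keys m. Poly_Mapping.lookup m i)"

text \<open>Polynomials in the \<open>n\<close> variables \<open>X 0, \<dots>, X (n - 1)\<close>. The coordinate ring of projective
  \<open>r\<close>-space is \<open>poly_ring (Suc r)\<close>.\<close>

definition polys :: "nat \<Rightarrow> 'k::zero mpol set" where
  "polys n = {p. \<forall>m\<in>Poly_Mapping.keys p. Poly_Mapping.keys m \<subseteq> {..<n}}"

definition poly_ring :: "nat \<Rightarrow> 'k::comm_ring_1 mpol ring" where
  "poly_ring n = \<lparr> carrier = polys n, mult = (*), one = 1, zero = 0, add = (+) \<rparr>"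

definition homogeneous :: "nat \<Rightarrow> nat \<Rightarrow> 'k::zero mpol set" where
  "homogeneous n d = {p \<in> polys n. \<forall>m\<in>Poly_Mapping.keys p. mon_deg m = d}"

definition eval_with :: "('k::zero \<Rightarrow> 'b) \<Rightarrow> (nat \<Rightarrow> 'b) \<Rightarrow> 'k mpol \<Rightarrow> 'b::comm_semiring_1" where
  "eval_with \<phi> \<xi> p = (\<Sum>m\<in>Poly_Mapping.keys p. \<phi> (Poly_Mapping.lookup p m) *
     (\<Prod>i\<in>Poly_Mapping.keys m. \<xi> i ^ Poly_Mapping.lookup m i))"

abbreviation subst :: "(nat \<Rightarrow> 'k::comm_semiring_1 mpol) \<Rightarrow> 'k mpol \<Rightarrow> 'k mpol" where
  "subst \<equiv> eval_with Const"

abbreviation eval_at :: "(nat \<Rightarrow> 'k::comm_semiring_1) \<Rightarrow> 'k mpol \<Rightarrow> 'k" where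
  "eval_at \<equiv> eval_with (\<lambda>c. c)"

section \<open>Rational normal curves and cones over them\<close>

definition minor :: "(nat \<Rightarrow> 'k::comm_ring_1 mpol) \<Rightarrow> nat \<Rightarrow> nat \<Rightarrow> 'k mpol" where
  "minor \<xi> p q = \<xi> (p - 1) * \<xi> q - \<xi> p * \<xi> (q - 1)"

definition minor_indices :: "nat \<Rightarrow> (nat \<times> nat) set" where
  "minor_indices n = {(p, q). 1 \<le> p \<and> p < q \<and> q \<le> n}"

text \<open>\<open>\<xi> 0, \<dots>, \<xi> n\<close> are homogeneous coordinates on projective \<open>n\<close>-space.\<close>

definition coordinate_system :: "nat \<Rightarrow> (nat \<Rightarrow> 'k::comm_ring_1 mpol) \<Rightarrow> bool" where
  "coordinate_system n \<xi> \<longleftrightarrow> (\<forall>i\<le>n. \<xi> i \<in> homogeneous (Suc n) 1) \<and>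
     (\<forall>c. (\<Sum>i\<le>n. Const (c i) * \<xi> i) = 0 \<longrightarrow> (\<forall>i\<le>n. c i = 0))"

text \<open>\<open>J\<close> is the homogeneous ideal of a rational normal curve (of degree \<open>n\<close>) in projective
  \<open>n\<close>-space.\<close>

definition rational_normal_curve :: "nat \<Rightarrow> 'k::comm_ring_1 mpol set \<Rightarrow> bool" where
  "rational_normal_curve n J \<longleftrightarrow> (\<exists>\<xi>. coordinate_system n \<xi> \<and>
     J = Idl\<^bsub>poly_ring (Suc n)\<^esub> ((\<lambda>(p, q). minor \<xi> p q) ` minor_indices n))"

text \<open>\<open>Z\<close> is the homogeneous ideal of a cone in projective \<open>r\<close>-space over the closed subscheme of
  projective \<open>(r - 1)\<close>-space with homogeneous ideal \<open>J\<close>. The vertex is the point where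
  \<open>\<xi> 0, \<dots>, \<xi> (r - 1)\<close> vanish, and the \<open>(r - 1)\<close>-space is embedded as the hyperplane \<open>\<xi> r = 0\<close>.\<close>

definition cone_over :: "nat \<Rightarrow> 'k::comm_ring_1 mpol set \<Rightarrow> 'k mpol set \<Rightarrow> bool" where
  "cone_over r J Z \<longleftrightarrow> (\<exists>\<xi>. coordinate_system r \<xi> \<and>
     Z = Idl\<^bsub>poly_ring (Suc r)\<^esub> (subst \<xi> ` J))"

section \<open>The double structure\<close>

text \<open>In \<open>K[t, u]\<close> the variables are \<open>t = X 0\<close> and \<open>u = X 1\<close>.\<close>

definition pullback_j :: "nat \<Rightarrow> 'k::comm_ring_1 mpol \<Rightarrow> 'k mpol" where
  "pullback_j r = subst (\<lambda>i. X 0 ^ (r - i) * X 1 ^ i)"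

text \<open>The coefficient of \<open>g\<^sub>k\<close> in the class
  \<open>\<Sum>h=p..q-1. t^(r-h-1) u^(h-1) g\<^bsub>p+q-1-h\<^esub>\<close> of \<open>f\<^bsub>pq\<^esub>\<close>.\<close>

definition minor_class :: "nat \<Rightarrow> nat \<Rightarrow> nat \<Rightarrow> nat \<Rightarrow> 'k::comm_ring_1 mpol" where
  "minor_class r p q k =
     (\<Sum>h\<in>{p..<q}. if p + q - 1 - h = k then X 0 ^ (r - h - 1) * X 1 ^ (h - 1) else 0)"

text \<open>\<open>F\<close> lies in the homogeneous ideal of \<open>C\<close>, and the class of \<open>F\<close> in the pulled back conormal
  sheaf is \<open>\<Sum>k=1..r-1. v k g\<^sub>k\<close>. The class is linear along \<open>j\<^sup>*\<close> and given on the generators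
  \<open>f\<^bsub>pq\<^esub>\<close> by the formula above. If \<open>F\<close> is homogeneous of degree \<open>d\<close>, its class is a section of the
  \<open>d\<close>-th twist, so the \<open>v k\<close> are forms of degree \<open>r d - r - 2\<close>.\<close>

definition conormal_class :: "nat \<Rightarrow> 'k::comm_ring_1 mpol \<Rightarrow> (nat \<Rightarrow> 'k mpol) \<Rightarrow> bool" where
  "conormal_class r F v \<longleftrightarrow> (\<exists>c. (\<forall>p q. c p q \<in> polys (Suc r)) \<and>
     F = (\<Sum>(p, q)\<in>minor_indices r. c p q * minor X p q) \<and>
     (\<forall>k\<in>{1..r - 1}.
        v k = (\<Sum>(p, q)\<in>minor_indices r. pullback_j r (c p q) * minor_class r p q k)))"

text \<open>Kernel, on the homogeneous ideal of \<open>C\<close>, of the conormal class followed by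
  \<open>\<mu> = (a 0, \<dots>, a (r - 2))\<close>, where \<open>\<mu>(g\<^sub>k) = a (k - 1)\<close>.\<close>

definition mu_kernel :: "nat \<Rightarrow> (nat \<Rightarrow> 'k::comm_ring_1) \<Rightarrow> 'k mpol set" where
  "mu_kernel r a =
     {F. \<exists>v. conormal_class r F v \<and> (\<Sum>k\<in>{1..r - 1}. Const (a (k - 1)) * v k) = 0}"

text \<open>The homogeneous ideal, that is, the graded module of sections of all twists, of the ideal
  sheaf associated to a homogeneous ideal \<open>I\<close>: a form \<open>F\<close> of degree \<open>d\<close> belongs to it iff on every
  chart \<open>X i \<noteq> 0\<close> the function \<open>F / X i ^ d\<close> is a section of the sheaf, that is,
  \<open>X i ^ k * F \<in> I\<close> for some \<open>k\<close>.\<close>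

definition sheaf_sections :: "nat \<Rightarrow> 'k::comm_ring_1 mpol set \<Rightarrow> 'k mpol set" where
  "sheaf_sections r I = {F \<in> polys (Suc r). \<forall>i\<le>r. \<exists>k. X i ^ k * F \<in> I}"

text \<open>Sheafification is exact, so the sheaf associated to \<open>mu_kernel r a\<close> is the kernel of the
  ideal sheaf of \<open>C\<close> mapping onto the line bundle, which is the ideal sheaf of \<open>X\<close>.\<close>

definition double_structure_ideal :: "nat \<Rightarrow> (nat \<Rightarrow> 'k::comm_ring_1) \<Rightarrow> 'k mpol set" where
  "double_structure_ideal r a = sheaf_sections r (mu_kernel r a)"

section \<open>Properties of closed subschemes of projective space\<close>

text \<open>A closed subscheme of projective \<open>r\<close>-space is given by its saturated homogeneous ideal
  \<open>I \<subseteq> polys (Suc r)\<close>.\<close>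

definition coordinate_ring :: "nat \<Rightarrow> 'k::comm_ring_1 mpol set \<Rightarrow> 'k mpol set ring" where
  "coordinate_ring r I = poly_ring (Suc r) Quot I"

definition arithmetically_cohen_macaulay :: "nat \<Rightarrow> 'k::comm_ring_1 mpol set \<Rightarrow> bool" where
  "arithmetically_cohen_macaulay r I \<longleftrightarrow> cohen_macaulay_ring (coordinate_ring r I)"

definition arithmetically_gorenstein :: "nat \<Rightarrow> 'k::comm_ring_1 mpol set \<Rightarrow> bool" where
  "arithmetically_gorenstein r I \<longleftrightarrow> gorenstein_ring (coordinate_ring r I)"

definition non_degenerate :: "nat \<Rightarrow> 'k::comm_ring_1 mpol set \<Rightarrow> bool" where
  "non_degenerate r I \<longleftrightarrow> (\<forall>l\<in>homogeneous (Suc r) 1. l \<noteq> 0 \<longrightarrow> l \<notin> I)"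

text \<open>The dimension of the scheme is one less than that of its homogeneous coordinate ring.\<close>

definition is_curve :: "nat \<Rightarrow> 'k::comm_ring_1 mpol set \<Rightarrow> bool" where
  "is_curve r I \<longleftrightarrow> krull_dim (coordinate_ring r I) = 2"

definition graded_dim :: "'k::field mpol set \<Rightarrow> nat" where
  "graded_dim V = vector_space.dim (\<lambda>c p. Const c * p) V"

definition hilbert_function :: "nat \<Rightarrow> 'k::field mpol set \<Rightarrow> nat \<Rightarrow> int" where
  "hilbert_function r I d =
     int (graded_dim (homogeneous (Suc r) d :: 'k mpol set)) -
     int (graded_dim (I \<inter> homogeneous (Suc r) d))"

definition hilbert_polynomial :: "nat \<Rightarrow> 'k::field mpol set \<Rightarrow> rat poly \<Rightarrow> bool" where
  "hilbert_polynomial r I P \<longleftrightarrow>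
     (\<exists>N. \<forall>d\<ge>N. poly P (of_nat d) = of_int (hilbert_function r I d))"

text \<open>Degree and arithmetic genus of a one-dimensional subscheme, read off from its Hilbert
  polynomial \<open>deg * d + 1 - genus\<close>.\<close>

definition has_degree_and_genus :: "nat \<Rightarrow> 'k::field mpol set \<Rightarrow> nat \<Rightarrow> int \<Rightarrow> bool" where
  "has_degree_and_genus r I e g \<longleftrightarrow>
     (\<exists>P. hilbert_polynomial r I P \<and> Polynomial.degree P = 1 \<and>
        lead_coeff P = of_nat e \<and> 1 - poly P 0 = of_int g)"

section \<open>The space of maps\<close>

text \<open>Maps \<open>\<mu>\<close> are points of affine \<open>(r - 1)\<close>-space; functions are \<open>undefined\<close> from index
  \<open>r - 1\<close> on.\<close>

definition affine_space :: "nat \<Rightarrow> (nat \<Rightarrow> 'k) set" where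
  "affine_space n = {..<n} \<rightarrow>\<^sub>E UNIV"

definition nonzero_maps :: "nat \<Rightarrow> (nat \<Rightarrow> 'k::zero) set" where
  "nonzero_maps r = {a \<in> affine_space (r - 1). \<exists>i<r - 1. a i \<noteq> 0}"

definition zariski_open :: "nat \<Rightarrow> (nat \<Rightarrow> 'k::comm_ring_1) set \<Rightarrow> bool" where
  "zariski_open n U \<longleftrightarrow>
     (\<exists>S \<subseteq> polys n. U = {a \<in> affine_space n. \<exists>f\<in>S. eval_at a f \<noteq> 0})"

end

theory Submission
  imports Defs
begin

text \<open>Write \<open>x\<^sub>i = z s\<^sup>i\<close> on the affine cone over \<open>C\<close>. Then \<open>X\<close> is parametrized by
  \<open>x\<^sub>i = z (s\<^sup>i + \<epsilon> b\<^sub>i)\<close> with \<open>\<epsilon>\<^sup>2 = 0\<close>, where the \<open>b\<^sub>i\<close> are determined by \<open>\<mu>\<close>, and \<open>I\<^sub>X\<close> is the kernel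
  of the resulting map \<open>R \<rightarrow> K[s, z][\<epsilon>]\<close>. Its reduction modulo \<open>\<epsilon>\<close> has as image the span of the
  monomials \<open>s\<^sup>e z\<^sup>d\<close> with \<open>e \<le> r d\<close>, and as \<open>\<mu> \<noteq> 0\<close>, it maps \<open>I\<^sub>C\<close> onto \<open>\<epsilon>\<close> times the span of
  those with \<open>e + r + 2 \<le> r d\<close>. Counting monomials yields the Hilbert polynomial \<open>2 r d - r\<close>.

  The ring \<open>R / I\<^sub>X\<close> is Gorenstein for every \<open>\<mu> \<noteq> 0\<close>. At each point of the affine cone there is a
  regular pair \<open>x, y\<close> such that a single element \<open>\<sigma>\<close> is a multiple of every non-zero element of the
  local ring modulo \<open>(x, y)\<close>, so that \<open>(x, y)\<close> is irreducible. At the vertex \<open>x = x\<^sub>0\<close>, \<open>y = x\<^sub>r\<close>,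
  the quotient has the basis \<open>1\<close>, \<open>x\<^sub>1, \<dots>, x\<^bsub>r-1\<^esub>\<close>, \<open>\<tau>\<^sub>k = \<epsilon> z\<^sup>2 s\<^sup>k\<close> for \<open>k \<le> r - 2\<close>, \<open>\<sigma> = \<epsilon> z\<^sup>3 s\<^bsup>r-1\<^esup>\<close>,
  and \<open>x\<^sub>i\<close> pairs with \<open>\<tau>\<^bsub>r-1-i\<^esub>\<close> to \<open>\<sigma>\<close>. Irreducibility passes from \<open>(x, y)\<close> to
  \<open>(x\<^sup>k, y\<^sup>k)\<close>, and from there to any parameter ideal \<open>(f, g)\<close> containing it, which is the colon
  ideal of \<open>(x\<^sup>k, y\<^sup>k)\<close> by a determinant. The dimension is at most \<open>2\<close> since any three polynomials in \<open>s, z\<close> are algebraically dependent.\<close>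

hide_const (open) up_ring.monom up_ring.coeff Module.smult

section \<open>Ideals generated by regular pairs\<close>

text \<open>The Gorenstein property concerns every localization, including those at maximal ideals
  of the affine cone that are not homogeneous, so graded arguments alone do not suffice. A
  Nullstellensatz in two variables locates these ideals: either x_0 is invertible, or the point lies
  on the ruling over the point at infinity of C, which contains the vertex.

  The parametrization can replace the conormal sheaf because the coefficient of \<epsilon> is a
  derivation along \<open>par\<close>. On I_C, where \<open>par\<close> vanishes, it is linear, so
  it agrees with \<mu> as soon as it has the right values on the minors. Being a function of F, it
  also settles that the image under \<mu> does not depend on how F is written in the minors.

  The constant r + 2 is the twist: a form of degree d pulls back to degree r d on the projective
  line, and its image under \<mu> has degree r d - r - 2. Characteristic 0 permits division by the 2
  that arises because quadrics only produce expressions symmetric in two indices.\<close>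

lemma (in ideal) minus_closed: "\<lbrakk>a \<in> I; b \<in> I\<rbrakk> \<Longrightarrow> a \<ominus> b \<in> I"
  by (simp add: a_minus_def)

lemma ideal_subset_carrier: "ideal I A \<Longrightarrow> I \<subseteq> carrier A"
  using ideal.Icarr by (intro subsetI)

text \<open>With \<open>I\<close> the whole ring this adjoins one generator \<open>d\<close> to
  \<open>Q\<close>; with \<open>d\<close> a determinant it carries ideals above (f, g) to ideals
  above (x, y).\<close>

lemma (in cring) ideal_scaled_sum:
  assumes "ideal I R" "ideal Q R" "d \<in> carrier R"
  shows "ideal {d \<otimes> i \<oplus> q | i q. i \<in> I \<and> q \<in> Q} R"
proof -
  interpret I: ideal I R by fact
  interpret Q: ideal Q R by fact
  note [simp] = I.Icarr Q.Icarr assms(3)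
  let ?S = "{d \<otimes> i \<oplus> q | i q. i \<in> I \<and> q \<in> Q}"
  have add: "u \<oplus> v \<in> ?S" if "u \<in> ?S" "v \<in> ?S" for u v
  proof -
    from that obtain i q i' q' where iq: "i \<in> I" "q \<in> Q" "i' \<in> I" "q' \<in> Q"
      and uv: "u = d \<otimes> i \<oplus> q" "v = d \<otimes> i' \<oplus> q'" by blast
    have "i \<in> carrier R" "i' \<in> carrier R" "q \<in> carrier R" "q' \<in> carrier R" using iq by auto
    then have "u \<oplus> v = d \<otimes> (i \<oplus> i') \<oplus> (q \<oplus> q')" unfolding uv using assms(3) by algebra
    then show ?thesis using iq by blast
  qed
  have mul: "x \<otimes> u \<in> ?S" if "u \<in> ?S" "x \<in> carrier R" for u x
  proof -
    from that obtain i q where iq: "i \<in> I" "q \<in> Q" and u: "u = d \<otimes> i \<oplus> q" by blast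
    have "i \<in> carrier R" "q \<in> carrier R" using iq by auto
    then have "x \<otimes> u = d \<otimes> (x \<otimes> i) \<oplus> (x \<otimes> q)" unfolding u using assms(3) that(2) by algebra
    then show ?thesis using I.I_l_closed[OF iq(1) that(2)] Q.I_l_closed[OF iq(2) that(2)] by blast
  qed
  show ?thesis
  proof (rule idealI[OF ring_axioms])
    show "subgroup ?S (add_monoid R)"
    proof (rule add.subgroupI)
      show "?S \<subseteq> carrier R" by auto
      have "d \<otimes> \<zero> \<oplus> \<zero> \<in> ?S" using I.zero_closed Q.zero_closed by blast
      then show "?S \<noteq> {}" by blast
      show "\<ominus> u \<in> ?S" if "u \<in> ?S" for u
      proof -
        have "u \<in> carrier R" using that by auto
        then have "\<ominus> u = (\<ominus> \<one>) \<otimes> u" by algebra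
        then show ?thesis using mul[OF that, of "\<ominus> \<one>"] by simp
      qed
      show "u \<oplus> v \<in> ?S" if "u \<in> ?S" "v \<in> ?S" for u v by (rule add[OF that])
    qed
    fix u x assume "u \<in> ?S" "x \<in> carrier R"
    moreover have "u \<in> carrier R" using \<open>u \<in> ?S\<close> by auto
    ultimately show 1: "x \<otimes> u \<in> ?S" by (intro mul)
    show "u \<otimes> x \<in> ?S"
      using 1 m_comm[OF \<open>u \<in> carrier R\<close> \<open>x \<in> carrier R\<close>] by (simp only:)
  qed
qed

lemma (in cring) genideal_insert:
  assumes "x \<in> carrier R" "S \<subseteq> carrier R"
  shows "Idl (insert x S) = {x \<otimes> a \<oplus> b | a b. a \<in> carrier R \<and> b \<in> Idl S}"
proof
  have I: "ideal (Idl S) R" using genideal_ideal[OF assms(2)] .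
  interpret S: ideal "Idl S" R by fact
  note id = ideal_scaled_sum[OF oneideal I assms(1)]
  show "Idl (insert x S) \<subseteq> {x \<otimes> a \<oplus> b | a b. a \<in> carrier R \<and> b \<in> Idl S}"
  proof (rule genideal_minimal[OF id])
    have "x = x \<otimes> \<one> \<oplus> \<zero>" using assms(1) by simp
    then have "x \<in> {x \<otimes> a \<oplus> b | a b. a \<in> carrier R \<and> b \<in> Idl S}" using S.zero_closed by blast
    moreover have "s \<in> {x \<otimes> a \<oplus> b | a b. a \<in> carrier R \<and> b \<in> Idl S}" if "s \<in> S" for s
    proof -
      have "s \<in> Idl S" using genideal_self[OF assms(2)] that by blast
      moreover have "s = x \<otimes> \<zero> \<oplus> s" using assms that by auto
      ultimately show ?thesis by blast
    qed
    ultimately show "insert x S \<subseteq> {x \<otimes> a \<oplus> b | a b. a \<in> carrier R \<and> b \<in> Idl S}" by blast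
  qed
  have xS: "insert x S \<subseteq> carrier R" using assms by auto
  interpret X: ideal "Idl (insert x S)" R using genideal_ideal[OF xS] .
  have "Idl S \<subseteq> Idl (insert x S)"
    by (rule genideal_minimal[OF X.ideal_axioms]) (use genideal_self[OF xS] in auto)
  moreover have "x \<in> Idl (insert x S)" using genideal_self[OF xS] by auto
  ultimately show "{x \<otimes> a \<oplus> b | a b. a \<in> carrier R \<and> b \<in> Idl S} \<subseteq> Idl (insert x S)"
    using X.I_r_closed X.a_closed by blast
qed

lemma (in cring) genideal_empty: "Idl {} = {\<zero>}"
  using genideal_minimal[OF zeroideal, of "{}"]
    additive_subgroup.zero_closed[OF ideal.axioms(1)[OF genideal_ideal[of "{}"]]] by auto

lemma (in cring) genideal_single:
  assumes "x \<in> carrier R"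
  shows "Idl {x} = {x \<otimes> a | a. a \<in> carrier R}"
proof -
  have "Idl {x} = {x \<otimes> a \<oplus> b | a b. a \<in> carrier R \<and> b \<in> {\<zero>}}"
    using genideal_insert[OF assms empty_subsetI] unfolding genideal_empty .
  moreover have "x \<otimes> a \<oplus> \<zero> = x \<otimes> a" if "a \<in> carrier R" for a using assms that by simp
  ultimately show ?thesis by (smt (verit) Collect_cong singletonD singletonI)
qed

lemma (in cring) genideal_pair:
  assumes "x \<in> carrier R" "y \<in> carrier R"
  shows "Idl {x, y} = {x \<otimes> a \<oplus> y \<otimes> b | a b. a \<in> carrier R \<and> b \<in> carrier R}"
proof -
  have "Idl {x, y} = {x \<otimes> a \<oplus> b | a b. a \<in> carrier R \<and> b \<in> Idl {y}}"
    using genideal_insert[OF assms(1), of "{y}"] assms(2) by simp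
  then show ?thesis unfolding genideal_single[OF assms(2)] by blast
qed

section \<open>Regular pairs and their powers\<close>

definition nonzerodivisor :: "('a, 'b) ring_scheme \<Rightarrow> 'a \<Rightarrow> bool" where
  "nonzerodivisor A x \<longleftrightarrow> (\<forall>c\<in>carrier A. x \<otimes>\<^bsub>A\<^esub> c = \<zero>\<^bsub>A\<^esub> \<longrightarrow> c = \<zero>\<^bsub>A\<^esub>)"

text \<open>Regularity of the sequence x, y together with y being a nonzerodivisor on the ring
  itself. The second condition makes the notion symmetric, and hence stable under powers of both
  elements.\<close>

definition regular_pair :: "('a, 'b) ring_scheme \<Rightarrow> 'a \<Rightarrow> 'a \<Rightarrow> bool" where
  "regular_pair A x y \<longleftrightarrow> x \<in> carrier A \<and> y \<in> carrier A \<and> nonzerodivisor A x \<and> nonzerodivisor A y \<and>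
     (\<forall>c\<in>carrier A. \<forall>d\<in>carrier A. y \<otimes>\<^bsub>A\<^esub> c = x \<otimes>\<^bsub>A\<^esub> d \<longrightarrow> (\<exists>e\<in>carrier A. c = x \<otimes>\<^bsub>A\<^esub> e))"

context cring
begin

lemma nonzerodivisor_cancel:
  assumes "nonzerodivisor R x" "x \<in> carrier R" "a \<in> carrier R" "b \<in> carrier R" "x \<otimes> a = x \<otimes> b"
  shows "a = b"
proof -
  have "x \<otimes> (a \<ominus> b) = x \<otimes> a \<ominus> x \<otimes> b" using assms(2-4) by algebra
  also have "\<dots> = \<zero>" using assms(2-5) by (simp add: r_right_minus_eq)
  finally have "a \<ominus> b = \<zero>" using assms unfolding nonzerodivisor_def by blast
  then show ?thesis using assms by (simp add: r_right_minus_eq)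
qed

lemma nonzerodivisor_pow:
  assumes "nonzerodivisor R x" "x \<in> carrier R"
  shows "nonzerodivisor R (x [^] (n::nat))"
proof (induction n)
  case 0
  then show ?case by (simp add: nonzerodivisor_def)
next
  case (Suc n)
  show ?case unfolding nonzerodivisor_def
  proof (intro ballI impI)
    fix c assume c: "c \<in> carrier R" "x [^] Suc n \<otimes> c = \<zero>"
    then have "x [^] n \<otimes> (x \<otimes> c) = \<zero>" using assms by (simp add: m_assoc)
    then have "x \<otimes> c = \<zero>"
      using Suc assms(2) c(1) m_closed unfolding nonzerodivisor_def by blast
    then show "c = \<zero>" using assms c by (simp add: nonzerodivisor_def)
  qed
qed

text \<open>If x c = y d, regularity gives d = x e, and then x cancels from x c = x y e.\<close>

lemma regular_pair_swap:
  assumes "regular_pair R x y"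
  shows "regular_pair R y x"
proof -
  have xy: "x \<in> carrier R" "y \<in> carrier R" "nonzerodivisor R x" "nonzerodivisor R y"
    using assms by (auto simp: regular_pair_def)
  have "\<exists>e\<in>carrier R. c = y \<otimes> e" if cd: "c \<in> carrier R" "d \<in> carrier R" "x \<otimes> c = y \<otimes> d" for c d
  proof -
    obtain e where e: "e \<in> carrier R" "d = x \<otimes> e"
      using assms cd unfolding regular_pair_def by metis
    have "x \<otimes> c = x \<otimes> (y \<otimes> e)" unfolding cd(3) e(2) using xy(1,2) e(1) by algebra
    then show ?thesis using nonzerodivisor_cancel[OF xy(3,1) cd(1), of "y \<otimes> e"] xy e by auto
  qed
  then show ?thesis using xy by (auto simp: regular_pair_def)
qed

lemma regular_pair_pow_right:
  assumes "regular_pair R x y"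
  shows "regular_pair R x (y [^] (n::nat))"
proof -
  have xy: "x \<in> carrier R" "y \<in> carrier R" "nonzerodivisor R x" "nonzerodivisor R y"
    using assms by (auto simp: regular_pair_def)
  have "\<exists>e\<in>carrier R. c = x \<otimes> e"
    if "c \<in> carrier R" "d \<in> carrier R" "y [^] n \<otimes> c = x \<otimes> d" for c d
    using that
  proof (induction n arbitrary: c)
    case 0
    then show ?case using xy by auto
  next
    case (Suc n)
    have "y [^] n \<otimes> (y \<otimes> c) = x \<otimes> d" using Suc.prems xy by (simp add: m_assoc)
    then obtain e where "e \<in> carrier R" "y \<otimes> c = x \<otimes> e"
      using Suc.IH[of "y \<otimes> c"] Suc.prems xy by auto
    then show ?case using assms Suc.prems unfolding regular_pair_def by metis
  qed
  then show ?thesis using xy nonzerodivisor_pow by (auto simp: regular_pair_def)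
qed

lemma regular_pair_pow:
  assumes "regular_pair R x y"
  shows "regular_pair R (x [^] (m::nat)) (y [^] (n::nat))"
  using assms regular_pair_swap regular_pair_pow_right by metis

lemma regular_pairD:
  assumes "regular_pair R x y" "c \<in> carrier R" "d \<in> carrier R" "y \<otimes> c = x \<otimes> d"
  obtains e where "e \<in> carrier R" "c = x \<otimes> e"
  using assms unfolding regular_pair_def by blast

section \<open>Irreducible ideals and change of parameters\<close>

lemma irreducible_idealI:
  assumes "ideal Q R" "Q \<noteq> carrier R"
    and "\<And>I J. \<lbrakk>ideal I R; ideal J R; Q = I \<inter> J; Q \<noteq> I; Q \<noteq> J\<rbrakk> \<Longrightarrow> False"
  shows "irreducible_ideal Q R"
  using assms unfolding irreducible_ideal_def by blast

text \<open>Every ideal strictly above Q contains \<sigma>, hence so does the intersection of two of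
  them, which therefore cannot be Q.\<close>

lemma irreducible_ideal_of_common_element:
  assumes "ideal Q R" "\<sigma> \<in> carrier R" "\<sigma> \<notin> Q"
    and "\<And>l. \<lbrakk>l \<in> carrier R; l \<notin> Q\<rbrakk> \<Longrightarrow> \<exists>b\<in>carrier R. l \<otimes> b \<ominus> \<sigma> \<in> Q"
  shows "irreducible_ideal Q R"
proof (rule irreducible_idealI[OF assms(1)])
  show "Q \<noteq> carrier R" using assms by auto
  have "\<sigma> \<in> I" if "ideal I R" "Q \<subset> I" for I
  proof -
    interpret I: ideal I R by fact
    from that obtain l where l: "l \<in> I" "l \<notin> Q" by blast
    then obtain b where b: "b \<in> carrier R" "l \<otimes> b \<ominus> \<sigma> \<in> Q" using assms(4) I.Icarr by blast
    have "l \<otimes> b \<ominus> (l \<otimes> b \<ominus> \<sigma>) \<in> I"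
      using I.minus_closed[OF I.I_r_closed[OF l(1) b(1)]] b(2) that(2) by blast
    moreover have "l \<otimes> b \<ominus> (l \<otimes> b \<ominus> \<sigma>) = \<sigma>"
      using b(1) assms(2) I.Icarr[OF l(1)] by algebra
    ultimately show ?thesis by simp
  qed
  then show False if "ideal I R" "ideal J R" "Q = I \<inter> J" "Q \<noteq> I" "Q \<noteq> J" for I J
    using that assms(3) by (metis IntI inf.cobounded1 inf.cobounded2 psubsetI)
qed

text \<open>Two cancellations suffice: x^k modulo y^(k+1), then y^k modulo x. Both rest on the
  regularity of powers of the pair.\<close>

lemma regular_pair_colon:
  assumes xy: "regular_pair R x y" and l: "l \<in> carrier R"
    and "(x [^] k \<otimes> y [^] k) \<otimes> l \<in> Idl {x [^] Suc k, y [^] Suc k}"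
  shows "l \<in> Idl {x, y}"
proof -
  have c: "x \<in> carrier R" "y \<in> carrier R" "nonzerodivisor R x" "nonzerodivisor R y"
    using xy by (auto simp: regular_pair_def)
  obtain a b where ab: "a \<in> carrier R" "b \<in> carrier R"
    "(x [^] k \<otimes> y [^] k) \<otimes> l = x [^] Suc k \<otimes> a \<oplus> y [^] Suc k \<otimes> b"
    using assms(3) c by (auto simp: genideal_pair)
  define X where "X = x [^] k"
  define Y where "Y = y [^] k"
  have XY: "X \<in> carrier R" "Y \<in> carrier R" using c by (auto simp: X_def Y_def)
  have eq: "(X \<otimes> Y) \<otimes> l = (X \<otimes> x) \<otimes> a \<oplus> (Y \<otimes> y) \<otimes> b"
    using ab(3) by (simp add: X_def Y_def)
  have "X \<otimes> (Y \<otimes> l \<ominus> x \<otimes> a) = (X \<otimes> Y) \<otimes> l \<ominus> (X \<otimes> x) \<otimes> a"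
    using XY c(1,2) ab(1,2) l by algebra
  also have "\<dots> = (Y \<otimes> y) \<otimes> b"
    unfolding eq using XY c(1,2) ab(1,2) by algebra
  finally have "X \<otimes> (Y \<otimes> l \<ominus> x \<otimes> a) = y [^] Suc k \<otimes> b" by (simp add: Y_def)
  moreover have "regular_pair R (y [^] Suc k) X"
    unfolding X_def using xy regular_pair_pow regular_pair_swap by blast
  moreover have "Y \<otimes> l \<ominus> x \<otimes> a \<in> carrier R" using XY c ab l by simp
  ultimately obtain e where e: "e \<in> carrier R" "Y \<otimes> l \<ominus> x \<otimes> a = y [^] Suc k \<otimes> e"
    using regular_pairD ab(2) by metis
  have "Y \<otimes> (l \<ominus> y \<otimes> e) = (Y \<otimes> l \<ominus> x \<otimes> a) \<oplus> x \<otimes> a \<ominus> (Y \<otimes> y) \<otimes> e"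
    using XY c(1,2) ab(1,2) l e(1) by algebra
  also have "\<dots> = x \<otimes> a"
    unfolding e(2) using XY c(1,2) ab(1,2) e(1) by (simp add: Y_def[symmetric]) algebra
  finally have eq2: "Y \<otimes> (l \<ominus> y \<otimes> e) = x \<otimes> a" .
  have "regular_pair R x Y" unfolding Y_def by (rule regular_pair_pow_right[OF xy])
  moreover have "l \<ominus> y \<otimes> e \<in> carrier R" using l c e by simp
  ultimately obtain f where f: "f \<in> carrier R" "l \<ominus> y \<otimes> e = x \<otimes> f"
    using regular_pairD[OF _ _ ab(1) eq2] by blast
  have "l = (l \<ominus> y \<otimes> e) \<oplus> y \<otimes> e" using l c(1,2) e(1) by algebra
  also have "\<dots> = x \<otimes> f \<oplus> y \<otimes> e" unfolding f(2) ..
  finally show ?thesis using f(1) e(1) c by (auto simp: genideal_pair)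
qed

text \<open>This is the socle of a monomial complete intersection, computed by cancellation in place
  of monomials.\<close>

lemma regular_pair_socle:
  assumes xy: "regular_pair R x y" and j: "j \<in> carrier R"
    and jx: "x \<otimes> j \<in> Idl {x [^] Suc k, y [^] Suc k}" and jy: "y \<otimes> j \<in> Idl {x [^] Suc k, y [^] Suc k}"
  shows "\<exists>l\<in>carrier R. j \<ominus> (x [^] k \<otimes> y [^] k) \<otimes> l \<in> Idl {x [^] Suc k, y [^] Suc k}"
proof -
  have c: "x \<in> carrier R" "y \<in> carrier R" "nonzerodivisor R x" "nonzerodivisor R y"
    using xy by (auto simp: regular_pair_def)
  define X where "X = x [^] k"
  define Y where "Y = y [^] k"
  have XY: "X \<in> carrier R" "Y \<in> carrier R" using c by (auto simp: X_def Y_def)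
  have Idl: "Idl {x [^] Suc k, y [^] Suc k}
    = {(X \<otimes> x) \<otimes> a \<oplus> (Y \<otimes> y) \<otimes> b | a b. a \<in> carrier R \<and> b \<in> carrier R}"
    using c by (simp add: genideal_pair X_def Y_def)
  obtain a b where ab: "a \<in> carrier R" "b \<in> carrier R" "x \<otimes> j = (X \<otimes> x) \<otimes> a \<oplus> (Y \<otimes> y) \<otimes> b"
    using jx unfolding Idl by blast
  obtain a' b' where ab': "a' \<in> carrier R" "b' \<in> carrier R" "y \<otimes> j = (X \<otimes> x) \<otimes> a' \<oplus> (Y \<otimes> y) \<otimes> b'"
    using jy unfolding Idl by blast
  \<comment> \<open>Cancelling x modulo y^(k+1) leaves j as x^k a up to a multiple of y^(k+1); it
    remains to extract y^k from a.\<close>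
  have "x \<otimes> (j \<ominus> X \<otimes> a) = x \<otimes> j \<ominus> (X \<otimes> x) \<otimes> a" using XY c(1,2) ab(1,2) j by algebra
  also have "\<dots> = (Y \<otimes> y) \<otimes> b" unfolding ab(3) using XY c(1,2) ab(1,2) j by algebra
  finally have "x \<otimes> (j \<ominus> X \<otimes> a) = y [^] Suc k \<otimes> b" by (simp add: Y_def)
  moreover have "regular_pair R (y [^] Suc k) x"
    using xy regular_pair_pow_right regular_pair_swap by blast
  moreover have "j \<ominus> X \<otimes> a \<in> carrier R" using XY ab j by simp
  ultimately obtain g where g: "g \<in> carrier R" "j \<ominus> X \<otimes> a = y [^] Suc k \<otimes> g"
    using regular_pairD ab(2) by metis
  have j_eq: "j = X \<otimes> a \<oplus> (Y \<otimes> y) \<otimes> g"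
  proof -
    have "j = (j \<ominus> X \<otimes> a) \<oplus> X \<otimes> a" using XY ab(1) j by algebra
    also have "\<dots> = (Y \<otimes> y) \<otimes> g \<oplus> X \<otimes> a" unfolding g(2) by (simp add: Y_def)
    also have "\<dots> = X \<otimes> a \<oplus> (Y \<otimes> y) \<otimes> g" using XY ab(1) g(1) c(1,2) by algebra
    finally show ?thesis .
  qed
  \<comment> \<open>With this form of j, the second hypothesis and cancellation of x^k show that y a
    and x a' agree modulo y^(k+1).\<close>
  have "X \<otimes> (y \<otimes> a \<ominus> x \<otimes> a') = y \<otimes> j \<ominus> (X \<otimes> x) \<otimes> a' \<ominus> y \<otimes> ((Y \<otimes> y) \<otimes> g)"
    unfolding j_eq using XY c(1,2) ab(1,2) ab'(1,2) g(1) by algebra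
  also have "\<dots> = (Y \<otimes> y) \<otimes> (b' \<ominus> y \<otimes> g)"
    unfolding ab'(3) using XY c(1,2) ab(1,2) ab'(1,2) g(1) by algebra
  finally have "X \<otimes> (y \<otimes> a \<ominus> x \<otimes> a') = y [^] Suc k \<otimes> (b' \<ominus> y \<otimes> g)" by (simp add: Y_def)
  moreover have "regular_pair R (y [^] Suc k) X"
    unfolding X_def using xy regular_pair_pow regular_pair_swap by blast
  moreover have "y \<otimes> a \<ominus> x \<otimes> a' \<in> carrier R" "b' \<ominus> y \<otimes> g \<in> carrier R" using c ab ab' g by simp_all
  ultimately obtain h where h: "h \<in> carrier R" "y \<otimes> a \<ominus> x \<otimes> a' = y [^] Suc k \<otimes> h"
    using regular_pairD by metis
  have "y \<otimes> (a \<ominus> Y \<otimes> h) = (y \<otimes> a \<ominus> x \<otimes> a') \<oplus> x \<otimes> a' \<ominus> (Y \<otimes> y) \<otimes> h"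
    using XY c(1,2) ab(1,2) ab'(1,2) h(1) by algebra
  also have "\<dots> = x \<otimes> a'"
    unfolding h(2) using XY c(1,2) ab'(1,2) h(1) by (simp add: Y_def[symmetric]) algebra
  finally have "y \<otimes> (a \<ominus> Y \<otimes> h) = x \<otimes> a'" .
  moreover have "a \<ominus> Y \<otimes> h \<in> carrier R" using XY ab h by simp
  ultimately obtain m where m: "m \<in> carrier R" "a \<ominus> Y \<otimes> h = x \<otimes> m"
    using regular_pairD[OF xy] ab' by metis
  have "j \<ominus> (X \<otimes> Y) \<otimes> h = X \<otimes> (a \<ominus> Y \<otimes> h) \<oplus> (Y \<otimes> y) \<otimes> g"
    unfolding j_eq using XY c(1,2) ab(1) g(1) h(1) by algebra
  also have "\<dots> = (X \<otimes> x) \<otimes> m \<oplus> (Y \<otimes> y) \<otimes> g"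
    unfolding m(2) using XY c(1,2) m(1) g(1) by algebra
  finally have "j \<ominus> (X \<otimes> Y) \<otimes> h \<in> Idl {x [^] Suc k, y [^] Suc k}"
    unfolding Idl using m(1) g(1) by blast
  then show ?thesis using h(1) unfolding X_def Y_def by blast
qed

lemma last_multiple_outside:
  assumes "ideal Q R" "x \<in> carrier R" "j \<in> carrier R" "j \<notin> Q" "x [^] (n::nat) \<otimes> j \<in> Q"
  obtains a :: nat where "x [^] a \<otimes> j \<notin> Q" "x \<otimes> (x [^] a \<otimes> j) \<in> Q"
proof -
  define m where "m = (LEAST m::nat. x [^] m \<otimes> j \<in> Q)"
  have m: "x [^] m \<otimes> j \<in> Q"
    unfolding m_def using assms(5) by (rule LeastI[of "\<lambda>m. x [^] m \<otimes> j \<in> Q"])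
  have "m \<noteq> 0" using m assms(3,4) by (intro notI) simp
  then obtain a where a: "m = Suc a" using not0_implies_Suc by blast
  have "x [^] a \<otimes> j \<notin> Q" using not_less_Least[of a "\<lambda>m. x [^] m \<otimes> j \<in> Q"] a by (simp add: m_def)
  moreover have "x \<otimes> (x [^] a \<otimes> j) = x [^] m \<otimes> j"
    unfolding a using assms(2,3) by (simp add: m_ac)
  ultimately show ?thesis using that m by simp
qed

text \<open>With \<Delta> = x^k y^k, the colon by \<Delta> takes Q to (x, y) and commutes with
  intersection, so a decomposition of Q yields one of (x, y). It stays proper because each ideal
  strictly above Q contains a socle element, which modulo Q is \<Delta> times an element outside (x,
  y).\<close>

lemma irreducible_ideal_pow:
  assumes xy: "regular_pair R x y" and irr: "irreducible_ideal (Idl {x, y}) R"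
  shows "irreducible_ideal (Idl {x [^] Suc k, y [^] Suc k}) R"
proof -
  have c: "x \<in> carrier R" "y \<in> carrier R" using xy by (auto simp: regular_pair_def)
  define Q where "Q = Idl {x [^] Suc k, y [^] Suc k}"
  define \<Delta> where "\<Delta> = x [^] k \<otimes> y [^] k"
  have \<Delta>: "\<Delta> \<in> carrier R" using c by (simp add: \<Delta>_def)
  have Qid: "ideal Q R" unfolding Q_def by (rule genideal_ideal) (use c in auto)
  interpret Q: ideal Q R by fact
  have pQ: "x [^] Suc k \<in> Q" "y [^] Suc k \<in> Q"
    unfolding Q_def using genideal_self[of "{x [^] Suc k, y [^] Suc k}"] c by auto
  have Q_sub: "Q \<subseteq> Idl {x, y}"
  proof -
    interpret P: ideal "Idl {x, y}" R by (rule genideal_ideal) (use c in auto)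
    have "x \<in> Idl {x, y}" "y \<in> Idl {x, y}" using genideal_self[of "{x, y}"] c by auto
    then have "x [^] k \<otimes> x \<in> Idl {x, y}" "y [^] k \<otimes> y \<in> Idl {x, y}" using c by (auto intro: P.I_l_closed)
    then show ?thesis unfolding Q_def by (intro genideal_minimal P.ideal_axioms) simp
  qed
  have down: "l \<in> Idl {x, y}" if "l \<in> carrier R" "\<Delta> \<otimes> l \<in> Q" for l
    using regular_pair_colon[OF xy that(1)] that(2) unfolding Q_def \<Delta>_def by blast
  have up: "\<Delta> \<otimes> l \<in> Q" if "l \<in> Idl {x, y}" for l
  proof -
    from that obtain a b where ab: "a \<in> carrier R" "b \<in> carrier R" "l = x \<otimes> a \<oplus> y \<otimes> b"
      using c by (auto simp: genideal_pair)
    define X where "X = x [^] k"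
    define Y where "Y = y [^] k"
    have XY: "X \<in> carrier R" "Y \<in> carrier R" using c by (auto simp: X_def Y_def)
    have "\<Delta> \<otimes> l = (X \<otimes> x) \<otimes> (Y \<otimes> a) \<oplus> (Y \<otimes> y) \<otimes> (X \<otimes> b)"
      unfolding \<Delta>_def X_def[symmetric] Y_def[symmetric] ab(3) using XY ab(1,2) c by algebra
    also have "\<dots> = x [^] Suc k \<otimes> (Y \<otimes> a) \<oplus> y [^] Suc k \<otimes> (X \<otimes> b)" by (simp add: X_def Y_def)
    also have "\<dots> \<in> Q" using pQ XY ab by (intro Q.a_closed Q.I_r_closed) auto
    finally show ?thesis .
  qed
  have meets: "\<exists>l\<in>carrier R. \<Delta> \<otimes> l \<in> I \<and> l \<notin> Idl {x, y}" if I: "ideal I R" "Q \<subset> I" for I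
  proof -
    interpret I: ideal I R by fact
    from I obtain j0 where j0: "j0 \<in> I" "j0 \<notin> Q" by blast
    have j0c: "j0 \<in> carrier R" using I.Icarr j0 by blast
    \<comment> \<open>Powers of x and of y carry everything into Q, so there is a last multiple
      outside Q, first for x and then for y; it is a socle element.\<close>
    have "x [^] Suc k \<otimes> j0 \<in> Q" using pQ Q.I_r_closed j0c by blast
    then obtain a where a: "x [^] (a::nat) \<otimes> j0 \<notin> Q" "x \<otimes> (x [^] a \<otimes> j0) \<in> Q"
      using last_multiple_outside[OF Qid c(1) j0c j0(2)] by metis
    define j1 where "j1 = x [^] a \<otimes> j0"
    have j1: "j1 \<in> I" "j1 \<notin> Q" "x \<otimes> j1 \<in> Q" "j1 \<in> carrier R"
      using a j0 c j0c I.I_l_closed unfolding j1_def by auto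
    have "y [^] Suc k \<otimes> j1 \<in> Q" using pQ Q.I_r_closed j1 by blast
    then obtain b where b: "y [^] (b::nat) \<otimes> j1 \<notin> Q" "y \<otimes> (y [^] b \<otimes> j1) \<in> Q"
      using last_multiple_outside[OF Qid c(2) j1(4,2)] by metis
    define j where "j = y [^] b \<otimes> j1"
    have "x \<otimes> j = y [^] b \<otimes> (x \<otimes> j1)" unfolding j_def using c j1 by (simp add: m_ac)
    then have j: "j \<in> I" "j \<notin> Q" "x \<otimes> j \<in> Q" "y \<otimes> j \<in> Q" "j \<in> carrier R"
      using b j1 c I.I_l_closed Q.I_l_closed unfolding j_def by auto
    obtain l where l: "l \<in> carrier R" "j \<ominus> \<Delta> \<otimes> l \<in> Q"
      using regular_pair_socle[OF xy j(5)] j(3,4) unfolding Q_def \<Delta>_def by blast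
    have eq: "\<Delta> \<otimes> l = j \<ominus> (j \<ominus> \<Delta> \<otimes> l)" using j(5) l(1) \<Delta> by algebra
    have "j \<ominus> (j \<ominus> \<Delta> \<otimes> l) \<in> I"
      using I.minus_closed[OF j(1)] l(2) I(2) by blast
    then have 1: "\<Delta> \<otimes> l \<in> I" using eq by simp
    have "l \<notin> Idl {x, y}"
    proof
      assume "l \<in> Idl {x, y}"
      then have "\<Delta> \<otimes> l \<oplus> (j \<ominus> \<Delta> \<otimes> l) \<in> Q" using up l by (intro Q.a_closed) auto
      moreover have "\<Delta> \<otimes> l \<oplus> (j \<ominus> \<Delta> \<otimes> l) = j" using j(5) l(1) \<Delta> by algebra
      ultimately show False using j by simp
    qed
    then show ?thesis using 1 l by blast
  qed
  show ?thesis unfolding Q_def[symmetric]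
  proof (rule irreducible_idealI[OF Qid])
    have "Idl {x, y} \<noteq> carrier R" using irr by (simp add: irreducible_ideal_def)
    then show "Q \<noteq> carrier R"
      using Q_sub ideal_subset_carrier[OF genideal_ideal[of "{x, y}"]] c by auto
    fix I J assume IJ: "ideal I R" "ideal J R" "Q = I \<inter> J" "Q \<noteq> I" "Q \<noteq> J"
    interpret I: ideal I R by fact
    interpret J: ideal J R by fact
    let ?I = "{l \<in> carrier R. \<Delta> \<otimes> l \<in> I}" and ?J = "{l \<in> carrier R. \<Delta> \<otimes> l \<in> J}"
    have id: "ideal ?I R" "ideal ?J R"
      using I.helper_max_prime[OF is_cring \<Delta>] J.helper_max_prime[OF is_cring \<Delta>] by auto
    have "Idl {x, y} \<subseteq> carrier R"
      using ideal_subset_carrier[OF genideal_ideal[of "{x, y}"]] c by simp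
    then have "Idl {x, y} = ?I \<inter> ?J" using up down IJ(3) by blast
    moreover have "\<exists>l\<in>?I. l \<notin> Idl {x, y}" using meets[of I] IJ by blast
    moreover have "\<exists>l\<in>?J. l \<notin> Idl {x, y}" using meets[of J] IJ by blast
    ultimately show False using irr id unfolding irreducible_ideal_def by blast
  qed
qed

text \<open>The colon ideal of \<open>(x, y)\<close> by the determinant \<open>a d - b c\<close> of the transition matrix is \<open>(f, g)\<close>.\<close>

lemma irreducible_ideal_determinant:
  assumes xy: "regular_pair R x y" and irr: "irreducible_ideal (Idl {x, y}) R"
    and fg: "f \<in> carrier R" "g \<in> carrier R" "x \<in> Idl {f, g}" "y \<in> Idl {f, g}"
    and proper: "Idl {f, g} \<noteq> carrier R"
  shows "irreducible_ideal (Idl {f, g}) R"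
proof -
  have cxy: "x \<in> carrier R" "y \<in> carrier R" "nonzerodivisor R x" using xy by (auto simp: regular_pair_def)
  obtain a b where ab: "a \<in> carrier R" "b \<in> carrier R" "x = f \<otimes> a \<oplus> g \<otimes> b"
    using fg by (auto simp: genideal_pair)
  obtain c d where cd: "c \<in> carrier R" "d \<in> carrier R" "y = f \<otimes> c \<oplus> g \<otimes> d"
    using fg by (auto simp: genideal_pair)
  note C = ab(1,2) cd(1,2) fg(1,2)
  define \<Delta> where "\<Delta> = a \<otimes> d \<ominus> b \<otimes> c"
  have \<Delta>: "\<Delta> \<in> carrier R" using C by (simp add: \<Delta>_def)
  define Q where "Q = Idl {x, y}"
  have Qeq: "Q = {x \<otimes> a \<oplus> y \<otimes> b | a b. a \<in> carrier R \<and> b \<in> carrier R}"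
    unfolding Q_def using cxy by (simp add: genideal_pair)
  have Qid: "ideal Q R" unfolding Q_def by (rule genideal_ideal) (use cxy in auto)
  interpret Q: ideal Q R by fact
  define P where "P = Idl {f, g}"
  have Peq: "P = {f \<otimes> a \<oplus> g \<otimes> b | a b. a \<in> carrier R \<and> b \<in> carrier R}"
    unfolding P_def using C by (simp add: genideal_pair)
  have Pid: "ideal P R" unfolding P_def by (rule genideal_ideal) (use C in auto)
  interpret P: ideal P R by fact
  \<comment> \<open>Cramer's rule: the adjugate of the transition matrix expresses f \<Delta> and g
    \<Delta> through x and y.\<close>
  have f\<Delta>: "f \<otimes> \<Delta> = x \<otimes> d \<oplus> y \<otimes> (\<ominus> b)" unfolding \<Delta>_def ab(3) cd(3) using C by algebra
  have g\<Delta>: "g \<otimes> \<Delta> = x \<otimes> (\<ominus> c) \<oplus> y \<otimes> a" unfolding \<Delta>_def ab(3) cd(3) using C by algebra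
  have up: "\<Delta> \<otimes> l \<in> Q" if "l \<in> P" for l
  proof -
    from that obtain u v where uv: "u \<in> carrier R" "v \<in> carrier R" "l = f \<otimes> u \<oplus> g \<otimes> v"
      using Peq by blast
    have "\<Delta> \<otimes> l = (f \<otimes> \<Delta>) \<otimes> u \<oplus> (g \<otimes> \<Delta>) \<otimes> v" unfolding uv(3) using C uv(1,2) \<Delta> by algebra
    moreover have "f \<otimes> \<Delta> \<in> Q" "g \<otimes> \<Delta> \<in> Q" unfolding f\<Delta> g\<Delta> Qeq using C by auto
    ultimately show ?thesis using uv by (simp add: Q.I_r_closed Q.a_closed)
  qed
  have down: "h \<in> P" if h: "h \<in> carrier R" "\<Delta> \<otimes> h \<in> Q" for h
  proof -
    obtain \<alpha> \<beta> where \<alpha>\<beta>: "\<alpha> \<in> carrier R" "\<beta> \<in> carrier R" "\<Delta> \<otimes> h = x \<otimes> \<alpha> \<oplus> y \<otimes> \<beta>"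
      using h Qeq by blast
    note C' = C \<alpha>\<beta>(1,2) h(1) \<Delta> cxy(1,2)
    have "h \<otimes> (f \<otimes> \<Delta>) = f \<otimes> (\<Delta> \<otimes> h)" using C' by algebra
    then have e1: "h \<otimes> (x \<otimes> d \<oplus> y \<otimes> (\<ominus> b)) = f \<otimes> (x \<otimes> \<alpha> \<oplus> y \<otimes> \<beta>)" unfolding f\<Delta> \<alpha>\<beta>(3) .
    \<comment> \<open>The last bracket is zero by \<open>e1\<close>; it is written out so that the
      equation is a formal identity before \<open>e1\<close> is applied.\<close>
    have "y \<otimes> (h \<otimes> b \<oplus> f \<otimes> \<beta>) = x \<otimes> (h \<otimes> d \<ominus> f \<otimes> \<alpha>)
        \<oplus> (f \<otimes> (x \<otimes> \<alpha> \<oplus> y \<otimes> \<beta>) \<ominus> h \<otimes> (x \<otimes> d \<oplus> y \<otimes> (\<ominus> b)))" using C' by algebra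
    also have "\<dots> = x \<otimes> (h \<otimes> d \<ominus> f \<otimes> \<alpha>)" unfolding e1 using C' by algebra
    finally have e1': "y \<otimes> (h \<otimes> b \<oplus> f \<otimes> \<beta>) = x \<otimes> (h \<otimes> d \<ominus> f \<otimes> \<alpha>)" .
    have "h \<otimes> (g \<otimes> \<Delta>) = g \<otimes> (\<Delta> \<otimes> h)" using C' by algebra
    then have e2: "h \<otimes> (x \<otimes> (\<ominus> c) \<oplus> y \<otimes> a) = g \<otimes> (x \<otimes> \<alpha> \<oplus> y \<otimes> \<beta>)" unfolding g\<Delta> \<alpha>\<beta>(3) .
    have "y \<otimes> (g \<otimes> \<beta> \<ominus> h \<otimes> a) = x \<otimes> (\<ominus> (h \<otimes> c) \<ominus> g \<otimes> \<alpha>)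
        \<oplus> (g \<otimes> (x \<otimes> \<alpha> \<oplus> y \<otimes> \<beta>) \<ominus> h \<otimes> (x \<otimes> (\<ominus> c) \<oplus> y \<otimes> a))" using C' by algebra
    also have "\<dots> = x \<otimes> (\<ominus> (h \<otimes> c) \<ominus> g \<otimes> \<alpha>)" unfolding e2 using C' by algebra
    finally have e2': "y \<otimes> (g \<otimes> \<beta> \<ominus> h \<otimes> a) = x \<otimes> (\<ominus> (h \<otimes> c) \<ominus> g \<otimes> \<alpha>)" .
    obtain \<xi> where \<xi>: "\<xi> \<in> carrier R" "h \<otimes> b \<oplus> f \<otimes> \<beta> = x \<otimes> \<xi>"
      using regular_pairD[OF xy _ _ e1'] C' by auto
    obtain \<eta> where \<eta>: "\<eta> \<in> carrier R" "g \<otimes> \<beta> \<ominus> h \<otimes> a = x \<otimes> \<eta>"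
      using regular_pairD[OF xy _ _ e2'] C' by auto
    \<comment> \<open>Eliminating \<beta> between the two multiples of x leaves x h, because x = f a
      + g b.\<close>
    have "x \<otimes> h = g \<otimes> (h \<otimes> b \<oplus> f \<otimes> \<beta>) \<ominus> f \<otimes> (g \<otimes> \<beta> \<ominus> h \<otimes> a)"
      unfolding ab(3) using C' by algebra
    also have "\<dots> = x \<otimes> (f \<otimes> (\<ominus> \<eta>) \<oplus> g \<otimes> \<xi>)" unfolding \<xi>(2) \<eta>(2) using C' \<xi>(1) \<eta>(1) by algebra
    finally have "x \<otimes> h = x \<otimes> (f \<otimes> (\<ominus> \<eta>) \<oplus> g \<otimes> \<xi>)" .
    moreover have "f \<otimes> (\<ominus> \<eta>) \<oplus> g \<otimes> \<xi> \<in> carrier R" using C \<xi>(1) \<eta>(1) by simp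
    ultimately have "h = f \<otimes> (\<ominus> \<eta>) \<oplus> g \<otimes> \<xi>"
      using nonzerodivisor_cancel[OF cxy(3,1) h(1)] by blast
    then show ?thesis unfolding Peq using \<xi>(1) \<eta>(1) by blast
  qed
  show ?thesis unfolding P_def[symmetric]
  proof (rule irreducible_idealI[OF Pid])
    show "P \<noteq> carrier R" using proper by (simp add: P_def)
    fix I J assume IJ: "ideal I R" "ideal J R" "P = I \<inter> J" "P \<noteq> I" "P \<noteq> J"
    interpret I: ideal I R by fact
    interpret J: ideal J R by fact
    \<comment> \<open>The direction is opposite to that for powers: ideals above (f, g) are
      multiplied by \<Delta> and enlarged by Q. \<open>down\<close> keeps the inclusions
      strict.\<close>
    let ?I = "{\<Delta> \<otimes> i \<oplus> q | i q. i \<in> I \<and> q \<in> Q}" and ?J = "{\<Delta> \<otimes> i \<oplus> q | i q. i \<in> J \<and> q \<in> Q}"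
    have id: "ideal ?I R" "ideal ?J R" using ideal_scaled_sum Qid IJ \<Delta> by auto
    have sub: "Q \<subseteq> {\<Delta> \<otimes> i \<oplus> q | i q. i \<in> I \<and> q \<in> Q}" if "ideal I R" for I
    proof
      fix q assume "q \<in> Q"
      moreover from this have "q = \<Delta> \<otimes> \<zero> \<oplus> q" using \<Delta> Q.Icarr by simp
      moreover have "\<zero> \<in> I" using that by (simp add: additive_subgroup.zero_closed ideal.axioms(1))
      ultimately show "q \<in> {\<Delta> \<otimes> i \<oplus> q | i q. i \<in> I \<and> q \<in> Q}" by blast
    qed
    have strict: "{\<Delta> \<otimes> i \<oplus> q | i q. i \<in> I \<and> q \<in> Q} \<noteq> Q" if "ideal I R" "P \<subset> I" for I
    proof -
      from that obtain i where i: "i \<in> I" "i \<notin> P" by blast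
      have ic: "i \<in> carrier R" using i(1) ideal_subset_carrier[OF that(1)] by blast
      have "\<Delta> \<otimes> i \<notin> Q" using down i ic by blast
      moreover have "\<Delta> \<otimes> i = \<Delta> \<otimes> i \<oplus> \<zero>" using ic \<Delta> by simp
      ultimately show ?thesis using i Q.zero_closed by blast
    qed
    have "u \<in> Q" if "u \<in> ?I" "u \<in> ?J" for u
    proof -
      from that(1) obtain i q where iq: "i \<in> I" "q \<in> Q" "u = \<Delta> \<otimes> i \<oplus> q" by blast
      from that(2) obtain j q' where jq: "j \<in> J" "q' \<in> Q" "u = \<Delta> \<otimes> j \<oplus> q'" by blast
      note c = I.Icarr[OF iq(1)] J.Icarr[OF jq(1)] Q.Icarr[OF iq(2)] Q.Icarr[OF jq(2)] \<Delta>
      \<comment> \<open>Two representations of u differ by an element of Q, so \<open>down\<close>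
        puts i - j into P and hence into J; thus i lies in both ideals.\<close>
      have "\<Delta> \<otimes> (i \<ominus> j) = (\<Delta> \<otimes> i \<oplus> q) \<ominus> (\<Delta> \<otimes> j \<oplus> q') \<oplus> (q' \<ominus> q)" using c by algebra
      also have "\<dots> = q' \<ominus> q" unfolding iq(3)[symmetric] jq(3)[symmetric] using c iq(3) by (simp add: r_right_minus_eq)
      finally have "\<Delta> \<otimes> (i \<ominus> j) \<in> Q" using Q.minus_closed iq jq by simp
      then have "i \<ominus> j \<in> P" using down c(1,2) by simp
      then have "i \<ominus> j \<in> J" unfolding IJ(3) by blast
      then have "(i \<ominus> j) \<oplus> j \<in> J" using jq by (intro J.a_closed)
      moreover have "(i \<ominus> j) \<oplus> j = i" using c by algebra
      ultimately have "i \<in> P" using iq IJ by auto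
      then show ?thesis using up iq Q.a_closed by auto
    qed
    then have "Q = ?I \<inter> ?J" using sub IJ by blast
    then show False using irr id strict[of I] strict[of J] IJ
      unfolding irreducible_ideal_def Q_def[symmetric] by blast
  qed
qed

end

section \<open>Depth, dimension and localization\<close>

context cring
begin

text \<open>Stated for an arbitrary set S, so that S = {1} gives maximal ideals and a multiplicative
  S gives primes.\<close>

lemma exists_maximal_avoiding:
  assumes I: "ideal I R" and disj: "I \<inter> S = {}"
  obtains M where "ideal M R" "I \<subseteq> M" "M \<inter> S = {}"
    "\<And>J. ideal J R \<Longrightarrow> M \<subseteq> J \<Longrightarrow> J \<inter> S = {} \<Longrightarrow> J = M"
proof -
  define \<A> where "\<A> = {J. ideal J R \<and> I \<subseteq> J \<and> J \<inter> S = {}}"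
  have "\<exists>M\<in>\<A>. \<forall>X\<in>\<A>. M \<subseteq> X \<longrightarrow> X = M"
  proof (rule subset_Zorn_nonempty)
    show "\<A> \<noteq> {}" using I disj by (auto simp: \<A>_def)
    fix C assume C: "C \<noteq> {}" "subset.chain \<A> C"
    then have "subset.chain {I. ideal I R} C" by (auto simp: \<A>_def pred_on.chain_def)
    from chain_Union_is_ideal[OF this] C(1) have "ideal (\<Union>C) R" by simp
    then show "\<Union>C \<in> \<A>" using C by (auto simp: \<A>_def pred_on.chain_def)
  qed
  then obtain M where M: "M \<in> \<A>" "\<And>X. X \<in> \<A> \<Longrightarrow> M \<subseteq> X \<Longrightarrow> X = M" by blast
  show ?thesis
  proof (rule that)
    show "ideal M R" "I \<subseteq> M" "M \<inter> S = {}" using M(1) by (auto simp: \<A>_def)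
    show "J = M" if "ideal J R" "M \<subseteq> J" "J \<inter> S = {}" for J
      using that M \<open>I \<subseteq> M\<close> by (auto simp: \<A>_def)
  qed
qed

lemma exists_maximalideal:
  assumes "\<one> \<noteq> \<zero>"
  shows "\<exists>M. maximalideal M R"
proof -
  obtain M where M: "ideal M R" "M \<inter> {\<one>} = {}"
      "\<And>J. ideal J R \<Longrightarrow> M \<subseteq> J \<Longrightarrow> J \<inter> {\<one>} = {} \<Longrightarrow> J = M"
    using exists_maximal_avoiding[OF zeroideal, of "{\<one>}"] assms by auto
  have "maximalideal M R"
  proof (rule maximalidealI[OF M(1)])
    show "carrier R \<noteq> M" using M(2) by auto
    show "J = M \<or> J = carrier R" if "ideal J R" "M \<subseteq> J" "J \<subseteq> carrier R" for J
      using M(3)[OF that(1,2)] ideal.one_imp_carrier[OF that(1)] by auto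
  qed
  then show ?thesis ..
qed

text \<open>If neither a nor b lies in the maximal avoiding ideal M, adjoining either one meets S.
  The product of the two elements met is in S, but would lie in M if a b did.\<close>

lemma exists_prime_avoiding:
  assumes I: "ideal I R" and S: "S \<subseteq> carrier R" "\<one> \<in> S" "\<And>a b. a \<in> S \<Longrightarrow> b \<in> S \<Longrightarrow> a \<otimes> b \<in> S"
    and disj: "I \<inter> S = {}"
  obtains P where "primeideal P R" "I \<subseteq> P" "P \<inter> S = {}"
proof -
  obtain M where Mid: "ideal M R" "I \<subseteq> M" "M \<inter> S = {}" and
    max: "\<And>J. ideal J R \<Longrightarrow> M \<subseteq> J \<Longrightarrow> J \<inter> S = {} \<Longrightarrow> J = M"
    using exists_maximal_avoiding[OF I disj] by blast
  interpret M: ideal M R by fact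
  have hit: "\<exists>s\<in>S. \<exists>r\<in>carrier R. \<exists>m\<in>M. s = a \<otimes> r \<oplus> m" if a: "a \<in> carrier R" "a \<notin> M" for a
  proof -
    let ?J = "{a \<otimes> i \<oplus> q | i q. i \<in> carrier R \<and> q \<in> M}"
    have J: "ideal ?J R" using ideal_scaled_sum[OF oneideal Mid(1) a(1)] .
    have sub: "M \<subseteq> ?J"
    proof
      fix q assume "q \<in> M"
      moreover have "q = a \<otimes> \<zero> \<oplus> q" using M.Icarr[OF \<open>q \<in> M\<close>] a(1) by simp
      ultimately show "q \<in> ?J" by blast
    qed
    have "a = a \<otimes> \<one> \<oplus> \<zero>" using a(1) by simp
    then have "a \<in> ?J" using M.zero_closed by blast
    then have "?J \<noteq> M" using a by blast
    then have "?J \<inter> S \<noteq> {}" using max[OF J sub] by blast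
    then show ?thesis by blast
  qed
  have "primeideal M R"
  proof (rule primeidealI[OF Mid(1) is_cring])
    show "carrier R \<noteq> M" using Mid(3) S by blast
    fix a b assume ab: "a \<in> carrier R" "b \<in> carrier R" "a \<otimes> b \<in> M"
    show "a \<in> M \<or> b \<in> M"
    proof (rule ccontr)
      assume "\<not> (a \<in> M \<or> b \<in> M)"
      then obtain s r m t q n where
        1: "s \<in> S" "r \<in> carrier R" "m \<in> M" "s = a \<otimes> r \<oplus> m" and
        2: "t \<in> S" "q \<in> carrier R" "n \<in> M" "t = b \<otimes> q \<oplus> n" using hit ab by metis
      note c = ab(1,2) 1(2) 2(2) M.Icarr[OF 1(3)] M.Icarr[OF 2(3)]
      have "s \<otimes> t = (a \<otimes> b) \<otimes> (r \<otimes> q) \<oplus> ((a \<otimes> r) \<otimes> n \<oplus> (b \<otimes> q \<oplus> n) \<otimes> m)"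
        unfolding 1(4) 2(4) using c by algebra
      also have "\<dots> \<in> M"
        using M.I_r_closed[OF ab(3), of "r \<otimes> q"] M.I_l_closed[OF 2(3), of "a \<otimes> r"]
          M.I_l_closed[OF 1(3), of "b \<otimes> q \<oplus> n"] c by (simp add: M.a_closed)
      finally show False using S(3)[OF 1(1) 2(1)] Mid(3) by blast
    qed
  qed
  then show ?thesis using that Mid by blast
qed

section \<open>Regular sequences, chains of primes and depth\<close>

lemma regular_sequence_snocD:
  assumes "regular_sequence R (xs @ [x])"
  shows "regular_sequence R xs" "x \<in> carrier R" "set xs \<subseteq> carrier R"
    "\<And>y. y \<in> carrier R \<Longrightarrow> x \<otimes> y \<in> Idl (set xs) \<Longrightarrow> y \<in> Idl (set xs)"
proof -
  have 1: "i < length (xs @ [x]) \<Longrightarrow> y \<in> carrier R \<Longrightarrow>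
      (xs @ [x]) ! i \<otimes> y \<in> Idl (set (take i (xs @ [x]))) \<Longrightarrow> y \<in> Idl (set (take i (xs @ [x])))" for i y
    using assms unfolding regular_sequence_def by blast
  show "set xs \<subseteq> carrier R" "x \<in> carrier R" using assms unfolding regular_sequence_def by auto
  then show "regular_sequence R xs" unfolding regular_sequence_def

  proof (intro conjI allI impI ballI)
    fix i y assume "i < length xs" "y \<in> carrier R" "xs ! i \<otimes> y \<in> Idl (set (take i xs))"
    then show "y \<in> Idl (set (take i xs))" using 1[of i y] by (simp add: nth_append)
  qed
  show "\<And>y. y \<in> carrier R \<Longrightarrow> x \<otimes> y \<in> Idl (set xs) \<Longrightarrow> y \<in> Idl (set xs)"
    using 1[of "length xs"] by simp
qed

text \<open>The last element x is a nonzerodivisor modulo the earlier ones, so some prime over those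
  inside P avoids x; it contains the shorter sequence, and the induction continues downwards. Hence
  depth is at most dimension.\<close>

lemma regular_sequence_prime_chain:
  assumes "regular_sequence R xs" "primeideal P R" "set xs \<subseteq> P"
  shows "\<exists>Q :: nat \<Rightarrow> 'a set. (\<forall>i\<le>length xs. primeideal (Q i) R) \<and>
    (\<forall>i<length xs. Q i \<subset> Q (Suc i)) \<and> Q (length xs) = P"
  using assms
proof (induction xs arbitrary: P rule: rev_induct)
  case Nil
  then show ?case by (intro exI[of _ "\<lambda>_. P"]) auto
next
  case (snoc x xs)
  note rs = regular_sequence_snocD[OF snoc.prems(1)]
  interpret P: primeideal P R by (rule snoc.prems)
  let ?I = "Idl (set xs)"
  interpret I: ideal ?I R by (rule genideal_ideal[OF rs(3)])
  \<comment> \<open>Avoiding all x^n s with s outside P does two things at once: n = 0 keeps the new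
    prime inside P, and s = 1 keeps x out of it.\<close>
  define S where "S = {x [^] n \<otimes> s | (n::nat) s. s \<in> carrier R - P}"
  have one: "\<one> \<in> carrier R - P" using P.I_notcarr P.one_imp_carrier by auto
  have S1: "S \<subseteq> carrier R" using rs(2) by (auto simp: S_def)
  have "\<one> = x [^] (0::nat) \<otimes> \<one>" by simp
  then have S2: "\<one> \<in> S" using one unfolding S_def by blast
  have S3: "a \<otimes> b \<in> S" if "a \<in> S" "b \<in> S" for a b
  proof -
    from that obtain n m s t where st: "s \<in> carrier R - P" "t \<in> carrier R - P"
      "a = x [^] (n::nat) \<otimes> s" "b = x [^] (m::nat) \<otimes> t" unfolding S_def by blast
    have "a \<otimes> b = x [^] (n + m) \<otimes> (s \<otimes> t)"
      unfolding st(3,4) using st(1,2) rs(2) by (simp add: nat_pow_mult[symmetric] m_ac)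
    moreover have "s \<otimes> t \<in> carrier R - P" using st P.I_prime by blast
    ultimately show ?thesis unfolding S_def by blast
  qed
  have cancel: "s \<in> ?I" if "s \<in> carrier R" "x [^] (n::nat) \<otimes> s \<in> ?I" for n s
    using that
  proof (induction n)
    case (Suc n)
    have xs: "x \<otimes> (x [^] n \<otimes> s) \<in> ?I" using Suc.prems rs(2) by (simp add: m_ac)
    have "x [^] n \<otimes> s \<in> carrier R" using rs(2) Suc.prems(1) by simp
    from rs(4)[OF this xs] have "x [^] n \<otimes> s \<in> ?I" .
    then show ?case using Suc.IH Suc.prems(1) by blast
  qed simp
  have IP: "?I \<subseteq> P" by (rule genideal_minimal[OF P.is_ideal]) (use snoc.prems in auto)
  have "?I \<inter> S = {}" using cancel IP unfolding S_def by blast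
  then obtain P' where P': "primeideal P' R" "?I \<subseteq> P'" "P' \<inter> S = {}"
    using exists_prime_avoiding[OF I.ideal_axioms S1 S2 S3] by blast
  have "P' \<subseteq> P"
  proof
    fix s assume s: "s \<in> P'"
    then have sc: "s \<in> carrier R" using P'(1) ideal_subset_carrier primeideal.axioms(1) by blast
    then have "s = x [^] (0::nat) \<otimes> s" by simp
    then have "s \<notin> carrier R - P" using s P'(3) unfolding S_def by blast
    then show "s \<in> P" using sc by blast
  qed
  moreover have "x = x [^] (1::nat) \<otimes> \<one>" using rs(2) by simp
  then have "x \<in> S" using one unfolding S_def by blast
  then have "x \<notin> P'" using P'(3) by blast
  moreover have "x \<in> P" using snoc.prems by simp
  ultimately have strict: "P' \<subset> P" by blast
  have "set xs \<subseteq> P'" using P'(2) genideal_self[OF rs(3)] by blast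
  from snoc.IH[OF rs(1) P'(1) this] obtain Q where Q: "\<forall>i\<le>length xs. primeideal (Q i) R"
    "\<forall>i<length xs. Q i \<subset> Q (Suc i)" "Q (length xs) = P'" by blast
  show ?case
  proof (intro exI[of _ "Q(Suc (length xs) := P)"] conjI allI impI)
    fix i assume "i \<le> length (xs @ [x])"
    then show "primeideal ((Q(Suc (length xs) := P)) i) R"
      using Q(1) snoc.prems(2) by auto
  next
    fix i assume "i < length (xs @ [x])"
    then show "(Q(Suc (length xs) := P)) i \<subset> (Q(Suc (length xs) := P)) (Suc i)"
      using Q strict by (cases "i = length xs") auto
  qed simp
qed

lemma depth_le_krull_dim:
  assumes "primeideal P R"
  shows "depth R P \<le> krull_dim R"
  unfolding depth_def
proof (rule Sup_least)
  fix e assume "e \<in> {enat (length xs) | xs. set xs \<subseteq> P \<and> regular_sequence R xs}"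
  then obtain xs where xs: "e = enat (length xs)" "set xs \<subseteq> P" "regular_sequence R xs" by blast
  show "e \<le> krull_dim R" unfolding krull_dim_def
    by (rule Sup_upper) (use regular_sequence_prime_chain[OF xs(3) assms xs(2)] xs(1) in blast)
qed

lemma regular_sequence_pair:
  assumes "regular_pair R x y"
  shows "regular_sequence R [x, y]"
proof -
  have c: "x \<in> carrier R" "y \<in> carrier R" using assms by (auto simp: regular_pair_def)
  have 1: "c \<in> Idl {}" if "c \<in> carrier R" "x \<otimes> c \<in> Idl {}" for c
    using assms that unfolding genideal_empty regular_pair_def nonzerodivisor_def by blast
  have 2: "c \<in> Idl {x}" if c': "c \<in> carrier R" "y \<otimes> c \<in> Idl {x}" for c
    using assms c' unfolding genideal_single[OF c(1)] regular_pair_def by blast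
  show ?thesis unfolding regular_sequence_def
  proof (intro conjI allI impI ballI)
    show "set [x, y] \<subseteq> carrier R" using c by simp
    fix i z assume "i < length [x, y]" "z \<in> carrier R" "[x, y] ! i \<otimes> z \<in> Idl (set (take i [x, y]))"
    moreover from this have "i = 0 \<or> i = 1" by auto
    ultimately show "z \<in> Idl (set (take i [x, y]))" using 1 2 by auto
  qed
qed

lemma depth_ge_2:
  assumes "regular_pair R x y" "x \<in> P" "y \<in> P"
  shows "2 \<le> depth R P"
proof -
  have "enat (length [x, y]) \<le> depth R P" unfolding depth_def
    by (rule Sup_upper) (use regular_sequence_pair[OF assms(1)] assms(2,3) in fastforce)
  then show ?thesis by (simp add: numeral_eq_enat numeral_2_eq_2)
qed

end

section \<open>Krull dimension along ring homomorphisms\<close>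

lemma krull_dim_leI:
  assumes "\<And>n P. \<lbrakk>\<forall>i\<le>n. primeideal (P i) A; \<forall>i<n. P i \<subset> P (Suc i)\<rbrakk> \<Longrightarrow> n \<le> N"
  shows "krull_dim A \<le> enat N"
  unfolding krull_dim_def by (rule Sup_least) (use assms in auto)

lemma primeideal_vimage:
  assumes "primeideal P B" "h \<in> ring_hom A B" "cring A"
  shows "primeideal {a \<in> carrier A. h a \<in> P} A"
proof -
  interpret P: primeideal P B by fact
  interpret A: cring A by fact
  interpret h: ring_hom_ring A B h by (intro ring_hom_ringI2 A.ring_axioms P.ring_axioms assms(2))
  show ?thesis
  proof (rule primeidealI[OF h.ideal_vimage[OF P.is_ideal] assms(3)])
    have "\<one>\<^bsub>B\<^esub> \<notin> P" using P.I_notcarr P.one_imp_carrier by auto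
    then show "carrier A \<noteq> {a \<in> carrier A. h a \<in> P}" using h.hom_one A.one_closed by force
    fix a b assume "a \<in> carrier A" "b \<in> carrier A" "a \<otimes>\<^bsub>A\<^esub> b \<in> {a \<in> carrier A. h a \<in> P}"
    then show "a \<in> {a \<in> carrier A. h a \<in> P} \<or> b \<in> {a \<in> carrier A. h a \<in> P}"
      using P.I_prime[of "h a" "h b"] by auto
  qed
qed

text \<open>Injectivity of contraction on ideals is what localizations and quotients have in common.\<close>

lemma krull_dim_le_of_hom:
  assumes "cring A" "h \<in> ring_hom A B"
    and "\<And>P Q. \<lbrakk>ideal P B; ideal Q B; P \<subseteq> Q; {a \<in> carrier A. h a \<in> Q} \<subseteq> {a \<in> carrier A. h a \<in> P}\<rbrakk> \<Longrightarrow> Q \<subseteq> P"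
  shows "krull_dim B \<le> krull_dim A"
  unfolding krull_dim_def[of B]
proof (rule Sup_least, clarify)
  fix n and P :: "nat \<Rightarrow> 'c set"
  assume P: "\<forall>i\<le>n. primeideal (P i) B" "\<forall>i<n. P i \<subset> P (Suc i)"
  let ?Q = "\<lambda>i. {a \<in> carrier A. h a \<in> P i}"
  have "primeideal (?Q i) A" if "i \<le> n" for i
    using P(1) that primeideal_vimage[OF _ assms(2,1)] by blast
  moreover have strict: "?Q i \<subset> ?Q (Suc i)" if "i < n" for i
  proof -
    have "ideal (P i) B" "ideal (P (Suc i)) B"
      using P(1) that by (auto intro: primeideal.axioms(1))
    then show ?thesis using assms(3)[of "P i" "P (Suc i)"] P(2) that by blast
  qed
  ultimately have "enat n \<in> {enat n | n. \<exists>P. (\<forall>i\<le>n. primeideal (P i) A) \<and> (\<forall>i<n. P i \<subset> P (Suc i))}"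
    by (intro CollectI exI[of _ n] exI[of _ ?Q] conjI) auto
  then show "enat n \<le> krull_dim A" unfolding krull_dim_def by (rule Sup_upper)
qed

section \<open>Localization at a multiplicative set\<close>

locale multiplicative_set = cring R for R (structure) +
  fixes S
  assumes S_sub: "S \<subseteq> carrier R" and one_S: "\<one> \<in> S"
    and mult_S: "\<lbrakk>s \<in> S; t \<in> S\<rbrakk> \<Longrightarrow> s \<otimes> t \<in> S"
begin

abbreviation L where "L \<equiv> localization R S"
abbreviation fr where "fr \<equiv> fraction R S"

lemma S_carrier: "s \<in> S \<Longrightarrow> s \<in> carrier R"
  using S_sub by blast

lemma frac_rel_iff:
  "((a, s), (b, t)) \<in> frac_rel R S \<longleftrightarrow> a \<in> carrier R \<and> b \<in> carrier R \<and> s \<in> S \<and> t \<in> S \<and>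
     (\<exists>u\<in>S. u \<otimes> (a \<otimes> t) = u \<otimes> (b \<otimes> s))"
  by (simp add: frac_rel_def)

lemma equiv_frac_rel: "equiv (carrier R \<times> S) (frac_rel R S)"
proof (rule equivI)
  show "frac_rel R S \<subseteq> (carrier R \<times> S) \<times> (carrier R \<times> S)" by (auto simp: frac_rel_def)
  show "refl_on (carrier R \<times> S) (frac_rel R S)"
    using one_S by (auto simp: refl_on_def frac_rel_iff)
  show "sym (frac_rel R S)"
    by (auto simp: sym_def frac_rel_iff) metis
  show "trans (frac_rel R S)"
  proof (rule transI, clarify)
    fix a s b t c v
    assume "((a, s), (b, t)) \<in> frac_rel R S" "((b, t), (c, v)) \<in> frac_rel R S"
    then obtain u w where *: "a \<in> carrier R" "b \<in> carrier R" "c \<in> carrier R" "s \<in> S" "t \<in> S" "v \<in> S"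
      "u \<in> S" "w \<in> S" and u: "u \<otimes> (a \<otimes> t) = u \<otimes> (b \<otimes> s)" and w: "w \<otimes> (b \<otimes> v) = w \<otimes> (c \<otimes> t)"
      by (auto simp: frac_rel_iff)
    note c = *(1-3) *(4-8)[THEN S_carrier]
    \<comment> \<open>The middle denominator t has to be part of the witness, since it cannot be
      cancelled.\<close>
    have "((u \<otimes> w) \<otimes> t) \<otimes> (a \<otimes> v) = (w \<otimes> v) \<otimes> (u \<otimes> (a \<otimes> t))" using c by algebra
    also have "\<dots> = (u \<otimes> s) \<otimes> (w \<otimes> (b \<otimes> v))" unfolding u using c by algebra
    also have "\<dots> = ((u \<otimes> w) \<otimes> t) \<otimes> (c \<otimes> s)" unfolding w using c by algebra
    finally show "((a, s), (c, v)) \<in> frac_rel R S"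
      using * mult_S unfolding frac_rel_iff by blast
  qed
qed

lemma fr_eq_iff:
  assumes "a \<in> carrier R" "b \<in> carrier R" "s \<in> S" "t \<in> S"
  shows "fr a s = fr b t \<longleftrightarrow> (\<exists>u\<in>S. u \<otimes> (a \<otimes> t) = u \<otimes> (b \<otimes> s))"
  using eq_equiv_class_iff[OF equiv_frac_rel, of "(a, s)" "(b, t)"] assms
  by (simp add: fraction_def frac_rel_iff)

lemma fr_eqI:
  assumes "a \<in> carrier R" "b \<in> carrier R" "s \<in> S" "t \<in> S" "a \<otimes> t = b \<otimes> s"
  shows "fr a s = fr b t"
  using assms one_S by (auto simp: fr_eq_iff)

lemma mem_fr_iff:
  assumes "a \<in> carrier R" "s \<in> S"
  shows "(b, t) \<in> fr a s \<longleftrightarrow> b \<in> carrier R \<and> t \<in> S \<and> fr b t = fr a s"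
  using assms fr_eq_iff[of a b s t] by (auto simp: fraction_def frac_rel_iff)

lemma carrier_L: "carrier L = {fr a s | a s. a \<in> carrier R \<and> s \<in> S}"
  by (auto simp: localization_def quotient_def fraction_def)

lemma fr_closed [simp]: "\<lbrakk>a \<in> carrier R; s \<in> S\<rbrakk> \<Longrightarrow> fr a s \<in> carrier L"
  by (auto simp: carrier_L)

text \<open>The operations of the localization are unions over all representatives; such a union
  collapses to a single class once the result is independent of them.\<close>

lemma UN_fr:
  assumes "a \<in> carrier R" "s \<in> S" "b \<in> carrier R" "t \<in> S"
    and "\<And>a' s' b' t'. \<lbrakk>a' \<in> carrier R; s' \<in> S; fr a' s' = fr a s; b' \<in> carrier R; t' \<in> S; fr b' t' = fr b t\<rbrakk>
      \<Longrightarrow> f a' s' b' t' = f a s b t"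
  shows "(\<Union>(a, s)\<in>fr a s. \<Union>(b, t)\<in>fr b t. f a s b t) = f a s b t"
proof -
  have "(a, s) \<in> fr a s" "(b, t) \<in> fr b t" using assms by (auto simp: mem_fr_iff)
  moreover have "f a' s' b' t' = f a s b t" if "(a', s') \<in> fr a s" "(b', t') \<in> fr b t" for a' s' b' t'
    using that assms(5)[of a' s' b' t'] by (simp add: mem_fr_iff assms(1-4))
  ultimately show ?thesis by fast
qed

lemma mult_L:
  assumes "a \<in> carrier R" "s \<in> S" "b \<in> carrier R" "t \<in> S"
  shows "fr a s \<otimes>\<^bsub>L\<^esub> fr b t = fr (a \<otimes> b) (s \<otimes> t)"
proof -
  have "(\<Union>(a, s)\<in>fr a s. \<Union>(b, t)\<in>fr b t. fr (a \<otimes> b) (s \<otimes> t)) = fr (a \<otimes> b) (s \<otimes> t)"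
  proof (rule UN_fr[OF assms])
    fix a' s' b' t'
    assume *: "a' \<in> carrier R" "s' \<in> S" "fr a' s' = fr a s" "b' \<in> carrier R" "t' \<in> S" "fr b' t' = fr b t"
    then obtain u w where uw: "u \<in> S" "w \<in> S" and u: "u \<otimes> (a' \<otimes> s) = u \<otimes> (a \<otimes> s')"
      and w: "w \<otimes> (b' \<otimes> t) = w \<otimes> (b \<otimes> t')" using assms by (auto simp: fr_eq_iff)
    note c = assms(1,3) *(1,4) S_carrier[OF assms(2)] S_carrier[OF assms(4)] S_carrier[OF *(2)]
      S_carrier[OF *(5)] S_carrier[OF uw(1)] S_carrier[OF uw(2)]
    have "(u \<otimes> w) \<otimes> ((a' \<otimes> b') \<otimes> (s \<otimes> t)) = (u \<otimes> (a' \<otimes> s)) \<otimes> (w \<otimes> (b' \<otimes> t))" using c by algebra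
    also have "\<dots> = (u \<otimes> w) \<otimes> ((a \<otimes> b) \<otimes> (s' \<otimes> t'))" unfolding u w using c by algebra
    finally show "fr (a' \<otimes> b') (s' \<otimes> t') = fr (a \<otimes> b) (s \<otimes> t)"
      using c * assms uw mult_S[OF uw] by (subst fr_eq_iff) (auto intro: mult_S)
  qed
  then show ?thesis by (simp add: localization_def)
qed

lemma add_L:
  assumes "a \<in> carrier R" "s \<in> S" "b \<in> carrier R" "t \<in> S"
  shows "fr a s \<oplus>\<^bsub>L\<^esub> fr b t = fr (a \<otimes> t \<oplus> b \<otimes> s) (s \<otimes> t)"
proof -
  have "(\<Union>(a, s)\<in>fr a s. \<Union>(b, t)\<in>fr b t. fr (a \<otimes> t \<oplus> b \<otimes> s) (s \<otimes> t)) = fr (a \<otimes> t \<oplus> b \<otimes> s) (s \<otimes> t)"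
  proof (rule UN_fr[OF assms])
    fix a' s' b' t'
    assume *: "a' \<in> carrier R" "s' \<in> S" "fr a' s' = fr a s" "b' \<in> carrier R" "t' \<in> S" "fr b' t' = fr b t"
    then obtain u w where uw: "u \<in> S" "w \<in> S" and u: "u \<otimes> (a' \<otimes> s) = u \<otimes> (a \<otimes> s')"
      and w: "w \<otimes> (b' \<otimes> t) = w \<otimes> (b \<otimes> t')" using assms by (auto simp: fr_eq_iff)
    note c = assms(1,3) *(1,4) S_carrier[OF assms(2)] S_carrier[OF assms(4)] S_carrier[OF *(2)]
      S_carrier[OF *(5)] S_carrier[OF uw(1)] S_carrier[OF uw(2)]
    have "(u \<otimes> w) \<otimes> ((a' \<otimes> t' \<oplus> b' \<otimes> s') \<otimes> (s \<otimes> t))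
        = (u \<otimes> (a' \<otimes> s)) \<otimes> (w \<otimes> (t' \<otimes> t)) \<oplus> (w \<otimes> (b' \<otimes> t)) \<otimes> (u \<otimes> (s' \<otimes> s))" using c by algebra
    also have "\<dots> = (u \<otimes> w) \<otimes> ((a \<otimes> t \<oplus> b \<otimes> s) \<otimes> (s' \<otimes> t'))" unfolding u w using c by algebra
    finally show "fr (a' \<otimes> t' \<oplus> b' \<otimes> s') (s' \<otimes> t') = fr (a \<otimes> t \<oplus> b \<otimes> s) (s \<otimes> t)"
      using c * assms uw mult_S[OF uw] by (subst fr_eq_iff) (auto intro: mult_S)
  qed
  then show ?thesis by (simp add: localization_def)
qed

lemma one_L: "\<one>\<^bsub>L\<^esub> = fr \<one> \<one>" and zero_L: "\<zero>\<^bsub>L\<^esub> = fr \<zero> \<one>"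
  by (simp_all add: localization_def)

lemma L_cases:
  assumes "l \<in> carrier L"
  obtains a s where "a \<in> carrier R" "s \<in> S" "l = fr a s"
  using assms by (auto simp: carrier_L)

lemma cring_L: "cring L"
proof (rule cringI)
  show "abelian_group L"
  proof (rule abelian_groupI)
    fix x y assume "x \<in> carrier L" "y \<in> carrier L"
    then show "x \<oplus>\<^bsub>L\<^esub> y \<in> carrier L"
      by (elim L_cases) (simp add: add_L mult_S S_carrier)
  next
    show "\<zero>\<^bsub>L\<^esub> \<in> carrier L" by (simp add: zero_L one_S)
  next
    fix x y z assume "x \<in> carrier L" "y \<in> carrier L" "z \<in> carrier L"
    then obtain a s b t c v where *: "a \<in> carrier R" "b \<in> carrier R" "c \<in> carrier R" "s \<in> S" "t \<in> S" "v \<in> S"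
      "x = fr a s" "y = fr b t" "z = fr c v" by (metis L_cases)
    note cc = *(1-3) *(4-6)[THEN S_carrier]
    have "((a \<otimes> t \<oplus> b \<otimes> s) \<otimes> v \<oplus> c \<otimes> (s \<otimes> t)) \<otimes> (s \<otimes> (t \<otimes> v)) = (a \<otimes> (t \<otimes> v) \<oplus> (b \<otimes> v \<oplus> c \<otimes> t) \<otimes> s) \<otimes> ((s \<otimes> t) \<otimes> v)"
      using cc by algebra
    then show "x \<oplus>\<^bsub>L\<^esub> y \<oplus>\<^bsub>L\<^esub> z = x \<oplus>\<^bsub>L\<^esub> (y \<oplus>\<^bsub>L\<^esub> z)"
      unfolding *(7-9) using *(1-6) cc by (simp add: add_L mult_S) (intro fr_eqI; simp add: mult_S)
  next
    fix x y assume "x \<in> carrier L" "y \<in> carrier L"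
    then obtain a s b t where *: "a \<in> carrier R" "b \<in> carrier R" "s \<in> S" "t \<in> S"
      "x = fr a s" "y = fr b t" by (metis L_cases)
    note cc = *(1,2) *(3,4)[THEN S_carrier]
    have "(a \<otimes> t \<oplus> b \<otimes> s) \<otimes> (t \<otimes> s) = (b \<otimes> s \<oplus> a \<otimes> t) \<otimes> (s \<otimes> t)" using cc by algebra
    then show "x \<oplus>\<^bsub>L\<^esub> y = y \<oplus>\<^bsub>L\<^esub> x"
      unfolding *(5,6) using *(1-4) cc by (simp add: add_L mult_S) (intro fr_eqI; simp add: mult_S)
  next
    fix x assume "x \<in> carrier L"
    then show "\<zero>\<^bsub>L\<^esub> \<oplus>\<^bsub>L\<^esub> x = x"
      by (elim L_cases) (simp add: zero_L add_L one_S S_carrier)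
  next
    fix x assume "x \<in> carrier L"
    then obtain a s where *: "a \<in> carrier R" "s \<in> S" "x = fr a s" by (metis L_cases)
    have "(\<ominus> a \<otimes> s \<oplus> a \<otimes> s) \<otimes> \<one> = \<zero> \<otimes> (s \<otimes> s)" using *(1) S_carrier[OF *(2)] by algebra
    then have "fr (\<ominus> a) s \<oplus>\<^bsub>L\<^esub> x = \<zero>\<^bsub>L\<^esub>"
      unfolding *(3) zero_L using *(1,2) S_carrier[OF *(2)]
      by (simp add: add_L) (intro fr_eqI; simp add: mult_S one_S)
    then show "\<exists>y\<in>carrier L. y \<oplus>\<^bsub>L\<^esub> x = \<zero>\<^bsub>L\<^esub>" using * by (intro bexI[of _ "fr (\<ominus> a) s"]) auto
  qed
  show "comm_monoid L"
  proof (rule comm_monoidI)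
    fix x y assume "x \<in> carrier L" "y \<in> carrier L"
    then show "x \<otimes>\<^bsub>L\<^esub> y \<in> carrier L"
      by (elim L_cases) (simp add: mult_L mult_S)
  next
    show "\<one>\<^bsub>L\<^esub> \<in> carrier L" by (simp add: one_L one_S)
  next
    fix x y z assume "x \<in> carrier L" "y \<in> carrier L" "z \<in> carrier L"
    then show "x \<otimes>\<^bsub>L\<^esub> y \<otimes>\<^bsub>L\<^esub> z = x \<otimes>\<^bsub>L\<^esub> (y \<otimes>\<^bsub>L\<^esub> z)"
      by (elim L_cases) (simp add: mult_L mult_S m_assoc S_carrier)
  next
    fix x assume "x \<in> carrier L"
    then show "\<one>\<^bsub>L\<^esub> \<otimes>\<^bsub>L\<^esub> x = x"
      by (elim L_cases) (simp add: one_L mult_L one_S S_carrier)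
  next
    fix x y assume "x \<in> carrier L" "y \<in> carrier L"
    then show "x \<otimes>\<^bsub>L\<^esub> y = y \<otimes>\<^bsub>L\<^esub> x"
      by (elim L_cases) (simp add: mult_L m_comm S_carrier)
  qed
  fix x y z assume "x \<in> carrier L" "y \<in> carrier L" "z \<in> carrier L"
  then obtain a s b t c v where *: "a \<in> carrier R" "b \<in> carrier R" "c \<in> carrier R" "s \<in> S" "t \<in> S" "v \<in> S"
    "x = fr a s" "y = fr b t" "z = fr c v" by (metis L_cases)
  note cc = *(1-3) *(4-6)[THEN S_carrier]
  have "((a \<otimes> t \<oplus> b \<otimes> s) \<otimes> c) \<otimes> ((s \<otimes> v) \<otimes> (t \<otimes> v)) = ((a \<otimes> c) \<otimes> (t \<otimes> v) \<oplus> (b \<otimes> c) \<otimes> (s \<otimes> v)) \<otimes> ((s \<otimes> t) \<otimes> v)"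
    using cc by algebra
  then show "(x \<oplus>\<^bsub>L\<^esub> y) \<otimes>\<^bsub>L\<^esub> z = x \<otimes>\<^bsub>L\<^esub> z \<oplus>\<^bsub>L\<^esub> y \<otimes>\<^bsub>L\<^esub> z"
    unfolding *(7-9) using *(1-6) cc by (simp add: add_L mult_L mult_S) (intro fr_eqI; simp add: mult_S)
qed

lemma localization_hom: "(\<lambda>a. fr a \<one>) \<in> ring_hom R L"
  by (intro ring_hom_memI) (auto simp: one_S mult_L add_L one_L)

end

section \<open>A Gorenstein criterion\<close>

locale prime_localization = primeideal m R for m and R (structure)

sublocale prime_localization \<subseteq> multiplicative_set R "carrier R - m"
proof (unfold_locales)
  show "\<one> \<in> carrier R - m" using I_notcarr one_imp_carrier by auto
  show "s \<otimes> t \<in> carrier R - m" if "s \<in> carrier R - m" "t \<in> carrier R - m" for s t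
    using that I_prime by blast
qed simp

context prime_localization
begin

abbreviation S where "S \<equiv> carrier R - m"

definition max_L where "max_L = {fr a s | a s. a \<in> m \<and> s \<in> S}"

lemma fr_mem_max_L_iff:
  assumes "a \<in> carrier R" "s \<in> S"
  shows "fr a s \<in> max_L \<longleftrightarrow> a \<in> m"
proof
  assume "fr a s \<in> max_L"
  then obtain b t where bt: "b \<in> m" "t \<in> S" "fr a s = fr b t" by (auto simp: max_L_def)
  have bc: "b \<in> carrier R" using bt(1) by (rule Icarr)
  obtain u where u: "u \<in> S" "u \<otimes> (a \<otimes> t) = u \<otimes> (b \<otimes> s)"
    using bt fr_eq_iff[OF assms(1) bc assms(2) bt(2)] by blast
  have "u \<otimes> (b \<otimes> s) \<in> m"
    using I_l_closed[OF I_r_closed[OF bt(1), of s], of u] u(1) assms(2) by simp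
  then have "u \<otimes> (a \<otimes> t) \<in> m" using u(2) by simp
  then show "a \<in> m" using u(1) bt(2) assms I_prime[of u "a \<otimes> t"] I_prime[of a t] by auto
qed (use assms in \<open>auto simp: max_L_def\<close>)

lemma max_L_subset: "max_L \<subseteq> carrier L"
  using Icarr by (auto simp: max_L_def)

lemma fr_self: "s \<in> S \<Longrightarrow> fr s s = \<one>\<^bsub>L\<^esub>"
  unfolding one_L by (rule fr_eqI) (auto simp: one_S[simplified])

lemma ideal_max_L: "ideal max_L L"
proof -
  interpret L: cring L by (rule cring_L)
  have mul: "x \<otimes>\<^bsub>L\<^esub> l \<in> max_L" if "l \<in> max_L" "x \<in> carrier L" for l x
  proof -
    obtain a s where l: "a \<in> m" "s \<in> S" "l = fr a s" using \<open>l \<in> max_L\<close> by (auto simp: max_L_def)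
    obtain b t where x: "b \<in> carrier R" "t \<in> S" "x = fr b t" using \<open>x \<in> carrier L\<close> by (rule L_cases)
    have "x \<otimes>\<^bsub>L\<^esub> l = fr (b \<otimes> a) (t \<otimes> s)" unfolding l(3) x(3) using l x Icarr[OF l(1)] by (intro mult_L)
    moreover have "b \<otimes> a \<in> m" using l x I_l_closed by blast
    ultimately show ?thesis using mult_S[OF x(2) l(2)] unfolding max_L_def by (intro CollectI exI conjI)
  qed
  have add: "l \<oplus>\<^bsub>L\<^esub> l' \<in> max_L" if "l \<in> max_L" "l' \<in> max_L" for l l'
  proof -
    obtain a s where l: "a \<in> m" "s \<in> S" "l = fr a s" using \<open>l \<in> max_L\<close> by (auto simp: max_L_def)
    obtain b t where l': "b \<in> m" "t \<in> S" "l' = fr b t" using \<open>l' \<in> max_L\<close> by (auto simp: max_L_def)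
    have "l \<oplus>\<^bsub>L\<^esub> l' = fr (a \<otimes> t \<oplus> b \<otimes> s) (s \<otimes> t)"
      unfolding l(3) l'(3) using l l' Icarr[OF l(1)] Icarr[OF l'(1)] by (intro add_L)
    moreover have "a \<otimes> t \<in> m" "b \<otimes> s \<in> m" using l l' I_r_closed by auto
    then have "a \<otimes> t \<oplus> b \<otimes> s \<in> m"
      by (rule additive_subgroup.a_closed[OF ideal.axioms(1)[OF is_ideal]])
    ultimately show ?thesis using mult_S[OF l(2) l'(2)] unfolding max_L_def by (intro CollectI exI conjI)
  qed
  show ?thesis
  proof (rule idealI[OF L.ring_axioms])
    show "subgroup max_L (add_monoid L)"
    proof (rule L.add.subgroupI[OF max_L_subset])
      have "fr \<zero> \<one> \<in> max_L"
        using fr_mem_max_L_iff[OF ring.ring_simprules(2)[OF ring_axioms] one_S]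
          additive_subgroup.zero_closed[OF ideal.axioms(1)[OF is_ideal]] by simp
      then show "max_L \<noteq> {}" by blast
      fix l l' assume "l \<in> max_L" "l' \<in> max_L"
      then show "l \<oplus>\<^bsub>L\<^esub> l' \<in> max_L" by (rule add)
      have lc: "l \<in> carrier L" using \<open>l \<in> max_L\<close> max_L_subset by blast
      then have "\<ominus>\<^bsub>L\<^esub> l = (\<ominus>\<^bsub>L\<^esub> \<one>\<^bsub>L\<^esub>) \<otimes>\<^bsub>L\<^esub> l" by (simp add: L.l_minus)
      then show "\<ominus>\<^bsub>L\<^esub> l \<in> max_L" using mul[OF \<open>l \<in> max_L\<close>, of "\<ominus>\<^bsub>L\<^esub> \<one>\<^bsub>L\<^esub>"] by simp
    qed
    fix l x assume l: "l \<in> max_L" and x: "x \<in> carrier L"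
    then show 1: "x \<otimes>\<^bsub>L\<^esub> l \<in> max_L" by (rule mul)
    have "l \<in> carrier L" using l max_L_subset by blast
    then show "l \<otimes>\<^bsub>L\<^esub> x \<in> max_L" using 1 L.m_comm[OF _ x] by simp
  qed
qed

text \<open>A fraction outside \<open>max_L\<close> has its numerator in S, hence is a unit.\<close>

lemma ideal_L_cases:
  assumes "ideal J L"
  shows "J = carrier L \<or> J \<subseteq> max_L"
proof (rule disjCI)
  interpret J: ideal J L by fact
  assume "\<not> J \<subseteq> max_L"
  then obtain l where l: "l \<in> J" "l \<notin> max_L" by blast
  then obtain a s where as: "a \<in> carrier R" "s \<in> S" "l = fr a s" using J.Icarr L_cases by metis
  then have a: "a \<in> S" using l fr_mem_max_L_iff by blast
  have "l \<otimes>\<^bsub>L\<^esub> fr s a = fr (a \<otimes> s) (s \<otimes> a)" unfolding as(3) using as a by (simp add: mult_L)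
  also have "\<dots> = \<one>\<^bsub>L\<^esub>" using as a mult_S fr_self m_comm[of a s] by auto
  finally have "\<one>\<^bsub>L\<^esub> \<in> J" using J.I_r_closed[OF l(1), of "fr s a"] as a by simp
  then show "J = carrier L" by (rule J.one_imp_carrier)
qed

lemma max_L_proper: "carrier L \<noteq> max_L"
proof
  assume "carrier L = max_L"
  moreover have "fr \<one> \<one> \<in> carrier L" using one_S by auto
  ultimately show False using fr_mem_max_L_iff[of \<one> \<one>] one_S by auto
qed

lemma maximalideal_max_L: "maximalideal max_L L"
  by (rule maximalidealI[OF ideal_max_L max_L_proper]) (use ideal_L_cases in blast)

lemma local_ring_L: "local_ring L max_L"
proof -
  have "J = max_L" if "maximalideal J L" for J
  proof -
    interpret J: maximalideal J L by fact
    have "J \<subseteq> max_L" using ideal_L_cases[OF J.is_ideal] J.I_notcarr by blast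
    then show ?thesis using J.I_maximal[OF ideal_max_L] max_L_subset max_L_proper by blast
  qed
  then show ?thesis using maximalideal_max_L cring_L unfolding local_ring_def by blast
qed

text \<open>Denominators are units, so an ideal of the localization is determined by its
  contraction. The dimension bound and the Noetherian property are transferred through this.\<close>

lemma fr_mem_ideal_iff:
  assumes "ideal J L" "a \<in> carrier R" "s \<in> S"
  shows "fr a s \<in> J \<longleftrightarrow> fr a \<one> \<in> J"
proof -
  interpret J: ideal J L by fact
  have s: "s \<in> carrier R" using assms by blast
  have "fr a s \<otimes>\<^bsub>L\<^esub> fr s \<one> = fr a \<one>"
    using assms one_S s by (simp add: mult_L) (intro fr_eqI; simp)
  moreover have "fr a \<one> \<otimes>\<^bsub>L\<^esub> fr \<one> s = fr a s" using assms one_S s by (simp add: mult_L)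
  moreover have "fr s \<one> \<in> carrier L" "fr \<one> s \<in> carrier L" using assms one_S s by auto
  ultimately show ?thesis using J.I_r_closed by metis
qed

lemma ideal_L_le:
  assumes "ideal P L" "ideal Q L" "{a \<in> carrier R. fr a \<one> \<in> Q} \<subseteq> {a \<in> carrier R. fr a \<one> \<in> P}"
  shows "Q \<subseteq> P"
proof
  fix l assume l: "l \<in> Q"
  then have "l \<in> carrier L" using ideal_subset_carrier[OF assms(2)] by blast
  then obtain a s where as: "a \<in> carrier R" "s \<in> S" "l = fr a s" by (rule L_cases)
  then show "l \<in> P" using l assms(3) fr_mem_ideal_iff[OF assms(1) as(1,2)]
    fr_mem_ideal_iff[OF assms(2) as(1,2)] by blast
qed

lemma krull_dim_L_le: "krull_dim L \<le> krull_dim R"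
  by (rule krull_dim_le_of_hom[OF is_cring localization_hom]) (use ideal_L_le in blast)

lemma noetherian_L:
  assumes "noetherian_ring R"
  shows "noetherian_ring L"
proof -
  interpret L: cring L by (rule cring_L)
  interpret h: ring_hom_ring R L "\<lambda>a. fr a \<one>"
    by (intro ring_hom_ringI2 ring_axioms L.ring_axioms localization_hom)
  show ?thesis
  proof (rule L.noetherian_ringI)
    fix J assume J: "ideal J L"
    let ?J = "{a \<in> carrier R. fr a \<one> \<in> J}"
    obtain F where F: "F \<subseteq> carrier R" "finite F" "?J = Idl F"
      using noetherian_ring.finetely_gen[OF assms h.ideal_vimage[OF J]] by blast
    let ?F = "(\<lambda>a. fr a \<one>) ` F"
    have F': "?F \<subseteq> carrier L" using F(1) one_S by auto
    have K: "ideal (Idl\<^bsub>L\<^esub> ?F) L" by (rule L.genideal_ideal[OF F'])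
    have "?J \<subseteq> {a \<in> carrier R. fr a \<one> \<in> Idl\<^bsub>L\<^esub> ?F}" unfolding F(3)
      by (rule genideal_minimal[OF h.ideal_vimage[OF K]]) (use F(1) L.genideal_self[OF F'] in blast)
    then have "J \<subseteq> Idl\<^bsub>L\<^esub> ?F" by (rule ideal_L_le[OF K J])
    moreover have "F \<subseteq> ?J" using genideal_self[OF F(1)] F(3) by blast
    then have "Idl\<^bsub>L\<^esub> ?F \<subseteq> J" by (intro L.genideal_minimal[OF J]) blast
    ultimately show "\<exists>A\<subseteq>carrier L. finite A \<and> J = Idl\<^bsub>L\<^esub> A" using F' F(2) by blast
  qed
qed

lemma regular_pair_L:
  assumes xy: "regular_pair R x y"
  shows "regular_pair L (fr x \<one>) (fr y \<one>)"
proof -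
  have c: "x \<in> carrier R" "y \<in> carrier R" "nonzerodivisor R x" "nonzerodivisor R y"
    using xy by (auto simp: regular_pair_def)
  note one = one_S
  have nzd: "nonzerodivisor L (fr z \<one>)" if z: "z \<in> carrier R" "nonzerodivisor R z" for z
    unfolding nonzerodivisor_def
  proof (intro ballI impI)
    fix l assume lc: "l \<in> carrier L" and l: "fr z \<one> \<otimes>\<^bsub>L\<^esub> l = \<zero>\<^bsub>L\<^esub>"
    obtain a s where as: "a \<in> carrier R" "s \<in> S" "l = fr a s" using lc by (rule L_cases)
    have "fr (z \<otimes> a) s = fr \<zero> \<one>" using l as z(1) one by (simp add: mult_L zero_L)
    then obtain u where u: "u \<in> S" "u \<otimes> (z \<otimes> a \<otimes> \<one>) = u \<otimes> (\<zero> \<otimes> s)"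
      using fr_eq_iff[of "z \<otimes> a" \<zero> s \<one>] as z(1) one by auto
    have "z \<otimes> (u \<otimes> a) = u \<otimes> (z \<otimes> a \<otimes> \<one>)" using u(1) as(1) z(1) by (simp add: m_ac)
    also have "\<dots> = \<zero>" unfolding u(2) using u(1) as(2) by simp
    finally have "u \<otimes> a = \<zero>" using z u(1) as(1) unfolding nonzerodivisor_def by blast
    then show "l = \<zero>\<^bsub>L\<^esub>"
      unfolding as(3) zero_L using fr_eq_iff[of a \<zero> s \<one>] as(1,2) one u(1) by auto
  qed
  have "\<exists>k\<in>carrier L. l = fr x \<one> \<otimes>\<^bsub>L\<^esub> k"
    if l: "l \<in> carrier L" "l' \<in> carrier L" "fr y \<one> \<otimes>\<^bsub>L\<^esub> l = fr x \<one> \<otimes>\<^bsub>L\<^esub> l'" for l l'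
  proof -
    obtain a s where as: "a \<in> carrier R" "s \<in> S" "l = fr a s" using l(1) by (rule L_cases)
    obtain b t where bt: "b \<in> carrier R" "t \<in> S" "l' = fr b t" using l(2) by (rule L_cases)
    have "fr (y \<otimes> a) s = fr (x \<otimes> b) t" using l as bt c one by (simp add: mult_L)
    then obtain u where u: "u \<in> S" "u \<otimes> (y \<otimes> a \<otimes> t) = u \<otimes> (x \<otimes> b \<otimes> s)"
      using fr_eq_iff[of "y \<otimes> a" "x \<otimes> b" s t] as bt c by auto
    have st: "s \<in> carrier R" "t \<in> carrier R" "u \<in> carrier R" using as bt u by auto
    have "y \<otimes> (u \<otimes> a \<otimes> t) = u \<otimes> (y \<otimes> a \<otimes> t)" using st as(1) c by algebra
    also have "\<dots> = x \<otimes> (u \<otimes> b \<otimes> s)" unfolding u(2) using st bt(1) c by algebra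
    finally obtain e where e: "e \<in> carrier R" "u \<otimes> a \<otimes> t = x \<otimes> e"
      using regular_pairD[OF xy, of "u \<otimes> a \<otimes> t" "u \<otimes> b \<otimes> s"] st as(1) bt(1) by auto
    \<comment> \<open>The denominator of the quotient absorbs u and t as well as s, because u a t,
      and not a itself, is known to be a multiple of x.\<close>
    have ut: "u \<otimes> t \<otimes> s \<in> S" using u(1) as(2) bt(2) by (intro mult_S)
    have "a \<otimes> (u \<otimes> t \<otimes> s) = (u \<otimes> a \<otimes> t) \<otimes> s" using st as(1) by algebra
    also have "\<dots> = (x \<otimes> e) \<otimes> s" unfolding e(2) ..
    finally have "l = fr (x \<otimes> e) (u \<otimes> t \<otimes> s)" unfolding as(3) using as e(1) c(1) ut by (intro fr_eqI) auto
    also have "\<dots> = fr x \<one> \<otimes>\<^bsub>L\<^esub> fr e (u \<otimes> t \<otimes> s)" using e(1) c(1) ut one st by (subst mult_L) auto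
    finally show ?thesis using e(1) ut by auto
  qed
  then show ?thesis using nzd c one unfolding regular_pair_def by auto
qed

lemma fr_mem_pair_ideal_iff:
  assumes xy: "x \<in> carrier R" "y \<in> carrier R" and a: "a \<in> carrier R" "s \<in> S"
  shows "fr a s \<in> Idl\<^bsub>L\<^esub> {fr x \<one>, fr y \<one>} \<longleftrightarrow> (\<exists>t\<in>S. t \<otimes> a \<in> Idl {x, y})"
proof -
  interpret L: cring L by (rule cring_L)
  note one = one_S
  have xyL: "fr x \<one> \<in> carrier L" "fr y \<one> \<in> carrier L" using xy one by auto
  interpret Q: ideal "Idl {x, y}" R by (rule genideal_ideal) (use xy in auto)
  have gen: "x \<in> Idl {x, y}" "y \<in> Idl {x, y}" using genideal_self[of "{x, y}"] xy by auto
  show ?thesis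
  proof
    assume "fr a s \<in> Idl\<^bsub>L\<^esub> {fr x \<one>, fr y \<one>}"
    then obtain k l where kl: "k \<in> carrier L" "l \<in> carrier L"
      "fr a s = fr x \<one> \<otimes>\<^bsub>L\<^esub> k \<oplus>\<^bsub>L\<^esub> fr y \<one> \<otimes>\<^bsub>L\<^esub> l"
      unfolding L.genideal_pair[OF xyL] by blast
    obtain b t where bt: "b \<in> carrier R" "t \<in> S" "k = fr b t" using kl(1) by (rule L_cases)
    obtain d v where dv: "d \<in> carrier R" "v \<in> S" "l = fr d v" using kl(2) by (rule L_cases)
    have "fr a s = fr (x \<otimes> b \<otimes> v \<oplus> y \<otimes> d \<otimes> t) (t \<otimes> v)"
      unfolding kl(3) bt(3) dv(3) using xy bt(1,2) dv(1,2) one by (simp add: mult_L add_L)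
    moreover have tv: "t \<otimes> v \<in> S" using bt dv by (intro mult_S)
    moreover have st: "s \<in> carrier R" "t \<in> carrier R" "v \<in> carrier R" using a bt dv by auto
    ultimately obtain u where u: "u \<in> S" "u \<otimes> (a \<otimes> (t \<otimes> v)) = u \<otimes> ((x \<otimes> b \<otimes> v \<oplus> y \<otimes> d \<otimes> t) \<otimes> s)"
      using fr_eq_iff[of a "x \<otimes> b \<otimes> v \<oplus> y \<otimes> d \<otimes> t" s "t \<otimes> v"] a xy bt(1) dv(1) by auto
    have uc: "u \<in> carrier R" using u by simp
    have "(u \<otimes> (t \<otimes> v)) \<otimes> a = u \<otimes> (a \<otimes> (t \<otimes> v))" using a(1) st uc by algebra
    also have "\<dots> = x \<otimes> (u \<otimes> b \<otimes> v \<otimes> s) \<oplus> y \<otimes> (u \<otimes> d \<otimes> t \<otimes> s)"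
      unfolding u(2) using xy bt(1) dv(1) st uc by algebra
    also have "\<dots> \<in> Idl {x, y}" using gen bt(1) dv(1) st uc by (simp add: Q.I_r_closed Q.a_closed)
    finally show "\<exists>t\<in>S. t \<otimes> a \<in> Idl {x, y}" using mult_S[OF u(1) tv] by blast
  next
    assume "\<exists>t\<in>S. t \<otimes> a \<in> Idl {x, y}"
    then obtain t b d where t: "t \<in> S" and bd: "b \<in> carrier R" "d \<in> carrier R" "t \<otimes> a = x \<otimes> b \<oplus> y \<otimes> d"
      unfolding genideal_pair[OF xy] by blast
    have c: "t \<in> carrier R" "s \<in> carrier R" using t a by auto
    have ts: "t \<otimes> s \<in> S" using t a by (intro mult_S)
    have "a \<otimes> (t \<otimes> s \<otimes> (t \<otimes> s)) = (t \<otimes> a) \<otimes> (t \<otimes> s) \<otimes> s" using c a(1) by algebra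
    also have "\<dots> = (x \<otimes> b \<otimes> (t \<otimes> s) \<oplus> y \<otimes> d \<otimes> (t \<otimes> s)) \<otimes> s"
      unfolding bd(3) using c xy bd(1,2) by algebra
    finally have "fr a s = fr (x \<otimes> b \<otimes> (t \<otimes> s) \<oplus> y \<otimes> d \<otimes> (t \<otimes> s)) (t \<otimes> s \<otimes> (t \<otimes> s))"
      using a c xy bd(1,2) mult_S[OF ts ts] by (intro fr_eqI) auto
    also have "\<dots> = fr x \<one> \<otimes>\<^bsub>L\<^esub> fr b (t \<otimes> s) \<oplus>\<^bsub>L\<^esub> fr y \<one> \<otimes>\<^bsub>L\<^esub> fr d (t \<otimes> s)"
      using xy bd(1,2) ts one c by (simp add: mult_L add_L)
    finally show "fr a s \<in> Idl\<^bsub>L\<^esub> {fr x \<one>, fr y \<one>}"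
      unfolding L.genideal_pair[OF xyL] using bd(1,2) ts fr_closed by blast
  qed
qed

text \<open>For a fraction a/s outside the pair ideal, the multiplier that takes a to \<sigma> only
  has to be corrected by s. \<open>\<sigma>_notin\<close> is what keeps \<sigma> from entering the
  ideal after localization.\<close>

lemma irreducible_L:
  assumes xy: "x \<in> carrier R" "y \<in> carrier R" and \<sigma>: "\<sigma> \<in> carrier R"
    and dich: "\<And>a. a \<in> carrier R \<Longrightarrow> a \<in> Idl {x, y} \<or> (\<exists>b\<in>carrier R. a \<otimes> b \<ominus> \<sigma> \<in> Idl {x, y})"
    and \<sigma>_notin: "\<And>s. s \<in> S \<Longrightarrow> s \<otimes> \<sigma> \<notin> Idl {x, y}"
  shows "irreducible_ideal (Idl\<^bsub>L\<^esub> {fr x \<one>, fr y \<one>}) L"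
proof -
  interpret L: cring L by (rule cring_L)
  interpret h: ring_hom_ring R L "\<lambda>a. fr a \<one>"
    by (intro ring_hom_ringI2 ring_axioms L.ring_axioms localization_hom)
  note one = one_S
  have xyL: "fr x \<one> \<in> carrier L" "fr y \<one> \<in> carrier L" using xy one by auto
  show ?thesis
  proof (rule L.irreducible_ideal_of_common_element)
    show "ideal (Idl\<^bsub>L\<^esub> {fr x \<one>, fr y \<one>}) L" by (rule L.genideal_ideal) (use xyL in auto)
    show "fr \<sigma> \<one> \<in> carrier L" using \<sigma> one by auto
    show "fr \<sigma> \<one> \<notin> Idl\<^bsub>L\<^esub> {fr x \<one>, fr y \<one>}"
      using fr_mem_pair_ideal_iff[OF xy \<sigma> one] \<sigma>_notin by blast
    fix l assume l: "l \<in> carrier L" "l \<notin> Idl\<^bsub>L\<^esub> {fr x \<one>, fr y \<one>}"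
    obtain a s where as: "a \<in> carrier R" "s \<in> S" "l = fr a s" using l(1) by (rule L_cases)
    have "a \<notin> Idl {x, y}"
    proof
      assume "a \<in> Idl {x, y}"
      then have "\<one> \<otimes> a \<in> Idl {x, y}" using as(1) by simp
      then show False using l(2) fr_mem_pair_ideal_iff[OF xy as(1,2)] as(3) one by blast
    qed
    then obtain b where b: "b \<in> carrier R" "a \<otimes> b \<ominus> \<sigma> \<in> Idl {x, y}" using dich as(1) by blast
    have sc: "s \<in> carrier R" using as by simp
    have "l \<otimes>\<^bsub>L\<^esub> fr (b \<otimes> s) \<one> = fr (a \<otimes> b) \<one>"
    proof -
      have "a \<otimes> (b \<otimes> s) \<otimes> \<one> = (a \<otimes> b) \<otimes> s" using as(1) b(1) sc by algebra
      then have "fr (a \<otimes> (b \<otimes> s)) s = fr (a \<otimes> b) \<one>"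
        using as(1,2) b(1) one sc by (intro fr_eqI) auto
      moreover have "l \<otimes>\<^bsub>L\<^esub> fr (b \<otimes> s) \<one> = fr (a \<otimes> (b \<otimes> s)) (s \<otimes> \<one>)"
        unfolding as(3) using as(1,2) b(1) one sc by (intro mult_L) auto
      ultimately show ?thesis using sc by simp
    qed
    then have "l \<otimes>\<^bsub>L\<^esub> fr (b \<otimes> s) \<one> \<ominus>\<^bsub>L\<^esub> fr \<sigma> \<one> = fr (a \<otimes> b \<ominus> \<sigma>) \<one>"
      using as(1) b(1) \<sigma> by (simp add: a_minus_def L.minus_eq)
    moreover have "\<one> \<otimes> (a \<otimes> b \<ominus> \<sigma>) \<in> Idl {x, y}" using as(1) b \<sigma> by simp
    then have "fr (a \<otimes> b \<ominus> \<sigma>) \<one> \<in> Idl\<^bsub>L\<^esub> {fr x \<one>, fr y \<one>}"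

      using fr_mem_pair_ideal_iff[OF xy _ one, of "a \<otimes> b \<ominus> \<sigma>"] as(1) b(1) \<sigma> one by blast
    ultimately show "\<exists>b\<in>carrier L. l \<otimes>\<^bsub>L\<^esub> b \<ominus>\<^bsub>L\<^esub> fr \<sigma> \<one> \<in> Idl\<^bsub>L\<^esub> {fr x \<one>, fr y \<one>}"
      using b(1) sc one by (intro bexI[of _ "fr (b \<otimes> s) \<one>"]) auto
  qed
qed

end

text \<open>The chain 2 \<le> depth \<le> dimension \<le> 2 is forced to consist of equalities. A
  system of parameters then has two members, whose ideal contains powers of x and y, so
  irreducibility of the single ideal (x, y) reaches all parameter ideals.\<close>

lemma (in cring) local_gorensteinI:
  assumes noeth: "noetherian_ring R" and loc: "local_ring R M"
    and dim: "krull_dim R \<le> 2" and xy: "regular_pair R x y" "x \<in> M" "y \<in> M"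
  shows "krull_dim R = 2" "local_cohen_macaulay R"
    and "irreducible_ideal (Idl {x, y}) R \<Longrightarrow> local_gorenstein R"
proof -
  have max: "maximalideal M R" using loc by (auto simp: local_ring_def)
  interpret M: primeideal M R by (rule maximalideal_prime[OF max])
  have "2 \<le> depth R M" by (rule depth_ge_2[OF xy])
  moreover have "depth R M \<le> krull_dim R" by (rule depth_le_krull_dim[OF M.primeideal])
  ultimately show dim2: "krull_dim R = 2" and "local_cohen_macaulay R"
    using dim noeth loc unfolding local_cohen_macaulay_def by (auto intro!: exI[of _ M])
  assume irr: "irreducible_ideal (Idl {x, y}) R"
  have "irreducible_ideal (Idl (set xs)) R" if "local_ring R M'" "system_of_parameters R M' xs" for M' xs
  proof -
    have M': "M' = M" using that(1) loc by (auto simp: local_ring_def)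
    have "length xs = 2" using that(2) dim2 by (simp add: system_of_parameters_def numeral_eq_enat)
    then obtain f g where xs: "xs = [f, g]" by (auto simp: numeral_2_eq_2 length_Suc_conv)
    have fg: "f \<in> M" "g \<in> M" using that(2) by (auto simp: system_of_parameters_def M' xs)
    have fgc: "f \<in> carrier R" "g \<in> carrier R" using fg M.Icarr by auto
    interpret Q: ideal "Idl {f, g}" R by (rule genideal_ideal) (use fgc in auto)
    have pow: "\<exists>n::nat. z [^] n \<in> Idl {f, g}" if "z \<in> M" for z
      using \<open>system_of_parameters R M' xs\<close> that by (auto simp: system_of_parameters_def M' xs)
    have c: "x \<in> carrier R" "y \<in> carrier R" using xy by (auto simp: regular_pair_def)
    obtain n :: nat where n: "x [^] n \<in> Idl {f, g}" using pow[OF xy(2)] ..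
    obtain k :: nat where k: "y [^] k \<in> Idl {f, g}" using pow[OF xy(3)] ..
    \<comment> \<open>A common exponent, because \<open>irreducible_ideal_pow\<close> raises both
      elements to the same power.\<close>
    let ?N = "n + k"
    have "x [^] Suc ?N = x [^] n \<otimes> x [^] Suc k" "y [^] Suc ?N = y [^] k \<otimes> y [^] Suc n"
      unfolding nat_pow_mult[OF c(1)] nat_pow_mult[OF c(2)] by (simp_all add: add.commute)
    then have mem: "x [^] Suc ?N \<in> Idl {f, g}" "y [^] Suc ?N \<in> Idl {f, g}"
      using Q.I_r_closed[OF n] Q.I_r_closed[OF k] c by simp_all
    have "Idl {f, g} \<subseteq> M" by (rule genideal_minimal[OF M.is_ideal]) (use fg in auto)
    then have "Idl {f, g} \<noteq> carrier R" using M.I_notcarr M.a_subset by blast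
    then show ?thesis
      using irreducible_ideal_determinant[OF regular_pair_pow[OF xy(1)] irreducible_ideal_pow[OF xy(1) irr]
          fgc mem] by (simp add: xs)
  qed
  then show "local_gorenstein R"
    using \<open>local_cohen_macaulay R\<close> unfolding local_gorenstein_def by blast
qed

text \<open>The pair at any one maximal ideal supplies the lower bound for the dimension, which is
  where the existence of a maximal ideal enters. The conditions on \<sigma> are stated in
  \<open>A\<close> rather than in the localization, so that they can be checked on
  polynomials.\<close>

theorem gorenstein_criterion:
  assumes A: "cring A" "noetherian_ring A" "krull_dim A \<le> 2" and max: "\<exists>M. maximalideal M A"
    and data: "\<And>M. maximalideal M A \<Longrightarrow> \<exists>x y \<sigma>. x \<in> M \<and> y \<in> M \<and> regular_pair A x y \<and> \<sigma> \<in> carrier A \<and>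
      (\<forall>a\<in>carrier A. a \<in> Idl\<^bsub>A\<^esub> {x, y} \<or> (\<exists>b\<in>carrier A. a \<otimes>\<^bsub>A\<^esub> b \<ominus>\<^bsub>A\<^esub> \<sigma> \<in> Idl\<^bsub>A\<^esub> {x, y})) \<and>
      (\<forall>s\<in>carrier A - M. s \<otimes>\<^bsub>A\<^esub> \<sigma> \<notin> Idl\<^bsub>A\<^esub> {x, y})"
  shows "krull_dim A = 2" "cohen_macaulay_ring A" "gorenstein_ring A"
proof -
  interpret A: cring A by fact
  have loc: "krull_dim A = 2 \<and> local_cohen_macaulay (localization A (carrier A - M)) \<and>
      local_gorenstein (localization A (carrier A - M))" if M: "maximalideal M A" for M
  proof -
    interpret M: primeideal M A by (rule A.maximalideal_prime[OF M])
    interpret P: prime_localization M A ..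
    obtain x y \<sigma> where xy: "x \<in> M" "y \<in> M" "regular_pair A x y" and \<sigma>: "\<sigma> \<in> carrier A"
      and d: "\<And>a. a \<in> carrier A \<Longrightarrow> a \<in> Idl\<^bsub>A\<^esub> {x, y} \<or> (\<exists>b\<in>carrier A. a \<otimes>\<^bsub>A\<^esub> b \<ominus>\<^bsub>A\<^esub> \<sigma> \<in> Idl\<^bsub>A\<^esub> {x, y})"
      and e: "\<And>s. s \<in> carrier A - M \<Longrightarrow> s \<otimes>\<^bsub>A\<^esub> \<sigma> \<notin> Idl\<^bsub>A\<^esub> {x, y}"
      using data[OF M] by metis
    have c: "x \<in> carrier A" "y \<in> carrier A" using xy M.Icarr by auto
    interpret L: cring P.L by (rule P.cring_L)
    have rp: "regular_pair P.L (P.fr x \<one>\<^bsub>A\<^esub>) (P.fr y \<one>\<^bsub>A\<^esub>)" by (rule P.regular_pair_L[OF xy(3)])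
    have mem: "P.fr x \<one>\<^bsub>A\<^esub> \<in> P.max_L" "P.fr y \<one>\<^bsub>A\<^esub> \<in> P.max_L"
      using xy c P.fr_mem_max_L_iff P.one_S by auto
    have dim: "krull_dim P.L \<le> 2" using P.krull_dim_L_le A(3) by (rule order_trans)
    note * = L.local_gorensteinI[OF P.noetherian_L[OF A(2)] P.local_ring_L dim rp mem]
    have "irreducible_ideal (Idl\<^bsub>P.L\<^esub> {P.fr x \<one>\<^bsub>A\<^esub>, P.fr y \<one>\<^bsub>A\<^esub>}) P.L"
      by (rule P.irreducible_L[OF c \<sigma> d e])
    moreover have "krull_dim A = 2" using *(1) P.krull_dim_L_le A(3) by simp
    ultimately show ?thesis using * by blast
  qed
  show "krull_dim A = 2" using max loc by blast
  show "cohen_macaulay_ring A" "gorenstein_ring A"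
    using A(1,2) loc unfolding cohen_macaulay_ring_def gorenstein_ring_def by auto
qed

section \<open>Polynomials in finitely many variables\<close>

lemma poly_mapping_sum_single: "p = (\<Sum>m\<in>Poly_Mapping.keys p. Poly_Mapping.single m (Poly_Mapping.lookup p m))"
proof (rule poly_mapping_eqI)
  fix k
  have "(\<Sum>m\<in>Poly_Mapping.keys p. Poly_Mapping.lookup (Poly_Mapping.single m (Poly_Mapping.lookup p m)) k)
      = (\<Sum>m\<in>Poly_Mapping.keys p. if m = k then Poly_Mapping.lookup p m else 0)"
    by (intro sum.cong) (auto simp: lookup_single when_def)
  then show "Poly_Mapping.lookup p k =
      Poly_Mapping.lookup (\<Sum>m\<in>Poly_Mapping.keys p. Poly_Mapping.single m (Poly_Mapping.lookup p m)) k"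
    by (simp add: lookup_sum in_keys_iff)
qed

lemma Const_simps [simp]:
  "Const 0 = 0" "Const 1 = 1" "Const (a + b) = Const a + Const b"
  by (simp_all add: Const_def single_add)

lemma Const_mult: "Const (a * b) = Const a * Const b"
  by (simp add: Const_def mult_single)

lemma Const_minus: "Const (a - b) = Const a - Const (b :: 'k :: ab_group_add)"
  by (simp add: Const_def single_diff)

lemma lookup_Const_times:
  "Poly_Mapping.lookup (Const c * p) m = (c :: 'k :: comm_ring_1) * Poly_Mapping.lookup p m"
proof -
  have "Const c * p = Poly_Mapping.map ((*) c) p" by (simp add: Const_def mult_map_scale_conv_mult)
  then show ?thesis by (simp add: Poly_Mapping.map.rep_eq when_def)
qed

lemma mon_deg_alt: "finite A \<Longrightarrow> Poly_Mapping.keys m \<subseteq> A \<Longrightarrow> mon_deg m = (\<Sum>i\<in>A. Poly_Mapping.lookup m i)"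
  unfolding mon_deg_def by (rule sum.mono_neutral_left) (auto simp: in_keys_iff)

lemma keys_add_nat: "Poly_Mapping.keys (m + n) = Poly_Mapping.keys m \<union> Poly_Mapping.keys (n :: nat \<Rightarrow>\<^sub>0 nat)"
  by (auto simp: in_keys_iff lookup_add)

lemma mon_deg_add: "mon_deg (m + n) = mon_deg m + mon_deg n"
proof -
  let ?A = "Poly_Mapping.keys m \<union> Poly_Mapping.keys n"
  have "mon_deg (m + n) = (\<Sum>i\<in>?A. Poly_Mapping.lookup (m + n) i)" by (intro mon_deg_alt) (auto simp: keys_add_nat)
  moreover have "mon_deg m = (\<Sum>i\<in>?A. Poly_Mapping.lookup m i)" "mon_deg n = (\<Sum>i\<in>?A. Poly_Mapping.lookup n i)"
    by (auto intro!: mon_deg_alt)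
  ultimately show ?thesis by (simp add: lookup_add sum.distrib)
qed

lemma mon_deg_simps [simp]: "mon_deg 0 = 0" "mon_deg (Poly_Mapping.single i k) = k"
  by (auto simp: mon_deg_def)

lemma mon_decomp:
  assumes "i \<in> Poly_Mapping.keys (m :: nat \<Rightarrow>\<^sub>0 nat)"
  obtains m' where "m = Poly_Mapping.single i 1 + m'" "Poly_Mapping.keys m' \<subseteq> Poly_Mapping.keys m"
proof
  let ?m = "m - Poly_Mapping.single i 1"
  show "m = Poly_Mapping.single i 1 + ?m"
    using assms by (intro poly_mapping_eqI) (auto simp: lookup_add lookup_minus lookup_single when_def in_keys_iff)
  show "Poly_Mapping.keys ?m \<subseteq> Poly_Mapping.keys m"
    by (auto simp: in_keys_iff lookup_minus)
qed

subsection \<open>Closure properties\<close>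

lemma polys_0 [simp]: "0 \<in> polys n"
  and polys_Const [simp]: "Const c \<in> polys n"
  and polys_X [simp]: "i < n \<Longrightarrow> X i \<in> polys n"
  by (auto simp: polys_def Const_def X_def split: if_splits)

lemma polys_1 [simp]: "(1 :: 'k :: comm_ring_1 mpol) \<in> polys n"
  unfolding Const_simps(2)[symmetric] by (rule polys_Const)

lemma polys_add [simp]: "p \<in> polys n \<Longrightarrow> q \<in> polys n \<Longrightarrow> p + q \<in> polys n"
  using keys_add[of p q] by (auto simp: polys_def)

lemma polys_uminus [simp]: "p \<in> polys n \<Longrightarrow> - p \<in> polys n" for p :: "'k :: comm_ring_1 mpol"
  by (auto simp: polys_def in_keys_iff)

lemma polys_diff [simp]: "p \<in> polys n \<Longrightarrow> q \<in> polys n \<Longrightarrow> p - q \<in> polys n" for p :: "'k :: comm_ring_1 mpol"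
  using polys_add[OF _ polys_uminus, of p n q] by simp

lemma polys_mult [simp]: "p \<in> polys n \<Longrightarrow> q \<in> polys n \<Longrightarrow> p * q \<in> polys n" for p :: "'k :: comm_ring_1 mpol"
  using keys_mult[of p q] unfolding polys_def by (fastforce simp: keys_add_nat)

lemma polys_power [simp]: "p \<in> polys n \<Longrightarrow> p ^ k \<in> polys n" for p :: "'k :: comm_ring_1 mpol"
  by (induction k) auto

lemma polys_sum [simp]: "(\<And>i. i \<in> A \<Longrightarrow> f i \<in> polys n) \<Longrightarrow> sum f A \<in> polys n"
  by (induction A rule: infinite_finite_induct) auto

lemma polys_mono: "n \<le> k \<Longrightarrow> polys n \<subseteq> polys k"
  by (fastforce simp: polys_def)

lemma polys_induct [consumes 1, case_names Const add X]:
  fixes p :: "'k :: comm_ring_1 mpol"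
  assumes "p \<in> polys n"
    and Const: "\<And>c. P (Const c)"
    and add: "\<And>p q. p \<in> polys n \<Longrightarrow> q \<in> polys n \<Longrightarrow> P p \<Longrightarrow> P q \<Longrightarrow> P (p + q)"
    and X: "\<And>i p. i < n \<Longrightarrow> p \<in> polys n \<Longrightarrow> P p \<Longrightarrow> P (X i * p)"
  shows "P p"
proof -
  have single: "P (Poly_Mapping.single m c) \<and> Poly_Mapping.single m c \<in> polys n"
    if "Poly_Mapping.keys m \<subseteq> {..<n}" for m c
    using that
  proof (induction "mon_deg m" arbitrary: m rule: less_induct)
    case less
    show ?case
    proof (cases "m = 0")
      case True
      then show ?thesis using Const[of c] polys_Const[of c n] by (simp add: Const_def)
    next
      case False
      then have "Poly_Mapping.keys m \<noteq> {}" by simp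
      then obtain i where i: "i \<in> Poly_Mapping.keys m" by blast
      then obtain m' where m': "m = Poly_Mapping.single i 1 + m'" "Poly_Mapping.keys m' \<subseteq> Poly_Mapping.keys m"
        by (rule mon_decomp)
      have "P (Poly_Mapping.single m' c) \<and> Poly_Mapping.single m' c \<in> polys n"
        using less.hyps[of m'] less.prems m' by (auto simp: mon_deg_add)
      moreover have "Poly_Mapping.single m c = X i * Poly_Mapping.single m' c"
        by (simp add: m'(1) X_def mult_single)
      ultimately show ?thesis using X[of i] i less.prems by auto
    qed
  qed
  have "P (\<Sum>m\<in>M. Poly_Mapping.single m (f m)) \<and> (\<Sum>m\<in>M. Poly_Mapping.single m (f m)) \<in> polys n"
    if "finite M" "\<forall>m\<in>M. Poly_Mapping.keys m \<subseteq> {..<n}" for M and f :: "_ \<Rightarrow> 'k"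
    using that
  proof (induction M)
    case empty
    then show ?case using Const[of 0] by simp
  next
    case (insert m M)
    then show ?case using single[of m "f m"] add by simp
  qed
  from this[of "Poly_Mapping.keys p" "Poly_Mapping.lookup p"] assms(1)
  show ?thesis unfolding poly_mapping_sum_single[symmetric] by (auto simp: polys_def)
qed

subsection \<open>Evaluation homomorphisms\<close>

definition mon_eval :: "(nat \<Rightarrow> 'b) \<Rightarrow> (nat \<Rightarrow>\<^sub>0 nat) \<Rightarrow> 'b :: comm_monoid_mult" where
  "mon_eval \<xi> m = (\<Prod>i\<in>Poly_Mapping.keys m. \<xi> i ^ Poly_Mapping.lookup m i)"

lemma mon_eval_alt:
  "finite A \<Longrightarrow> Poly_Mapping.keys m \<subseteq> A \<Longrightarrow> mon_eval \<xi> m = (\<Prod>i\<in>A. \<xi> i ^ Poly_Mapping.lookup m i)"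
  unfolding mon_eval_def by (rule prod.mono_neutral_left) (auto simp: in_keys_iff)

lemma mon_eval_add: "mon_eval \<xi> (m + n) = mon_eval \<xi> m * mon_eval \<xi> n"
proof -
  let ?A = "Poly_Mapping.keys m \<union> Poly_Mapping.keys n"
  have "mon_eval \<xi> k = (\<Prod>i\<in>?A. \<xi> i ^ Poly_Mapping.lookup k i)" if "k = m \<or> k = n \<or> k = m + n" for k
    by (rule mon_eval_alt) (use that in \<open>auto simp: keys_add_nat\<close>)
  then show ?thesis by (simp add: lookup_add power_add prod.distrib)
qed

lemma mon_eval_simps [simp]: "mon_eval \<xi> 0 = 1" "mon_eval \<xi> (Poly_Mapping.single i k) = \<xi> i ^ k"
  by (auto simp: mon_eval_def)

text \<open>The homomorphism laws are proved once here and shared by \<open>par\<close>,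
  \<open>dual\<close>, \<open>chart_tu\<close>, \<open>pullback_j\<close> and the changes of
  coordinates.\<close>

locale coeff_hom =
  fixes \<phi> :: "'k :: comm_ring_1 \<Rightarrow> 'b :: comm_ring_1" and \<xi> :: "nat \<Rightarrow> 'b"
  assumes hom_1: "\<phi> 1 = 1" and hom_add: "\<phi> (a + b) = \<phi> a + \<phi> b" and hom_mult: "\<phi> (a * b) = \<phi> a * \<phi> b"
begin

abbreviation ev where "ev \<equiv> eval_with \<phi> \<xi>"

lemma hom_0: "\<phi> 0 = 0"
  using hom_add[of 0 0] by simp

lemma ev_alt:
  assumes "finite M" "Poly_Mapping.keys p \<subseteq> M"
  shows "ev p = (\<Sum>m\<in>M. \<phi> (Poly_Mapping.lookup p m) * mon_eval \<xi> m)"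
  unfolding eval_with_def mon_eval_def[symmetric]
  by (rule sum.mono_neutral_left) (use assms in \<open>auto simp: in_keys_iff hom_0\<close>)

lemma ev_add [simp]: "ev (p + q) = ev p + ev q"
proof -
  let ?M = "Poly_Mapping.keys p \<union> Poly_Mapping.keys q"
  have "ev k = (\<Sum>m\<in>?M. \<phi> (Poly_Mapping.lookup k m) * mon_eval \<xi> m)" if "k = p \<or> k = q \<or> k = p + q" for k
    by (rule ev_alt) (use that keys_add[of p q] in auto)
  then show ?thesis by (simp add: lookup_add hom_add distrib_right sum.distrib)
qed

lemma ev_single: "ev (Poly_Mapping.single m c) = \<phi> c * mon_eval \<xi> m"
  by (subst ev_alt[of "{m}"]) (auto split: if_splits)

lemma ev_Const [simp]: "ev (Const c) = \<phi> c" and ev_X [simp]: "ev (X i) = \<xi> i"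
  by (simp_all add: Const_def X_def ev_single hom_1)

lemma ev_0 [simp]: "ev 0 = 0" and ev_1 [simp]: "ev 1 = 1"
  using ev_Const[of 0] ev_Const[of 1] by (simp_all add: hom_0 hom_1)

lemma ev_sum [simp]: "ev (sum f A) = (\<Sum>i\<in>A. ev (f i))"
  by (induction A rule: infinite_finite_induct) auto

lemma ev_mult [simp]: "ev (p * q) = ev p * ev q"
proof -
  let ?s = "\<lambda>p m. Poly_Mapping.single m (Poly_Mapping.lookup p m)"
  have "ev (p * q) = ev ((\<Sum>m\<in>Poly_Mapping.keys p. ?s p m) * (\<Sum>m\<in>Poly_Mapping.keys q. ?s q m))"
    by (simp flip: poly_mapping_sum_single)
  also have "\<dots> = (\<Sum>m\<in>Poly_Mapping.keys p. \<Sum>n\<in>Poly_Mapping.keys q. ev (?s p m) * ev (?s q n))"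
    by (simp add: sum_product mult_single ev_single hom_mult mon_eval_add mult_ac)
  also have "\<dots> = ev (\<Sum>m\<in>Poly_Mapping.keys p. ?s p m) * ev (\<Sum>m\<in>Poly_Mapping.keys q. ?s q m)"
    by (simp add: sum_product)
  also have "\<dots> = ev p * ev q"
    by (simp flip: poly_mapping_sum_single)
  finally show ?thesis .
qed

lemma ev_uminus [simp]: "ev (- p) = - ev p"
proof -
  have "ev p + ev (- p) = ev (p + - p)" by (simp only: ev_add)
  then show ?thesis by (simp add: eq_neg_iff_add_eq_0 add.commute)
qed

lemma ev_diff [simp]: "ev (p - q) = ev p - ev q"
  using ev_add[of p "- q"] by simp

lemma ev_power [simp]: "ev (p ^ k) = ev p ^ k"
  by (induction k) auto

end

subsection \<open>The polynomial ring as an object\<close>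

lemma poly_ring_simps [simp]:
  "carrier (poly_ring n) = polys n" "x \<otimes>\<^bsub>poly_ring n\<^esub> y = x * y" "x \<oplus>\<^bsub>poly_ring n\<^esub> y = x + y"
  "\<one>\<^bsub>poly_ring n\<^esub> = 1" "\<zero>\<^bsub>poly_ring n\<^esub> = 0"
  by (simp_all add: poly_ring_def)

lemma cring_poly_ring: "cring (poly_ring n :: 'k :: comm_ring_1 mpol ring)"
proof (rule cringI)
  show "abelian_group (poly_ring n :: 'k mpol ring)"
  proof (rule abelian_groupI)
    fix x :: "'k mpol" assume "x \<in> carrier (poly_ring n)"
    then show "\<exists>y\<in>carrier (poly_ring n). y \<oplus>\<^bsub>poly_ring n\<^esub> x = \<zero>\<^bsub>poly_ring n\<^esub>"
      by (intro bexI[of _ "- x"]) auto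
  qed (auto simp: algebra_simps)
  show "comm_monoid (poly_ring n :: 'k mpol ring)"
    by (rule comm_monoidI) (auto simp: algebra_simps)
qed (auto simp: algebra_simps)

lemma poly_ring_uminus [simp]:
  assumes "(x :: 'k :: comm_ring_1 mpol) \<in> polys n"
  shows "\<ominus>\<^bsub>poly_ring n\<^esub> x = - x"
proof -
  interpret cring "poly_ring n :: 'k mpol ring" by (rule cring_poly_ring)
  show ?thesis by (rule minus_equality) (use assms in auto)
qed

lemma ideal_poly_ring_iff:
  "ideal I (poly_ring n :: 'k :: comm_ring_1 mpol ring) \<longleftrightarrow> I \<subseteq> polys n \<and> 0 \<in> I \<and> (\<forall>p\<in>I. \<forall>q\<in>I. p + q \<in> I) \<and>
    (\<forall>p\<in>polys n. \<forall>q\<in>I. p * q \<in> I)"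
proof
  interpret R: cring "poly_ring n :: 'k mpol ring" by (rule cring_poly_ring)
  assume "ideal I (poly_ring n)"
  then interpret I: ideal I "poly_ring n" .
  show "I \<subseteq> polys n \<and> 0 \<in> I \<and> (\<forall>p\<in>I. \<forall>q\<in>I. p + q \<in> I) \<and> (\<forall>p\<in>polys n. \<forall>q\<in>I. p * q \<in> I)"
    using I.a_subset I.zero_closed I.a_closed I.I_l_closed by auto
next
  interpret R: cring "poly_ring n :: 'k mpol ring" by (rule cring_poly_ring)
  assume I: "I \<subseteq> polys n \<and> 0 \<in> I \<and> (\<forall>p\<in>I. \<forall>q\<in>I. p + q \<in> I) \<and> (\<forall>p\<in>polys n. \<forall>q\<in>I. p * q \<in> I)"
  show "ideal I (poly_ring n)"
  proof (rule idealI[OF R.ring_axioms])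
    show "subgroup I (add_monoid (poly_ring n))"
    proof (rule R.add.subgroupI)
      fix a assume a: "a \<in> I"
      then have "(- 1) * a \<in> I" using I by (metis polys_1 polys_uminus)
      then show "\<ominus>\<^bsub>poly_ring n\<^esub> a \<in> I" using a I by auto
    qed (use I in auto)
  next
    fix a x :: "'k mpol" assume "a \<in> I" "x \<in> carrier (poly_ring n)"
    then show "x \<otimes>\<^bsub>poly_ring n\<^esub> a \<in> I" "a \<otimes>\<^bsub>poly_ring n\<^esub> x \<in> I"
      using I by (simp_all add: mult.commute[of a x])
  qed
qed

subsection \<open>Hilbert's basis theorem\<close>

definition subring_of :: "'a :: comm_ring_1 set \<Rightarrow> bool" where
  "subring_of B \<longleftrightarrow> 0 \<in> B \<and> 1 \<in> B \<and> (\<forall>a\<in>B. \<forall>b\<in>B. a + b \<in> B \<and> a - b \<in> B \<and> a * b \<in> B)"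

definition ideal_in :: "'a :: comm_ring_1 set \<Rightarrow> 'a set \<Rightarrow> bool" where
  "ideal_in B I \<longleftrightarrow> I \<subseteq> B \<and> 0 \<in> I \<and> (\<forall>a\<in>I. \<forall>b\<in>I. a + b \<in> I) \<and> (\<forall>a\<in>B. \<forall>b\<in>I. a * b \<in> I)"

text \<open>Finite generation is phrased through all ideals containing F, which avoids forming
  generated ideals inside the subring B.\<close>

definition noetherian_in :: "'a :: comm_ring_1 set \<Rightarrow> bool" where
  "noetherian_in B \<longleftrightarrow> (\<forall>I. ideal_in B I \<longrightarrow>
     (\<exists>F. finite F \<and> F \<subseteq> I \<and> (\<forall>J. ideal_in B J \<longrightarrow> F \<subseteq> J \<longrightarrow> I \<subseteq> J)))"

text \<open>The subring B[x] of the ambient ring. Coefficients need not be unique, as x may be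
  algebraic over B.\<close>

definition adjoin :: "'a :: comm_ring_1 set \<Rightarrow> 'a \<Rightarrow> 'a set" where
  "adjoin B x = {\<Sum>i<n. b i * x ^ i | n b. \<forall>i. b i \<in> B}"

text \<open>The coefficients of x^n in elements of I that admit an expression of degree at most n;
  the existence of one expression stands in for uniqueness.\<close>

definition leading :: "'a :: comm_ring_1 set \<Rightarrow> 'a \<Rightarrow> 'a set \<Rightarrow> nat \<Rightarrow> 'a set" where
  "leading B x I n = {c \<in> B. \<exists>b. (\<forall>i. b i \<in> B) \<and> c * x ^ n + (\<Sum>i<n. b i * x ^ i) \<in> I}"

lemma adjoinI: "\<forall>i. b i \<in> B \<Longrightarrow> (\<Sum>i<n. b i * x ^ i) \<in> adjoin B x"
  by (auto simp: adjoin_def)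

lemma leadingI:
  "\<lbrakk>c \<in> B; \<forall>i. b i \<in> B; c * x ^ n + (\<Sum>i<n. b i * x ^ i) \<in> I\<rbrakk> \<Longrightarrow> c \<in> leading B x I n"
  by (auto simp: leading_def)

lemma adjoin_scale:
  assumes "subring_of B" "a \<in> B" "f \<in> adjoin B x"
  shows "a * f \<in> adjoin B x"
proof -
  obtain n b where b: "f = (\<Sum>i<n. b i * x ^ i)" "\<forall>i. b i \<in> B" using assms(3) by (auto simp: adjoin_def)
  then have "a * f = (\<Sum>i<n. (a * b i) * x ^ i)" by (simp add: sum_distrib_left mult_ac)
  moreover have "\<forall>i. a * b i \<in> B" using b assms by (auto simp: subring_of_def)
  ultimately show ?thesis by (auto simp: adjoin_def intro!: exI[of _ n] exI[of _ "\<lambda>i. a * b i"])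
qed

lemma adjoin_times_x:
  assumes "subring_of B" "f \<in> adjoin B x"
  shows "x * f \<in> adjoin B x"
proof -
  obtain n b where b: "f = (\<Sum>i<n. b i * x ^ i)" "\<forall>i. b i \<in> B" using assms(2) by (auto simp: adjoin_def)
  let ?b = "\<lambda>i. case i of 0 \<Rightarrow> 0 | Suc j \<Rightarrow> b j"
  have "x * f = (\<Sum>i<Suc n. ?b i * x ^ i)"
    by (subst sum.lessThan_Suc_shift) (simp add: b sum_distrib_left mult_ac)
  moreover have "\<forall>i. ?b i \<in> B" using b assms by (auto simp: subring_of_def split: nat.split)
  ultimately show ?thesis unfolding adjoin_def by blast
qed

lemma adjoin_add:
  assumes "subring_of B" "f \<in> adjoin B x" "g \<in> adjoin B x"
  shows "f + g \<in> adjoin B x"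
proof -
  obtain n b where b: "f = (\<Sum>i<n. b i * x ^ i)" "\<forall>i. b i \<in> B" using assms(2) by (auto simp: adjoin_def)
  obtain m c where c: "g = (\<Sum>i<m. c i * x ^ i)" "\<forall>i. c i \<in> B" using assms(3) by (auto simp: adjoin_def)
  let ?N = "max n m"
  let ?b = "\<lambda>i. if i < n then b i else 0" and ?c = "\<lambda>i. if i < m then c i else 0"
  have "f = (\<Sum>i<?N. ?b i * x ^ i)"
    unfolding b(1) by (rule sum.mono_neutral_cong_left) auto
  moreover have "g = (\<Sum>i<?N. ?c i * x ^ i)"
    unfolding c(1) by (rule sum.mono_neutral_cong_left) auto
  ultimately have "f + g = (\<Sum>i<?N. (?b i + ?c i) * x ^ i)" by (simp add: sum.distrib distrib_right)
  moreover have "\<forall>i. ?b i + ?c i \<in> B" using b c assms by (auto simp: subring_of_def)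
  ultimately show ?thesis using adjoinI[of "\<lambda>i. ?b i + ?c i" B x ?N] by simp
qed

lemma adjoin_mem:
  assumes "subring_of B"
  shows "B \<subseteq> adjoin B x" "x \<in> adjoin B x"
proof -
  show 1: "B \<subseteq> adjoin B x"
  proof
    fix b assume "b \<in> B"
    then show "b \<in> adjoin B x" unfolding adjoin_def by (intro CollectI exI[of _ 1] exI[of _ "\<lambda>_. b"]) auto
  qed
  show "x \<in> adjoin B x" using adjoin_times_x[OF assms, of 1 x] 1 assms by (auto simp: subring_of_def)
qed

lemma adjoin_mult:
  assumes "subring_of B" "f \<in> adjoin B x" "g \<in> adjoin B x"
  shows "f * g \<in> adjoin B x"
proof -
  obtain n b where b: "f = (\<Sum>i<n. b i * x ^ i)" "\<forall>i. b i \<in> B" using assms(2) by (auto simp: adjoin_def)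
  have pow: "x ^ i * g \<in> adjoin B x" for i
    by (induction i) (use assms adjoin_times_x in \<open>auto simp: mult.assoc\<close>)
  have "(\<Sum>i<n. b i * (x ^ i * g)) \<in> adjoin B x"
  proof (induction n)
    case 0
    then show ?case using adjoin_mem[OF assms(1)] assms(1) by (auto simp: subring_of_def)
  next
    case (Suc n)
    then show ?case using adjoin_add[OF assms(1)] adjoin_scale[OF assms(1) _ pow] b(2) by simp
  qed
  then show ?thesis by (simp add: b(1) sum_distrib_right mult.assoc)
qed

lemma subring_adjoin:
  assumes "subring_of B"
  shows "subring_of (adjoin B x)"
proof -
  have "- 1 \<in> B" using assms unfolding subring_of_def by (metis diff_0)
  then have "- g \<in> adjoin B x" if "g \<in> adjoin B x" for g using adjoin_scale[OF assms _ that, of "- 1"] by simp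
  then have "f - g \<in> adjoin B x" if "f \<in> adjoin B x" "g \<in> adjoin B x" for f g
    using adjoin_add[OF assms that(1), of "- g"] that(2) by simp
  moreover have "0 \<in> adjoin B x" "1 \<in> adjoin B x"
    using adjoin_mem(1)[OF assms] assms by (auto simp: subring_of_def)
  ultimately show ?thesis
    using adjoin_add[OF assms] adjoin_mult[OF assms] by (simp add: subring_of_def)
qed

lemma leading_ideal:
  assumes B: "subring_of B" and I: "ideal_in (adjoin B x) I"
  shows "ideal_in B (leading B x I n)"
proof -
  have z: "0 \<in> B" using B by (simp add: subring_of_def)
  have "0 \<in> leading B x I n" unfolding leading_def
    using z I by (auto simp: ideal_in_def intro!: exI[of _ "\<lambda>_. 0"])
  moreover have "c + d \<in> leading B x I n" if cd: "c \<in> leading B x I n" "d \<in> leading B x I n" for c d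
  proof -
    obtain b where b: "\<forall>i. b i \<in> B" "c * x ^ n + (\<Sum>i<n. b i * x ^ i) \<in> I" using cd(1) by (auto simp: leading_def)
    obtain b' where b': "\<forall>i. b' i \<in> B" "d * x ^ n + (\<Sum>i<n. b' i * x ^ i) \<in> I" using cd(2) by (auto simp: leading_def)
    have "(c * x ^ n + (\<Sum>i<n. b i * x ^ i)) + (d * x ^ n + (\<Sum>i<n. b' i * x ^ i)) \<in> I"
      using b b' I by (auto simp: ideal_in_def)
    then have "(c + d) * x ^ n + (\<Sum>i<n. (b i + b' i) * x ^ i) \<in> I"
      by (simp add: sum.distrib algebra_simps)
    moreover have "\<forall>i. b i + b' i \<in> B" using b b' B by (auto simp: subring_of_def)
    moreover have "c + d \<in> B" using cd B by (auto simp: leading_def subring_of_def)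
    ultimately show ?thesis using leadingI[of "c + d" B "\<lambda>i. b i + b' i"] by simp
  qed
  moreover have "a * c \<in> leading B x I n" if ac: "a \<in> B" "c \<in> leading B x I n" for a c
  proof -
    obtain b where b: "\<forall>i. b i \<in> B" "c * x ^ n + (\<Sum>i<n. b i * x ^ i) \<in> I" using ac(2) by (auto simp: leading_def)
    have "a * (c * x ^ n + (\<Sum>i<n. b i * x ^ i)) \<in> I"
      using b I ac(1) adjoin_mem[OF B] unfolding ideal_in_def by blast
    then have "(a * c) * x ^ n + (\<Sum>i<n. (a * b i) * x ^ i) \<in> I"
      by (simp add: sum_distrib_left algebra_simps)
    moreover have "\<forall>i. a * b i \<in> B" using b ac B by (auto simp: subring_of_def)
    moreover have "a * c \<in> B" using ac B by (auto simp: leading_def subring_of_def)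
    ultimately show ?thesis using leadingI[of "a * c" B "\<lambda>i. a * b i"] by simp
  qed
  ultimately show ?thesis unfolding ideal_in_def by (auto simp: leading_def)
qed

lemma leading_Suc:
  assumes B: "subring_of B" and I: "ideal_in (adjoin B x) I"
  shows "leading B x I n \<subseteq> leading B x I (Suc n)"
proof
  fix c assume "c \<in> leading B x I n"
  then obtain b where b: "c \<in> B" "\<forall>i. b i \<in> B" "c * x ^ n + (\<Sum>i<n. b i * x ^ i) \<in> I" by (auto simp: leading_def)
  let ?b = "\<lambda>i. case i of 0 \<Rightarrow> 0 | Suc j \<Rightarrow> b j"
  have "x * (c * x ^ n + (\<Sum>i<n. b i * x ^ i)) \<in> I"
    using b I adjoin_mem[OF B] unfolding ideal_in_def by blast
  moreover have "(\<Sum>i<Suc n. ?b i * x ^ i) = x * (\<Sum>i<n. b i * x ^ i)"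
    by (subst sum.lessThan_Suc_shift) (simp add: sum_distrib_left mult_ac)
  ultimately have "c * x ^ Suc n + (\<Sum>i<Suc n. ?b i * x ^ i) \<in> I"
    by (simp add: algebra_simps del: sum.lessThan_Suc)
  moreover have "\<forall>i. ?b i \<in> B" using b B by (auto simp: subring_of_def split: nat.split)
  ultimately show "c \<in> leading B x I (Suc n)" using b(1) unfolding leading_def by blast
qed

text \<open>The leading-coefficient ideals increase with the degree and stabilize at some N; lifts
  of generators for the degrees up to N generate I, by descent on the degree.\<close>

theorem hilbert_basis:
  assumes B: "subring_of B" and noeth: "noetherian_in B"
  shows "noetherian_in (adjoin B x)"
  unfolding noetherian_in_def
proof (intro allI impI)
  fix I assume I: "ideal_in (adjoin B x) I"
  let ?L = "leading B x I"
  have mono: "?L m \<subseteq> ?L n" if "m \<le> n" for m n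
    using lift_Suc_mono_le[of ?L, OF leading_Suc[OF B I] that] .
  have U: "ideal_in B (\<Union>n. ?L n)"
  proof -
    note L = leading_ideal[OF B I]
    have add: "a + b \<in> (\<Union>n. ?L n)" if "a \<in> ?L m" "b \<in> ?L n" for a b m n
    proof -
      have "a \<in> ?L (max m n)" "b \<in> ?L (max m n)" using that mono[of m "max m n"] mono[of n "max m n"] by auto
      then show ?thesis using L[of "max m n"] unfolding ideal_in_def by blast
    qed
    have sub: "?L n \<subseteq> B" and zero: "0 \<in> ?L n" and mult: "\<And>a b. a \<in> B \<Longrightarrow> b \<in> ?L n \<Longrightarrow> a * b \<in> ?L n" for n
      using L[of n] unfolding ideal_in_def by auto
    show ?thesis unfolding ideal_in_def
    proof (intro conjI ballI)
      show "a + b \<in> (\<Union>n. ?L n)" if "a \<in> (\<Union>n. ?L n)" "b \<in> (\<Union>n. ?L n)" for a b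
        using that by (elim UN_E) (rule add)
      show "(\<Union>n. ?L n) \<subseteq> B" using sub by (rule UN_least)
      show "0 \<in> (\<Union>n. ?L n)" using zero[of 0] by (rule UN_I[OF UNIV_I])
      show "a * b \<in> (\<Union>n. ?L n)" if "a \<in> B" "b \<in> (\<Union>n. ?L n)" for a b
        using that(2) by (elim UN_E) (rule UN_I[OF UNIV_I], rule mult[OF that(1)])
    qed
  qed
  then obtain F where F: "finite F" "F \<subseteq> (\<Union>n. ?L n)" "\<And>J. ideal_in B J \<Longrightarrow> F \<subseteq> J \<Longrightarrow> (\<Union>n. ?L n) \<subseteq> J"
    using noeth unfolding noetherian_in_def by metis
  have "\<exists>N. F \<subseteq> ?L N" using F(1,2)
  proof (induction F)
    case (insert a F)
    then obtain N m where "F \<subseteq> ?L N" "a \<in> ?L m" by auto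
    then have "insert a F \<subseteq> ?L (max m N)" using mono[of m "max m N"] mono[of N "max m N"] by auto
    then show ?case ..
  qed auto
  then obtain N where "F \<subseteq> ?L N" ..
  then have N: "?L n \<subseteq> ?L N" for n using F(3)[OF leading_ideal[OF B I]] by blast
  have "\<forall>n. \<exists>F. finite F \<and> F \<subseteq> ?L n \<and> (\<forall>J. ideal_in B J \<longrightarrow> F \<subseteq> J \<longrightarrow> ?L n \<subseteq> J)"
    using noeth leading_ideal[OF B I] unfolding noetherian_in_def by blast
  then obtain G where G: "\<And>n. finite (G n)" "\<And>n. G n \<subseteq> ?L n"
    "\<And>n J. ideal_in B J \<Longrightarrow> G n \<subseteq> J \<Longrightarrow> ?L n \<subseteq> J" by metis
  have "\<forall>n c. \<exists>f. c \<in> G n \<longrightarrow> (\<exists>b. (\<forall>i. b i \<in> B) \<and> f = c * x ^ n + (\<Sum>i<n. b i * x ^ i)) \<and> f \<in> I"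
    using G(2) unfolding leading_def by blast
  then obtain w where w: "\<And>n c. c \<in> G n \<Longrightarrow> (\<exists>b. (\<forall>i. b i \<in> B) \<and> w n c = c * x ^ n + (\<Sum>i<n. b i * x ^ i)) \<and> w n c \<in> I"
    by metis
  let ?H = "\<Union>n\<le>N. w n ` G n"
  have "I \<subseteq> J" if J: "ideal_in (adjoin B x) J" "?H \<subseteq> J" for J
  proof -
    \<comment> \<open>Up to degree N the leading ideals of I are those of the intersection with J,
      so each reduction can subtract an element lying in both I and J.\<close>
    have IJ: "ideal_in (adjoin B x) (I \<inter> J)" using I J(1) unfolding ideal_in_def by blast
    have LL: "?L n \<subseteq> leading B x (I \<inter> J) n" if "n \<le> N" for n
    proof (rule G(3)[OF leading_ideal[OF B IJ]])
      show "G n \<subseteq> leading B x (I \<inter> J) n"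
      proof
        fix c assume c: "c \<in> G n"
        then have "w n c \<in> I \<inter> J" using w J(2) that by blast
        moreover have "c \<in> B" using c G(2) by (auto simp: leading_def)
        ultimately show "c \<in> leading B x (I \<inter> J) n" using w[OF c] unfolding leading_def by auto
      qed
    qed
    have "(\<Sum>i<n. b i * x ^ i) \<in> I \<Longrightarrow> \<forall>i. b i \<in> B \<Longrightarrow> (\<Sum>i<n. b i * x ^ i) \<in> J" for n b
    proof (induction n arbitrary: b)
      case 0
      then show ?case using J(1) by (simp add: ideal_in_def)
    next
      case (Suc n)
      let ?f = "\<Sum>i<Suc n. b i * x ^ i"
      \<comment> \<open>Above degree N no new leading coefficients occur, so a witness of degree k
        is taken and multiplied by x^(n - k).\<close>
      define k where "k = min n N"
      have "b n \<in> ?L n" using Suc.prems by (auto simp: leading_def add.commute)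
      then have "b n \<in> ?L k" using N by (auto simp: k_def min_def)
      then have "b n \<in> leading B x (I \<inter> J) k" using LL[of k] by (auto simp: k_def)
      then obtain d where d: "\<forall>i. d i \<in> B" "b n * x ^ k + (\<Sum>i<k. d i * x ^ i) \<in> I \<inter> J"
        unfolding leading_def by blast
      define g where "g = x ^ (n - k) * (b n * x ^ k + (\<Sum>i<k. d i * x ^ i))"
      have "x ^ m \<in> adjoin B x" for m
        by (induction m) (use B adjoin_mem[OF B] adjoin_times_x[OF B] in \<open>auto simp: subring_of_def\<close>)
      then have g: "g \<in> I" "g \<in> J" using d(2) IJ unfolding g_def ideal_in_def by blast+
      define d' where "d' = (\<lambda>i. if i < n - k then 0 else d (i - (n - k)))"
      have kn: "k \<le> n" by (simp add: k_def)
      have "(\<Sum>i<n. d' i * x ^ i) = (\<Sum>i\<in>{n-k..<n}. d' i * x ^ i)"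
        by (rule sum.mono_neutral_right) (auto simp: d'_def)
      also have "\<dots> = (\<Sum>i<k. d' (i + (n - k)) * x ^ (i + (n - k)))"
        using kn sum.shift_bounds_nat_ivl[of "\<lambda>i. d' i * x ^ i" 0 "n - k" k] by (simp add: atLeast0LessThan)
      also have "\<dots> = x ^ (n - k) * (\<Sum>i<k. d i * x ^ i)"
        by (simp add: d'_def sum_distrib_left power_add mult_ac)
      finally have g_eq: "g = b n * x ^ n + (\<Sum>i<n. d' i * x ^ i)"
        using kn by (simp add: g_def algebra_simps flip: power_add)
      have "- 1 \<in> adjoin B x" using subring_adjoin[OF B, of x] unfolding subring_of_def by (metis diff_0)
      then have "(- 1) * g \<in> I" using g(1) I unfolding ideal_in_def by blast
      then have "?f + (- 1) * g \<in> I" using Suc.prems(1) I unfolding ideal_in_def by blast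
      moreover have e: "?f + (- 1) * g = (\<Sum>i<n. (b i - d' i) * x ^ i)"
        by (simp add: g_eq algebra_simps sum_subtractf)
      moreover have "\<forall>i. b i - d' i \<in> B" using Suc.prems(2) d(1) B by (auto simp: d'_def subring_of_def)
      ultimately have "?f + (- 1) * g \<in> J" using Suc.IH by metis
      then have "(?f + (- 1) * g) + g \<in> J" using g(2) J(1) unfolding ideal_in_def by blast
      then show ?case by simp
    qed
    then show ?thesis using I unfolding ideal_in_def adjoin_def by blast
  qed
  moreover have "finite ?H" using G(1) by auto
  moreover have "?H \<subseteq> I" using w by blast
  ultimately show "\<exists>F. finite F \<and> F \<subseteq> I \<and> (\<forall>J. ideal_in (adjoin B x) J \<longrightarrow> F \<subseteq> J \<longrightarrow> I \<subseteq> J)" by blast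
qed

lemma subring_polys: "subring_of (polys n :: 'k :: comm_ring_1 mpol set)"
  by (simp add: subring_of_def)

lemma polys_Suc_adjoin: "polys (Suc n) = adjoin (polys n :: 'k :: comm_ring_1 mpol set) (X n)"
proof
  show "adjoin (polys n) (X n) \<subseteq> polys (Suc n)"
    using polys_mono[of n "Suc n"] by (fastforce simp: adjoin_def intro!: polys_sum polys_mult)
  show "polys (Suc n) \<subseteq> adjoin (polys n :: 'k mpol set) (X n)"
  proof
    fix p :: "'k mpol" assume "p \<in> polys (Suc n)"
    then show "p \<in> adjoin (polys n) (X n)"
    proof (induction rule: polys_induct)
      case (Const c)
      then show ?case using adjoin_mem(1)[OF subring_polys, of n] polys_Const by blast
    next
      case (add p q)
      then show ?case using adjoin_add[OF subring_polys] by blast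
    next
      case (X i p)
      show ?case
      proof (cases "i = n")
        case True
        then show ?thesis using adjoin_times_x[OF subring_polys X(3)] by simp
      next
        case False
        then have "X i \<in> polys n" using X(1) by (intro polys_X) simp
        then show ?thesis using adjoin_scale[OF subring_polys _ X(3)] by blast
      qed
    qed
  qed
qed

lemma noetherian_in_polys: "noetherian_in (polys n :: 'k :: field mpol set)"
proof (induction n)
  case 0
  have "polys 0 = range (Const :: 'k \<Rightarrow> _)"
  proof
    show "polys 0 \<subseteq> range (Const :: 'k \<Rightarrow> _)"
    proof
      fix p :: "'k mpol" assume "p \<in> polys 0"
      then show "p \<in> range Const"
        by (induction rule: polys_induct) (auto simp flip: Const_simps)
    qed
  qed auto
  then have B: "p \<in> polys 0 \<longleftrightarrow> (\<exists>c. p = Const c)" for p :: "'k mpol" by auto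
  show ?case unfolding noetherian_in_def
  proof (intro allI impI)
    fix I :: "'k mpol set" assume I: "ideal_in (polys 0) I"
    show "\<exists>F. finite F \<and> F \<subseteq> I \<and> (\<forall>J. ideal_in (polys 0) J \<longrightarrow> F \<subseteq> J \<longrightarrow> I \<subseteq> J)"
    proof (cases "I = {0}")
      case True
      then show ?thesis by (intro exI[of _ "{}"]) (auto simp: ideal_in_def)
    next
      case False
      then obtain p where p: "p \<in> I" "p \<noteq> 0" using I by (auto simp: ideal_in_def)
      have "p \<in> polys 0" using p I unfolding ideal_in_def by blast
      then obtain c where c: "p = Const c" using B by blast
      with p have c0: "c \<noteq> 0" by auto
      have "I \<subseteq> J" if J: "ideal_in (polys 0) J" "{p} \<subseteq> J" for J
      proof
        fix q assume "q \<in> I"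
        then have "q \<in> polys 0" using I unfolding ideal_in_def by blast
        then obtain d where d: "q = Const d" using B by blast
        have "Const (d / c) * p \<in> J" using J unfolding ideal_in_def by auto
        then show "q \<in> J" using c0 by (simp add: c d flip: Const_mult)
      qed
      then show ?thesis using p by (intro exI[of _ "{p}"]) auto
    qed
  qed
next
  case (Suc n)
  then show ?case unfolding polys_Suc_adjoin using hilbert_basis[OF subring_polys] by blast
qed

lemma noetherian_poly_ring: "noetherian_ring (poly_ring n :: 'k :: field mpol ring)"
proof -
  interpret cring "poly_ring n :: 'k mpol ring" by (rule cring_poly_ring)
  have id: "ideal J (poly_ring n) \<longleftrightarrow> ideal_in (polys n) J" for J :: "'k mpol set"
    unfolding ideal_poly_ring_iff ideal_in_def by blast
  show ?thesis
  proof (rule noetherian_ringI)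
    fix I :: "'k mpol set" assume I: "ideal I (poly_ring n)"
    then obtain F where F: "finite F" "F \<subseteq> I" "\<And>J. ideal J (poly_ring n) \<Longrightarrow> F \<subseteq> J \<Longrightarrow> I \<subseteq> J"
      using noetherian_in_polys[of n] unfolding noetherian_in_def id by metis
    have Fc: "F \<subseteq> carrier (poly_ring n)" using F(2) I unfolding ideal_poly_ring_iff by auto
    have "I = Idl\<^bsub>poly_ring n\<^esub> F"
      using F(3)[OF genideal_ideal[OF Fc] genideal_self[OF Fc]] genideal_minimal[OF I F(2)] by blast
    then show "\<exists>A\<subseteq>carrier (poly_ring n). finite A \<and> I = Idl\<^bsub>poly_ring n\<^esub> A" using F(1) Fc by blast
  qed
qed

section \<open>The affine parametrization of the double curve\<close>

text \<open>In \<open>K[s][z]\<close> (with \<open>z\<close> the outer variable) the curve is \<open>x\<^sub>i = z s\<^sup>i\<close>, and the double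
  structure is \<open>x\<^sub>i = z (s\<^sup>i + \<epsilon> b\<^sub>i)\<close> with \<open>\<epsilon>\<^sup>2 = 0\<close>. The recursion for \<open>b\<^sub>i\<close> says that the minor
  \<open>f\<^bsub>i+1,i+2\<^esub>\<close> is mapped to \<open>\<epsilon> a\<^sub>i s\<^sup>i z\<^sup>2\<close>. Dual numbers are polynomials in \<open>\<epsilon>\<close>, of which only the
  first two coefficients are used.\<close>

abbreviation mon2 :: "'k::comm_ring_1 \<Rightarrow> nat \<Rightarrow> nat \<Rightarrow> 'k poly poly" where
  "mon2 c d e \<equiv> monom (monom c e) d"

fun tangent :: "(nat \<Rightarrow> 'k::comm_ring_1) \<Rightarrow> nat \<Rightarrow> 'k poly" where
  "tangent a 0 = 0"
| "tangent a (Suc 0) = 0"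
| "tangent a (Suc (Suc i)) = 2 * monom 1 1 * tangent a (Suc i) - monom 1 2 * tangent a i + [:a i:]"

definition par :: "'k::comm_ring_1 mpol \<Rightarrow> 'k poly poly" where
  "par = eval_with (\<lambda>c. [:[:c:]:]) (\<lambda>i. mon2 1 1 i)"

definition dual :: "(nat \<Rightarrow> 'k::comm_ring_1) \<Rightarrow> 'k mpol \<Rightarrow> 'k poly poly poly" where
  "dual a = eval_with (\<lambda>c. [:[:[:c:]:]:]) (\<lambda>i. [:mon2 1 1 i, monom (tangent a i) 1:])"

definition eps :: "(nat \<Rightarrow> 'k::comm_ring_1) \<Rightarrow> 'k mpol \<Rightarrow> 'k poly poly" where
  "eps a F = coeff (dual a F) 1"

interpretation par: coeff_hom "\<lambda>c::'k::comm_ring_1. [:[:c:]:]" "\<lambda>i. mon2 1 1 i"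
  rewrites "eval_with (\<lambda>c::'k::comm_ring_1. [:[:c:]:]) (\<lambda>i. mon2 1 1 i) \<equiv> par"
  by (unfold_locales) (simp_all add: par_def one_pCons)

interpretation dual: coeff_hom "\<lambda>c::'k::comm_ring_1. [:[:[:c:]:]:]" "\<lambda>i. [:mon2 1 1 i, monom (tangent a i) 1:]"
  rewrites "eval_with (\<lambda>c::'k::comm_ring_1. [:[:[:c:]:]:]) (\<lambda>i. [:mon2 1 1 i, monom (tangent a i) 1:]) \<equiv> dual a"
  for a
  by (unfold_locales) (simp_all add: dual_def one_pCons)

lemma ex_polys: "\<exists>n. F \<in> polys n"
proof -
  have "finite (\<Union>m\<in>Poly_Mapping.keys F. Poly_Mapping.keys m)" by auto
  then obtain n where "\<forall>i\<in>(\<Union>m\<in>Poly_Mapping.keys F. Poly_Mapping.keys m). i < n"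
    using finite_nat_set_iff_bounded by blast
  then show ?thesis by (intro exI[of _ n]) (auto simp: polys_def)
qed

lemma coeff_0_dual [simp]: "coeff (dual a F) 0 = par F"
proof -
  obtain n where "F \<in> polys n" using ex_polys by blast
  then show ?thesis by (induction rule: polys_induct) (auto simp: coeff_mult_0)
qed

lemma eps_add [simp]: "eps a (F + G) = eps a F + eps a G"
  and eps_diff [simp]: "eps a (F - G) = eps a F - eps a G"
  and eps_Const [simp]: "eps a (Const c) = 0"
  and eps_0 [simp]: "eps a 0 = 0"
  and eps_1 [simp]: "eps a 1 = 0"
  and eps_X [simp]: "eps a (X i) = monom (tangent a i) 1"
  and eps_uminus [simp]: "eps a (- F) = - eps a F"
  and eps_sum [simp]: "eps a (sum f A) = (\<Sum>i\<in>A. eps a (f i))"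
  by (simp_all add: eps_def coeff_sum)

lemma eps_mult [simp]: "eps a (F * G) = par F * eps a G + eps a F * par G"
  by (simp add: eps_def coeff_mult atMost_Suc)

subsection \<open>Homogeneous polynomials\<close>

lemma homogeneous_polys: "F \<in> homogeneous n d \<Longrightarrow> F \<in> polys n"
  by (simp add: homogeneous_def)

lemma homogeneous_0 [simp]: "0 \<in> homogeneous n d"
  by (simp add: homogeneous_def)

lemma homogeneous_1 [simp]: "(1 :: 'k::comm_ring_1 mpol) \<in> homogeneous n 0"
  by (simp add: homogeneous_def)

lemma homogeneous_X: "i < n \<Longrightarrow> X i \<in> homogeneous n 1"
  by (simp add: homogeneous_def) (simp add: X_def)

lemma homogeneous_add: "F \<in> homogeneous n d \<Longrightarrow> G \<in> homogeneous n d \<Longrightarrow> F + G \<in> homogeneous n d"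
  using keys_add[of F G] by (auto simp: homogeneous_def)

lemma homogeneous_uminus: "F \<in> homogeneous n d \<Longrightarrow> - F \<in> homogeneous n d" for F :: "'k::comm_ring_1 mpol"
  by (auto simp: homogeneous_def in_keys_iff)

lemma homogeneous_diff:
  "F \<in> homogeneous n d \<Longrightarrow> G \<in> homogeneous n d \<Longrightarrow> F - G \<in> homogeneous n d" for F :: "'k::comm_ring_1 mpol"
  using homogeneous_add[OF _ homogeneous_uminus, of F n d G] by simp

lemma homogeneous_mult:
  "F \<in> homogeneous n d \<Longrightarrow> G \<in> homogeneous n e \<Longrightarrow> F * G \<in> homogeneous n (d + e)" for F :: "'k::comm_ring_1 mpol"
  using keys_mult[of F G] unfolding homogeneous_def by (fastforce simp: mon_deg_add)

lemma homogeneous_Const: "F \<in> homogeneous n d \<Longrightarrow> Const c * F \<in> homogeneous n d" for F :: "'k::comm_ring_1 mpol"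
  by (auto simp: homogeneous_def in_keys_iff lookup_Const_times)

lemma homogeneous_induct [consumes 1, case_names zero add single]:
  fixes F :: "'k::comm_ring_1 mpol"
  assumes "F \<in> homogeneous n d" "P 0"
    and "\<And>F G. P F \<Longrightarrow> P G \<Longrightarrow> P (F + G)"
    and "\<And>m c. Poly_Mapping.keys m \<subseteq> {..<n} \<Longrightarrow> mon_deg m = d \<Longrightarrow> P (Poly_Mapping.single m c)"
  shows "P F"
proof -
  have "P (\<Sum>m\<in>M. Poly_Mapping.single m (f m))"
    if "finite M" "\<forall>m\<in>M. Poly_Mapping.keys m \<subseteq> {..<n} \<and> mon_deg m = d" for M and f :: "_ \<Rightarrow> 'k"
    using that by (induction M) (auto intro: assms)
  from this[of "Poly_Mapping.keys F" "Poly_Mapping.lookup F"] assms(1)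
  show ?thesis unfolding poly_mapping_sum_single[symmetric] by (auto simp: homogeneous_def polys_def)
qed

text \<open>In both components every variable goes to z times something free of z, so the degree of
  a form is its degree in z.\<close>

lemma homogeneous_parts:
  assumes "F \<in> homogeneous n d" "i \<noteq> d"
  shows "coeff (par F) i = 0" "coeff (eps a F) i = 0"
proof -
  have single: "\<forall>i. i \<noteq> mon_deg m \<longrightarrow> coeff (par (Poly_Mapping.single m c)) i = 0 \<and>
      coeff (eps a (Poly_Mapping.single m c)) i = 0" for m and c :: 'a
  proof (induction "mon_deg m" arbitrary: m rule: less_induct)
    case less
    show ?case
    proof (cases "m = 0")
      case True
      then have "Poly_Mapping.single m c = Const c" by (simp add: Const_def)
      then show ?thesis using True by (auto simp: coeff_pCons split: nat.split)
    next
      case False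
      then have "Poly_Mapping.keys m \<noteq> {}" by simp
      then obtain j where j: "j \<in> Poly_Mapping.keys m" by blast
      then obtain m' where m': "m = Poly_Mapping.single j 1 + m'" by (rule mon_decomp)
      have eq: "Poly_Mapping.single m c = X j * Poly_Mapping.single m' c"
        by (simp add: m' X_def mult_single)
      have deg: "mon_deg m = Suc (mon_deg m')" by (simp add: m' mon_deg_add)
      have IH: "\<forall>i. i \<noteq> mon_deg m' \<longrightarrow> coeff (par (Poly_Mapping.single m' c)) i = 0 \<and>
          coeff (eps a (Poly_Mapping.single m' c)) i = 0" using less.hyps deg by simp
      show ?thesis
      proof (intro allI impI)
        fix i assume "i \<noteq> mon_deg m"
        then show "coeff (par (Poly_Mapping.single m c)) i = 0 \<and> coeff (eps a (Poly_Mapping.single m c)) i = 0"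
          unfolding eq using IH deg
          by (cases i) (auto simp: coeff_monom_mult mult.commute[of "eps a (X j)"] monom_Suc coeff_mult_0
              mult.commute[of _ "monom _ _"])
      qed
    qed
  qed
  have "coeff (par F) i = 0 \<and> coeff (eps a F) i = 0" using assms(1)
    by (induction rule: homogeneous_induct) (use single assms(2) in auto)
  then show "coeff (par F) i = 0" "coeff (eps a F) i = 0" by auto
qed

subsection \<open>Weighted pieces\<close>

text \<open>With s = u/t and z = t^r, the condition says that s^e z^d / t^k is a monomial in t and
  u: these are the sections of all twists of O(-k) on the curve. \<open>k = 0\<close> gives the
  coordinate ring of C, and \<open>k = r + 2\<close> the image of I_C under \<open>eps\<close> when
  \<mu> is non-zero.\<close>

definition wt :: "nat \<Rightarrow> nat \<Rightarrow> 'k::comm_ring_1 poly poly set" where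
  "wt r k = {f. \<forall>d e. coeff (coeff f d) e \<noteq> 0 \<longrightarrow> e + k \<le> r * d}"

lemma wt_0 [simp]: "0 \<in> wt r k"
  by (simp add: wt_def)

lemma wt_add: "f \<in> wt r k \<Longrightarrow> g \<in> wt r k \<Longrightarrow> f + g \<in> wt r k"
  unfolding wt_def by (clarsimp) (metis add.right_neutral add_0)

lemma wt_uminus: "f \<in> wt r k \<Longrightarrow> - f \<in> wt r k"
  by (simp add: wt_def)

lemma wt_sum: "(\<And>i. i \<in> A \<Longrightarrow> f i \<in> wt r k) \<Longrightarrow> sum f A \<in> wt r k"
  by (induction A rule: infinite_finite_induct) (auto intro: wt_add)

lemma wt_mon2: "e + k \<le> r * d \<Longrightarrow> mon2 c d e \<in> wt r k"
  by (auto simp: wt_def coeff_monom split: if_splits)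

lemma wt_Const: "[:[:c:]:] \<in> wt r 0"
  using wt_mon2[of 0 0 r 0 c] by (simp add: monom_0)

lemma wt_mult:
  assumes "f \<in> wt r k" "g \<in> wt r l"
  shows "f * g \<in> wt r (k + l)"
  unfolding wt_def
proof (intro CollectI allI impI)
  fix d e assume "coeff (coeff (f * g) d) e \<noteq> 0"
  then have "(\<Sum>i\<le>d. \<Sum>j\<le>e. coeff (coeff f i) j * coeff (coeff g (d - i)) (e - j)) \<noteq> 0"
    by (simp add: coeff_mult coeff_sum)
  then obtain i where i: "i \<le> d" "(\<Sum>j\<le>e. coeff (coeff f i) j * coeff (coeff g (d - i)) (e - j)) \<noteq> 0"
    using sum.neutral by (metis (no_types, lifting) atMost_iff)
  then obtain j where j: "j \<le> e" "coeff (coeff f i) j * coeff (coeff g (d - i)) (e - j) \<noteq> 0"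
    using sum.neutral by (metis (no_types, lifting) atMost_iff)
  then have "coeff (coeff f i) j \<noteq> 0" "coeff (coeff g (d - i)) (e - j) \<noteq> 0" by auto
  then have "j + k \<le> r * i" "e - j + l \<le> r * (d - i)" using assms by (auto simp: wt_def)
  then have "e + (k + l) \<le> r * i + r * (d - i)" using j by linarith
  also have "\<dots> = r * d" using i(1) by (simp flip: distrib_left)
  finally show "e + (k + l) \<le> r * d" .
qed

lemma wt_mult_0: "f \<in> wt r 0 \<Longrightarrow> g \<in> wt r k \<Longrightarrow> f * g \<in> wt r k"
  using wt_mult[of f r 0 g k] by simp

lemma wt_induct [consumes 1, case_names zero add mon2]:
  assumes f: "f \<in> wt r k" and "P 0"
    and "\<And>f g. f \<in> wt r k \<Longrightarrow> g \<in> wt r k \<Longrightarrow> P f \<Longrightarrow> P g \<Longrightarrow> P (f + g)"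
    and "\<And>c d e. e + k \<le> r * d \<Longrightarrow> P (mon2 c d e)"
  shows "P f"
proof -
  have sum: "(\<Sum>i\<in>A. h i) \<in> wt r k \<and> P (\<Sum>i\<in>A. h i)"
    if "\<And>i. i \<in> A \<Longrightarrow> h i \<in> wt r k \<and> P (h i)" for A :: "nat set" and h
    using that assms(2,3) by (induction A rule: infinite_finite_induct) (auto intro: wt_add)
  have "monom (coeff (coeff f d) e) e = 0 \<or> e + k \<le> r * d" for d e
    using f by (auto simp: wt_def)
  then have 1: "mon2 (coeff (coeff f d) e) d e \<in> wt r k \<and> P (mon2 (coeff (coeff f d) e) d e)" for d e
    using assms(2,4) wt_mon2 by (metis monom_eq_0 wt_0)
  have "f = (\<Sum>d\<le>degree f. monom (coeff f d) d)" by (simp add: poly_as_sum_of_monoms)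
  also have "\<dots> = (\<Sum>d\<le>degree f. \<Sum>e\<le>degree (coeff f d). mon2 (coeff (coeff f d) e) d e)"
    by (intro sum.cong refl) (simp flip: monom_sum add: poly_as_sum_of_monoms)
  finally have eq: "f = (\<Sum>d\<le>degree f. \<Sum>e\<le>degree (coeff f d). mon2 (coeff (coeff f d) e) d e)" .
  have "P (\<Sum>d\<le>degree f. \<Sum>e\<le>degree (coeff f d). mon2 (coeff (coeff f d) e) d e)"
    by (rule conjunct2[OF sum], rule sum, rule 1)
  then show ?thesis by (subst eq)
qed

lemma par_in_wt: "F \<in> polys (Suc r) \<Longrightarrow> par F \<in> wt r 0"
proof (induction rule: polys_induct)
  case (X i p)
  then show ?case using wt_mult[OF wt_mon2[of i 0 r 1 1] X(3)] by simp
qed (auto intro: wt_add simp: wt_Const)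

subsection \<open>The ideal of the rational normal curve\<close>

text \<open>Explicit combinations, in the form in which \<open>conormal_class\<close> quantifies
  over the coefficients.\<close>

definition minors_ideal :: "nat \<Rightarrow> 'k::comm_ring_1 mpol set" where
  "minors_ideal r = {\<Sum>(p, q)\<in>minor_indices r. c p q * minor X p q | c. \<forall>p q. c p q \<in> polys (Suc r)}"

lemma finite_minor_indices [simp]: "finite (minor_indices r)"
  by (rule finite_subset[of _ "{..r} \<times> {..r}"]) (auto simp: minor_indices_def)

lemma minor_polys: "(p, q) \<in> minor_indices r \<Longrightarrow> (minor X p q :: 'k::comm_ring_1 mpol) \<in> polys (Suc r)"
  by (auto simp: minor_indices_def minor_def intro!: polys_diff polys_mult polys_X)

lemma minors_ideal_polys: "F \<in> minors_ideal r \<Longrightarrow> F \<in> polys (Suc r)"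
  by (auto simp: minors_ideal_def intro!: polys_sum polys_mult minor_polys)

lemma minors_ideal_0 [simp]: "0 \<in> minors_ideal r"
  unfolding minors_ideal_def by (intro CollectI exI[of _ "\<lambda>_ _. 0"]) auto

lemma minors_ideal_add: "F \<in> minors_ideal r \<Longrightarrow> G \<in> minors_ideal r \<Longrightarrow> F + G \<in> minors_ideal r"
proof -
  assume "F \<in> minors_ideal r" "G \<in> minors_ideal r"
  then obtain c d where "\<forall>p q. c p q \<in> polys (Suc r)" "F = (\<Sum>(p, q)\<in>minor_indices r. c p q * minor X p q)"
    "\<forall>p q. d p q \<in> polys (Suc r)" "G = (\<Sum>(p, q)\<in>minor_indices r. d p q * minor X p q)"
    unfolding minors_ideal_def by blast
  then show ?thesis unfolding minors_ideal_def
    by (intro CollectI exI[of _ "\<lambda>p q. c p q + d p q"]) (auto simp: sum.distrib split_def distrib_right)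
qed

lemma minors_ideal_mult: "P \<in> polys (Suc r) \<Longrightarrow> F \<in> minors_ideal r \<Longrightarrow> P * F \<in> minors_ideal r"
proof -
  assume P: "P \<in> polys (Suc r)" and "F \<in> minors_ideal r"
  then obtain c where "\<forall>p q. c p q \<in> polys (Suc r)" "F = (\<Sum>(p, q)\<in>minor_indices r. c p q * minor X p q)"
    unfolding minors_ideal_def by blast
  then show ?thesis unfolding minors_ideal_def using P
    by (intro CollectI exI[of _ "\<lambda>p q. P * c p q"]) (auto simp: sum_distrib_left split_def mult.assoc)
qed

lemma minors_ideal_uminus: "F \<in> minors_ideal r \<Longrightarrow> - F \<in> minors_ideal r"
  using minors_ideal_mult[of "- 1" r F] by simp

lemma minors_ideal_diff: "F \<in> minors_ideal r \<Longrightarrow> G \<in> minors_ideal r \<Longrightarrow> F - G \<in> minors_ideal r"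
  using minors_ideal_add[OF _ minors_ideal_uminus, of F r G] by simp

lemma minor_in_minors_ideal:
  assumes "(p, q) \<in> minor_indices r"
  shows "minor X p q \<in> minors_ideal r"
proof -
  have "(\<Sum>(p', q')\<in>minor_indices r. (if p' = p \<and> q' = q then 1 else 0) * minor X p' q') =
      (\<Sum>x\<in>minor_indices r. if x = (p, q) then minor X p q else (0 :: 'a mpol))"
    by (intro sum.cong) (auto split: if_splits)
  also have "\<dots> = minor X p q" using assms by simp
  finally have "minor X p q = (\<Sum>(p', q')\<in>minor_indices r. (if p' = p \<and> q' = q then 1 else 0) * (minor X p' q' :: 'a mpol))" ..
  then show ?thesis unfolding minors_ideal_def
    by (intro CollectI exI[of _ "\<lambda>p' q'. if p' = p \<and> q' = q then 1 else 0"]) auto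
qed

lemma minor_swap: "X i * X (Suc k) - X (Suc i) * X k \<in> minors_ideal r" if "i < r" "k < r"
proof (cases i k rule: linorder_cases)
  case less
  then have "minor X (Suc i) (Suc k) \<in> minors_ideal r"
    using that by (intro minor_in_minors_ideal) (auto simp: minor_indices_def)
  then show ?thesis by (simp add: minor_def)
next
  case greater
  then have "minor X (Suc k) (Suc i) \<in> minors_ideal r"
    using that by (intro minor_in_minors_ideal) (auto simp: minor_indices_def)
  from minors_ideal_uminus[OF this] show ?thesis by (simp add: minor_def mult.commute)
qed (simp add: mult.commute)

text \<open>Telescoping: t units of index move from one factor to the other by t exchanges, each
  given by one minor.\<close>

lemma quadric_shift:
  "i + t \<le> r \<Longrightarrow> k + t \<le> r \<Longrightarrow>
    X i * X (k + t) - X (i + t) * X k \<in> (minors_ideal r :: 'k::comm_ring_1 mpol set)"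
proof (induction t arbitrary: k)
  case (Suc t)
  have "X i * X (Suc k + t) - X (i + t) * X (Suc k) \<in> (minors_ideal r :: 'k mpol set)"
    using Suc.IH[of "Suc k"] Suc.prems by simp
  moreover have "X (i + t) * X (Suc k) - X (Suc (i + t)) * X k \<in> (minors_ideal r :: 'k mpol set)"
    using Suc.prems by (intro minor_swap) auto
  ultimately have "(X i * X (Suc k + t) - X (i + t) * X (Suc k)) + (X (i + t) * X (Suc k) - X (Suc (i + t)) * X k)
      \<in> (minors_ideal r :: 'k mpol set)" by (rule minors_ideal_add)
  then show ?case by simp
qed (simp add: mult.commute)

lemma quadric_exchange:
  assumes "i \<le> r" "k \<le> r" "l \<le> r" "n \<le> r" "i + k = l + n"
  shows "X i * X k - X l * X n \<in> (minors_ideal r :: 'k::comm_ring_1 mpol set)"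
proof (cases "i \<le> l")
  case True
  then have "n + (l - i) = k" "i + (l - i) = l" using assms by auto
  then show ?thesis using quadric_shift[of i "l - i" r n] assms by simp
next
  case False
  then have "k + (i - l) = n" "l + (i - l) = i" using assms by auto
  then have "X l * X n - X i * X k \<in> (minors_ideal r :: 'k mpol set)"
    using quadric_shift[of l "i - l" r k] assms by simp
  from minors_ideal_uminus[OF this] show ?thesis by simp
qed

lemma par_minors_ideal:
  fixes F :: "'k::comm_ring_1 mpol"
  assumes "F \<in> minors_ideal r"
  shows "par F = 0"
proof -
  have "par (minor X p q :: 'k mpol) = 0" if "(p, q) \<in> minor_indices r" for p q
    using that by (auto simp: minor_def minor_indices_def mult_monom)
  then show ?thesis using assms by (auto simp: minors_ideal_def split_def intro!: sum.neutral)
qed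

text \<open>The greedy monomial of degree d with indices summing to e: as many factors
  \<open>X r\<close> as fit, at most one index strictly between 0 and r, then \<open>X 0\<close>. It
  is the normal form for s^e z^d modulo the minors.\<close>

fun std_mon :: "nat \<Rightarrow> nat \<Rightarrow> nat \<Rightarrow> 'k::comm_ring_1 mpol" where
  "std_mon r 0 e = 1"
| "std_mon r (Suc d) e = X (min r e) * std_mon r d (e - min r e)"

lemma std_mon_polys [simp]: "std_mon r d e \<in> polys (Suc r)"
  by (induction d arbitrary: e) auto

lemma std_mon_homogeneous: "(std_mon r d e :: 'k::comm_ring_1 mpol) \<in> homogeneous (Suc r) d"
proof (induction d arbitrary: e)
  case (Suc d)
  have "(X (min r e) * std_mon r d (e - min r e) :: 'k mpol) \<in> homogeneous (Suc r) (1 + d)"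
    by (rule homogeneous_mult[OF homogeneous_X Suc.IH]) simp
  then show ?case by simp
qed simp

lemma par_std_mon: "e \<le> r * d \<Longrightarrow> par (std_mon r d e) = mon2 1 d e"
proof (induction d arbitrary: e)
  case (Suc d)
  have "e - min r e \<le> r * d" using Suc.prems by (auto simp: min_def)
  then show ?case by (simp add: Suc.IH mult_monom)
qed (simp add: monom_0 one_pCons)

text \<open>Straightening: one exchange makes the leading factor of the product the greedy one, and
  the remaining variable is absorbed by induction.\<close>

lemma X_times_std_mon:
  assumes "i \<le> r" "e \<le> r * d"
  shows "X i * std_mon r d e - std_mon r (Suc d) (e + i) \<in> (minors_ideal r :: 'k::comm_ring_1 mpol set)"
  using assms
proof (induction d arbitrary: i e)
  case 0
  then show ?case by (simp add: min_def)
next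
  case (Suc d)
  \<comment> \<open>k is the first factor of the given standard monomial, l the first factor of the
    one to be reached.\<close>
  define k where "k = min r e"
  define l where "l = min r (e + i)"
  have k: "k \<le> r" "k \<le> e" "e - k \<le> r * d" using Suc.prems by (auto simp: k_def min_def)
  have l: "l \<le> r" "l \<le> i + k" "i + k - l \<le> r" using Suc.prems by (auto simp: k_def l_def min_def)
  let ?m = "std_mon r d (e - k) :: 'k mpol"
  have "?m * (X i * X k - X l * X (i + k - l)) \<in> minors_ideal r"
    using Suc.prems k l by (intro minors_ideal_mult quadric_exchange std_mon_polys) auto
  moreover have "X l * (X (i + k - l) * ?m - std_mon r (Suc d) (e - k + (i + k - l))) \<in> minors_ideal r"
    using l k by (intro minors_ideal_mult Suc.IH) auto
  moreover have "e - k + (i + k - l) = e + i - l" using k l by linarith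
  ultimately have "?m * (X i * X k - X l * X (i + k - l)) +
      X l * (X (i + k - l) * ?m - std_mon r (Suc d) (e + i - l)) \<in> minors_ideal r"
    using minors_ideal_add by metis
  moreover have "X i * std_mon r (Suc d) e = ?m * (X i * X k)" by (simp add: k_def mult_ac)
  moreover have "std_mon r (Suc (Suc d)) (e + i) = X l * (std_mon r (Suc d) (e + i - l) :: 'k mpol)"
    by (simp only: std_mon.simps(2)[of r "Suc d"] l_def)
  ultimately show ?case by (simp add: algebra_simps del: std_mon.simps(2))
qed

inductive_set std_span :: "nat \<Rightarrow> 'k::comm_ring_1 mpol set" for r where
  std_span_mon2: "e \<le> r * d \<Longrightarrow> Const c * std_mon r d e \<in> std_span r"
| std_span_add: "F \<in> std_span r \<Longrightarrow> G \<in> std_span r \<Longrightarrow> F + G \<in> std_span r"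

text \<open>Distinct standard monomials have distinct images, so the coefficients can be read off
  from \<open>par F\<close>. Summing over all sufficiently large squares makes the statement
  additive in F.\<close>

lemma std_span_determined:
  assumes "F \<in> std_span r"
  shows "\<exists>N. \<forall>M\<ge>N. F = (\<Sum>d\<le>M. \<Sum>e\<le>M. Const (coeff (coeff (par F) d) e) * std_mon r d e)"
  using assms
proof (induction rule: std_span.induct)
  case (std_span_mon2 e d c)
  have "Const c * std_mon r d e = (\<Sum>i\<le>M. \<Sum>j\<le>M. Const (coeff (coeff (par (Const c * std_mon r d e)) i) j) * std_mon r i j)"
    if "M \<ge> max d e" for M
  proof -
    have "par (Const c * std_mon r d e) = mon2 c d e"
      using std_span_mon2 by (simp add: par_std_mon smult_monom)
    then have "(\<Sum>i\<le>M. \<Sum>j\<le>M. Const (coeff (coeff (par (Const c * std_mon r d e)) i) j) * std_mon r i j)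
      = (\<Sum>i\<le>M. \<Sum>j\<le>M. if j = e then (if i = d then Const c * std_mon r i j else 0) else 0)"
      by (intro sum.cong refl) (simp add: coeff_monom)
    also have "\<dots> = Const c * std_mon r d e" using that by simp
    finally show ?thesis ..
  qed
  then show ?case by blast
next
  case (std_span_add F G)
  define S where "S = (\<lambda>f M. \<Sum>d\<le>M. \<Sum>e\<le>M. Const (coeff (coeff f d) e) * (std_mon r d e :: 'a mpol))"
  have S: "S (f + g) M = S f M + S g M" for f g M
    by (simp add: S_def sum.distrib distrib_right)
  obtain N where N: "\<forall>M\<ge>N. F = S (par F) M" using std_span_add.IH(1) unfolding S_def by blast
  obtain N' where N': "\<forall>M\<ge>N'. G = S (par G) M" using std_span_add.IH(2) unfolding S_def by blast
  have "\<forall>M\<ge>max N N'. F + G = S (par (F + G)) M"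
    unfolding par.ev_add S using N N' by (auto intro!: arg_cong2[of _ _ _ _ "(+)"])
  then show ?case unfolding S_def by blast
qed

lemma std_span_X:
  assumes "F \<in> std_span r" "i \<le> r"
  shows "\<exists>G\<in>std_span r. X i * F - G \<in> minors_ideal r"
  using assms(1)
proof (induction rule: std_span.induct)
  case (std_span_mon2 e d c)
  have "Const c * (X i * std_mon r d e - std_mon r (Suc d) (e + i)) \<in> minors_ideal r"
    using std_span_mon2 assms(2) by (intro minors_ideal_mult X_times_std_mon) auto
  then have "X i * (Const c * std_mon r d e) - Const c * std_mon r (Suc d) (e + i) \<in> minors_ideal r"
    by (simp add: algebra_simps)
  moreover have "e + i \<le> r * Suc d" using std_span_mon2 assms(2) by simp
  ultimately show ?case using std_span.std_span_mon2 by blast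
next
  case (std_span_add F G)
  then obtain F' G' where FG: "F' \<in> std_span r" "G' \<in> std_span r"
    "X i * F - F' \<in> minors_ideal r" "X i * G - G' \<in> minors_ideal r" by blast
  from minors_ideal_add[OF FG(3,4)] have "X i * (F + G) - (F' + G') \<in> minors_ideal r"
    by (simp add: algebra_simps)
  then show ?case using FG std_span.std_span_add by blast
qed

lemma std_span_representative:
  "F \<in> polys (Suc r) \<Longrightarrow> \<exists>G\<in>std_span r. F - G \<in> minors_ideal r"
proof (induction rule: polys_induct)
  case (Const c)
  show ?case using std_span_mon2[of 0 r 0 c] by (intro bexI[of _ "Const c"]) auto
next
  case (add F G)
  then obtain F' G' where FG: "F' \<in> std_span r" "G' \<in> std_span r"
    "F - F' \<in> minors_ideal r" "G - G' \<in> minors_ideal r" by blast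
  from minors_ideal_add[OF FG(3,4)] have "(F + G) - (F' + G') \<in> minors_ideal r"
    by (simp add: algebra_simps)
  then show ?case using FG std_span.std_span_add by blast
next
  case (X i F)
  then obtain F' where F': "F' \<in> std_span r" "F - F' \<in> minors_ideal r" by blast
  obtain G where G: "G \<in> std_span r" "X i * F' - G \<in> minors_ideal r"
    using std_span_X[OF F'(1), of i] X by auto
  have "X i * (F - F') \<in> minors_ideal r" using F' X by (intro minors_ideal_mult) auto
  from minors_ideal_add[OF this G(2)] have "X i * F - G \<in> minors_ideal r" by (simp add: algebra_simps)
  then show ?case using G by blast
qed

text \<open>Modulo the minors every polynomial is a combination of standard monomials, and on these
  \<open>par\<close> is injective; so the minors generate the whole ideal of C.\<close>

theorem par_eq_0_iff:
  assumes "F \<in> polys (Suc r)"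
  shows "par F = 0 \<longleftrightarrow> F \<in> minors_ideal r"
proof
  assume 0: "par F = 0"
  obtain G where G: "G \<in> std_span r" "F - G \<in> minors_ideal r"
    using std_span_representative[OF assms] by blast
  have "par F - par G = 0" using par_minors_ideal[OF G(2)] by simp
  then have "par G = 0" using 0 by simp
  then have "G = 0" using std_span_determined[OF G(1)] by (auto simp: sum.neutral)
  then show "F \<in> minors_ideal r" using G by simp
qed (rule par_minors_ideal)

theorem par_surj:
  assumes "f \<in> wt r 0"
  obtains F where "F \<in> polys (Suc r)" "par F = f"
proof -
  have "\<exists>F\<in>polys (Suc r). par F = f" using assms
  proof (induction rule: wt_induct)
    case zero
    show ?case by (intro bexI[of _ 0]) auto
  next
    case (add f g)
    then show ?case by (metis par.ev_add polys_add)
  next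
    case (mon2 c d e)
    then show ?case
      by (intro bexI[of _ "Const c * std_mon r d e"]) (auto simp: par_std_mon smult_monom)
  qed
  then show ?thesis using that by blast
qed

subsection \<open>The infinitesimal part\<close>

text \<open>The recursion of \<open>tangent\<close> applies the operator "shift minus s" twice. Here
  it is applied once, which leaves a first-order recursion.\<close>

definition tdiff :: "(nat \<Rightarrow> 'k::comm_ring_1) \<Rightarrow> nat \<Rightarrow> 'k poly" where
  "tdiff a k = tangent a (Suc k) - monom 1 1 * tangent a k"

lemma tdiff_Suc: "tdiff a (Suc k) = monom 1 1 * tdiff a k + [:a k:]"
proof -
  have e: "monom 1 2 = monom 1 1 * (monom 1 1 :: 'a poly)" by (simp add: mult_monom numeral_2_eq_2)
  have "2 * m * t' - m * m * t + c - m * t' = m * (t' - m * t) + c" for m t t' c :: "'a poly"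
    by (simp add: algebra_simps)
  then show ?thesis unfolding tdiff_def tangent.simps e .
qed

lemma tdiff_0 [simp]: "tdiff a 0 = 0"
  by (simp add: tdiff_def)

lemma tdiff_eq_sum: "tdiff a k = (\<Sum>m<k. monom (a m) (k - 1 - m))"
proof (induction k)
  case (Suc k)
  have "monom 1 1 * (\<Sum>m<k. monom (a m) (k - 1 - m)) = (\<Sum>m<k. monom (a m) (Suc k - 1 - m))"
    unfolding sum_distrib_left by (intro sum.cong) (auto simp: mult_monom Suc_diff_Suc)
  then show ?case by (simp add: tdiff_Suc Suc monom_0)
qed simp

lemma eps_swap:
  "eps a (X i * X (Suc k) - X (Suc i) * X k) = monom (monom 1 i * tdiff a k - monom 1 k * tdiff a i) 2"
proof -
  have e: "monom 1 (Suc i) = monom 1 1 * (monom 1 i :: 'a poly)" for i by (simp add: mult_monom)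
  have "eps a (X i * X (Suc k) - X (Suc i) * X k) =
      monom (monom 1 i * tangent a (Suc k) + tangent a i * monom 1 (Suc k)
        - (monom 1 (Suc i) * tangent a k + tangent a (Suc i) * monom 1 k)) 2"
    by (simp add: mult_monom add_monom diff_monom numeral_2_eq_2)
  also have "\<dots> = monom (monom 1 i * tdiff a k - monom 1 k * tdiff a i) 2"
    unfolding e[of i] e[of k] tdiff_def by (simp add: algebra_simps)
  finally show ?thesis .
qed

text \<open>\<mu> of the class of f_pq at t = 1, u = s. The index is (p + q - 1 - h) - 1 because
  \<mu> sends g_k to a_(k-1).\<close>

definition minor_weight :: "(nat \<Rightarrow> 'k::comm_ring_1) \<Rightarrow> nat \<Rightarrow> nat \<Rightarrow> 'k poly" where
  "minor_weight a p q = (\<Sum>h\<in>{p..<q}. monom (a (p + q - 2 - h)) (h - 1))"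

lemma eps_minor:
  assumes "(p, q) \<in> minor_indices r"
  shows "eps a (minor X p q) = monom (minor_weight a p q) 2"
proof -
  obtain i k where pq: "p = Suc i" "q = Suc k" "i < k"
    using assms by (auto simp: minor_indices_def) (metis Suc_pred' Suc_less_eq Suc_le_eq less_trans)
  have "monom 1 i * tdiff a k = (\<Sum>m<k. monom (a m) (i + k - 1 - m))"
    unfolding tdiff_eq_sum sum_distrib_left by (intro sum.cong) (auto simp: mult_monom)
  moreover have "monom 1 k * tdiff a i = (\<Sum>m<i. monom (a m) (i + k - 1 - m))"
    unfolding tdiff_eq_sum sum_distrib_left by (intro sum.cong) (auto simp: mult_monom add.commute)
  \<comment> \<open>The terms with m < i cancel between the two products; the others form the class
    of the minor, with h = i + k - m.\<close>
  moreover have "(\<Sum>m<k. monom (a m) (i + k - 1 - m))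
      = (\<Sum>m<i. monom (a m) (i + k - 1 - m)) + (\<Sum>m\<in>{i..<k}. monom (a m) (i + k - 1 - m))"
    using pq(3) by (subst sum.union_disjoint[symmetric]) (auto intro!: sum.cong)
  moreover have "(\<Sum>m\<in>{i..<k}. monom (a m) (i + k - 1 - m)) = minor_weight a p q"
    unfolding minor_weight_def pq
    by (rule sum.reindex_bij_witness[of _ "\<lambda>h. i + k - h" "\<lambda>m. i + k - m"]) auto
  ultimately show ?thesis using eps_swap[of a i k] by (simp add: minor_def pq)
qed

lemma minor_weight_wt:
  assumes "(p, q) \<in> minor_indices r"
  shows "monom (minor_weight a p q) 2 \<in> wt r (r + 2)"
  unfolding minor_weight_def monom_sum
  by (intro wt_sum wt_mon2) (use assms in \<open>auto simp: minor_indices_def\<close>)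

text \<open>The product rule loses its second term because the minors vanish under
  \<open>par\<close>. This is the linearity by which the derivation factors through I_C /
  I_C^2.\<close>

lemma eps_minor_combination:
  fixes c :: "nat \<Rightarrow> nat \<Rightarrow> 'k::comm_ring_1 mpol"
  shows "eps a (\<Sum>(p, q)\<in>minor_indices r. c p q * minor X p q)
    = (\<Sum>(p, q)\<in>minor_indices r. par (c p q) * monom (minor_weight a p q) 2)"
proof -
  have "par (minor X p q :: 'k mpol) = 0" if "(p, q) \<in> minor_indices r" for p q
    using par_minors_ideal minor_in_minors_ideal that by blast
  then show ?thesis by (auto simp: split_def eps_minor intro!: sum.cong)
qed

lemma eps_minors_ideal:
  fixes F :: "'k::comm_ring_1 mpol"
  assumes "F \<in> minors_ideal r"
  shows "eps a F \<in> wt r (r + 2)"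
proof -
  obtain c where c: "\<forall>p q. c p q \<in> polys (Suc r)" "F = (\<Sum>(p, q)\<in>minor_indices r. c p q * minor X p q)"
    using assms unfolding minors_ideal_def by blast
  have "eps a F = (\<Sum>(p, q)\<in>minor_indices r. par (c p q) * monom (minor_weight a p q) 2)"
    unfolding c(2) by (rule eps_minor_combination)
  also have "\<dots> \<in> wt r (r + 2)"
    using c(1) by (intro wt_sum)
      (auto simp del: add_2_eq_Suc' intro!: wt_mult_0 par_in_wt minor_weight_wt)
  finally show ?thesis .
qed

text \<open>The differences \<open>f\<^bsub>i+1,k+2\<^esub> - f\<^bsub>i+2,k+1\<^esub>\<close> realize \<open>a\<^sub>k s\<^sup>i + a\<^sub>i s\<^sup>k\<close>. Since some \<open>a\<^sub>i\<close> is
  non-zero, the case \<open>k = i\<close> gives \<open>s\<^sup>i\<close> and then the general case gives every \<open>s\<^sup>k\<close>.\<close>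

lemma eps_degree_2_surj:
  fixes a :: "nat \<Rightarrow> 'k::field_char_0"
  assumes "i < r - 1" "a i \<noteq> 0" "k < r - 1"
  shows "\<exists>F\<in>minors_ideal r \<inter> homogeneous (Suc r) 2. eps a F = mon2 1 2 k"
proof -
  let ?J = "minors_ideal r \<inter> homogeneous (Suc r) 2"
  have sym: "\<exists>F\<in>?J. eps a F = mon2 (a k) 2 i + mon2 (a i) 2 k" if "i < r - 1" "k < r - 1" for i k
  proof -
    let ?F = "(X i * X (Suc (Suc k)) - X (Suc i) * X (Suc k)) - (X (Suc i) * X (Suc k) - X (Suc (Suc i)) * X k) :: 'k mpol"
    have "?F \<in> minors_ideal r" using that by (intro minors_ideal_diff minor_swap) auto
    moreover have "(X l * X n :: 'k mpol) \<in> homogeneous (Suc r) 2" if "l \<le> r" "n \<le> r" for l n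
    proof -
      have "(X l * X n :: 'k mpol) \<in> homogeneous (Suc r) (1 + 1)"
        using that by (intro homogeneous_mult homogeneous_X) auto
      then show ?thesis by (simp add: numeral_2_eq_2)
    qed
    then have "?F \<in> homogeneous (Suc r) 2" using that by (intro homogeneous_diff) auto
    moreover have "eps a ?F = mon2 (a k) 2 i + mon2 (a i) 2 k"
    proof -
      have e: "monom 1 (Suc i) = monom 1 1 * (monom 1 i :: 'k poly)" for i by (simp add: mult_monom)
      have c: "monom 1 i * [:c:] = monom c i" for i and c :: 'k by (simp add: smult_monom)
      have "eps a ?F = monom (monom 1 i * (monom 1 1 * tdiff a k + [:a k:]) - monom 1 (Suc k) * tdiff a i
           - (monom 1 (Suc i) * tdiff a k - monom 1 k * (monom 1 1 * tdiff a i + [:a i:]))) 2"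
        unfolding eps_diff[of a "X i * X (Suc (Suc k)) - X (Suc i) * X (Suc k)"] eps_swap
        by (simp only: diff_monom tdiff_Suc)
      also have "\<dots> = monom (monom 1 i * [:a k:] + monom 1 k * [:a i:]) 2"
        unfolding e by (simp add: algebra_simps)
      finally show ?thesis by (simp only: c add_monom)
    qed
    ultimately show ?thesis by blast
  qed
  obtain F where F: "F \<in> minors_ideal r" "eps a F = mon2 (a i) 2 i + mon2 (a i) 2 i" "F \<in> homogeneous (Suc r) 2"
    using sym[of i i] assms by blast
  obtain G where G: "G \<in> minors_ideal r" "eps a G = mon2 (a k) 2 i + mon2 (a i) 2 k" "G \<in> homogeneous (Suc r) 2"
    using sym[of i k] assms by blast
  \<comment> \<open>The image of \<open>F\<close> is 2 a_i s^i z^2, so the factor 2 has to be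
    invertible.\<close>
  let ?F = "Const (1 / (2 * a i)) * F"
  have F': "?F \<in> minors_ideal r" "eps a ?F = mon2 1 2 i"
    using F assms(2) by (auto intro: minors_ideal_mult simp: smult_monom add_monom)
  \<comment> \<open>The unwanted term a_k s^i is removed with the element just found, and a_i is
    divided out.\<close>
  let ?G = "Const (1 / a i) * (G - Const (a k) * ?F)"
  have "?G \<in> minors_ideal r" using F(1) G(1) by (intro minors_ideal_mult minors_ideal_diff) auto
  moreover have "?G \<in> homogeneous (Suc r) 2"
    using F(3) G(3) by (intro homogeneous_Const homogeneous_diff) auto
  moreover have "par ?F = 0" "par G = 0" using par_minors_ideal F' G by blast+
  have "eps a ?G = mon2 1 2 k"
    using F' G assms(2) by (simp add: smult_monom smult_add_right del: par.ev_mult)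
  ultimately show ?thesis by blast
qed

text \<open>The monomial is a product of one reached in degree 2 and one in the image of
  \<open>par\<close>, which lifts to a standard monomial. Keeping the lift homogeneous serves the
  Hilbert function.\<close>

lemma eps_mon2_surj:
  fixes a :: "nat \<Rightarrow> 'k::field_char_0"
  assumes nz: "\<exists>i<r - 1. a i \<noteq> 0" and e: "e + (r + 2) \<le> r * d"
  shows "\<exists>F\<in>minors_ideal r \<inter> homogeneous (Suc r) d. eps a F = mon2 1 d e"
proof -
  have "d \<noteq> 0"
  proof
    assume "d = 0"
    then show False using e by simp
  qed
  moreover have "d \<noteq> 1" using e by auto
  ultimately obtain d' where d: "d = d' + 2" by (metis One_nat_def Suc_1 add.commute add_2_eq_Suc not0_implies_Suc)
  \<comment> \<open>r - 2 is the largest exponent reached in degree 2; taking as much as possible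
    leaves e - k within the bound r d'.\<close>
  define k where "k = min e (r - 2)"
  have "r \<ge> 2" using nz by auto
  then have k: "k < r - 1" "k \<le> e" "e - k \<le> r * d'" using e d by (auto simp: k_def min_def)
  obtain i where "i < r - 1" "a i \<noteq> 0" using nz by blast
  then obtain F where F: "F \<in> minors_ideal r" "eps a F = mon2 1 2 k" "F \<in> homogeneous (Suc r) 2"
    using eps_degree_2_surj[of i r a k] k(1) by blast
  let ?F = "std_mon r d' (e - k) * F"
  have "?F \<in> minors_ideal r" using F by (intro minors_ideal_mult) auto
  moreover have "?F \<in> homogeneous (Suc r) d" unfolding d using F by (intro homogeneous_mult std_mon_homogeneous)
  moreover have "eps a ?F = mon2 1 d e"
    using F par_minors_ideal[OF F(1)] k d by (simp add: par_std_mon mult_monom smult_monom)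
  ultimately show ?thesis by blast
qed

theorem eps_minors_ideal_surj:
  fixes a :: "nat \<Rightarrow> 'k::field_char_0"
  assumes nz: "\<exists>i<r - 1. a i \<noteq> 0" and g: "g \<in> wt r (r + 2)"
  obtains F where "F \<in> minors_ideal r" "eps a F = g"
proof -
  have "\<exists>F\<in>minors_ideal r. eps a F = g" using g
  proof (induction rule: wt_induct)
    case zero
    show ?case by (intro bexI[of _ 0]) auto
  next
    case (add f g)
    then show ?case by (metis eps_add minors_ideal_add)
  next
    case (mon2 c d e)
    obtain F where F: "F \<in> minors_ideal r" "eps a F = mon2 1 d e" using eps_mon2_surj[OF nz mon2] by blast
    then show ?case
      by (intro bexI[of _ "Const c * F"]) (auto simp: smult_monom intro: minors_ideal_mult)
  qed
  then show ?thesis using that by blast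
qed

section \<open>The ideal of the double structure\<close>

definition dker :: "nat \<Rightarrow> (nat \<Rightarrow> 'k::comm_ring_1) \<Rightarrow> 'k mpol set" where
  "dker r a = {F \<in> polys (Suc r). par F = 0 \<and> eps a F = 0}"

lemma dker_polys: "F \<in> dker r a \<Longrightarrow> F \<in> polys (Suc r)"
  and dker_0 [simp]: "0 \<in> dker r a"
  and dker_add: "F \<in> dker r a \<Longrightarrow> G \<in> dker r a \<Longrightarrow> F + G \<in> dker r a"
  and dker_diff: "F \<in> dker r a \<Longrightarrow> G \<in> dker r a \<Longrightarrow> F - G \<in> dker r a"
  and dker_mult: "P \<in> polys (Suc r) \<Longrightarrow> F \<in> dker r a \<Longrightarrow> P * F \<in> dker r a"
  by (auto simp: dker_def)

lemma ideal_dker: "ideal (dker r a) (poly_ring (Suc r))"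
  unfolding ideal_poly_ring_iff using dker_polys dker_add dker_mult by auto

text \<open>Both \<open>j\<^sup>*\<close> and \<open>par\<close> embed into \<open>K[t][s]\<close>, via \<open>u = t s\<close> and \<open>z = t\<^sup>r\<close>.\<close>

definition chart_tu :: "'k::comm_ring_1 mpol \<Rightarrow> 'k poly poly" where
  "chart_tu = eval_with (\<lambda>c. [:[:c:]:]) (\<lambda>i. if i = 0 then mon2 1 1 0 else mon2 1 1 1)"

interpretation chart_tu: coeff_hom "\<lambda>c::'k::comm_ring_1. [:[:c:]:]" "\<lambda>i. if i = 0 then mon2 1 1 0 else mon2 1 1 1"
  rewrites "eval_with (\<lambda>c::'k::comm_ring_1. [:[:c:]:]) (\<lambda>i. if i = 0 then mon2 1 1 0 else mon2 1 1 1) \<equiv> chart_tu"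
  by (unfold_locales) (simp_all add: chart_tu_def one_pCons)

interpretation pullback_j: coeff_hom "Const :: 'k::comm_ring_1 \<Rightarrow> 'k mpol" "\<lambda>i. X 0 ^ (r - i) * X 1 ^ i"
  rewrites "eval_with (Const :: 'k::comm_ring_1 \<Rightarrow> 'k mpol) (\<lambda>i. X 0 ^ (r - i) * X 1 ^ i) \<equiv> pullback_j r"
  for r
  by (unfold_locales) (simp_all add: pullback_j_def Const_mult)

lemma power_monom: "monom c d ^ n = monom (c ^ n) (d * n)"
  by (induction n) (auto simp: mult_monom add.commute)

lemma mon_eval_chart_tu:
  assumes "Poly_Mapping.keys m \<subseteq> {..<2}"
  shows "mon_eval (\<lambda>i. if i = 0 then mon2 1 1 0 else mon2 1 1 1) m
    = (mon2 1 (Poly_Mapping.lookup m 0 + Poly_Mapping.lookup m 1) (Poly_Mapping.lookup m 1) :: 'k::comm_ring_1 poly poly)"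
proof -
  have "{..<2::nat} = {0, 1}" by auto
  then have "mon_eval (\<lambda>i. if i = 0 then mon2 1 1 0 else mon2 1 1 1) m
    = (mon2 1 1 0 :: 'k poly poly) ^ Poly_Mapping.lookup m 0 * mon2 1 1 1 ^ Poly_Mapping.lookup m 1"
    using mon_eval_alt[of "{..<2}" m "\<lambda>i. if i = 0 then mon2 1 1 0 else mon2 1 1 1 :: 'k poly poly"] assms by simp
  then show ?thesis by (simp add: power_monom mult_monom)
qed

text \<open>t^a u^b goes to t^(a+b) s^b, and these exponents determine a and b, so coefficients can
  be read off.\<close>

lemma chart_tu_inj:
  assumes "p \<in> polys 2" "chart_tu p = 0"
  shows "p = (0 :: 'k::comm_ring_1 mpol)"
proof (rule poly_mapping_eqI)
  fix n :: "nat \<Rightarrow>\<^sub>0 nat"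
  show "Poly_Mapping.lookup p n = Poly_Mapping.lookup 0 n"
  proof (cases "n \<in> Poly_Mapping.keys p")
    case True
    have k: "Poly_Mapping.keys m \<subseteq> {..<2}" if "m \<in> Poly_Mapping.keys p" for m
      using assms(1) that by (auto simp: polys_def)
    have eq: "m = n" if "m \<in> Poly_Mapping.keys p" "Poly_Mapping.lookup m 0 + Poly_Mapping.lookup m 1
        = Poly_Mapping.lookup n 0 + Poly_Mapping.lookup n 1" "Poly_Mapping.lookup m 1 = Poly_Mapping.lookup n 1" for m
    proof (rule poly_mapping_eqI)
      fix i
      show "Poly_Mapping.lookup m i = Poly_Mapping.lookup n i"
        using k[OF that(1)] k[OF True] that(2,3)
        by (cases "i = 0 \<or> i = 1") (auto, metis in_keys_iff less_2_cases lessThan_iff subsetD One_nat_def)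
    qed
    have "0 = coeff (coeff (chart_tu p) (Poly_Mapping.lookup n 0 + Poly_Mapping.lookup n 1)) (Poly_Mapping.lookup n 1)"
      using assms(2) by simp
    also have "\<dots> = (\<Sum>m\<in>Poly_Mapping.keys p. if m = n then Poly_Mapping.lookup p m else 0)"
      unfolding chart_tu.ev_alt[OF finite_keys order_refl] coeff_sum
      by (intro sum.cong) (auto simp: mon_eval_chart_tu k smult_monom coeff_monom dest: eq)
    also have "\<dots> = Poly_Mapping.lookup p n" using True by simp
    finally show ?thesis by simp
  qed (simp add: in_keys_iff)
qed

lemma chart_tu_pullback_j:
  "F \<in> polys (Suc r) \<Longrightarrow> chart_tu (pullback_j r F) = pcompose (par F) (monom 1 r)"
proof (induction rule: polys_induct)
  case (X i F)
  have "chart_tu (X 0 ^ (r - i) * X 1 ^ i) = (mon2 1 r i :: 'a poly poly)"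
    using X(1) by (simp add: power_monom mult_monom)
  moreover have "pcompose (mon2 1 1 i) (monom 1 r) = (mon2 1 r i :: 'a poly poly)"
    by (simp add: monom_Suc monom_0 pcompose_pCons smult_monom)
  ultimately show ?case using X(3) by (simp add: pcompose_mult del: chart_tu.ev_power pullback_j.ev_power)
qed (auto simp: pcompose_add)

text \<open>\<mu> of the class of f_pq as a form of degree r - 2 in t and u;
  \<open>minor_weight\<close> is its dehomogenization.\<close>

definition minor_hat :: "nat \<Rightarrow> (nat \<Rightarrow> 'k::comm_ring_1) \<Rightarrow> nat \<Rightarrow> nat \<Rightarrow> 'k mpol" where
  "minor_hat r a p q = (\<Sum>h\<in>{p..<q}. Const (a (p + q - 2 - h)) * (X 0 ^ (r - h - 1) * X 1 ^ (h - 1)))"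

lemma minor_class_combination:
  assumes "(p, q) \<in> minor_indices r"
  shows "(\<Sum>k\<in>{1..r - 1}. Const (a (k - 1)) * minor_class r p q k) = minor_hat r a p q"
proof -
  have "(\<Sum>k\<in>{1..r - 1}. Const (a (k - 1)) * minor_class r p q k) =
    (\<Sum>h\<in>{p..<q}. \<Sum>k\<in>{1..r - 1}. if k = p + q - 1 - h then Const (a (k - 1)) * (X 0 ^ (r - h - 1) * X 1 ^ (h - 1)) else 0)"
    unfolding minor_class_def sum_distrib_left
    by (subst sum.swap) (intro sum.cong refl, auto)
  also have "\<dots> = minor_hat r a p q"
    unfolding minor_hat_def
  proof (intro sum.cong refl)
    fix h assume "h \<in> {p..<q}"
    moreover from this assms have "p + q - 1 - h \<in> {1..r - 1}" "p + q - 1 - h - 1 = p + q - 2 - h"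
      by (auto simp: minor_indices_def)
    ultimately show "(\<Sum>k\<in>{1..r - 1}. if k = p + q - 1 - h then Const (a (k - 1)) * (X 0 ^ (r - h - 1) * X 1 ^ (h - 1)) else 0)
        = Const (a (p + q - 2 - h)) * (X 0 ^ (r - h - 1) * X 1 ^ (h - 1))" by simp
  qed
  finally show ?thesis .
qed

lemma chart_tu_minor_hat:
  assumes "(p, q) \<in> minor_indices r"
  shows "chart_tu (minor_hat r a p q) = monom (minor_weight a p q) (r - 2)"
proof -
  have "chart_tu (Const (a (p + q - 2 - h)) * (X 0 ^ (r - h - 1) * X 1 ^ (h - 1))) = mon2 (a (p + q - 2 - h)) (r - 2) (h - 1)"
    if "h \<in> {p..<q}" for h
  proof -
    have "r - h - 1 + (h - 1) = r - 2" using that assms by (auto simp: minor_indices_def)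
    then show ?thesis by (simp add: power_monom mult_monom smult_monom)
  qed
  then show ?thesis unfolding minor_hat_def minor_weight_def monom_sum chart_tu.ev_sum by (rule sum.cong[OF refl])
qed

lemma pullback_j_polys: "F \<in> polys (Suc r) \<Longrightarrow> pullback_j r F \<in> polys 2"
  by (induction rule: polys_induct) auto

lemma mu_kernel_iff:
  fixes a :: "nat \<Rightarrow> 'k::comm_ring_1"
  shows "F \<in> mu_kernel r a \<longleftrightarrow> (\<exists>c. (\<forall>p q. c p q \<in> polys (Suc r)) \<and>
    F = (\<Sum>(p, q)\<in>minor_indices r. c p q * minor X p q) \<and>
    (\<Sum>(p, q)\<in>minor_indices r. pullback_j r (c p q) * minor_hat r a p q) = 0)"
proof -
  have *: "(\<Sum>k\<in>{1..r - 1}. Const (a (k - 1)) * (\<Sum>(p, q)\<in>minor_indices r. pullback_j r (c p q) * minor_class r p q k))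
      = (\<Sum>(p, q)\<in>minor_indices r. pullback_j r (c p q) * minor_hat r a p q)" for c :: "nat \<Rightarrow> nat \<Rightarrow> 'k mpol"
  proof -
    have "(\<Sum>k\<in>{1..r - 1}. Const (a (k - 1)) * (\<Sum>(p, q)\<in>minor_indices r. pullback_j r (c p q) * minor_class r p q k))
      = (\<Sum>(p, q)\<in>minor_indices r. pullback_j r (c p q) * (\<Sum>k\<in>{1..r - 1}. Const (a (k - 1)) * minor_class r p q k))"
      unfolding sum_distrib_left split_def by (subst sum.swap) (simp add: mult_ac)
    also have "\<dots> = (\<Sum>(p, q)\<in>minor_indices r. pullback_j r (c p q) * minor_hat r a p q)"
      by (intro sum.cong refl, clarify) (simp only: minor_class_combination)
    finally show ?thesis .
  qed
  show ?thesis
  proof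
    assume "F \<in> mu_kernel r a"
    then obtain v c where c: "\<forall>p q. c p q \<in> polys (Suc r)" "F = (\<Sum>(p, q)\<in>minor_indices r. c p q * minor X p q)"
      "\<forall>k\<in>{1..r - 1}. v k = (\<Sum>(p, q)\<in>minor_indices r. pullback_j r (c p q) * minor_class r p q k)"
      "(\<Sum>k\<in>{1..r - 1}. Const (a (k - 1)) * v k) = 0"
      unfolding mu_kernel_def conormal_class_def by blast
    have "(\<Sum>k\<in>{1..r - 1}. Const (a (k - 1)) * v k) =
      (\<Sum>k\<in>{1..r - 1}. Const (a (k - 1)) * (\<Sum>(p, q)\<in>minor_indices r. pullback_j r (c p q) * minor_class r p q k))"
      using c(3) by (intro sum.cong) auto
    then have "(\<Sum>(p, q)\<in>minor_indices r. pullback_j r (c p q) * minor_hat r a p q) = 0"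
      by (rule trans[OF sym[OF *] trans[OF sym c(4)]])
    then show "\<exists>c. (\<forall>p q. c p q \<in> polys (Suc r)) \<and> F = (\<Sum>(p, q)\<in>minor_indices r. c p q * minor X p q) \<and>
      (\<Sum>(p, q)\<in>minor_indices r. pullback_j r (c p q) * minor_hat r a p q) = 0"
      using c(1,2) by blast
  next
    assume "\<exists>c. (\<forall>p q. c p q \<in> polys (Suc r)) \<and> F = (\<Sum>(p, q)\<in>minor_indices r. c p q * minor X p q) \<and>
      (\<Sum>(p, q)\<in>minor_indices r. pullback_j r (c p q) * minor_hat r a p q) = 0"
    then obtain c where c: "\<forall>p q. c p q \<in> polys (Suc r)" "F = (\<Sum>(p, q)\<in>minor_indices r. c p q * minor X p q)"
      "(\<Sum>(p, q)\<in>minor_indices r. pullback_j r (c p q) * minor_hat r a p q) = 0" by blast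
    show "F \<in> mu_kernel r a" unfolding mu_kernel_def conormal_class_def mem_Collect_eq
    proof (intro exI[of _ "\<lambda>k. \<Sum>(p, q)\<in>minor_indices r. pullback_j r (c p q) * minor_class r p q k"] conjI exI[of _ c])
      show "(\<Sum>k\<in>{1..r - 1}. Const (a (k - 1)) *
        (\<Sum>(p, q)\<in>minor_indices r. pullback_j r (c p q) * minor_class r p q k)) = 0"
        unfolding * by (rule c(3))
    qed (use c(1,2) in auto)
  qed
qed

text \<open>Both sides are compared in K[t][s]. Substituting z = t^r turns z^2 into t^(2 r), whereas
  \<open>minor_hat\<close> contributes t^(r - 2). The difference t^(r + 2) is a nonzerodivisor, and
  both substitutions are injective.\<close>

lemma mu_condition_iff:
  fixes c :: "nat \<Rightarrow> nat \<Rightarrow> 'k::idom mpol"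
  assumes r: "r \<ge> 2" and c: "\<forall>p q. c p q \<in> polys (Suc r)"
  shows "(\<Sum>(p, q)\<in>minor_indices r. pullback_j r (c p q) * minor_hat r a p q) = 0 \<longleftrightarrow>
    eps a (\<Sum>(p, q)\<in>minor_indices r. c p q * minor X p q) = 0"
proof -
  define W where "W = (\<Sum>(p, q)\<in>minor_indices r. pullback_j r (c p q) * minor_hat r a p q)"
  let ?E = "eps a (\<Sum>(p, q)\<in>minor_indices r. c p q * minor X p q)"
  have "minor_hat r a p q \<in> polys 2" for p q
    by (auto simp: minor_hat_def intro!: polys_sum polys_mult polys_power)
  moreover have "pullback_j r (c p q) \<in> polys 2" for p q using c pullback_j_polys by blast
  ultimately have "W \<in> polys 2" by (auto simp: W_def intro!: polys_sum polys_mult)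
  then have 1: "W = 0 \<longleftrightarrow> chart_tu W = 0" using chart_tu_inj[of W] by auto
  have "pcompose ?E (monom 1 r) = monom 1 (r + 2) * chart_tu W"
    unfolding W_def eps_minor_combination chart_tu.ev_sum pcompose_sum sum_distrib_left
  proof (intro sum.cong refl, clarify)
    fix p q assume pq: "(p, q) \<in> minor_indices r"
    have "pcompose (monom (minor_weight a p q) 2) (monom 1 r) = monom (minor_weight a p q) (r + r)"
      by (simp add: numeral_2_eq_2 monom_Suc monom_0 pcompose_pCons mult_monom smult_monom)
    moreover have "monom 1 (r + 2) * monom (minor_weight a p q) (r - 2) = monom (minor_weight a p q) (r + r)"
    proof -
      have "r + 2 + (r - 2) = r + r" using r by simp
      then show ?thesis by (simp only: mult_monom mult_1)
    qed
    ultimately show "pcompose (par (c p q) * monom (minor_weight a p q) 2) (monom 1 r) =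
      monom 1 (r + 2) * chart_tu (pullback_j r (c p q) * minor_hat r a p q)"
      using c by (simp add: pcompose_mult chart_tu_pullback_j chart_tu_minor_hat[OF pq] mult_ac)
  qed
  moreover have "pcompose ?E (monom 1 r) = 0 \<longleftrightarrow> ?E = 0"
    using r pcompose_eq_0[of ?E "monom 1 r"] by (auto simp: degree_monom_eq)
  ultimately show ?thesis unfolding W_def[symmetric] 1 by simp
qed

text \<open>The vanishing of \<open>eps a F\<close> does not mention the coefficients of F in the
  minors, so any one expression of F decides membership.\<close>

theorem mu_kernel_eq:
  fixes a :: "nat \<Rightarrow> 'k::idom"
  assumes r: "r \<ge> 2"
  shows "mu_kernel r a = dker r a"
proof (intro Set.set_eqI iffI)
  fix F assume "F \<in> mu_kernel r a"
  then obtain c where c: "\<forall>p q. c p q \<in> polys (Suc r)" "F = (\<Sum>(p, q)\<in>minor_indices r. c p q * minor X p q)"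
    "(\<Sum>(p, q)\<in>minor_indices r. pullback_j r (c p q) * minor_hat r a p q) = 0" unfolding mu_kernel_iff by blast
  then have "F \<in> minors_ideal r" unfolding minors_ideal_def by blast
  then show "F \<in> dker r a"
    using mu_condition_iff[OF r c(1), of a] c par_minors_ideal minors_ideal_polys unfolding dker_def by blast
next
  fix F assume F: "F \<in> dker r a"
  then have "F \<in> minors_ideal r" using par_eq_0_iff by (auto simp: dker_def)
  then obtain c where c: "\<forall>p q. c p q \<in> polys (Suc r)" "F = (\<Sum>(p, q)\<in>minor_indices r. c p q * minor X p q)"
    unfolding minors_ideal_def by blast
  then show "F \<in> mu_kernel r a"
    using mu_condition_iff[OF r c(1), of a] F unfolding mu_kernel_iff dker_def by blast
qed

lemma par_eps_power_X0: "par (X 0 ^ k) = mon2 1 k 0" "eps a (X 0 ^ k) = 0"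
proof -
  show "par (X 0 ^ k) = mon2 1 k 0" by (simp add: power_monom)
  show "eps a (X 0 ^ k) = 0" by (induction k) auto
qed

text \<open>\<open>X 0\<close> acts on both components as multiplication by z, because
  \<open>tangent a 0 = 0\<close>. Cancelling z shows that the kernel is already saturated.\<close>

theorem double_structure_ideal_eq:
  fixes a :: "nat \<Rightarrow> 'k::idom"
  assumes r: "r \<ge> 2"
  shows "double_structure_ideal r a = dker r a"
proof (intro Set.set_eqI iffI)
  fix F assume "F \<in> double_structure_ideal r a"
  then obtain k where F: "F \<in> polys (Suc r)" "X 0 ^ k * F \<in> dker r a"
    unfolding double_structure_ideal_def sheaf_sections_def mu_kernel_eq[OF r] by blast
  then have "mon2 1 k 0 * par F = 0" "mon2 1 k 0 * eps a F = 0"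
    by (auto simp: dker_def par_eps_power_X0 simp del: par.ev_power)
  then show "F \<in> dker r a" using F(1) by (auto simp: dker_def)
next
  fix F assume "F \<in> dker r a"
  then show "F \<in> double_structure_ideal r a"
    unfolding double_structure_ideal_def sheaf_sections_def mu_kernel_eq[OF r]
    by (auto intro!: exI[of _ 0] simp: dker_polys)
qed

subsection \<open>Non-degeneracy\<close>

lemma coeff_par_linear:
  assumes "l \<in> homogeneous n 1"
  shows "coeff (coeff (par l) 1) i = Poly_Mapping.lookup l (Poly_Mapping.single i 1)"
  using assms
proof (induction rule: homogeneous_induct)
  case (single m c)
  then have "Poly_Mapping.keys m \<noteq> {}" by (auto simp: mon_deg_def)
  then obtain j where j: "j \<in> Poly_Mapping.keys m" by blast
  then obtain m' where m': "m = Poly_Mapping.single j 1 + m'" by (rule mon_decomp)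
  then have "mon_deg m' = 0" using single by (simp add: mon_deg_add)
  then have "m' = 0" by (intro poly_mapping_eqI) (auto simp: mon_deg_def in_keys_iff)
  then have m: "m = Poly_Mapping.single j 1" using m' by simp
  have "par (Poly_Mapping.single m c) = mon2 c 1 j"
    unfolding par.ev_single m by (simp add: smult_monom)
  moreover have "Poly_Mapping.single j (1::nat) = Poly_Mapping.single i 1 \<longleftrightarrow> j = i"
    by (auto simp: poly_mapping_eq_iff fun_eq_iff lookup_single when_def split: if_splits)
  ultimately show ?case unfolding m by (auto simp: coeff_monom lookup_single when_def)
qed (auto simp: lookup_add)

lemma linear_eq_0I:
  assumes "l \<in> homogeneous n 1" "par l = 0"
  shows "l = 0"
proof (rule poly_mapping_eqI)
  fix m
  show "Poly_Mapping.lookup l m = Poly_Mapping.lookup 0 m"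
  proof (cases "m \<in> Poly_Mapping.keys l")
    case True
    then have "mon_deg m = 1" using assms(1) by (auto simp: homogeneous_def)
    then have "Poly_Mapping.keys m \<noteq> {}" by (auto simp: mon_deg_def)
    then obtain j where j: "j \<in> Poly_Mapping.keys m" by blast
    then obtain m' where m': "m = Poly_Mapping.single j 1 + m'" by (rule mon_decomp)
    then have "mon_deg m' = 0" using \<open>mon_deg m = 1\<close> by (simp add: mon_deg_add)
    then have "m' = 0" by (intro poly_mapping_eqI) (auto simp: mon_deg_def in_keys_iff)
    then show ?thesis using coeff_par_linear[OF assms(1), of j] assms(2) m' by simp
  qed (simp add: in_keys_iff)
qed

theorem non_degenerate_dker: "non_degenerate r (dker r a)"
  unfolding non_degenerate_def dker_def using linear_eq_0I by blast

subsection \<open>Hilbert polynomial\<close>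

interpretation mpol_vs: vector_space "\<lambda>(c :: 'k::field) (p :: 'k mpol). Const c * p"
  by unfold_locales (simp_all add: algebra_simps Const_mult)

lemma (in vector_space) dim_kernel_functional:
  assumes V: "subspace V" "V \<subseteq> span S" "finite S" and e: "e \<in> V"
    and \<phi>: "\<And>x y. \<phi> (x + y) = \<phi> x + \<phi> y" "\<And>c x. \<phi> (scale c x) = c * \<phi> x" "\<phi> e = 1"
  shows "dim V = Suc (dim {v \<in> V. \<phi> v = (0 :: 'a)})"
proof -
  let ?U = "{v \<in> V. \<phi> v = 0}"
  obtain B where B: "B \<subseteq> ?U" "independent B" "?U \<subseteq> span B" "card B = dim ?U"
    using basis_exists by blast
  have "B \<subseteq> span S" using B V by blast
  then have fin: "finite B" using independent_span_bound[OF V(3) B(2)] by blast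
  have \<phi>0: "\<phi> 0 = 0" using \<phi>(2)[of 0 0] by simp
  have "subspace ?U" unfolding subspace_def using V(1) \<phi> \<phi>0
    by (auto simp: subspace_0 subspace_add subspace_scale)
  then have "span B \<subseteq> ?U" using B(1) by (rule span_minimal[rotated])
  then have "e \<notin> span B" using \<phi>(3) by auto
  moreover from this have "e \<notin> B" using span_base by blast
  ultimately have ind: "independent (insert e B)" using B(2) by (simp add: independent_insert)
  have "V \<subseteq> span (insert e B)"
  proof
    fix v assume v: "v \<in> V"
    have neg: "\<phi> (v - scale (\<phi> v) e) = 0"
    proof -
      have "\<phi> (v - scale (\<phi> v) e) + \<phi> (scale (\<phi> v) e) = \<phi> v" by (simp flip: \<phi>(1))
      then show ?thesis using \<phi> by simp
    qed
    have "v - scale (\<phi> v) e \<in> V" using V(1) v e by (intro subspace_diff subspace_scale)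
    then have "v - scale (\<phi> v) e \<in> span B" using neg B(3) by blast
    then show "v \<in> span (insert e B)" by (auto simp: span_insert)
  qed
  moreover have "insert e B \<subseteq> V" using B e by blast
  ultimately have "dim V = card (insert e B)" using ind dim_unique by blast
  then show ?thesis using fin \<open>e \<notin> B\<close> B(4) by simp
qed

text \<open>The vectors e_j are dual to the functionals, so imposing these one at a time always
  leaves a vector of the current kernel on which the next one is 1.\<close>

lemma (in vector_space) dim_kernel_functionals:
  assumes V: "subspace V" "V \<subseteq> span S" "finite S" and e: "\<And>i. i < N \<Longrightarrow> e i \<in> V"
    and \<phi>: "\<And>i x y. \<phi> i (x + y) = \<phi> i x + \<phi> i y" "\<And>i c x. \<phi> i (scale c x) = c * \<phi> i x"
      "\<And>i j. i < N \<Longrightarrow> j < N \<Longrightarrow> \<phi> i (e j) = (if i = j then 1 else 0 :: 'a)"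
  shows "dim V = N + dim {v \<in> V. \<forall>i<N. \<phi> i v = 0}"
  using e \<phi>(3)
proof (induction N)
  case (Suc N)
  let ?U = "{v \<in> V. \<forall>i<N. \<phi> i v = 0}"
  have \<phi>0: "\<phi> i 0 = 0" for i using \<phi>(2)[of i 0 0] by simp
  have "subspace ?U" unfolding subspace_def using V(1) \<phi>(1,2) \<phi>0
    by (auto simp: subspace_0 subspace_add subspace_scale)
  moreover have "?U \<subseteq> span S" using V by blast
  moreover have "e N \<in> ?U" "\<phi> N (e N) = 1" using Suc.prems by auto
  ultimately have "dim ?U = Suc (dim {v \<in> ?U. \<phi> N v = 0})"
    using dim_kernel_functional[of ?U S "e N" "\<phi> N"] V(3) \<phi>(1,2) by blast
  moreover have "{v \<in> ?U. \<phi> N v = 0} = {v \<in> V. \<forall>i<Suc N. \<phi> i v = 0}" by (auto simp: less_Suc_eq)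
  ultimately show ?case using Suc by simp
qed simp

lemma finite_monomials: "finite {m :: nat \<Rightarrow>\<^sub>0 nat. Poly_Mapping.keys m \<subseteq> {..<n} \<and> mon_deg m = d}" (is "finite ?M")
proof (rule finite_imageD)
  show "finite ((\<lambda>m. restrict (Poly_Mapping.lookup m) {..<n}) ` ?M)"
  proof (rule finite_subset)
    show "(\<lambda>m. restrict (Poly_Mapping.lookup m) {..<n}) ` ?M \<subseteq> {..<n} \<rightarrow>\<^sub>E {..d}"
    proof (rule image_subsetI)
      fix m assume m: "m \<in> ?M"
      have "Poly_Mapping.lookup m i \<le> d" if "i < n" for i
        using mon_deg_alt[of "{..<n}" m] m that
          member_le_sum[of i "{..<n}" "Poly_Mapping.lookup m"] by auto
      then show "restrict (Poly_Mapping.lookup m) {..<n} \<in> {..<n} \<rightarrow>\<^sub>E {..d}" by auto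
    qed
  qed (simp add: finite_PiE)
  show "inj_on (\<lambda>m. restrict (Poly_Mapping.lookup m) {..<n}) ?M"
  proof (rule inj_onI, rule poly_mapping_eqI)
    fix m m' i assume *: "m \<in> ?M" "m' \<in> ?M"
      "restrict (Poly_Mapping.lookup m) {..<n} = restrict (Poly_Mapping.lookup m') {..<n}"
    show "Poly_Mapping.lookup m i = Poly_Mapping.lookup m' i"
    proof (cases "i < n")
      case True
      then show ?thesis using fun_cong[OF *(3), of i] by simp
    next
      case False
      then show ?thesis using *(1,2) by (metis (mono_tags, lifting) in_keys_iff lessThan_iff mem_Collect_eq subsetD)
    qed
  qed
qed

lemma homogeneous_spanning:
  "homogeneous n d \<subseteq> mpol_vs.span ((\<lambda>m. Poly_Mapping.single m (1 :: 'k::field)) `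
     {m. Poly_Mapping.keys m \<subseteq> {..<n} \<and> mon_deg m = d})"
proof
  fix F :: "'k mpol" assume "F \<in> homogeneous n d"
  then show "F \<in> mpol_vs.span ((\<lambda>m. Poly_Mapping.single m 1) ` {m. Poly_Mapping.keys m \<subseteq> {..<n} \<and> mon_deg m = d})"
  proof (induction rule: homogeneous_induct)
    case (single m c)
    have "Poly_Mapping.single m c = Const c * Poly_Mapping.single m 1" by (simp add: Const_def mult_single)
    moreover have "Poly_Mapping.single m (1 :: 'k) \<in> (\<lambda>m. Poly_Mapping.single m 1) `
        {m. Poly_Mapping.keys m \<subseteq> {..<n} \<and> mon_deg m = d}" using single by blast
    ultimately show ?case by (simp only: mpol_vs.span_scale mpol_vs.span_base)
  qed (auto intro: mpol_vs.span_add mpol_vs.span_zero)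
qed

text \<open>The codimension is counted in two layers: \<open>par\<close> detects the r d + 1
  monomials with e \<le> r d, and on its kernel \<open>eps\<close> detects the r d - r - 1 monomials
  with e + r + 2 \<le> r d.\<close>

lemma hilbert_function_dker:
  fixes a :: "nat \<Rightarrow> 'k::field_char_0"
  assumes r: "r \<ge> 2" and nz: "\<exists>i<r - 1. a i \<noteq> 0" and d: "d \<ge> 2"
  shows "hilbert_function r (dker r a) d = 2 * int r * int d - int r"
proof -
  let ?V = "homogeneous (Suc r) d :: 'k mpol set"
  let ?S = "(\<lambda>m. Poly_Mapping.single m (1 :: 'k)) ` {m. Poly_Mapping.keys m \<subseteq> {..<Suc r} \<and> mon_deg m = d}"
  let ?U = "{F \<in> ?V. par F = 0}"
  have V: "mpol_vs.subspace ?V" unfolding mpol_vs.subspace_def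
    by (auto intro: homogeneous_add homogeneous_Const)
  have U: "mpol_vs.subspace ?U" unfolding mpol_vs.subspace_def
    by (auto intro: homogeneous_add homogeneous_Const)
  have S: "finite ?S" "?V \<subseteq> mpol_vs.span ?S"
    by (intro finite_imageI finite_monomials, rule homogeneous_spanning)
  let ?e = "\<lambda>i. std_mon r d i :: 'k mpol"
  have "mpol_vs.dim ?V = Suc (r * d) + mpol_vs.dim {F \<in> ?V. \<forall>i<Suc (r * d). coeff (coeff (par F) d) i = 0}"
    by (rule mpol_vs.dim_kernel_functionals[OF V S(2,1), where e = ?e])
      (auto simp: std_mon_homogeneous par_std_mon coeff_monom)
  moreover have "{F \<in> ?V. \<forall>i<Suc (r * d). coeff (coeff (par F) d) i = 0} = ?U"
  proof (intro Set.set_eqI iffI)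
    fix F assume "F \<in> {F \<in> ?V. \<forall>i<Suc (r * d). coeff (coeff (par F) d) i = 0}"
    then have F: "F \<in> ?V" "\<forall>i<Suc (r * d). coeff (coeff (par F) d) i = 0" by auto
    have w: "par F \<in> wt r 0" using par_in_wt homogeneous_polys[OF F(1)] by blast
    have "coeff (coeff (par F) i) j = 0" for i j
      using homogeneous_parts(1)[OF F(1), of i] F(2) w by (cases "i = d") (force simp: wt_def)+
    then show "F \<in> ?U" using F(1) by (auto intro!: poly_eqI)
  qed auto
  ultimately have 1: "mpol_vs.dim ?V = Suc (r * d) + mpol_vs.dim ?U" by simp
  \<comment> \<open>For d \<ge> 2 the subtraction on natural numbers is exact, so this counts the
    exponents e with e + r + 2 \<le> r d.\<close>
  let ?N = "r * d - r - 1"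
  have "r * 2 \<le> r * d" using d by simp
  then have N: "r * d = ?N + (r + 1)" using r by linarith
  have "\<exists>F. F \<in> minors_ideal r \<inter> ?V \<and> eps a F = mon2 1 d i" if "i < ?N" for i
  proof -
    have "i + (r + 2) \<le> r * d" using that N by linarith
    then show ?thesis using eps_mon2_surj[OF nz] by blast
  qed
  then obtain f where f: "\<And>i. i < ?N \<Longrightarrow> f i \<in> minors_ideal r \<and> f i \<in> ?V \<and> eps a (f i) = mon2 1 d i"
    by (metis IntD1 IntD2)
  have "mpol_vs.dim ?U = ?N + mpol_vs.dim {F \<in> ?U. \<forall>i<?N. coeff (coeff (eps a F) d) i = 0}"
    by (rule mpol_vs.dim_kernel_functionals[OF U _ S(1), where e = f])
      (use S(2) f par_minors_ideal in \<open>auto simp: coeff_monom\<close>)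
  moreover have "{F \<in> ?U. \<forall>i<?N. coeff (coeff (eps a F) d) i = 0} = dker r a \<inter> ?V"
  proof (intro Set.set_eqI iffI)
    fix F assume F: "F \<in> {F \<in> ?U. \<forall>i<?N. coeff (coeff (eps a F) d) i = 0}"
    then have FV: "F \<in> ?V" and p: "par F = 0" by auto
    have "F \<in> minors_ideal r" using par_eq_0_iff[OF homogeneous_polys[OF FV]] p by simp
    then have w: "eps a F \<in> wt r (r + 2)" by (rule eps_minors_ideal)
    have "coeff (coeff (eps a F) i) j = 0" for i j
    proof (cases "i = d")
      case True
      have "j < ?N" if "j + (r + 2) \<le> r * d" using that N by linarith
      then show ?thesis using True F w unfolding wt_def by blast
    qed (simp add: homogeneous_parts(2)[OF FV])
    then show "F \<in> dker r a \<inter> ?V" using FV p homogeneous_polys[OF FV] by (auto simp: dker_def intro!: poly_eqI)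
  qed (auto simp: dker_def)
  ultimately have "mpol_vs.dim ?V = Suc (r * d) + ?N + mpol_vs.dim (dker r a \<inter> ?V)" using 1 by simp
  moreover have "int (Suc (r * d) + ?N) = 2 * int r * int d - int r"
    using arg_cong[OF N, of int] by (simp add: algebra_simps)
  ultimately show ?thesis unfolding hilbert_function_def graded_dim_def by simp
qed

theorem degree_and_genus_dker:
  fixes a :: "nat \<Rightarrow> 'k::field_char_0"
  assumes r: "r \<ge> 2" and nz: "\<exists>i<r - 1. a i \<noteq> 0"
  shows "has_degree_and_genus r (dker r a) (2 * r) (int r + 1)"
  unfolding has_degree_and_genus_def hilbert_polynomial_def
proof (intro exI[of _ "[:- of_nat r, of_nat (2 * r):]"] conjI exI[of _ 2] allI impI)
  fix d :: nat assume "d \<ge> 2"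
  then show "poly [:- of_nat r, of_nat (2 * r):] (of_nat d) = (of_int (hilbert_function r (dker r a) d) :: rat)"
    by (simp add: hilbert_function_dker[OF r nz] algebra_simps)
qed (use r in auto)

subsection \<open>The cone\<close>

text \<open>The linear forms \<open>\<beta> x\<^sub>i - \<alpha> x\<^bsub>i+1\<^esub>\<close> cut out the point \<open>j(\<alpha>:\<beta>)\<close>, and projecting \<open>C\<close> from it
  gives a rational normal curve of degree \<open>r - 1\<close>.\<close>

definition cone_coord :: "nat \<Rightarrow> 'k::comm_ring_1 \<Rightarrow> 'k \<Rightarrow> nat \<Rightarrow> 'k mpol" where
  "cone_coord r \<alpha> \<beta> i = (if i < r then Const \<beta> * X i - Const \<alpha> * X (Suc i)
     else if \<beta> = 0 then X 0 else X r)"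

lemma cone_coord_linear: "cone_coord r \<alpha> \<beta> i \<in> homogeneous (Suc r) 1"
  by (auto simp: cone_coord_def simp del: Const_simps
      intro!: homogeneous_diff homogeneous_Const homogeneous_X[unfolded One_nat_def])

lemma cone_coord_polys [simp]: "cone_coord r \<alpha> \<beta> i \<in> polys (Suc r)"
  by (rule homogeneous_polys[OF cone_coord_linear])

lemma lookup_X: "Poly_Mapping.lookup (X i :: 'k::comm_ring_1 mpol) (Poly_Mapping.single j 1) = (if i = j then 1 else 0)"
proof -
  have "Poly_Mapping.single i (1::nat) = Poly_Mapping.single j 1 \<longleftrightarrow> i = j"
    by (auto simp: poly_mapping_eq_iff fun_eq_iff lookup_single when_def split: if_splits)
  then show ?thesis by (auto simp: X_def lookup_single when_def)
qed

lemma coordinate_system_X: "coordinate_system n (X :: nat \<Rightarrow> 'k::comm_ring_1 mpol)"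
  unfolding coordinate_system_def
proof (intro conjI allI impI)
  fix c :: "nat \<Rightarrow> 'k" and i assume 0: "(\<Sum>i\<le>n. Const (c i) * X i) = 0" and i: "i \<le> n"
  have "0 = Poly_Mapping.lookup (\<Sum>i\<le>n. Const (c i) * X i) (Poly_Mapping.single i 1)" unfolding 0 by simp
  also have "\<dots> = (\<Sum>k\<le>n. if k = i then c k else 0)"
    unfolding lookup_sum lookup_Const_times lookup_X by (intro sum.cong) auto
  also have "\<dots> = c i" using i by simp
  finally show "c i = 0" ..
qed (auto intro: homogeneous_X[unfolded One_nat_def])

text \<open>Independence is triangular. For \<beta> non-zero it is read off from \<open>X 0\<close>
  upwards, and \<open>X r\<close> completes the system; for \<beta> = 0 the first r forms are
  multiples of \<open>X 1\<close> to \<open>X r\<close>, and \<open>X 0\<close> is the one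
  missing.\<close>

lemma coordinate_system_cone_coord:
  fixes \<alpha> \<beta> :: "'k::idom"
  assumes "(\<alpha>, \<beta>) \<noteq> (0, 0)"
  shows "coordinate_system r (cone_coord r \<alpha> \<beta>)"
  unfolding coordinate_system_def
proof (intro conjI allI impI)
  fix c :: "nat \<Rightarrow> 'k" and i
  assume 0: "(\<Sum>i\<le>r. Const (c i) * cone_coord r \<alpha> \<beta> i) = 0" and i: "i \<le> r"
  let ?l = "\<lambda>F j. Poly_Mapping.lookup F (Poly_Mapping.single j (1::nat))"
  have eq: "(\<Sum>i<r. c i * (\<beta> * (if i = j then 1 else 0) - \<alpha> * (if Suc i = j then 1 else 0)))
      + c r * (if \<beta> = 0 then if 0 = j then 1 else 0 else if r = j then 1 else 0) = 0" for j
  proof -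
    have "?l (cone_coord r \<alpha> \<beta> r) j = (if \<beta> = 0 then if 0 = j then 1 else 0 else if r = j then 1 else 0)"
      by (auto simp: cone_coord_def lookup_X[unfolded One_nat_def])
    moreover have "?l (cone_coord r \<alpha> \<beta> i) j = \<beta> * (if i = j then 1 else 0) - \<alpha> * (if Suc i = j then 1 else 0)"
      if "i < r" for i
      using that by (simp add: cone_coord_def lookup_X lookup_minus lookup_Const_times del: One_nat_def)
    moreover have "?l (\<Sum>i\<le>r. Const (c i) * cone_coord r \<alpha> \<beta> i) j = 0" unfolding 0 by simp
    then have "(\<Sum>i<r. c i * ?l (cone_coord r \<alpha> \<beta> i) j) + c r * ?l (cone_coord r \<alpha> \<beta> r) j = 0"
      unfolding lookup_sum lookup_Const_times by (simp only: lessThan_Suc_atMost[symmetric] sum.lessThan_Suc)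
    moreover from calculation(2) have "(\<Sum>i<r. c i * ?l (cone_coord r \<alpha> \<beta> i) j)
        = (\<Sum>i<r. c i * (\<beta> * (if i = j then 1 else 0) - \<alpha> * (if Suc i = j then 1 else 0)))"
      by (intro sum.cong) auto
    ultimately show ?thesis by (simp only:)
  qed
  have s1: "(\<Sum>i<r. c i * (\<beta> * (if i = j then 1 else 0) - \<alpha> * (if Suc i = j then 1 else 0)))
      = (if j < r then c j * \<beta> else 0) - (if 0 < j \<and> j \<le> r then c (j - 1) * \<alpha> else 0)" for j
  proof -
    have "(\<Sum>i<r. c i * (\<beta> * (if i = j then 1 else 0) - \<alpha> * (if Suc i = j then 1 else 0)))
      = (\<Sum>i<r. if i = j then c i * \<beta> else 0) - (\<Sum>i<r. if Suc i = j then c i * \<alpha> else 0)"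
      unfolding sum_subtractf[symmetric] by (intro sum.cong) (auto simp: algebra_simps)
    moreover have "(\<Sum>i<r. if Suc i = j then c i * \<alpha> else 0) = (if 0 < j \<and> j \<le> r then c (j - 1) * \<alpha> else 0)"
      by (cases j) auto
    ultimately show ?thesis by simp
  qed
  show "c i = 0"
  proof (cases "\<beta> = 0")
    case True
    then have "\<alpha> \<noteq> 0" using assms by simp
    have "c r = 0" using eq[of 0] True unfolding s1 by (auto split: if_splits)
    moreover have "c j = 0" if "j < r" for j
      using eq[of "Suc j"] True that \<open>\<alpha> \<noteq> 0\<close> unfolding s1 by (auto split: if_splits)
    ultimately show ?thesis using i by (cases "i = r") auto
  next
    case False
    have lt: "j < r \<Longrightarrow> c j = 0" for j
    proof (induction j)
      case 0
      then show ?case using eq[of 0] False unfolding s1 by simp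
    next
      case (Suc j)
      then show ?case using eq[of "Suc j"] False unfolding s1 by simp
    qed
    moreover have "c r = 0" if "0 < r"
      using eq[of r] False that lt[of "r - 1"] unfolding s1 by simp
    moreover have "c r = 0" if "r = 0" using eq[of r] False that unfolding s1 by simp
    ultimately show ?thesis using i by (cases "i = r") auto
  qed
qed (rule cone_coord_linear)

text \<open>On the curve the new coordinates are z s^i (\<beta> - \<alpha> s), again a geometric
  progression, so the minors vanish there. To first order they vanish once the differences v_k of
  the \<epsilon>-parts satisfy v_k = s^k v_0, which follows from \<beta> a_k = \<alpha>
  a_(k+1).\<close>

lemma cone_minor_in_dker:
  fixes \<alpha> \<beta> :: "'k::idom"
  assumes "(p, q) \<in> minor_indices (r - 1)" and a: "\<And>i. i < r - 1 \<Longrightarrow> a i = \<alpha> ^ (r - 2 - i) * \<beta> ^ i"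
  shows "minor (cone_coord r \<alpha> \<beta>) p q \<in> dker r a"
proof -
  obtain i k where pq: "p = Suc i" "q = Suc k" "i < k" "Suc k < r"
    using assms(1) by (intro that[of "p - 1" "q - 1"]) (auto simp: minor_indices_def)
  define g where "g = [:\<beta>:] - [:\<alpha>:] * monom 1 1"
  define u where "u i = [:\<beta>:] * tangent a i - [:\<alpha>:] * tangent a (Suc i)" for i
  define v where "v k = u (Suc k) - monom 1 1 * u k" for k
  have e: "monom 1 (Suc i) = monom 1 1 * (monom 1 i :: 'k poly)" for i by (simp add: mult_monom)
  have sm: "[:c:] * monom b i = monom (c * b) i" for c b :: 'k and i by (simp add: smult_monom)
  have par_coord: "par (cone_coord r \<alpha> \<beta> i) = monom (monom 1 i * g) 1" if "i < r" for i
  proof -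
    have "par (cone_coord r \<alpha> \<beta> i) = mon2 \<beta> 1 i - mon2 \<alpha> 1 (Suc i)"
      using that by (simp add: cone_coord_def smult_monom)
    also have "mon2 \<beta> 1 i - mon2 \<alpha> 1 (Suc i) = monom (monom \<beta> i - monom \<alpha> (Suc i)) 1" by (simp add: diff_monom)
    also have "monom \<beta> i - monom \<alpha> (Suc i) = monom 1 i * g"
      by (simp add: g_def right_diff_distrib smult_monom mult_monom)
    finally show ?thesis .
  qed
  have eps_coord: "eps a (cone_coord r \<alpha> \<beta> i) = monom (u i) 1" if "i < r" for i
    using that by (simp add: cone_coord_def u_def smult_monom diff_monom)
  have v_alt: "v k = [:\<beta>:] * tdiff a k - [:\<alpha>:] * tdiff a (Suc k)" for k
    unfolding v_def u_def tdiff_def by (simp only: algebra_simps)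
  have v_Suc: "v (Suc k) = monom 1 1 * v k" if "Suc k < r - 1" for k
  proof -
    have "r - 2 - k = Suc (r - 2 - Suc k)" using that by simp
    \<comment> \<open>The special form of \<mu> enters here: consecutive entries are proportional to
      \<alpha> and \<beta>.\<close>
    then have "\<beta> * a k = \<alpha> * a (Suc k)" using that by (simp add: a)
    then have z: "[:\<beta>:] * [:a k:] = [:\<alpha>:] * [:a (Suc k):]" by (simp add: mult.commute)
    have "v (Suc k) = monom 1 1 * v k + ([:\<beta>:] * [:a k:] - [:\<alpha>:] * [:a (Suc k):])"
      unfolding v_alt tdiff_Suc[of a "Suc k"] tdiff_Suc[of a k] by (simp only: algebra_simps)
    then show ?thesis using z by simp
  qed
  have v_eq: "v k = monom 1 k * v 0" if "k < r - 1" for k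
    using that
  proof (induction k)
    case (Suc k)
    then have "v (Suc k) = monom 1 1 * (monom 1 k * v 0)" using v_Suc by simp
    then show ?case unfolding e[of k] by (simp only: mult.assoc)
  qed simp
  have less: "i < r" "Suc i < r" "k < r" "Suc k < r" using pq by auto
  have "eps a (minor (cone_coord r \<alpha> \<beta>) p q) = monom (g * (monom 1 i * v k - monom 1 k * v i)) 2"
  proof -
    have "eps a (minor (cone_coord r \<alpha> \<beta>) p q) = monom (monom 1 i * g * u (Suc k) + u i * (monom 1 (Suc k) * g)
        - (monom 1 (Suc i) * g * u k + u (Suc i) * (monom 1 k * g))) 2"
      using less by (simp add: minor_def pq(1,2) par_coord eps_coord mult_monom add_monom diff_monom numeral_2_eq_2)
    also have "monom 1 i * g * u (Suc k) + u i * (monom 1 (Suc k) * g)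
        - (monom 1 (Suc i) * g * u k + u (Suc i) * (monom 1 k * g)) = g * (monom 1 i * v k - monom 1 k * v i)"
      unfolding v_def e[of i] e[of k] by (simp only: algebra_simps)
    finally show ?thesis .
  qed
  also have "monom 1 i * v k - monom 1 k * v i = 0"
    using pq v_eq[of i] v_eq[of k] by (simp add: mult_ac)
  finally have "eps a (minor (cone_coord r \<alpha> \<beta>) p q) = 0" by simp
  moreover have "par (minor (cone_coord r \<alpha> \<beta>) p q) = 0"
    using less by (simp add: minor_def pq(1,2) par_coord mult_monom)
  moreover have "minor (cone_coord r \<alpha> \<beta>) p q \<in> polys (Suc r)"
    unfolding minor_def by simp
  ultimately show ?thesis by (simp add: dker_def)
qed

theorem cone_contains:
  fixes \<alpha> \<beta> :: "'k::idom"
  assumes r: "r \<ge> 2" and ab: "(\<alpha>, \<beta>) \<noteq> (0, 0)" and a: "\<And>i. i < r - 1 \<Longrightarrow> a i = \<alpha> ^ (r - 2 - i) * \<beta> ^ i"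
  shows "\<exists>J Z. rational_normal_curve (r - 1) J \<and> cone_over r J Z \<and> Z \<subseteq> dker r a"
proof -
  let ?G = "(\<lambda>(p, q). minor (X :: nat \<Rightarrow> 'k mpol) p q) ` minor_indices (r - 1)"
  let ?J = "Idl\<^bsub>poly_ring (Suc (r - 1))\<^esub> ?G"
  let ?\<xi> = "cone_coord r \<alpha> \<beta>"
  let ?Z = "Idl\<^bsub>poly_ring (Suc r)\<^esub> (subst ?\<xi> ` ?J)"
  interpret sub: coeff_hom "Const :: 'k \<Rightarrow> 'k mpol" ?\<xi>
    by unfold_locales (simp_all add: Const_mult)
  interpret R: cring "poly_ring (Suc (r - 1)) :: 'k mpol ring" by (rule cring_poly_ring)
  interpret R': cring "poly_ring (Suc r) :: 'k mpol ring" by (rule cring_poly_ring)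
  have polys: "subst ?\<xi> F \<in> polys (Suc r)" if "F \<in> polys (Suc (r - 1))" for F
    using that by (induction rule: polys_induct) auto
  \<comment> \<open>The preimage of \<open>dker r a\<close> under the substitution is an ideal, so
    only the minors have to be checked.\<close>
  let ?K = "{F \<in> polys (Suc (r - 1)). subst ?\<xi> F \<in> dker r a}"
  have K: "ideal ?K (poly_ring (Suc (r - 1)))"
    unfolding ideal_poly_ring_iff using polys by (auto intro: dker_add dker_mult)
  have "?G \<subseteq> ?K"
  proof clarify
    fix p q assume pq: "(p, q) \<in> minor_indices (r - 1)"
    have "subst ?\<xi> (minor X p q) = minor ?\<xi> p q" by (simp add: minor_def)
    then show "minor X p q \<in> polys (Suc (r - 1)) \<and> subst ?\<xi> (minor X p q) \<in> dker r a"
      using cone_minor_in_dker[OF pq a] minor_polys[OF pq] by simp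
  qed
  then have "?J \<subseteq> ?K" by (rule R.genideal_minimal[OF K])
  then have "subst ?\<xi> ` ?J \<subseteq> dker r a" by blast
  then have "?Z \<subseteq> dker r a" by (rule R'.genideal_minimal[OF ideal_dker])
  moreover have "rational_normal_curve (r - 1) ?J"
    unfolding rational_normal_curve_def using coordinate_system_X by blast
  moreover have "cone_over r ?J ?Z"
    unfolding cone_over_def using coordinate_system_cone_coord[OF ab] by blast
  ultimately show ?thesis by blast
qed

section \<open>Points of the cone over the curve\<close>

text \<open>Evaluation with coefficients pushed through a homomorphism; iterating it evaluates
  elements of K[s][z].\<close>

locale poly_hom =
  fixes \<phi> :: "'a :: comm_ring_1 \<Rightarrow> 'b :: comm_ring_1" and v :: 'b
  assumes \<phi>_1: "\<phi> 1 = 1" and \<phi>_add: "\<phi> (x + y) = \<phi> x + \<phi> y" and \<phi>_mult: "\<phi> (x * y) = \<phi> x * \<phi> y"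
begin

definition pe :: "'a poly \<Rightarrow> 'b" where "pe f = poly (map_poly \<phi> f) v"

lemma \<phi>_0: "\<phi> 0 = 0"
  using \<phi>_add[of 0 0] by simp

lemma pe_0 [simp]: "pe 0 = 0"
  by (simp add: pe_def)

lemma pe_pCons [simp]: "pe (pCons c f) = \<phi> c + v * pe f"
  by (simp add: pe_def map_poly_pCons \<phi>_0)

lemma pe_add [simp]: "pe (f + g) = pe f + pe g"
proof (induction f arbitrary: g)
  case (pCons c f)
  then show ?case by (cases g) (simp add: \<phi>_add algebra_simps)
qed simp

lemma pe_smult [simp]: "pe (smult c f) = \<phi> c * pe f"
  by (induction f) (simp_all add: \<phi>_mult algebra_simps)

lemma pe_mult [simp]: "pe (f * g) = pe f * pe g"
  by (induction f) (simp_all add: algebra_simps \<phi>_0)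

lemma pe_1 [simp]: "pe 1 = 1"
  by (simp add: one_pCons \<phi>_1)

lemma pe_diff [simp]: "pe (f - g) = pe f - pe g"
proof -
  have "pe (f - g) + pe g = pe f" by (simp flip: pe_add)
  then show ?thesis by (simp add: eq_diff_eq)
qed

end

text \<open>If no non-zero polynomial in \<open>x\<close> alone lies in the ideal, take an element \<open>f\<close> of least degree
  in \<open>y\<close>: pseudo-division by \<open>f\<close> shows that the ideal vanishes at all zeros of \<open>f\<close> outside the zeros
  of its leading coefficient, so that \<open>x - \<kappa>\<close> is not invertible for the corresponding \<open>\<kappa>\<close>.\<close>

lemma nullstellensatz_plane:
  fixes n :: "'k::{alg_closed_field, field_char_0} poly poly set"
  assumes zero: "0 \<in> n" and add: "\<And>f g. f \<in> n \<Longrightarrow> g \<in> n \<Longrightarrow> f + g \<in> n"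
    and mult: "\<And>f g. g \<in> n \<Longrightarrow> f * g \<in> n" and proper: "1 \<notin> n"
    and inv: "\<And>f. f \<notin> n \<Longrightarrow> \<exists>g. f * g - 1 \<in> n"
  shows "\<exists>\<kappa> \<eta>. [:[:-\<kappa>, 1:]:] \<in> n \<and> [:[:-\<eta>:], 1:] \<in> n"
proof -
  have minus: "f - g \<in> n" if "f \<in> n" "g \<in> n" for f g
    using add[OF that(1) mult[OF that(2), of "- 1"]] by simp
  have prime: "f \<in> n \<or> g \<in> n" if "f * g \<in> n" for f g
  proof (rule disjCI)
    assume "g \<notin> n"
    then obtain h where h: "g * h - 1 \<in> n" using inv by blast
    have "h * (f * g) - f * (g * h - 1) \<in> n" by (rule minus[OF mult[OF that] mult[OF h]])
    then show "f \<in> n" by (simp add: algebra_simps)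
  qed
  have const: "[:[:c:]:] \<notin> n" if "c \<noteq> 0" for c
  proof
    assume "[:[:c:]:] \<in> n"
    from mult[OF this, of "[:[:inverse c:]:]"] have "1 \<in> n" using that by (simp add: one_pCons)
    then show False using proper by simp
  qed
  interpret sp: poly_hom "\<lambda>p. [:poly p \<kappa>:]" "[:0, 1:] :: 'k poly" for \<kappa>
    by unfold_locales (auto simp: one_pCons)
  define ev where "ev \<kappa> = sp.pe \<kappa>" for \<kappa>
  have ev_simps [simp]: "ev \<kappa> (f + g) = ev \<kappa> f + ev \<kappa> g" "ev \<kappa> (f * g) = ev \<kappa> f * ev \<kappa> g"
    "ev \<kappa> (f - g) = ev \<kappa> f - ev \<kappa> g" "ev \<kappa> 1 = 1" "ev \<kappa> 0 = 0" "ev \<kappa> (pCons c f) = pCons (poly c \<kappa>) (ev \<kappa> f)"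
    "ev \<kappa> (smult c f) = [:poly c \<kappa>:] * ev \<kappa> f"
    for \<kappa> f g c by (simp_all add: ev_def)
  have coeff_ev: "coeff (ev \<kappa> f) i = poly (coeff f i) \<kappa>" for \<kappa> f i
    by (induction f arbitrary: i) (auto simp: coeff_pCons split: nat.split)
  show ?thesis
  proof (cases "\<exists>p\<noteq>0. [:p:] \<in> n")
    case True
    then obtain p where p: "p \<noteq> 0" "[:p:] \<in> n" by blast
    \<comment> \<open>Over the algebraically closed field the polynomial in x splits into linear
      factors, and primality of n selects one.\<close>
    then have "\<exists>\<kappa>. [:[:-\<kappa>, 1:]:] \<in> n"
    proof (induction "degree p" arbitrary: p rule: less_induct)
      case less
      have "degree p > 0"
      proof (rule ccontr)
        assume "\<not> degree p > 0"
        then obtain c where "p = [:c:]" by (metis degree_eq_zeroE neq0_conv)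
        then show False using less.prems const by auto
      qed
      then obtain \<kappa> where "poly p \<kappa> = 0" using alg_closed_imp_poly_has_root by blast
      then obtain q where q: "p = [:-\<kappa>, 1:] * q" by (auto simp: poly_eq_0_iff_dvd)
      then have "q \<noteq> 0" using less.prems by auto
      moreover from this have "degree p = Suc (degree q)" unfolding q by (subst degree_mult_eq) auto
      then have "degree q < degree p" by simp
      moreover have "[:[:-\<kappa>, 1:]:] * [:q:] \<in> n" using less.prems(2) q by simp
      then have "[:[:-\<kappa>, 1:]:] \<in> n \<or> [:q:] \<in> n" by (rule prime)
      ultimately show ?case using less.hyps by blast
    qed
    then obtain \<kappa> where \<kappa>: "[:[:-\<kappa>, 1:]:] \<in> n" by blast
    interpret lift: poly_hom "\<lambda>c. [:[:c:]:]" "[:0, 1:] :: 'k poly poly"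
      by unfold_locales (auto simp: one_pCons)
    \<comment> \<open>Modulo x - \<kappa> every element is congruent to its value at x = \<kappa>,
      so only polynomials in y remain to be considered.\<close>
    have red: "f - lift.pe (ev \<kappa> f) \<in> n" for f
    proof (induction f)
      case (pCons c f)
      have "poly (c - [:poly c \<kappa>:]) \<kappa> = 0" by simp
      then obtain q where q: "c - [:poly c \<kappa>:] = [:-\<kappa>, 1:] * q" by (auto simp only: poly_eq_0_iff_dvd)
      have "pCons c f - lift.pe (ev \<kappa> (pCons c f)) = [:c - [:poly c \<kappa>:]:] + [:0, 1:] * (f - lift.pe (ev \<kappa> f))"
        by (simp add: algebra_simps)
      also have "[:c - [:poly c \<kappa>:]:] = [:q:] * [:[:-\<kappa>, 1:]:]" unfolding q by (simp add: mult.commute)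
      finally have eq: "pCons c f - lift.pe (ev \<kappa> (pCons c f)) =
        [:q:] * [:[:-\<kappa>, 1:]:] + [:0, 1:] * (f - lift.pe (ev \<kappa> f))" .
      show ?case unfolding eq by (rule add[OF mult[OF \<kappa>] mult[OF pCons.IH]])
    qed (simp add: zero)
    show ?thesis
    proof (cases "\<exists>q\<noteq>0. lift.pe q \<in> n")
      case True
      then obtain q where q: "q \<noteq> 0" "lift.pe q \<in> n" by blast
      then have "\<exists>\<eta>. [:[:-\<eta>:], 1:] \<in> n"
      proof (induction "degree q" arbitrary: q rule: less_induct)
        case less
        have "degree q > 0"
        proof (rule ccontr)
          assume "\<not> degree q > 0"
          then obtain c where "q = [:c:]" by (metis degree_eq_zeroE neq0_conv)
          then show False using less.prems const by auto
        qed
        then obtain \<eta> where "poly q \<eta> = 0" using alg_closed_imp_poly_has_root by blast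
        then obtain q' where q': "q = [:-\<eta>, 1:] * q'" by (auto simp: poly_eq_0_iff_dvd)
        then have "q' \<noteq> 0" using less.prems by auto
        moreover from this have "degree q = Suc (degree q')" unfolding q' by (subst degree_mult_eq) auto
        then have "degree q' < degree q" by simp
        moreover have "lift.pe [:-\<eta>, 1:] = [:[:-\<eta>:], 1:]"
          unfolding lift.pe_pCons lift.pe_0 by (simp add: one_pCons)
        then have "[:[:-\<eta>:], 1:] * lift.pe q' \<in> n"
          using less.prems(2) unfolding q' lift.pe_mult by (simp only:)
        then have "[:[:-\<eta>:], 1:] \<in> n \<or> lift.pe q' \<in> n" by (rule prime)
        ultimately show ?case using less.hyps by blast
      qed
      then show ?thesis using \<kappa> by blast
    next
      case False
      \<comment> \<open>No non-zero polynomial in y lies in n, so all of n vanishes at x = \<kappa>;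
        invertibility of y modulo n would then make y a unit of K[y].\<close>
      have ev0: "ev \<kappa> f = 0" if "f \<in> n" for f
        using minus[OF that red[of f]] False by auto
      have "[:0, 1:] \<notin> n" using ev0[of "[:0, 1:]"] by auto
      then obtain g where "[:0, 1:] * g - 1 \<in> n" using inv by blast
      from ev0[OF this] have "[:0, 1:] * ev \<kappa> g = 1" by simp
      then have "poly ([:0, 1:] * ev \<kappa> g) 0 = 1" by simp
      then show ?thesis by simp
    qed
  next
    case False
    \<comment> \<open>x is invertible modulo n, and x g - 1 is non-zero because its value at x = 0
      is -1; so n contains a non-zero element.\<close>
    have "[:[:0, 1:]:] \<notin> n" using False by (metis pCons_eq_0_iff one_neq_zero)
    then obtain g where g: "[:[:0, 1:]:] * g - 1 \<in> n" using inv by blast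
    have "ev 0 ([:[:0, 1:]:] * g - 1) \<noteq> 0" by simp
    then have "[:[:0, 1:]:] * g - 1 \<noteq> 0" using ev_simps(5)[of 0] by metis
    then have "\<exists>f. f \<in> n \<and> f \<noteq> 0" using g by blast
    then obtain f where f: "f \<in> n" "f \<noteq> 0" and least: "\<And>g. g \<in> n \<Longrightarrow> g \<noteq> 0 \<Longrightarrow> degree f \<le> degree g"
      using ex_has_least_nat[of "\<lambda>f. f \<in> n \<and> f \<noteq> 0" _ degree] by metis
    have deg: "degree f > 0"
    proof (rule ccontr)
      assume "\<not> degree f > 0"
      then obtain p where "f = [:p:]" by (metis degree_eq_zeroE neq0_conv)
      then show False using f False by auto
    qed
    let ?l = "lead_coeff f"
    have "infinite (UNIV :: 'k set)" by (rule infinite_UNIV_char_0)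
    moreover have "finite {x. poly ?l x = 0}" using f(2) by (intro poly_roots_finite) simp
    ultimately obtain \<kappa> where \<kappa>: "poly ?l \<kappa> \<noteq> 0" by (metis (mono_tags, lifting) UNIV_eq_I mem_Collect_eq)
    have "coeff (ev \<kappa> f) (degree f) \<noteq> 0" using \<kappa> by (simp add: coeff_ev)
    then have "degree (ev \<kappa> f) \<ge> degree f" by (rule le_degree)
    then obtain \<eta> where \<eta>: "poly (ev \<kappa> f) \<eta> = 0" using deg alg_closed_imp_poly_has_root[of "ev \<kappa> f"] by auto
    have van: "poly (ev \<kappa> g) \<eta> = 0" if "g \<in> n" for g
    proof -
      obtain q s where qs: "pseudo_divmod g f = (q, s)" by fastforce
      define k where "k = Suc (degree g) - degree f"
      have eq: "smult (?l ^ k) g = f * q + s" and s: "s = 0 \<or> degree s < degree f"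
        using pseudo_divmod[OF f(2) qs] by (auto simp: k_def)
      have "[:?l ^ k:] * g - q * f \<in> n" using that f by (intro minus mult)
      moreover have "[:?l ^ k:] * g - q * f = s" using eq by (simp add: algebra_simps)
      ultimately have "s = 0" using s least by fastforce
      then have "poly (ev \<kappa> (smult (?l ^ k) g)) \<eta> = 0" unfolding eq using \<eta> by simp
      then show ?thesis using \<kappa> by (simp add: poly_power)
    qed
    \<comment> \<open>At the common zero (\<kappa>, \<eta>) of n the element (x - \<kappa>) g - 1
      takes the value -1.\<close>
    have "[:[:-\<kappa>, 1:]:] \<notin> n" using False by (metis pCons_eq_0_iff one_neq_zero)
    then obtain g where "[:[:-\<kappa>, 1:]:] * g - 1 \<in> n" using inv by blast
    from van[OF this] show ?thesis by simp
  qed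
qed

section \<open>Maximal ideals containing I_X and their points\<close>

definition poly_maximal :: "nat \<Rightarrow> 'k::comm_ring_1 mpol set \<Rightarrow> bool" where
  "poly_maximal r m \<longleftrightarrow> m \<subseteq> polys (Suc r) \<and> 0 \<in> m \<and> (\<forall>F\<in>m. \<forall>G\<in>m. F + G \<in> m) \<and>
    (\<forall>P\<in>polys (Suc r). \<forall>F\<in>m. P * F \<in> m) \<and> 1 \<notin> m \<and>
    (\<forall>F\<in>polys (Suc r) - m. \<exists>G\<in>polys (Suc r). F * G - 1 \<in> m)"

locale max_ideal =
  fixes r :: nat and m :: "'k::{alg_closed_field, field_char_0} mpol set" and a :: "nat \<Rightarrow> 'k"
  assumes max: "poly_maximal r m" and dker_sub: "dker r a \<subseteq> m" and r: "r \<ge> 2"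
begin

lemma m_polys: "F \<in> m \<Longrightarrow> F \<in> polys (Suc r)"
  and m_0 [simp]: "0 \<in> m"
  and m_add: "F \<in> m \<Longrightarrow> G \<in> m \<Longrightarrow> F + G \<in> m"
  and m_mult: "P \<in> polys (Suc r) \<Longrightarrow> F \<in> m \<Longrightarrow> P * F \<in> m"
  and m_1: "1 \<notin> m"
  and m_inv: "F \<in> polys (Suc r) \<Longrightarrow> F \<notin> m \<Longrightarrow> \<exists>G\<in>polys (Suc r). F * G - 1 \<in> m"
  using max unfolding poly_maximal_def by auto

lemma m_uminus: "F \<in> m \<Longrightarrow> - F \<in> m"
  using m_mult[of "- 1" F] by simp

lemma m_diff: "F \<in> m \<Longrightarrow> G \<in> m \<Longrightarrow> F - G \<in> m"
  using m_add[OF _ m_uminus, of F G] by simp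

lemma m_prime:
  assumes "F \<in> polys (Suc r)" "G \<in> polys (Suc r)" "F * G \<in> m"
  shows "F \<in> m \<or> G \<in> m"
proof (rule disjCI)
  assume "G \<notin> m"
  then obtain H where H: "H \<in> polys (Suc r)" "G * H - 1 \<in> m" using m_inv assms by blast
  have "H * (F * G) - F * (G * H - 1) \<in> m"
    by (rule m_diff[OF m_mult[OF H(1) assms(3)] m_mult[OF assms(1) H(2)]])
  then show "F \<in> m" by (simp add: algebra_simps)
qed

text \<open>The square of an element of I_C is killed by both components, so it lies in I_X: the
  double structure has the same points as C.\<close>

lemma minors_in_m: "F \<in> minors_ideal r \<Longrightarrow> F \<in> m"
proof -
  assume F: "F \<in> minors_ideal r"
  then have "F * F \<in> dker r a" using par_minors_ideal[OF F] minors_ideal_polys[OF F] by (simp add: dker_def)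
  then show "F \<in> m" using dker_sub m_prime minors_ideal_polys[OF F] by blast
qed

lemma Const_in_m_iff: "Const c \<in> m \<longleftrightarrow> c = 0"
proof
  assume "Const c \<in> m"
  then have "Const (inverse c) * Const c \<in> m" by (intro m_mult) auto
  then show "c = 0" using m_1 by (cases "c = 0") (auto simp flip: Const_mult)
qed simp

text \<open>If modulo m all variables are scalar multiples of monomials in u and v, then R/m is a
  quotient of a polynomial ring in two variables, to which the plane Nullstellensatz
  applies.\<close>

lemma residue_point:
  assumes uv: "u \<in> polys (Suc r)" "v \<in> polys (Suc r)"
    and gen: "\<And>i. i \<le> r \<Longrightarrow> \<exists>k l c. X i - Const c * (u ^ k * v ^ l) \<in> m"
  shows "\<exists>\<kappa> \<eta>. u - Const \<kappa> \<in> m \<and> v - Const \<eta> \<in> m"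
proof -
  interpret inner: poly_hom "Const :: 'k \<Rightarrow> 'k mpol" u
    by unfold_locales (simp_all add: Const_mult)
  interpret outer: poly_hom inner.pe v
    by unfold_locales simp_all
  let ?\<theta> = outer.pe
  have inner_polys: "inner.pe p \<in> polys (Suc r)" for p
    by (induction p) (use uv in auto)
  have polys: "?\<theta> f \<in> polys (Suc r)" for f
    by (induction f) (use uv inner_polys in auto)
  have pow: "?\<theta> (mon2 c l k) = Const c * (u ^ k * v ^ l)" for c k l
  proof -
    have "inner.pe (monom c k) = Const c * u ^ k"
      by (induction k) (auto simp: monom_0 monom_Suc algebra_simps)
    then show ?thesis
      by (induction l) (auto simp: monom_0 monom_Suc algebra_simps)
  qed
  have surj: "\<exists>f. F - ?\<theta> f \<in> m" if "F \<in> polys (Suc r)" for F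
    using that
  proof (induction rule: polys_induct)
    case (Const c)
    then show ?case using pow[of c 0 0] by (intro exI[of _ "mon2 c 0 0"]) simp
  next
    case (add F G)
    then obtain f g where "F - ?\<theta> f \<in> m" "G - ?\<theta> g \<in> m" by blast
    from m_add[OF this] show ?case by (intro exI[of _ "f + g"]) (simp add: algebra_simps)
  next
    case (X i F)
    then obtain f where f: "F - ?\<theta> f \<in> m" by blast
    obtain k l c where "X i - Const c * (u ^ k * v ^ l) \<in> m" using gen[of i] X by auto
    then have g: "X i - ?\<theta> (mon2 c l k) \<in> m" by (simp only: pow)
    have "X i * (F - ?\<theta> f) + ?\<theta> f * (X i - ?\<theta> (mon2 c l k)) \<in> m"
      using X(1) polys f g by (intro m_add m_mult) auto
    then show ?case by (intro exI[of _ "mon2 c l k * f"]) (simp add: algebra_simps)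
  qed
  let ?n = "{f. ?\<theta> f \<in> m}"
  have "\<exists>\<kappa> \<eta>. [:[:-\<kappa>, 1:]:] \<in> ?n \<and> [:[:-\<eta>:], 1:] \<in> ?n"
  proof (rule nullstellensatz_plane)
    fix f assume "f \<notin> ?n"
    then obtain G where G: "G \<in> polys (Suc r)" "?\<theta> f * G - 1 \<in> m" using m_inv polys by blast
    obtain g where g: "G - ?\<theta> g \<in> m" using surj[OF G(1)] by blast
    have "(?\<theta> f * G - 1) - ?\<theta> f * (G - ?\<theta> g) \<in> m" by (rule m_diff[OF G(2) m_mult[OF polys g]])
    then show "\<exists>g. f * g - 1 \<in> ?n" by (intro exI[of _ g]) (simp add: algebra_simps)
  qed (use m_add m_mult m_1 polys in auto)
  then obtain \<kappa> \<eta> where "?\<theta> [:[:-\<kappa>, 1:]:] \<in> m" "?\<theta> [:[:-\<eta>:], 1:] \<in> m" by blast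
  moreover have "Const (- c) = - Const c" for c :: 'k
    using Const_minus[of 0 c] by simp
  ultimately show ?thesis by (intro exI[of _ \<kappa>] exI[of _ \<eta>]) simp
qed

lemma X_shift_in_m: "i < r \<Longrightarrow> X 0 * X (Suc i) - X 1 * X i \<in> m"
  using minors_in_m[OF minor_swap[of 0 r i]] r by simp

text \<open>Where x_0 is invertible, v = x_1/x_0 satisfies x_i = x_0 v^i by the minors, so x_0 and v
  generate the residue ring.\<close>

lemma affine_point:
  assumes "X 0 \<notin> m"
  obtains \<kappa> \<eta> where "\<kappa> \<noteq> 0" "\<And>i. i \<le> r \<Longrightarrow> X i - Const (\<kappa> * \<eta> ^ i) \<in> m"
proof -
  obtain w where w: "w \<in> polys (Suc r)" "X 0 * w - 1 \<in> m" using m_inv[OF polys_X assms] by auto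
  let ?v = "w * X 1"
  have v: "?v \<in> polys (Suc r)" using w r by simp
  have pow: "i \<le> r \<Longrightarrow> X i - X 0 * ?v ^ i \<in> m" for i
  proof (induction i)
    case (Suc i)
    have "w * (X 0 * X (Suc i) - X 1 * X i) - X (Suc i) * (X 0 * w - 1) + ?v * (X i - X 0 * ?v ^ i) \<in> m"
    proof (rule m_add[OF m_diff[OF m_mult m_mult] m_mult])
      show "X i - X 0 * ?v ^ i \<in> m" using Suc by simp
    qed (use Suc.prems w v in \<open>auto intro: X_shift_in_m[unfolded One_nat_def]\<close>)
    then show ?case by (simp add: algebra_simps)
  qed simp
  have "\<exists>k l c. X i - Const c * (X 0 ^ k * ?v ^ l) \<in> m" if "i \<le> r" for i
    using pow[OF that] by (intro exI[of _ 1] exI[of _ i]) simp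
  then obtain \<kappa> \<eta> where le: "X 0 - Const \<kappa> \<in> m" "?v - Const \<eta> \<in> m"
    using residue_point[of "X 0" ?v] v by auto
  have "\<kappa> \<noteq> 0" using le(1) assms by auto
  moreover have pt: "i \<le> r \<Longrightarrow> X 0 * ?v ^ i - Const (\<kappa> * \<eta> ^ i) \<in> m" for i
  proof (induction i)
    case 0
    then show ?case using le by simp
  next
    case (Suc i)
    have "?v * (X 0 * ?v ^ i - Const (\<kappa> * \<eta> ^ i)) + Const (\<kappa> * \<eta> ^ i) * (?v - Const \<eta>) \<in> m"
      using Suc v le by (intro m_add m_mult) auto
    moreover have "Const (\<kappa> * \<eta> ^ Suc i) = Const (\<kappa> * \<eta> ^ i) * Const \<eta>" by (simp add: mult_ac flip: Const_mult)
    ultimately show ?case by (simp add: algebra_simps)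
  qed
  moreover have "X i - Const (\<kappa> * \<eta> ^ i) \<in> m" if "i \<le> r" for i
    using m_add[OF pow[OF that] pt[OF that]] by simp
  ultimately show ?thesis using that by blast
qed

text \<open>The minors give x_(i+1)^2 = x_i x_(i+2), so vanishing spreads from x_0 up to x_(r-1).
  The case c = 0 is the vertex.\<close>

lemma point_at_infinity:
  assumes "X 0 \<in> m"
  obtains c where "\<And>i. i < r \<Longrightarrow> X i \<in> m" "X r - Const c \<in> m"
proof -
  have X: "i < r \<Longrightarrow> X i \<in> m" for i
  proof (induction i)
    case (Suc i)
    have "X i * X (Suc (Suc i)) - X (Suc i) * X (Suc i) \<in> m"
      using Suc by (intro minors_in_m minor_swap) auto
    moreover have "X (Suc (Suc i)) * X i \<in> m" using Suc by (intro m_mult) auto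
    ultimately have "X (Suc (Suc i)) * X i - (X i * X (Suc (Suc i)) - X (Suc i) * X (Suc i)) \<in> m" by (rule m_diff[rotated])
    then have "X (Suc i) * X (Suc i) \<in> m" by (simp add: mult.commute)
    then show ?case using m_prime[of "X (Suc i)" "X (Suc i)"] Suc by auto
  qed (use assms in simp)
  \<comment> \<open>The second generator is 0, with exponent 0 for the variable \<open>X r\<close>
    and exponent 1 for the others.\<close>
  have "\<exists>k l c. X i - Const c * (X r ^ k * 0 ^ l) \<in> m" if "i \<le> r" for i
  proof (cases "i = r")
    case True
    then show ?thesis by (intro exI[of _ 1] exI[of _ 0]) simp
  next
    case False
    then show ?thesis using X that by (intro exI[of _ 0] exI[of _ 1]) simp
  qed
  then obtain \<kappa> \<eta> where "X r - Const \<kappa> \<in> m" using residue_point[of "X r" 0] by auto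
  then show ?thesis using that X by blast
qed

end

section \<open>Parameters at a point\<close>

text \<open>\<open>parameter_data r I m\<close> provides a regular pair \<open>x, y\<close> in \<open>m\<close> and an element \<open>\<sigma>\<close> that,
  modulo \<open>I\<close>, generates the smallest ideal properly containing \<open>(x, y)\<close> near \<open>m\<close>.\<close>

definition pair_ideal :: "nat \<Rightarrow> 'k::comm_ring_1 mpol set \<Rightarrow> 'k mpol \<Rightarrow> 'k mpol \<Rightarrow> 'k mpol set" where
  "pair_ideal r I x y = {F \<in> polys (Suc r). \<exists>G\<in>polys (Suc r). \<exists>H\<in>polys (Suc r). F - x * G - y * H \<in> I}"

definition parameter_data :: "nat \<Rightarrow> 'k::comm_ring_1 mpol set \<Rightarrow> 'k mpol set \<Rightarrow> bool" where
  "parameter_data r I m \<longleftrightarrow> (\<exists>x\<in>m. \<exists>y\<in>m. \<exists>\<sigma>\<in>polys (Suc r).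
     (\<forall>F\<in>polys (Suc r). x * F \<in> I \<longrightarrow> F \<in> I) \<and> (\<forall>F\<in>polys (Suc r). y * F \<in> I \<longrightarrow> F \<in> I) \<and>
     (\<forall>F\<in>polys (Suc r). \<forall>G\<in>polys (Suc r). y * F - x * G \<in> I \<longrightarrow> (\<exists>E\<in>polys (Suc r). F - x * E \<in> I)) \<and>
     (\<forall>F\<in>polys (Suc r). F \<in> pair_ideal r I x y \<or> (\<exists>B\<in>polys (Suc r). F * B - \<sigma> \<in> pair_ideal r I x y)) \<and>
     (\<forall>s\<in>polys (Suc r) - m. s * \<sigma> \<notin> pair_ideal r I x y))"

lemma regular_of_par:
  fixes a :: "nat \<Rightarrow> 'k::idom"
  assumes "par x \<noteq> 0" "F \<in> polys (Suc r)" "x * F \<in> dker r a"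
  shows "F \<in> dker r a"
  using assms by (auto simp: dker_def)

locale nonzero_map =
  fixes r :: nat and a :: "nat \<Rightarrow> 'k::{alg_closed_field, field_char_0}"
  assumes r: "r \<ge> 2" and nz: "\<exists>i<r - 1. a i \<noteq> 0"
begin

abbreviation I where "I \<equiv> dker r a"
abbreviation P where "P \<equiv> polys (Suc r) :: 'k mpol set"
abbreviation J where "J \<equiv> minors_ideal r :: 'k mpol set"

lemma J_P: "F \<in> J \<Longrightarrow> F \<in> P"
  by (rule minors_ideal_polys)

lemma par_J [simp]: "F \<in> J \<Longrightarrow> par F = 0"
  by (rule par_minors_ideal)

lemma J_I: "F \<in> P \<Longrightarrow> par F = 0 \<Longrightarrow> F \<in> J"
  using par_eq_0_iff by blast

lemma I_iff: "F \<in> I \<longleftrightarrow> F \<in> P \<and> par F = 0 \<and> eps a F = 0"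
  by (simp add: dker_def)

subsection \<open>Points with non-zero first coordinate\<close>

text \<open>Restriction to the slice z = c of the affine cone, on which s remains as
  coordinate.\<close>

definition sp :: "'k \<Rightarrow> 'k poly poly \<Rightarrow> 'k poly" where "sp c f = poly f [:c:]"

lemma sp_simps [simp]: "sp c (f + g) = sp c f + sp c g" "sp c (f * g) = sp c f * sp c g"
  "sp c (f - g) = sp c f - sp c g" "sp c 0 = 0" "sp c [:p:] = p" "sp c (smult p f) = p * sp c f"
  by (simp_all add: sp_def)

lemma sp_mon2: "sp c (mon2 b d e) = monom (b * c ^ d) e"
proof -
  have "[:c:] ^ d = [:c ^ d:]" by (induction d) (auto simp: one_pCons)
  then show ?thesis by (simp add: sp_def poly_monom smult_monom mult.commute)
qed

text \<open>Solving f = (z - c) g from low powers of z upwards expresses each coefficient of g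
  through those of f and the preceding one of g; as c is non-zero, g inherits the weight
  bound.\<close>

lemma sp_zero_division:
  assumes f: "f \<in> wt r k" "sp c f = 0" and c: "c \<noteq> 0"
  obtains g where "g \<in> wt r k" "f = [:[:-c:], 1:] * g"
proof -
  have "poly f [:c:] = 0" using f(2) by (simp add: sp_def)
  then obtain g where g: "f = [:- [:c:], 1:] * g" by (auto simp only: poly_eq_0_iff_dvd)
  then have fg: "f = [:[:-c:], 1:] * g" by simp
  have c0: "coeff f 0 = smult (- c) (coeff g 0)" unfolding fg by (simp add: coeff_mult_0)
  have cS: "coeff f (Suc d) = coeff g d - smult c (coeff g (Suc d))" for d unfolding fg by simp
  have "coeff (coeff g d) e \<noteq> 0 \<longrightarrow> e + k \<le> r * d" for d e
  proof (induction d arbitrary: e)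
    case 0
    have "coeff (coeff f 0) e = - c * coeff (coeff g 0) e" by (simp add: c0)
    then have "coeff (coeff g 0) e \<noteq> 0 \<longrightarrow> coeff (coeff f 0) e \<noteq> 0" using c by simp
    then show ?case using f(1) unfolding wt_def by blast
  next
    case (Suc d)
    have "coeff (coeff f (Suc d)) e = coeff (coeff g d) e - c * coeff (coeff g (Suc d)) e" by (simp add: cS)
    then have "coeff (coeff g (Suc d)) e \<noteq> 0 \<longrightarrow> coeff (coeff f (Suc d)) e \<noteq> 0 \<or> coeff (coeff g d) e \<noteq> 0"
      using c by auto
    moreover have "e + k \<le> r * Suc d" if "coeff (coeff g d) e \<noteq> 0" using Suc[of e] that by simp
    ultimately show ?case using f(1) unfolding wt_def by blast
  qed
  then have "g \<in> wt r k" by (simp add: wt_def)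
  then show ?thesis using fg that by blast
qed

text \<open>On the slice a power of z is only a scalar, while in the weight bound it makes room for
  any power of s.\<close>

lemma sp_surj:
  assumes "c \<noteq> 0"
  obtains f where "f \<in> wt r k" "sp c f = q"
proof -
  let ?N = "degree q + k"
  let ?f = "monom (smult (1 / c ^ ?N) q) ?N"
  have "?f \<in> wt r k" unfolding wt_def
  proof (intro CollectI allI impI)
    fix d e assume "coeff (coeff ?f d) e \<noteq> 0"
    then have "d = ?N" "coeff q e \<noteq> 0" by (auto simp: coeff_monom split: if_splits)
    moreover from this have "e \<le> degree q" by (intro le_degree)
    moreover have "?N \<le> r * ?N" using r by simp
    ultimately show "e + k \<le> r * d" by (metis add_le_mono1 le_trans)
  qed
  moreover have "[:c:] ^ n = [:c ^ n:]" for n by (induction n) (auto simp: one_pCons)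
  then have "sp c ?f = q" using assms by (simp add: sp_def poly_monom)
  ultimately show ?thesis using that by blast
qed

text \<open>The quotient by x = x_0 - c and y = x_1 - c \<eta> is K[\<epsilon>] with \<epsilon>^2 =
  0: membership in the pair ideal means that \<open>par\<close> and \<open>eps\<close> vanish at the
  point. Neither x nor y has an \<epsilon>-part, as b_0 = b_1 = 0, and \<sigma> lifts
  \<epsilon>.\<close>

lemma affine_data:
  assumes c: "c \<noteq> 0" and m: "\<And>F. F \<in> P \<Longrightarrow> F \<in> m \<longleftrightarrow> poly (sp c (par F)) \<eta> = 0"
  shows "parameter_data r I m"
proof -
  define x :: "'k mpol" where "x = X 0 - Const c"
  define y :: "'k mpol" where "y = X 1 - Const (c * \<eta>)"
  define Z :: "'k poly poly" where "Z = [:[:-c:], 1:]"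
  define L where "L = [:-\<eta>, 1:]"
  have xy: "x \<in> P" "y \<in> P" using r by (auto simp: x_def y_def)
  have Z: "Z \<noteq> 0" "sp c Z = 0" by (simp_all add: Z_def sp_def)
  have L: "L \<noteq> 0" "poly L \<eta> = 0" by (simp_all add: L_def)
  have px: "par x = Z" "eps a x = 0"
    by (simp_all add: x_def Z_def monom_Suc monom_0 one_pCons)
  have ey: "eps a y = 0" by (simp add: y_def)
  have "sp c (par y) = monom c 1 - [:c * \<eta>:]" by (simp add: y_def sp_mon2)
  also have "\<dots> = smult c L" by (simp add: L_def monom_Suc monom_0)
  finally have py: "sp c (par y) = smult c L" .
  \<comment> \<open>Division by x proceeds in two layers: dividing \<open>par F\<close> leaves an
    element of I_C, and then only its \<open>eps\<close> has to be divided.\<close>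
  have div: "\<exists>H\<in>P. F - x * H \<in> I" if F: "F \<in> P" "sp c (par F) = 0" "sp c (eps a F) = 0" for F
  proof -
    obtain f where f: "f \<in> wt r 0" "par F = Z * f"
      using sp_zero_division[OF par_in_wt[OF F(1)] F(2) c] unfolding Z_def by blast
    obtain H where H: "H \<in> P" "par H = f" using par_surj[OF f(1)] by blast
    define F' where "F' = F - x * H"
    have F'P: "F' \<in> P" using F H xy by (simp add: F'_def)
    have "par F' = 0" using H f px by (simp add: F'_def)
    then have FJ: "F' \<in> J" by (rule J_I[OF F'P])
    have "sp c (eps a F') = 0" using px F(3) Z by (simp add: F'_def)
    then obtain g where g: "g \<in> wt r (r + 2)" "eps a F' = Z * g"
      using sp_zero_division[OF eps_minors_ideal[OF FJ] _ c] unfolding Z_def by blast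
    obtain H' where H': "H' \<in> J" "eps a H' = g" using eps_minors_ideal_surj[OF nz g(1)] by blast
    have "par (F' - x * H') = 0" "eps a (F' - x * H') = 0" using FJ H' g px by simp_all
    moreover have "F' - x * H' = F - x * (H + H')" by (simp add: F'_def algebra_simps)
    ultimately have "F - x * (H + H') \<in> I" using F'P J_P[OF H'(1)] xy F H unfolding I_iff by simp
    moreover have "H + H' \<in> P" using H(1) J_P[OF H'(1)] by simp
    ultimately show ?thesis by blast
  qed
  have vanish: "poly (sp c (par F)) \<eta> = 0 \<and> poly (sp c (eps a F)) \<eta> = 0"
    if F: "F \<in> pair_ideal r I x y" for F
  proof -
    obtain G H where "F - x * G - y * H \<in> I" using F unfolding pair_ideal_def by blast
    then have "par F = Z * par G + par y * par H" "eps a F = Z * eps a G + par y * eps a H"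
      unfolding I_iff by (simp_all add: px ey algebra_simps)
    then show ?thesis using Z py L by simp
  qed
  have mem: "F \<in> pair_ideal r I x y"
    if F: "F \<in> P" "poly (sp c (par F)) \<eta> = 0" "poly (sp c (eps a F)) \<eta> = 0" for F
  proof -
    obtain q where q: "sp c (par F) = L * q"
      using F(2) unfolding L_def by (auto simp only: poly_eq_0_iff_dvd)
    obtain f where f: "f \<in> wt r 0" "sp c f = smult (1 / c) q" using sp_surj[OF c] by blast
    obtain H where H: "H \<in> P" "par H = f" using par_surj[OF f(1)] by blast
    define F' where "F' = F - y * H"
    have F'P: "F' \<in> P" using F H xy by (simp add: F'_def)
    have 1: "sp c (par F') = 0" using q H f c by (simp add: F'_def py)
    have "poly (sp c (eps a F')) \<eta> = 0" using F(3) L by (simp add: F'_def ey py)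
    then obtain q' where q': "sp c (eps a F') = L * q'"
      unfolding L_def by (auto simp only: poly_eq_0_iff_dvd)
    obtain g where g: "g \<in> wt r (r + 2)" "sp c g = smult (1 / c) q'" using sp_surj[OF c] by blast
    obtain H' where H': "H' \<in> J" "eps a H' = g" using eps_minors_ideal_surj[OF nz g(1)] by blast
    note H'P = J_P[OF H'(1)]
    have "sp c (par (F' - y * H')) = 0" "sp c (eps a (F' - y * H')) = 0"
      using 1 H' q' g c by (simp_all add: ey py)
    moreover have "F' - y * H' \<in> P" using F'P H'P xy by simp
    ultimately obtain G where G: "G \<in> P" "F' - y * H' - x * G \<in> I" using div by blast
    have "F - x * G - y * (H + H') \<in> I" using G(2) by (simp add: F'_def algebra_simps)
    moreover have "H + H' \<in> P" using H(1) H'P by simp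
    ultimately show ?thesis unfolding pair_ideal_def using F(1) G(1) by blast
  qed
  obtain g where g: "g \<in> wt r (r + 2)" "sp c g = 1" using sp_surj[OF c] by blast
  obtain \<sigma> where \<sigma>: "\<sigma> \<in> J" "eps a \<sigma> = g" using eps_minors_ideal_surj[OF nz g(1)] by blast
  have \<sigma>P: "\<sigma> \<in> P" by (rule J_P[OF \<sigma>(1)])
  have xm: "x \<in> m" unfolding m[OF xy(1)] px Z by simp
  have ym: "y \<in> m" unfolding m[OF xy(2)] py using L by simp
  show ?thesis unfolding parameter_data_def
  proof (rule bexI[OF _ xm], rule bexI[OF _ ym], rule bexI[OF _ \<sigma>P], intro conjI ballI impI)
    show "F \<in> I" if "F \<in> P" "x * F \<in> I" for F
      by (rule regular_of_par[OF _ that]) (simp add: px Z)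
    show "F \<in> I" if "F \<in> P" "y * F \<in> I" for F
    proof (rule regular_of_par[OF _ that])
      show "par y \<noteq> 0"
      proof
        assume "par y = 0"
        then show False using py c L by simp
      qed
    qed
    show "\<exists>E\<in>P. F - x * E \<in> I" if FG: "F \<in> P" "G \<in> P" "y * F - x * G \<in> I" for F G
    proof (rule div[OF FG(1)])
      have "par y * par F = Z * par G" "par y * eps a F = Z * eps a G"
        using FG(3) unfolding I_iff by (simp_all add: px ey)
      then have "sp c (par y * par F) = 0" "sp c (par y * eps a F) = 0" using Z by simp_all
      then show "sp c (par F) = 0" "sp c (eps a F) = 0" using py c L by simp_all
    qed
    show "F \<in> pair_ideal r I x y \<or> (\<exists>B\<in>P. F * B - \<sigma> \<in> pair_ideal r I x y)" if F: "F \<in> P" for F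
    proof -
      define \<alpha> where "\<alpha> = poly (sp c (par F)) \<eta>"
      define \<beta> where "\<beta> = poly (sp c (eps a F)) \<eta>"
      \<comment> \<open>In the dual numbers \<alpha> + \<beta> \<epsilon> divides \<epsilon> unless
        it is zero: the multiplier is \<epsilon>/\<alpha>, or 1/\<beta> when \<alpha> = 0.\<close>
      consider "\<alpha> \<noteq> 0" | "\<alpha> = 0" "\<beta> \<noteq> 0" | "\<alpha> = 0" "\<beta> = 0" by blast
      then show ?thesis
      proof cases
        case 1
        have "F * (Const (1 / \<alpha>) * \<sigma>) - \<sigma> \<in> pair_ideal r I x y"
          by (rule mem) (use F \<sigma>P \<sigma> g 1 in \<open>auto simp: \<alpha>_def[symmetric]\<close>)
        then show ?thesis using \<sigma>P by (intro disjI2 bexI[of _ "Const (1 / \<alpha>) * \<sigma>"]) auto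
      next
        case 2
        have "F * Const (1 / \<beta>) - \<sigma> \<in> pair_ideal r I x y"
          by (rule mem) (use F \<sigma>P \<sigma> g 2 in \<open>auto simp: \<alpha>_def[symmetric] \<beta>_def[symmetric]\<close>)
        then show ?thesis by (intro disjI2 bexI[of _ "Const (1 / \<beta>)"]) auto
      next
        case 3
        then show ?thesis using mem[OF F] by (simp add: \<alpha>_def \<beta>_def)
      qed
    qed
    show "s * \<sigma> \<notin> pair_ideal r I x y" if s: "s \<in> P - m" for s
    proof
      assume "s * \<sigma> \<in> pair_ideal r I x y"
      then have "poly (sp c (eps a (s * \<sigma>))) \<eta> = 0" using vanish by blast
      then have "poly (sp c (par s)) \<eta> = 0" using \<sigma> g by simp
      then show False using s m by blast
    qed
  qed
qed

subsection \<open>The vertex and the point at infinity\<close>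

text \<open>The quotient by z has to satisfy the weight bound again. For c = 0 the equation reads
  s^r f = g, and the gain of r in the s-exponent pays for the loss of z; for c non-zero,
  coefficients are compared by induction on the power of z.\<close>

lemma infinity_division:
  fixes f g :: "'k poly poly"
  assumes f: "f \<in> wt r k" and g: "g \<in> wt r k" and eq: "(mon2 1 1 r - [:[:c:]:]) * f = mon2 1 1 0 * g"
  obtains h where "h \<in> wt r k" "f = mon2 1 1 0 * h"
proof -
  have z: "mon2 1 1 0 * h = pCons 0 h" for h :: "'k poly poly" by (simp add: monom_Suc monom_0 pCons_one)
  have "mon2 1 1 r * f = pCons 0 (smult (monom 1 r) f)" by (simp add: monom_Suc monom_0)
  moreover have "[:[:c:]:] * f = smult [:c:] f" by simp
  ultimately have lhs: "(mon2 1 1 r - [:[:c:]:]) * f = pCons 0 (smult (monom 1 r) f) - smult [:c:] f"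
    by (simp only: left_diff_distrib)
  have e0: "smult c (coeff f 0) = 0"
    using arg_cong[OF eq, of "\<lambda>p. coeff p 0"] unfolding lhs z by simp
  have eS: "monom 1 r * coeff f d - smult c (coeff f (Suc d)) = coeff g d" for d
    using arg_cong[OF eq, of "\<lambda>p. coeff p (Suc d)"] unfolding lhs z by simp
  have shift: "coeff (monom 1 r * p) e = (if e < r then 0 else coeff p (e - r))" for p :: "'k poly" and e
    by (simp add: coeff_monom_mult)
  have main: "coeff f 0 = 0 \<and> (\<forall>d e. coeff (coeff f (Suc d)) e \<noteq> 0 \<longrightarrow> e + k \<le> r * d)"
  proof (cases "c = 0")
    case True
    have le: "e + r + k \<le> r * d" if "coeff (coeff f d) e \<noteq> 0" for d e
    proof -
      have "coeff (coeff g d) (e + r) \<noteq> 0" using eS[of d] True that shift[of "coeff f d" "e + r"] by simp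
      then show ?thesis using g unfolding wt_def by blast
    qed
    have "coeff f 0 = 0"
    proof (rule poly_eqI)
      fix e
      show "coeff (coeff f 0) e = coeff 0 e" using le[of 0 e] r by auto
    qed
    then show ?thesis using le by fastforce
  next
    case False
    have f0: "coeff f 0 = 0" using e0 False by simp
    have "coeff (coeff f (Suc d)) e \<noteq> 0 \<longrightarrow> e + k \<le> r * d" for d e
    proof (induction d arbitrary: e)
      case 0
      have "coeff (coeff g 0) e = - c * coeff (coeff f (Suc 0)) e" using eS[of 0] f0 by (metis coeff_minus coeff_smult diff_0 mult_minus_left mult_zero_right)
      then have "coeff (coeff f (Suc 0)) e \<noteq> 0 \<longrightarrow> coeff (coeff g 0) e \<noteq> 0" using False by simp
      then show ?case using g unfolding wt_def by blast
    next
      case (Suc d)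
      have eq: "(if e < r then 0 else coeff (coeff f (Suc d)) (e - r)) - c * coeff (coeff f (Suc (Suc d))) e = coeff (coeff g (Suc d)) e"
        using arg_cong[OF eS[of "Suc d"], of "\<lambda>p. coeff p e"] by (simp add: shift)
      show ?case
      proof
        assume nz: "coeff (coeff f (Suc (Suc d))) e \<noteq> 0"
        show "e + k \<le> r * Suc d"
        proof (cases "coeff (coeff g (Suc d)) e = 0")
          case True
          then have "e \<ge> r" "coeff (coeff f (Suc d)) (e - r) \<noteq> 0" using eq nz False by (auto split: if_splits)
          then show ?thesis using Suc.IH[of "e - r"] by simp
        next
          case False
          then show ?thesis using g unfolding wt_def by blast
        qed
      qed
    qed
    then show ?thesis using f0 by blast
  qed
  obtain b h where h: "f = pCons b h" by (cases f)
  have "b = 0" using main h by simp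
  moreover have "h \<in> wt r k" using main h by (simp add: wt_def)
  ultimately show ?thesis using that h z by simp
qed

text \<open>A monomial is discarded when division by z respects the weight bound, and otherwise z
  s^r is replaced by c. Only 1 and z s^i with 0 < i < r admit neither.\<close>

lemma wt_0_normal_form:
  fixes f :: "'k poly poly"
  assumes "f \<in> wt r 0"
  shows "\<exists>\<alpha> \<beta> v w. v \<in> wt r 0 \<and> w \<in> wt r 0 \<and>
    f = [:[:\<alpha>:]:] + (\<Sum>i\<in>{1..<r}. mon2 (\<beta> i) 1 i) + mon2 1 1 0 * v + (mon2 1 1 r - [:[:c:]:]) * w"
  using assms
proof (induction rule: wt_induct)
  case zero
  show ?case by (intro exI[of _ 0] exI[of _ "\<lambda>_. 0"]) simp
next
  case (add f g)
  from add.IH(1) obtain \<alpha> \<beta> v w where vw: "v \<in> wt r 0" "w \<in> wt r 0"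
    and f: "f = [:[:\<alpha>:]:] + (\<Sum>i\<in>{1..<r}. mon2 (\<beta> i) 1 i) + mon2 1 1 0 * v + (mon2 1 1 r - [:[:c:]:]) * w"
    by blast
  from add.IH(2) obtain \<alpha>' \<beta>' v' w' where vw': "v' \<in> wt r 0" "w' \<in> wt r 0"
    and g: "g = [:[:\<alpha>':]:] + (\<Sum>i\<in>{1..<r}. mon2 (\<beta>' i) 1 i) + mon2 1 1 0 * v' + (mon2 1 1 r - [:[:c:]:]) * w'"
    by blast
  have "(\<Sum>i\<in>{1..<r}. mon2 (\<beta> i + \<beta>' i) 1 i) = (\<Sum>i\<in>{1..<r}. mon2 (\<beta> i) 1 i) + (\<Sum>i\<in>{1..<r}. mon2 (\<beta>' i) 1 i)"
    by (simp add: add_monom[symmetric] sum.distrib)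
  moreover have "[:[:\<alpha> + \<alpha>':]:] = [:[:\<alpha>:]:] + [:[:\<alpha>':]:]" by simp
  ultimately have "f + g = [:[:\<alpha> + \<alpha>':]:] + (\<Sum>i\<in>{1..<r}. mon2 (\<beta> i + \<beta>' i) 1 i) + mon2 1 1 0 * (v + v')
      + (mon2 1 1 r - [:[:c:]:]) * (w + w')"
    unfolding f g by (simp only: algebra_simps)
  then show ?case using wt_add[OF vw(1) vw'(1)] wt_add[OF vw(2) vw'(2)]
    by (intro exI[of _ "\<alpha> + \<alpha>'"] exI[of _ "\<lambda>i. \<beta> i + \<beta>' i"] exI[of _ "v + v'"] exI[of _ "w + w'"] conjI)
next
  case (mon2 b d e)
  have *: "\<exists>\<alpha> \<beta> v w. v \<in> wt r 0 \<and> w \<in> wt r 0 \<and>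
    mon2 b d e = [:[:\<alpha>:]:] + (\<Sum>i\<in>{1..<r}. mon2 (\<beta> i) 1 i) + mon2 1 1 0 * v + (mon2 1 1 r - [:[:c:]:]) * w" (is "?Q b d e")
    if "e \<le> r * d" for b d e
    using that
  proof (induction d arbitrary: b e)
    case 0
    then show ?case by (intro exI[of _ b] exI[of _ "\<lambda>_. 0"] exI[of _ 0]) (simp add: monom_0)
  next
    case (Suc d)
    show ?case
    proof (cases "e \<le> r * d")
      case True
      then have "mon2 b d e \<in> wt r 0" by (intro wt_mon2) simp
      moreover have "mon2 b (Suc d) e = mon2 1 1 0 * mon2 b d e" by (simp add: mult_monom)
      ultimately show ?thesis by (intro exI[of _ 0] exI[of _ "\<lambda>_. 0"] exI[of _ "mon2 b d e"]) simp
    next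
      case False
      show ?thesis
      proof (cases "e < r")
        case True
        then have d: "d = 0" using False by (cases d) auto
        have "1 \<le> e" using False by (cases e) auto
        then have "(\<Sum>i\<in>{1..<r}. mon2 (if i = e then b else 0) 1 i) = mon2 b 1 e"
          using True by (subst sum.remove[of _ e]) (auto intro!: sum.neutral)
        then show ?thesis unfolding d
          by (intro exI[of _ 0] exI[of _ "\<lambda>i. if i = e then b else 0"]) simp
      next
        case ge: False
        have le: "e - r \<le> r * d" using Suc.prems by simp
        obtain \<alpha> \<beta> v w where IH: "v \<in> wt r 0" "w \<in> wt r 0"
          "mon2 (c * b) d (e - r) = [:[:\<alpha>:]:] + (\<Sum>i\<in>{1..<r}. mon2 (\<beta> i) 1 i) + mon2 1 1 0 * v + (mon2 1 1 r - [:[:c:]:]) * w"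
          using Suc.IH[OF le] by blast
        have "mon2 b (Suc d) e = mon2 (c * b) d (e - r) + (mon2 1 1 r - [:[:c:]:]) * mon2 b d (e - r)"
          using ge by (simp add: left_diff_distrib mult_monom smult_monom)
        also have "\<dots> = [:[:\<alpha>:]:] + (\<Sum>i\<in>{1..<r}. mon2 (\<beta> i) 1 i) + mon2 1 1 0 * v
            + (mon2 1 1 r - [:[:c:]:]) * (w + mon2 b d (e - r))"
          unfolding IH(3) by (simp only: distrib_left add.assoc)
        finally show ?thesis using IH(1) wt_add[OF IH(2) wt_mon2[of "e - r" 0 r d b]] le by auto
      qed
    qed
  qed
  show ?case using *[of e d b] mon2 by simp
qed

text \<open>The same reduction under the bound e + r + 2 \<le> r d. Besides the z^2 s^i with i \<le>
  r - 2, the monomial z^3 s^(r-1) survives, which becomes the socle.\<close>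

lemma wt_normal_form:
  fixes f :: "'k poly poly"
  assumes "f \<in> wt r (r + 2)"
  shows "\<exists>\<gamma> \<delta> v w. v \<in> wt r (r + 2) \<and> w \<in> wt r (r + 2) \<and>
    f = (\<Sum>i\<in>{..<r - 1}. mon2 (\<gamma> i) 2 i) + mon2 \<delta> 3 (r - 1) + mon2 1 1 0 * v + (mon2 1 1 r - [:[:c:]:]) * w"
  using assms
proof (induction rule: wt_induct)
  case zero
  show ?case by (intro exI[of _ "\<lambda>_. 0"] exI[of _ 0]) simp
next
  case (add f g)
  from add.IH(1) obtain \<gamma> \<delta> v w where vw: "v \<in> wt r (r + 2)" "w \<in> wt r (r + 2)"
    and f: "f = (\<Sum>i\<in>{..<r - 1}. mon2 (\<gamma> i) 2 i) + mon2 \<delta> 3 (r - 1) + mon2 1 1 0 * v + (mon2 1 1 r - [:[:c:]:]) * w"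
    by blast
  from add.IH(2) obtain \<gamma>' \<delta>' v' w' where vw': "v' \<in> wt r (r + 2)" "w' \<in> wt r (r + 2)"
    and g: "g = (\<Sum>i\<in>{..<r - 1}. mon2 (\<gamma>' i) 2 i) + mon2 \<delta>' 3 (r - 1) + mon2 1 1 0 * v' + (mon2 1 1 r - [:[:c:]:]) * w'"
    by blast
  have "(\<Sum>i\<in>{..<r - 1}. mon2 (\<gamma> i + \<gamma>' i) 2 i) = (\<Sum>i\<in>{..<r - 1}. mon2 (\<gamma> i) 2 i) + (\<Sum>i\<in>{..<r - 1}. mon2 (\<gamma>' i) 2 i)"
    by (simp add: add_monom[symmetric] sum.distrib)
  moreover have "mon2 (\<delta> + \<delta>') 3 (r - 1) = mon2 \<delta> 3 (r - 1) + mon2 \<delta>' 3 (r - 1)" by (simp add: add_monom[symmetric])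
  ultimately have "f + g = (\<Sum>i\<in>{..<r - 1}. mon2 (\<gamma> i + \<gamma>' i) 2 i) + mon2 (\<delta> + \<delta>') 3 (r - 1) + mon2 1 1 0 * (v + v')
      + (mon2 1 1 r - [:[:c:]:]) * (w + w')"
    unfolding f g by (simp only: algebra_simps)
  then show ?case using wt_add[OF vw(1) vw'(1)] wt_add[OF vw(2) vw'(2)]
    by (intro exI[of _ "\<lambda>i. \<gamma> i + \<gamma>' i"] exI[of _ "\<delta> + \<delta>'"] exI[of _ "v + v'"] exI[of _ "w + w'"] conjI)
next
  case (mon2 b d e)
  have *: "\<exists>\<gamma> \<delta> v w. v \<in> wt r (r + 2) \<and> w \<in> wt r (r + 2) \<and>
    mon2 b d e = (\<Sum>i\<in>{..<r - 1}. mon2 (\<gamma> i) 2 i) + mon2 \<delta> 3 (r - 1) + mon2 1 1 0 * v + (mon2 1 1 r - [:[:c:]:]) * w"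
    if "e + (r + 2) \<le> r * d" for b d e
    using that
  proof (induction d arbitrary: b e)
    case (Suc d)
    show ?case
    proof (cases "e + (r + 2) \<le> r * d")
      case True
      then have "mon2 b d e \<in> wt r (r + 2)" by (rule wt_mon2)
      moreover have "mon2 b (Suc d) e = mon2 1 1 0 * mon2 b d e" by (simp add: mult_monom)
      ultimately show ?thesis by (intro exI[of _ 0] exI[of _ "\<lambda>_. 0"] exI[of _ "mon2 b d e"]) simp
    next
      case False
      \<comment> \<open>Without room for division by z, a monomial z^(d+1) s^e satisfies r d < e + r
        + 2 \<le> r (d + 1); below e = r only the first two cases are possible.\<close>
      consider "d = 1" "e < r - 1" | "d = 2" "e = r - 1" | "e \<ge> r"
      proof -
        have "d \<noteq> 0" using Suc.prems by (cases d) auto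
        moreover have "e < r - 1" if "d = 1" using Suc.prems that by auto
        moreover have "e = r - 1 \<or> e \<ge> r" if "d = 2" using False that by auto
        moreover have "e \<ge> r" if "d \<ge> 3"
        proof -
          have "r * 3 \<le> r * d" using that by simp
          then show ?thesis using False r by linarith
        qed
        ultimately show ?thesis using that by (cases "d = 1"; cases "d = 2") auto
      qed
      then show ?thesis
      proof cases
        case 1
        then have "(\<Sum>i\<in>{..<r - 1}. mon2 (if i = e then b else 0) 2 i) = mon2 b 2 e"
          by (subst sum.remove[of _ e]) (auto intro!: sum.neutral)
        then show ?thesis unfolding 1
          by (intro exI[of _ "\<lambda>i. if i = e then b else 0"] exI[of _ 0]) (simp add: numeral_2_eq_2)
      next
        case 2
        then show ?thesis
          by (intro exI[of _ "\<lambda>_. 0"] exI[of _ b] exI[of _ 0]) (simp add: numeral_3_eq_3 numeral_2_eq_2)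
      next
        case 3
        have le: "e - r + (r + 2) \<le> r * d" using Suc.prems 3 by simp
        obtain \<gamma> \<delta> v w where IH: "v \<in> wt r (r + 2)" "w \<in> wt r (r + 2)"
          "mon2 (c * b) d (e - r) = (\<Sum>i\<in>{..<r - 1}. mon2 (\<gamma> i) 2 i) + mon2 \<delta> 3 (r - 1) + mon2 1 1 0 * v + (mon2 1 1 r - [:[:c:]:]) * w"
          using Suc.IH[OF le] by blast
        have "mon2 b (Suc d) e = mon2 (c * b) d (e - r) + (mon2 1 1 r - [:[:c:]:]) * mon2 b d (e - r)"
          using 3 by (simp add: left_diff_distrib mult_monom smult_monom)
        also have "\<dots> = (\<Sum>i\<in>{..<r - 1}. mon2 (\<gamma> i) 2 i) + mon2 \<delta> 3 (r - 1) + mon2 1 1 0 * v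
            + (mon2 1 1 r - [:[:c:]:]) * (w + mon2 b d (e - r))"
          unfolding IH(3) by (simp only: distrib_left add.assoc)
        finally show ?thesis using IH(1) wt_add[OF IH(2) wt_mon2[OF le]] by blast
      qed
    qed
  qed simp
  show ?case using *[of e d b] mon2 by simp
qed

end

context nonzero_map
begin

text \<open>The socle generator \<open>\<sigma>\<close> has codegree \<open>r d - e = 2 r + 1\<close>. Comparing the coefficients of this
  codegree in \<open>\<sigma> = z g\<^sub>1 + (z s\<^sup>r - c) g\<^sub>2\<close> gives a geometric sequence of coefficients of \<open>g\<^sub>2\<close>.\<close>

lemma socle_not_in_ideal:
  fixes g1 g2 :: "'k poly poly"
  assumes g: "g1 \<in> wt r (r + 2)" "g2 \<in> wt r (r + 2)"
    and eq: "mon2 1 3 (r - 1) = mon2 1 1 0 * g1 + (mon2 1 1 r - [:[:c:]:]) * g2"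
  shows False
proof -
  have z: "mon2 1 1 0 * h = pCons 0 h" for h :: "'k poly poly" by (simp add: monom_Suc monom_0 pCons_one)
  have "mon2 1 1 r * g2 = pCons 0 (smult (monom 1 r) g2)" by (simp add: monom_Suc monom_0)
  moreover have "[:[:c:]:] * g2 = smult [:c:] g2" by simp
  ultimately have rhs: "mon2 1 1 0 * g1 + (mon2 1 1 r - [:[:c:]:]) * g2
      = pCons 0 g1 + (pCons 0 (smult (monom 1 r) g2) - smult [:c:] g2)"
    by (simp only: left_diff_distrib z)
  have shift: "coeff (monom 1 r * p) e = (if e < r then 0 else coeff p (e - r))" for p :: "'k poly" and e
    by (simp add: coeff_monom_mult)
  \<comment> \<open>The codegree is r (d + 3) - (r d + r - 1) = 2 r + 1 for every d.\<close>
  define \<kappa> where "\<kappa> d = coeff (coeff g2 (d + 3)) (r * d + (r - 1))" for d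
  have rec: "(if d = 0 then 1 else 0) = (if d = 0 then 0 else \<kappa> (d - 1)) - c * \<kappa> d" for d
  proof -
    \<comment> \<open>Multiplication by z raises the codegree by r, so g1 would have to contribute
      in codegree r + 1, just below its bound r + 2.\<close>
    have "coeff (coeff g1 (d + 2)) (r * d + (r - 1)) = 0"
    proof (rule ccontr)
      assume "coeff (coeff g1 (d + 2)) (r * d + (r - 1)) \<noteq> 0"
      then have "r * d + (r - 1) + (r + 2) \<le> r * (d + 2)" using g(1) unfolding wt_def by blast
      then show False using r by (simp add: algebra_simps)
    qed
    moreover have "coeff (monom 1 r * coeff g2 (d + 2)) (r * d + (r - 1)) = (if d = 0 then 0 else \<kappa> (d - 1))"
    proof (cases d)
      case 0
      then show ?thesis using r by (simp add: shift)
    next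
      case (Suc d')
      have "r * Suc d' + (r - 1) - r = r * d' + (r - 1)" by simp
      then show ?thesis unfolding Suc shift \<kappa>_def by (simp add: eval_nat_numeral)
    qed
    moreover have "coeff (coeff (mon2 1 3 (r - 1)) (d + 3)) (r * d + (r - 1)) = (if d = 0 then 1 else (0 :: 'k))"
      using r by (auto simp: coeff_monom)
    moreover have "coeff (coeff (mon2 1 3 (r - 1)) (d + 3)) (r * d + (r - 1)) =
      coeff (coeff g1 (d + 2)) (r * d + (r - 1)) + (coeff (monom 1 r * coeff g2 (d + 2)) (r * d + (r - 1)) - c * \<kappa> d)"
      unfolding eq rhs \<kappa>_def by (simp add: eval_nat_numeral)
    ultimately show ?thesis by simp
  qed
  \<comment> \<open>At d = 0 the recursion reads 1 = - c \<kappa>_0; afterwards each coefficient is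
    the preceding one divided by c, so none vanishes, contrary to finiteness of g2.\<close>
  have c: "c \<noteq> 0" using rec[of 0] by auto
  have "\<kappa> d \<noteq> 0" for d
  proof (induction d)
    case 0
    then show ?case using rec[of 0] by auto
  next
    case (Suc d)
    then show ?case using rec[of "Suc d"] by auto
  qed
  moreover have "\<kappa> (degree g2) = 0" by (simp add: \<kappa>_def coeff_eq_0)
  ultimately show False by blast
qed

text \<open>One argument covers the vertex (c = 0) and the rest of the ruling over the point at
  infinity: modulo x_0 and x_r - c the same 2 r elements span, with the same products. \<sigma> is
  reached from the leading term of any non-zero normal form.\<close>

lemma infinity_data:
  assumes m: "m \<subseteq> P" "0 \<in> m" "\<And>F G. F \<in> m \<Longrightarrow> G \<in> m \<Longrightarrow> F + G \<in> m" "\<And>F G. F \<in> P \<Longrightarrow> G \<in> m \<Longrightarrow> F * G \<in> m"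
    and Jm: "J \<subseteq> m" and Xm: "\<And>i. i < r \<Longrightarrow> X i \<in> m" and Xr: "X r - Const c \<in> m"
  shows "parameter_data r I m"
proof -
  define x :: "'k mpol" where "x = X 0"
  define y :: "'k mpol" where "y = X r - Const c"
  define zz :: "'k poly poly" where "zz = mon2 1 1 0"
  define yy :: "'k poly poly" where "yy = mon2 1 1 r - [:[:c:]:]"
  have xm: "x \<in> m" and ym: "y \<in> m" using Xm[of 0] Xr r by (auto simp: x_def y_def)
  have xy: "x \<in> P" "y \<in> P" using m(1) xm ym by auto
  have px: "par x = zz" "eps a x = 0" by (simp_all add: x_def zz_def)
  have py: "par y = yy" by (simp add: y_def yy_def)
  have zz0: "zz \<noteq> 0" by (simp add: zz_def)
  have yy0: "yy \<noteq> 0"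
  proof
    assume "yy = 0"
    then have "coeff (coeff yy 1) r = 0" by simp
    then show False by (simp add: yy_def coeff_monom coeff_pCons)
  qed
  define Q where "Q = pair_ideal r I x y"
  have QI: "F \<in> Q" if "F \<in> P" "G \<in> P" "H \<in> P" "F - x * G - y * H \<in> I" for F G H
    using that unfolding Q_def pair_ideal_def by blast
  have QE: "\<exists>G\<in>P. \<exists>H\<in>P. F - x * G - y * H \<in> I" "F \<in> P" if "F \<in> Q" for F
    using that unfolding Q_def pair_ideal_def by auto
  have I_Q: "F \<in> Q" if "F \<in> I" for F
    using QI[of F 0 0] that by (simp add: I_iff)
  have Q_add: "F + G \<in> Q" if FG: "F \<in> Q" "G \<in> Q" for F G
  proof -
    obtain A B where AB: "A \<in> P" "B \<in> P" "F - x * A - y * B \<in> I" using QE(1)[OF FG(1)] by blast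
    obtain A' B' where AB': "A' \<in> P" "B' \<in> P" "G - x * A' - y * B' \<in> I" using QE(1)[OF FG(2)] by blast
    have "(F - x * A - y * B) + (G - x * A' - y * B') \<in> I" using AB AB' by (intro dker_add)
    then have "(F + G) - x * (A + A') - y * (B + B') \<in> I" by (simp add: algebra_simps)
    then show ?thesis using AB AB' QE(2)[OF FG(1)] QE(2)[OF FG(2)] by (intro QI[of "F + G" "A + A'" "B + B'"]) auto
  qed
  have Q_mult: "E * F \<in> Q" if EF: "E \<in> P" "F \<in> Q" for E F
  proof -
    obtain A B where AB: "A \<in> P" "B \<in> P" "F - x * A - y * B \<in> I" using QE(1)[OF EF(2)] by blast
    have "E * (F - x * A - y * B) \<in> I" using AB EF by (intro dker_mult)
    then have "E * F - x * (E * A) - y * (E * B) \<in> I" by (simp add: algebra_simps)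
    then show ?thesis using AB EF QE(2)[OF EF(2)] by (intro QI[of "E * F" "E * A" "E * B"]) auto
  qed
  have Q_diff: "F - G \<in> Q" if "F \<in> Q" "G \<in> Q" for F G
    using Q_add[OF that(1) Q_mult[of "- 1" G]] that(2) by simp
  have Q_scale: "Const b * F \<in> Q" if "F \<in> Q" for b F
    by (rule Q_mult[OF polys_Const that])
  have Q_0: "0 \<in> Q" by (rule I_Q) simp
  have Q_sum: "sum f A \<in> Q" if "\<And>i. i \<in> A \<Longrightarrow> f i \<in> Q" for f and A :: "nat set"
    using that by (induction A rule: infinite_finite_induct) (auto intro: Q_0 Q_add)
  have Q_m: "F \<in> m" if F: "F \<in> Q" for F
  proof -
    obtain A B where AB: "A \<in> P" "B \<in> P" "F - x * A - y * B \<in> I" using QE(1)[OF F] by blast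
    have "F - x * A - y * B \<in> m" using J_I Jm AB(3) unfolding I_iff by blast
    moreover have "A * x \<in> m" "B * y \<in> m" using m(4) AB xm ym by auto
    ultimately have "(F - x * A - y * B) + A * x + B * y \<in> m" using m(3) by blast
    then show ?thesis by (simp add: algebra_simps)
  qed
  \<comment> \<open>Lifting g and h inside I_C leaves \<open>par\<close> untouched and suppresses
    the contribution of \<open>eps a y\<close>.\<close>
  have J_Q: "n \<in> Q" if n: "n \<in> J" "g \<in> wt r (r + 2)" "h \<in> wt r (r + 2)" "eps a n = zz * g + yy * h" for n g h
  proof -
    obtain G where G: "G \<in> J" "eps a G = g" using eps_minors_ideal_surj[OF nz n(2)] by blast
    obtain H where H: "H \<in> J" "eps a H = h" using eps_minors_ideal_surj[OF nz n(3)] by blast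
    have "n - x * G - y * H \<in> I" unfolding I_iff using n G H xy J_P px py by simp
    then show ?thesis using n G H J_P by (intro QI[of n G H])
  qed
  have J_Q_mon: "n \<in> Q" if n: "n \<in> J" "e + (r + 2) \<le> r * d" "eps a n = mon2 b (Suc d) e" for n b d e
  proof -
    have "eps a n = zz * mon2 b d e + yy * 0" unfolding n(3) zz_def by (simp add: mult_monom)
    then show ?thesis using n(1) wt_mon2[OF n(2)] by (intro J_Q[of n "mon2 b d e" 0]) auto
  qed
  have J_I': "n \<in> I" if "n \<in> J" "eps a n = 0" for n using that J_P by (simp add: I_iff)
  have J_J: "n * n' \<in> I" if "n \<in> J" "n' \<in> J" for n n' using that J_P by (simp add: I_iff)
  have "r - 1 + (r + 2) \<le> r * 3" using r by simp
  then obtain \<sigma> where \<sigma>: "\<sigma> \<in> J" "eps a \<sigma> = mon2 1 3 (r - 1)" using eps_mon2_surj[OF nz] by blast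
  have "\<exists>n. n \<in> J \<and> eps a n = mon2 1 2 i" if "i < r - 1" for i
  proof -
    have "i + (r + 2) \<le> r * 2" using that by simp
    then show ?thesis using eps_mon2_surj[OF nz] by blast
  qed
  then obtain \<tau> where \<tau>: "\<And>i. i < r - 1 \<Longrightarrow> \<tau> i \<in> J" "\<And>i. i < r - 1 \<Longrightarrow> eps a (\<tau> i) = mon2 1 2 i" by metis
  have \<sigma>P: "\<sigma> \<in> P" and \<tau>P: "i < r - 1 \<Longrightarrow> \<tau> i \<in> P" for i using \<sigma> \<tau> J_P by auto
  \<comment> \<open>The product has \<epsilon>-part z^4 s^(k+r-1), and k < r leaves room for
    division by z.\<close>
  have X\<sigma>: "X k * \<sigma> \<in> Q" if "1 \<le> k" "k < r" for k
  proof (rule J_Q_mon)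
    show "X k * \<sigma> \<in> J" using \<sigma> that by (intro minors_ideal_mult) auto
    show "k + (r - 1) + (r + 2) \<le> r * 3" using that by simp
    show "eps a (X k * \<sigma>) = mon2 1 (Suc 3) (k + (r - 1))" using \<sigma> by (simp add: mult_monom)
  qed
  have X\<tau>: "X k * \<tau> i \<in> Q" if "k + i < r - 1" for k i
  proof (rule J_Q_mon)
    show "X k * \<tau> i \<in> J" using \<tau> that by (intro minors_ideal_mult) auto
    show "k + i + (r + 2) \<le> r * 2" using that by simp
    show "eps a (X k * \<tau> i) = mon2 1 (Suc 2) (k + i)" using \<tau> that by (simp add: mult_monom eval_nat_numeral)
  qed
  have X\<tau>\<sigma>: "X k * \<tau> i - \<sigma> \<in> Q" if "k + i = r - 1" "1 \<le> k" for k i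
  proof (rule I_Q, rule J_I')
    have i: "i < r - 1" using that r by simp
    show "X k * \<tau> i - \<sigma> \<in> J" using \<tau> i \<sigma> that by (intro minors_ideal_diff minors_ideal_mult) auto
    have "mon2 1 (1 + 2) (k + i) = (mon2 1 3 (r - 1) :: 'k poly poly)" using that by (simp add: eval_nat_numeral)
    then show "eps a (X k * \<tau> i - \<sigma>) = 0" using \<tau>[OF i] \<sigma> by (simp add: mult_monom)
  qed
  let ?N = "\<lambda>\<alpha> \<beta> \<gamma> \<delta>. Const \<alpha> + (\<Sum>i\<in>{1..<r}. Const (\<beta> i) * X i) + ((\<Sum>i\<in>{..<r - 1}. Const (\<gamma> i) * \<tau> i) + Const \<delta> * \<sigma>)"
  have NP: "?N \<alpha> \<beta> \<gamma> \<delta> \<in> P" for \<alpha> \<beta> \<gamma> \<delta>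
    using \<sigma>P \<tau>P by (intro polys_add polys_sum polys_mult) auto
  have NJ: "(\<Sum>i\<in>{..<r - 1}. Const (\<gamma> i) * \<tau> i) + Const \<delta> * \<sigma> \<in> J" for \<gamma> \<delta>
  proof (rule minors_ideal_add)
    have "(\<Sum>i\<in>A. Const (\<gamma> i) * \<tau> i) \<in> J" if "finite A" "A \<subseteq> {..<r - 1}" for A
      using that \<tau>(1) by (induction A) (auto intro!: minors_ideal_add minors_ideal_mult)
    then show "(\<Sum>i\<in>{..<r - 1}. Const (\<gamma> i) * \<tau> i) \<in> J" by simp
  qed (use \<sigma> in \<open>auto intro: minors_ideal_mult\<close>)
  have NF: "\<exists>\<alpha> \<beta> \<gamma> \<delta>. F - ?N \<alpha> \<beta> \<gamma> \<delta> \<in> Q" if F: "F \<in> P" for F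
  proof -
    obtain \<alpha> \<beta> v w where vw: "v \<in> wt r 0" "w \<in> wt r 0"
      and f: "par F = [:[:\<alpha>:]:] + (\<Sum>i\<in>{1..<r}. mon2 (\<beta> i) 1 i) + zz * v + yy * w"
      using wt_0_normal_form[OF par_in_wt[OF F], of c] unfolding zz_def yy_def by blast
    obtain V where V: "V \<in> P" "par V = v" using par_surj[OF vw(1)] by blast
    obtain W where W: "W \<in> P" "par W = w" using par_surj[OF vw(2)] by blast
    let ?L = "Const \<alpha> + (\<Sum>i\<in>{1..<r}. Const (\<beta> i) * X i)"
    have LP: "?L \<in> P" by (intro polys_add polys_sum polys_mult) auto
    define n where "n = F - ?L - x * V - y * W"
    have nP: "n \<in> P" unfolding n_def using F LP V W xy by simp
    have "par ?L = [:[:\<alpha>:]:] + (\<Sum>i\<in>{1..<r}. mon2 (\<beta> i) 1 i)" by (simp add: smult_monom)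
    then have "par n = 0" unfolding n_def par.ev_diff par.ev_mult f px py V W by simp
    then have nJ: "n \<in> J" by (rule J_I[OF nP])
    obtain \<gamma> \<delta> v' w' where vw': "v' \<in> wt r (r + 2)" "w' \<in> wt r (r + 2)"
      and g: "eps a n = (\<Sum>i\<in>{..<r - 1}. mon2 (\<gamma> i) 2 i) + mon2 \<delta> 3 (r - 1) + zz * v' + yy * w'"
      using wt_normal_form[OF eps_minors_ideal[OF nJ], of a c] unfolding zz_def yy_def by blast
    let ?M = "(\<Sum>i\<in>{..<r - 1}. Const (\<gamma> i) * \<tau> i) + Const \<delta> * \<sigma>"
    have "eps a ?M = (\<Sum>i\<in>{..<r - 1}. mon2 (\<gamma> i) 2 i) + mon2 \<delta> 3 (r - 1)"
      using \<tau> \<sigma> by (simp add: smult_monom)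
    then have "eps a (n - ?M) = zz * v' + yy * w'" unfolding eps_diff g by simp
    then have "n - ?M \<in> Q" using J_Q vw' minors_ideal_diff[OF nJ NJ] by blast
    moreover have "x * V + y * W \<in> Q"
      using V W xy by (intro QI[of _ V W]) (auto simp: I_iff)
    ultimately have "(n - ?M) + (x * V + y * W) \<in> Q" by (rule Q_add)
    moreover have "(n - ?M) + (x * V + y * W) = F - ?N \<alpha> \<beta> \<gamma> \<delta>" by (simp add: n_def algebra_simps)
    ultimately have "F - ?N \<alpha> \<beta> \<gamma> \<delta> \<in> Q" by (simp only:)
    then show ?thesis by (intro exI)
  qed
  have \<sigma>Q: "\<sigma> \<notin> Q"
  proof
    assume "\<sigma> \<in> Q"
    then obtain G H where GH: "G \<in> P" "H \<in> P" "\<sigma> - x * G - y * H \<in> I" using QE(1) by blast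
    have "zz * par G + yy * par H = par \<sigma> - par (\<sigma> - x * G - y * H)" by (simp add: px py)
    also have "\<dots> = 0" using \<sigma> GH(3) unfolding I_iff by simp
    \<comment> \<open>The \<open>par\<close> parts form a syzygy of the pair, hence a multiple of
      the Koszul relation; subtracting it moves G and H into I_C, where only \<open>eps\<close>
      matters.\<close>
    finally have "yy * par H = zz * (- par G)" by (simp add: eq_neg_iff_add_eq_0 add.commute)
    then obtain h where h: "h \<in> wt r 0" "par H = zz * h"
      using infinity_division[OF par_in_wt[OF GH(2)] wt_uminus[OF par_in_wt[OF GH(1)]], of c]
      unfolding zz_def yy_def by blast
    obtain E where E: "E \<in> P" "par E = h" using par_surj[OF h(1)] by blast
    define H1 where "H1 = H - x * E"
    define G1 where "G1 = G + y * E"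
    have HG: "H1 \<in> P" "G1 \<in> P" using GH E xy by (auto simp: H1_def G1_def)
    have "par H1 = 0" by (simp add: H1_def h(2) E px)
    then have H1: "H1 \<in> J" by (rule J_I[OF HG(1)])
    have "\<sigma> - x * G1 - y * H1 \<in> I" using GH(3) by (simp add: H1_def G1_def algebra_simps)
    then have e: "par \<sigma> = zz * par G1 + yy * par H1" "eps a \<sigma> = zz * eps a G1 + (yy * eps a H1 + eps a y * par H1)"
      unfolding I_iff by (simp_all add: px py algebra_simps)
    have "zz * par G1 = 0" using e(1) \<open>par H1 = 0\<close> \<sigma> by simp
    then have "par G1 = 0" using zz0 by simp
    then have G1: "G1 \<in> J" by (rule J_I[OF HG(2)])
    show False
      using socle_not_in_ideal[OF eps_minors_ideal[OF G1, of a] eps_minors_ideal[OF H1, of a], of c]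
        e(2) \<sigma>(2) \<open>par H1 = 0\<close> unfolding zz_def yy_def by simp
  qed
  have reg: "\<exists>E\<in>P. F - x * E \<in> I" if FG: "F \<in> P" "G \<in> P" "y * F - x * G \<in> I" for F G
  proof -
    have "yy * par F = zz * par G" using FG(3) unfolding I_iff by (simp add: px py)
    then obtain h where h: "h \<in> wt r 0" "par F = zz * h"
      using infinity_division[OF par_in_wt[OF FG(1)] par_in_wt[OF FG(2)], of c]
      unfolding zz_def yy_def by blast
    obtain H where H: "H \<in> P" "par H = h" using par_surj[OF h(1)] by blast
    define F1 where "F1 = F - x * H"
    define G1 where "G1 = G - y * H"
    have FG1: "F1 \<in> P" "G1 \<in> P" using FG H xy by (auto simp: F1_def G1_def)
    have F10: "par F1 = 0" by (simp add: F1_def h(2) H px)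
    then have F1: "F1 \<in> J" by (rule J_I[OF FG1(1)])
    have "y * F1 - x * G1 \<in> I" using FG(3) by (simp add: F1_def G1_def algebra_simps)
    then have e: "yy * par F1 = zz * par G1" "yy * eps a F1 + eps a y * par F1 = zz * eps a G1"
      unfolding I_iff by (simp_all add: px py)
    have "zz * par G1 = 0" using e(1) F10 by simp
    then have "par G1 = 0" using zz0 by simp
    then have G1: "G1 \<in> J" by (rule J_I[OF FG1(2)])
    have "yy * eps a F1 = zz * eps a G1" using e(2) F10 by simp
    then obtain h' where h': "h' \<in> wt r (r + 2)" "eps a F1 = zz * h'"
      using infinity_division[OF eps_minors_ideal[OF F1] eps_minors_ideal[OF G1], of c a a]
      unfolding zz_def yy_def by blast
    obtain H' where H': "H' \<in> J" "eps a H' = h'" using eps_minors_ideal_surj[OF nz h'(1)] by blast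
    have "F1 - x * H' \<in> I" using F1 H' h' J_P xy FG1 unfolding I_iff by (simp add: px)
    then have "F - x * (H + H') \<in> I" by (simp add: F1_def algebra_simps)
    moreover have "H + H' \<in> P" using H(1) J_P[OF H'(1)] by simp
    ultimately show ?thesis by blast
  qed
  \<comment> \<open>The variables x_i with 0 < i < r kill \<sigma> modulo Q, and so does I_C, since
    products of two \<epsilon>-parts vanish; only the constant term acts.\<close>
  have N\<sigma>: "?N \<alpha> \<beta> \<gamma> \<delta> * \<sigma> - Const \<alpha> * \<sigma> \<in> Q" for \<alpha> \<beta> \<gamma> \<delta>
  proof -
    have "(\<Sum>i\<in>{1..<r}. Const (\<beta> i) * (X i * \<sigma>)) \<in> Q" using X\<sigma> by (intro Q_sum Q_scale) auto
    moreover have "((\<Sum>i\<in>{..<r - 1}. Const (\<gamma> i) * \<tau> i) + Const \<delta> * \<sigma>) * \<sigma> \<in> Q"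
      by (rule I_Q[OF J_J[OF NJ \<sigma>(1)]])
    ultimately have "(\<Sum>i\<in>{1..<r}. Const (\<beta> i) * (X i * \<sigma>)) + ((\<Sum>i\<in>{..<r - 1}. Const (\<gamma> i) * \<tau> i) + Const \<delta> * \<sigma>) * \<sigma> \<in> Q"
      by (rule Q_add)
    moreover have "(\<Sum>i\<in>{1..<r}. Const (\<beta> i) * X i) * \<sigma> = (\<Sum>i\<in>{1..<r}. Const (\<beta> i) * (X i * \<sigma>))"
      by (simp add: sum_distrib_right mult.assoc)
    ultimately show ?thesis by (simp add: distrib_right)
  qed
  have cancel: "Const (1 / b) * (Const b * F) = F" if "b \<noteq> 0" for b and F :: "'k mpol"
    using that by (simp flip: mult.assoc Const_mult)
  have dich: "F \<in> Q \<or> (\<exists>B\<in>P. F * B - \<sigma> \<in> Q)" if F: "F \<in> P" for F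
  proof -
    obtain \<alpha> \<beta> \<gamma> \<delta> where N: "F - ?N \<alpha> \<beta> \<gamma> \<delta> \<in> Q" using NF[OF F] by blast
    define N where "N = ?N \<alpha> \<beta> \<gamma> \<delta>"
    have red: "\<exists>B\<in>P. F * B - \<sigma> \<in> Q" if B: "B \<in> P" "N * B - \<sigma> \<in> Q" for B
    proof -
      have "B * (F - N) + (N * B - \<sigma>) \<in> Q" using B N unfolding N_def by (intro Q_add Q_mult)
      then show ?thesis using B(1) by (intro bexI[of _ B]) (simp_all add: algebra_simps)
    qed
    have scale: "\<exists>B\<in>P. F * B - \<sigma> \<in> Q" if B: "B \<in> P" "b \<noteq> 0" "N * B - Const b * \<sigma> \<in> Q" for B b
    proof (rule red)
      have "Const (1 / b) * (N * B - Const b * \<sigma>) \<in> Q" by (rule Q_scale[OF B(3)])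
      then show "N * (Const (1 / b) * B) - \<sigma> \<in> Q"
        by (simp only: right_diff_distrib cancel[OF B(2)] mult.left_commute[of N])
    qed (use B in simp)
    consider "\<alpha> \<noteq> 0" | "\<alpha> = 0" "\<exists>i\<in>{1..<r}. \<beta> i \<noteq> 0" | "\<alpha> = 0" "\<forall>i\<in>{1..<r}. \<beta> i = 0" "\<exists>i<r - 1. \<gamma> i \<noteq> 0"
      | "\<alpha> = 0" "\<forall>i\<in>{1..<r}. \<beta> i = 0" "\<forall>i<r - 1. \<gamma> i = 0" by blast
    then show ?thesis
    proof cases
      case 1
      then show ?thesis using scale[OF \<sigma>P 1] N\<sigma> unfolding N_def by blast
    next
      case 2
      \<comment> \<open>For the largest index with \<beta> non-zero, multiplication by
        \<tau>_(r-1-i) sends x_i to \<sigma> and kills the smaller indices as well as I_C, modulo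
        Q.\<close>
      define i where "i = Max {i \<in> {1..<r}. \<beta> i \<noteq> 0}"
      have "i \<in> {i \<in> {1..<r}. \<beta> i \<noteq> 0}" unfolding i_def using 2 by (intro Max_in) auto
      then have i: "1 \<le> i" "i < r" "\<beta> i \<noteq> 0" by auto
      have above: "\<beta> k = 0" if "k \<in> {1..<r}" "i < k" for k
        using that Max_ge[of "{i \<in> {1..<r}. \<beta> i \<noteq> 0}" k] unfolding i_def by fastforce
      let ?B = "\<tau> (r - 1 - i)"
      have idx: "r - 1 - i < r - 1" using i by simp
      have "(\<Sum>k\<in>{1..<r} - {i}. Const (\<beta> k) * (X k * ?B)) \<in> Q"
      proof (rule Q_sum)
        fix k assume k: "k \<in> {1..<r} - {i}"
        show "Const (\<beta> k) * (X k * ?B) \<in> Q"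
        proof (cases "i < k")
          case True
          then show ?thesis using above[of k] k Q_0 by simp
        next
          case False
          then have "k + (r - 1 - i) < r - 1" using k i by auto
          then show ?thesis by (intro Q_scale X\<tau>)
        qed
      qed
      moreover have "Const (\<beta> i) * (X i * ?B - \<sigma>) \<in> Q" using X\<tau>\<sigma>[of i "r - 1 - i"] i by (intro Q_mult) auto
      moreover have "((\<Sum>i\<in>{..<r - 1}. Const (\<gamma> i) * \<tau> i) + Const \<delta> * \<sigma>) * ?B \<in> Q"
        by (rule I_Q[OF J_J[OF NJ \<tau>(1)[OF idx]]])
      ultimately have "(\<Sum>k\<in>{1..<r} - {i}. Const (\<beta> k) * (X k * ?B)) + Const (\<beta> i) * (X i * ?B - \<sigma>) +
        ((\<Sum>i\<in>{..<r - 1}. Const (\<gamma> i) * \<tau> i) + Const \<delta> * \<sigma>) * ?B \<in> Q" by (intro Q_add)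
      moreover have "(\<Sum>k\<in>{1..<r}. Const (\<beta> k) * X k) * ?B =
          Const (\<beta> i) * (X i * ?B) + (\<Sum>k\<in>{1..<r} - {i}. Const (\<beta> k) * (X k * ?B))"
        using i by (subst sum.remove[of _ i]) (auto simp: sum_distrib_right mult.assoc distrib_right)
      ultimately have "N * ?B - Const (\<beta> i) * \<sigma> \<in> Q"
        unfolding N_def 2(1) by (simp add: algebra_simps)
      then show ?thesis using scale[OF \<tau>P[OF idx] i(3)] by blast
    next
      case 3
      \<comment> \<open>The dual choice: x_(r-1-i) sends \<tau>_i to \<sigma> and kills the smaller
        indices and \<sigma> itself, modulo Q.\<close>
      define i where "i = Max {i. i < r - 1 \<and> \<gamma> i \<noteq> 0}"
      have "i \<in> {i. i < r - 1 \<and> \<gamma> i \<noteq> 0}" unfolding i_def using 3 by (intro Max_in) auto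
      then have i: "i < r - 1" "\<gamma> i \<noteq> 0" by auto
      have above: "\<gamma> k = 0" if "k < r - 1" "i < k" for k
        using that Max_ge[of "{i. i < r - 1 \<and> \<gamma> i \<noteq> 0}" k] unfolding i_def by fastforce
      let ?B = "X (r - 1 - i) :: 'k mpol"
      have idx: "1 \<le> r - 1 - i" "r - 1 - i < r" using i by auto
      have B: "?B \<in> P" using idx by simp
      have "(\<Sum>k\<in>{..<r - 1} - {i}. Const (\<gamma> k) * (?B * \<tau> k)) \<in> Q"
      proof (rule Q_sum)
        fix k assume k: "k \<in> {..<r - 1} - {i}"
        show "Const (\<gamma> k) * (?B * \<tau> k) \<in> Q"
        proof (cases "i < k")
          case True
          then show ?thesis using above[of k] k Q_0 by simp
        next
          case False
          then have "(r - 1 - i) + k < r - 1" using k i by auto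
          then show ?thesis by (intro Q_scale X\<tau>)
        qed
      qed
      moreover have "Const (\<gamma> i) * (?B * \<tau> i - \<sigma>) \<in> Q" using X\<tau>\<sigma>[of "r - 1 - i" i] i idx by (intro Q_mult) auto
      moreover have "Const \<delta> * (?B * \<sigma>) \<in> Q" by (rule Q_scale[OF X\<sigma>[OF idx]])
      ultimately have "(\<Sum>k\<in>{..<r - 1} - {i}. Const (\<gamma> k) * (?B * \<tau> k)) + Const (\<gamma> i) * (?B * \<tau> i - \<sigma>) +
        Const \<delta> * (?B * \<sigma>) \<in> Q" by (intro Q_add)
      moreover have "(\<Sum>k\<in>{..<r - 1}. Const (\<gamma> k) * \<tau> k) * ?B = (\<Sum>k\<in>{..<r - 1}. Const (\<gamma> k) * (?B * \<tau> k))"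
        by (simp only: sum_distrib_right mult.assoc mult.commute[of "\<tau> _" ?B])
      then have "(\<Sum>k\<in>{..<r - 1}. Const (\<gamma> k) * \<tau> k) * ?B =
          Const (\<gamma> i) * (?B * \<tau> i) + (\<Sum>k\<in>{..<r - 1} - {i}. Const (\<gamma> k) * (?B * \<tau> k))"
        by (simp only: sum.remove[of "{..<r - 1}" i "\<lambda>k. Const (\<gamma> k) * (?B * \<tau> k)"] finite_lessThan lessThan_iff i(1))
      moreover have "(\<Sum>i\<in>{1..<r}. Const (\<beta> i) * X i) = 0" using 3(2) by (intro sum.neutral) auto
      ultimately have "N * ?B - Const (\<gamma> i) * \<sigma> \<in> Q"
        unfolding N_def 3(1) by (simp add: algebra_simps)
      then show ?thesis using scale[OF B i(2)] by blast
    next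
      case 4
      have "(\<Sum>i\<in>{1..<r}. Const (\<beta> i) * X i) = 0" using 4(2) by (intro sum.neutral) auto
      moreover have "(\<Sum>i\<in>{..<r - 1}. Const (\<gamma> i) * \<tau> i) = 0" using 4(3) by (intro sum.neutral) auto
      ultimately have N4: "N = Const \<delta> * \<sigma>" unfolding N_def 4(1) by simp
      show ?thesis
      proof (cases "\<delta> = 0")
        case True
        then show ?thesis using N N4 by (simp add: N_def)
      next
        case False
        have "N * 1 - Const \<delta> * \<sigma> \<in> Q" using N4 Q_0 by simp
        then show ?thesis using scale[OF polys_1 False] by blast
      qed
    qed
  qed
  have out: "s * \<sigma> \<notin> Q" if s: "s \<in> P - m" for s
  proof
    assume sQ: "s * \<sigma> \<in> Q"
    obtain \<alpha> \<beta> \<gamma> \<delta> where N: "s - ?N \<alpha> \<beta> \<gamma> \<delta> \<in> Q" using NF s by blast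
    have sum_m: "sum f A \<in> m" if "\<And>i. i \<in> A \<Longrightarrow> f i \<in> m" for f and A :: "nat set"
      using that m(2,3) by (induction A rule: infinite_finite_induct) auto
    \<comment> \<open>All spanning elements other than 1 lie in m, so an element outside m has a
      non-zero constant term, and it acts on \<sigma> as that scalar.\<close>
    have "\<alpha> \<noteq> 0"
    proof
      assume "\<alpha> = 0"
      moreover have "(\<Sum>i\<in>{1..<r}. Const (\<beta> i) * X i) \<in> m" using Xm m(4) by (intro sum_m) auto
      moreover have "(\<Sum>i\<in>{..<r - 1}. Const (\<gamma> i) * \<tau> i) + Const \<delta> * \<sigma> \<in> m" using NJ Jm by blast
      ultimately have "?N \<alpha> \<beta> \<gamma> \<delta> \<in> m" using m(3) by simp
      then have "(s - ?N \<alpha> \<beta> \<gamma> \<delta>) + ?N \<alpha> \<beta> \<gamma> \<delta> \<in> m" using m(3) Q_m[OF N] by blast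
      then show False using s by simp
    qed
    define N where "N = ?N \<alpha> \<beta> \<gamma> \<delta>"
    have "\<sigma> * (s - N) \<in> Q" unfolding N_def by (rule Q_mult[OF \<sigma>P N])
    moreover have "N * \<sigma> - Const \<alpha> * \<sigma> \<in> Q" unfolding N_def by (rule N\<sigma>)
    ultimately have "s * \<sigma> - (\<sigma> * (s - N) + (N * \<sigma> - Const \<alpha> * \<sigma>)) \<in> Q" by (intro Q_diff[OF sQ] Q_add)
    moreover have "s * \<sigma> - (\<sigma> * (s - N) + (N * \<sigma> - Const \<alpha> * \<sigma>)) = Const \<alpha> * \<sigma>" by (simp add: algebra_simps)
    ultimately have "Const \<alpha> * \<sigma> \<in> Q" by (simp only:)
    from Q_scale[OF this, of "1 / \<alpha>"] have "Const (1 / \<alpha>) * (Const \<alpha> * \<sigma>) \<in> Q" .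
    then show False using \<sigma>Q unfolding cancel[OF \<open>\<alpha> \<noteq> 0\<close>] by blast
  qed
  show ?thesis unfolding parameter_data_def
  proof (rule bexI[OF _ xm], rule bexI[OF _ ym], rule bexI[OF _ \<sigma>P], intro conjI ballI impI)
    show "F \<in> I" if "F \<in> P" "x * F \<in> I" for F
      by (rule regular_of_par[OF _ that]) (simp add: px zz0)
    show "F \<in> I" if "F \<in> P" "y * F \<in> I" for F
      by (rule regular_of_par[OF _ that]) (simp add: py yy0)
  qed (use reg dich out Q_def in auto)
qed

end

section \<open>The dimension bound\<close>

interpretation pp_vs: vector_space "\<lambda>(c :: 'k::field) (f :: 'k poly poly). smult [:c:] f"
proof unfold_locales
  fix x y :: 'k and f :: "'k poly poly"
  have "[:x + y:] = [:x:] + [:y:]" by simp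
  then show "smult [:x + y:] f = smult [:x:] f + smult [:y:] f" by (simp only: smult_add_left)
qed (simp_all add: smult_add_right mult.commute one_pCons[symmetric])

text \<open>Stated for indexed families because different monomials in f, g, h may coincide as
  polynomials; such a coincidence is itself a relation.\<close>

lemma (in vector_space) dependent_family:
  assumes T: "finite T" and S: "finite S" "card S < card T" and v: "\<And>t. t \<in> T \<Longrightarrow> v t \<in> span S"
  shows "\<exists>c. (\<exists>t\<in>T. c t \<noteq> 0) \<and> (\<Sum>t\<in>T. scale (c t) (v t)) = 0"
proof (cases "inj_on v T")
  case True
  have "dependent (v ` T)"
  proof (rule ccontr)
    assume "\<not> dependent (v ` T)"
    moreover have "v ` T \<subseteq> span S" using v by blast
    ultimately have "card (v ` T) \<le> card S" using independent_span_bound[OF S(1)] by blast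
    then show False using S(2) card_image[OF True] by simp
  qed
  then obtain u where u: "\<exists>w\<in>v ` T. u w \<noteq> 0" "(\<Sum>w\<in>v ` T. scale (u w) w) = 0"
    using dependent_finite[of "v ` T"] T by auto
  have "(\<Sum>t\<in>T. scale (u (v t)) (v t)) = 0" using u(2) by (simp add: sum.reindex[OF True])
  then show ?thesis using u(1) by (intro exI[of _ "\<lambda>t. u (v t)"]) auto
next
  case False
  then obtain s t where st: "s \<in> T" "t \<in> T" "s \<noteq> t" "v s = v t" by (auto simp: inj_on_def)
  let ?c = "\<lambda>x. if x = s then 1 else if x = t then - 1 else 0"
  have "(\<Sum>x\<in>T. scale (?c x) (v x)) = (\<Sum>x\<in>{s, t}. scale (?c x) (v x))"
    using T st by (intro sum.mono_neutral_right) auto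
  also have "\<dots> = 0" using st by simp
  finally show ?thesis using st by (intro exI[of _ ?c]) auto
qed

definition box :: "nat \<Rightarrow> 'k::comm_ring_1 poly poly set" where
  "box n = {f. \<forall>d e. coeff (coeff f d) e \<noteq> 0 \<longrightarrow> d \<le> n \<and> e \<le> n}"

lemma box_mult:
  assumes "f \<in> box n" "g \<in> box m"
  shows "f * g \<in> box (n + m)"
  unfolding box_def
proof (intro CollectI allI impI)
  fix d e assume "coeff (coeff (f * g) d) e \<noteq> 0"
  then have "(\<Sum>i\<le>d. \<Sum>j\<le>e. coeff (coeff f i) j * coeff (coeff g (d - i)) (e - j)) \<noteq> 0"
    by (simp add: coeff_mult coeff_sum)
  then obtain i where i: "i \<le> d" "(\<Sum>j\<le>e. coeff (coeff f i) j * coeff (coeff g (d - i)) (e - j)) \<noteq> 0"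
    using sum.neutral by (metis (no_types, lifting) atMost_iff)
  then obtain j where j: "j \<le> e" "coeff (coeff f i) j * coeff (coeff g (d - i)) (e - j) \<noteq> 0"
    using sum.neutral by (metis (no_types, lifting) atMost_iff)
  then have "coeff (coeff f i) j \<noteq> 0" "coeff (coeff g (d - i)) (e - j) \<noteq> 0" by auto
  then have "i \<le> n" "j \<le> n" "d - i \<le> m" "e - j \<le> m" using assms by (auto simp: box_def)
  then show "d \<le> n + m \<and> e \<le> n + m" by linarith
qed

lemma box_mono: "n \<le> m \<Longrightarrow> box n \<subseteq> box m"
  by (force simp: box_def)

lemma box_power: "f \<in> box n \<Longrightarrow> f ^ k \<in> box (k * n)"
proof (induction k)
  case (Suc k)
  then show ?case using box_mult[of f n "f ^ k" "k * n"] by simp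
qed (auto simp: box_def one_pCons coeff_pCons split: nat.splits)

lemma ex_box: "\<exists>n. f \<in> box n"
proof -
  let ?n = "Max (insert (degree f) ((\<lambda>i. degree (coeff f i)) ` {..degree f}))"
  have "f \<in> box ?n" unfolding box_def
  proof (intro CollectI allI impI)
    fix d e assume nz: "coeff (coeff f d) e \<noteq> 0"
    then have d: "d \<le> degree f" by (intro le_degree) auto
    have "e \<le> degree (coeff f d)" using nz by (rule le_degree)
    also have "\<dots> \<le> ?n" using d by (intro Max_ge) auto
    moreover have "degree f \<le> ?n" by (intro Max_ge) auto
    ultimately show "d \<le> ?n \<and> e \<le> ?n" using d by linarith
  qed
  then show ?thesis ..
qed

lemma box_span:
  "box n \<subseteq> pp_vs.span ((\<lambda>(i, j). mon2 (1 :: 'k::field) i j) ` ({..n} \<times> {..n}))"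
proof
  fix f :: "'k poly poly" assume f: "f \<in> box n"
  have "f = (\<Sum>i\<le>n. \<Sum>j\<le>n. mon2 (coeff (coeff f i) j) i j)"
  proof (rule poly_eqI, rule poly_eqI)
    fix d e
    have "coeff (coeff (\<Sum>i\<le>n. \<Sum>j\<le>n. mon2 (coeff (coeff f i) j) i j) d) e
        = (\<Sum>i\<le>n. \<Sum>j\<le>n. if j = e then (if i = d then coeff (coeff f i) j else 0) else 0)"
      unfolding coeff_sum by (intro sum.cong refl) (simp add: coeff_monom)
    also have "\<dots> = (if d \<le> n \<and> e \<le> n then coeff (coeff f d) e else 0)" by (cases "e \<le> n") (auto simp: sum.delta)
    also have "\<dots> = coeff (coeff f d) e" using f by (auto simp: box_def)
    finally show "coeff (coeff f d) e = coeff (coeff (\<Sum>i\<le>n. \<Sum>j\<le>n. mon2 (coeff (coeff f i) j) i j) d) e" ..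
  qed
  also have "\<dots> = (\<Sum>i\<le>n. \<Sum>j\<le>n. smult [:coeff (coeff f i) j:] (mon2 1 i j))" by (simp add: smult_monom)
  also have "\<dots> \<in> pp_vs.span ((\<lambda>(i, j). mon2 1 i j) ` ({..n} \<times> {..n}))"
    by (intro pp_vs.span_sum pp_vs.span_scale pp_vs.span_base) auto
  finally show "f \<in> pp_vs.span ((\<lambda>(i, j). mon2 1 i j) ` ({..n} \<times> {..n}))" .
qed

text \<open>There are \<open>(D + 1)\<^sup>3\<close> monomials of degree at most \<open>D\<close> in each of \<open>f, g, h\<close>, but their span has
  dimension \<open>O(D\<^sup>2)\<close>.\<close>

lemma three_dependent:
  fixes f g h :: "'k::field poly poly"
  shows "\<exists>D c. (\<exists>i\<le>D. \<exists>j\<le>D. \<exists>l\<le>D. c i j l \<noteq> 0) \<and>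
    (\<Sum>i\<le>D. (\<Sum>j\<le>D. (\<Sum>l\<le>D. [:[:c i j l:]:] * h ^ l) * g ^ j) * f ^ i) = 0"
proof -
  obtain n1 n2 n3 where n: "f \<in> box n1" "g \<in> box n2" "h \<in> box n3" using ex_box by metis
  define e where "e = n1 + n2 + n3"
  have e: "f \<in> box e" "g \<in> box e" "h \<in> box e"
    using n box_mono[of n1 e] box_mono[of n2 e] box_mono[of n3 e] by (auto simp: e_def)
  \<comment> \<open>The products lie in a box of side 3 D e, of dimension at most (3 D e + 1)^2
    \<le> (3 e + 1)^2 (D + 1)^2. This D makes the bound D (D + 1)^2, below the number (D + 1)^3 of
    products.\<close>
  define D where "D = (3 * e + 1)\<^sup>2"
  let ?T = "{..D} \<times> {..D} \<times> {..D}"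
  let ?v = "\<lambda>(i, j, l). f ^ i * g ^ j * h ^ l"
  let ?S = "(\<lambda>(i, j). mon2 (1 :: 'k) i j) ` ({..3 * D * e} \<times> {..3 * D * e})"
  have "card ?S \<le> (3 * D * e + 1)\<^sup>2"
    using card_image_le[of "{..3 * D * e} \<times> {..3 * D * e}" "\<lambda>(i, j). mon2 (1 :: 'k) i j"]
    by (simp add: power2_eq_square)
  also have "(3 * D * e + 1)\<^sup>2 \<le> ((3 * e + 1) * (D + 1))\<^sup>2"
    by (intro power_mono) (auto simp: algebra_simps)
  also have "\<dots> = D * (D + 1)\<^sup>2" unfolding D_def by (simp only: power_mult_distrib)
  also have "\<dots> < (D + 1) ^ 3" by (simp add: power3_eq_cube power2_eq_square)
  also have "\<dots> = card ?T" by (simp add: power3_eq_cube)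
  finally have "card ?S < card ?T" .
  moreover have "?v t \<in> pp_vs.span ?S" if t: "t \<in> ?T" for t
  proof -
    obtain i j l where ijl: "t = (i, j, l)" "i \<le> D" "j \<le> D" "l \<le> D" using t by auto
    have "f ^ i * g ^ j * h ^ l \<in> box (i * e + j * e + l * e)" by (intro box_mult box_power e)
    moreover have "i * e + j * e + l * e \<le> 3 * D * e"
      using mult_le_mono1[of "i + j + l" "3 * D" e] ijl by (simp add: add_mult_distrib)
    ultimately have "f ^ i * g ^ j * h ^ l \<in> box (3 * D * e)" using box_mono by blast
    then show ?thesis using box_span ijl by auto
  qed
  ultimately obtain c where c: "\<exists>t\<in>?T. c t \<noteq> 0" "(\<Sum>t\<in>?T. smult [:c t:] (?v t)) = 0"
    using pp_vs.dependent_family[of ?T ?S ?v] by auto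
  have "(\<Sum>t\<in>?T. smult [:c t:] (?v t)) = (\<Sum>i\<le>D. \<Sum>j\<le>D. \<Sum>l\<le>D. smult [:c (i, j, l):] (f ^ i * g ^ j * h ^ l))"
    by (simp add: sum.cartesian_product split_def)
  also have "\<dots> = (\<Sum>i\<le>D. (\<Sum>j\<le>D. (\<Sum>l\<le>D. [:[:c (i, j, l):]:] * h ^ l) * g ^ j) * f ^ i)"
    unfolding sum_distrib_right
    by (intro sum.cong refl) (simp add: mult_ac)
  finally show ?thesis using c by (intro exI[of _ D] exI[of _ "\<lambda>i j l. c (i, j, l)"]) auto
qed

section \<open>Chains of primes containing I_X\<close>

definition poly_prime :: "nat \<Rightarrow> 'k::comm_ring_1 mpol set \<Rightarrow> bool" where
  "poly_prime r p \<longleftrightarrow> p \<subseteq> polys (Suc r) \<and> (\<forall>F\<in>p. \<forall>G\<in>p. F + G \<in> p) \<and>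
    (\<forall>P\<in>polys (Suc r). \<forall>F\<in>p. P * F \<in> p) \<and> 1 \<notin> p \<and>
    (\<forall>F\<in>polys (Suc r). \<forall>G\<in>polys (Suc r). F * G \<in> p \<longrightarrow> F \<in> p \<or> G \<in> p)"

text \<open>Of a relation \<open>\<Sum> g\<^sub>i x\<^sup>i \<in> p\<close> only the lowest non-vanishing coefficient survives in \<open>q\<close>.\<close>

lemma prime_step:
  fixes g :: "nat \<Rightarrow> 'k::comm_ring_1 mpol"
  assumes p: "poly_prime r p" and q: "poly_prime r q" and pq: "p \<subseteq> q" and x: "x \<in> q" "x \<notin> p"
    and g: "\<And>i. g i \<in> polys (Suc r)" and sum: "(\<Sum>i\<le>D. g i * x ^ i) \<in> p"
    and low: "i \<le> D" "\<And>k. k < i \<Longrightarrow> g k = 0"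
  shows "g i \<in> q"
proof -
  have xP: "x \<in> polys (Suc r)" using x q by (auto simp: poly_prime_def)
  have p_prime: "F \<in> p \<or> G \<in> p" if "F \<in> polys (Suc r)" "G \<in> polys (Suc r)" "F * G \<in> p" for F G
    using p that unfolding poly_prime_def by blast
  have q_mult: "F * G \<in> q" if "F \<in> polys (Suc r)" "G \<in> q" for F G
    using q that unfolding poly_prime_def by blast
  have "(\<Sum>k\<le>D. g k * x ^ k) = (\<Sum>k\<in>{i..D}. g k * x ^ k)"
    by (rule sum.mono_neutral_right) (use low in auto)
  also have "\<dots> = (\<Sum>k\<in>{i..D}. x ^ i * (g k * x ^ (k - i)))"
    by (intro sum.cong) (auto simp: mult_ac simp flip: power_add)
  also have "\<dots> = x ^ i * (\<Sum>k\<in>{i..D}. g k * x ^ (k - i))" by (simp add: sum_distrib_left)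
  finally have "x ^ i * (\<Sum>k\<in>{i..D}. g k * x ^ (k - i)) \<in> p" using sum by simp
  moreover have "(\<Sum>k\<in>{i..D}. g k * x ^ (k - i)) \<in> polys (Suc r)" using g xP by (intro polys_sum polys_mult) auto
  moreover have "x ^ n \<notin> p" for n
  proof (induction n)
    case 0
    then show ?case using p by (simp add: poly_prime_def)
  next
    case (Suc n)
    then show ?case using p_prime[OF xP polys_power[OF xP, of n]] x by auto
  qed
  ultimately have "(\<Sum>k\<in>{i..D}. g k * x ^ (k - i)) \<in> p"
    using p_prime[OF polys_power[OF xP]] by blast
  then have S: "(\<Sum>k\<in>{i..D}. g k * x ^ (k - i)) \<in> q" using pq by blast
  have eq: "(\<Sum>k\<in>{i..D}. g k * x ^ (k - i)) = g i + (\<Sum>k\<in>{Suc i..D}. g k * x ^ (k - Suc i)) * x"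
  proof -
    have "{i..D} = insert i {Suc i..D}" using low(1) by auto
    moreover have "(\<Sum>k\<in>{Suc i..D}. g k * x ^ (k - i)) = (\<Sum>k\<in>{Suc i..D}. g k * x ^ (k - Suc i) * x)"

    proof (intro sum.cong refl)
      fix k assume "k \<in> {Suc i..D}"
      then have "k - i = Suc (k - Suc i)" by auto
      then show "g k * x ^ (k - i) = g k * x ^ (k - Suc i) * x" by (simp add: mult_ac)
    qed
    ultimately show ?thesis by (simp add: sum_distrib_right)
  qed
  have "(- (\<Sum>k\<in>{Suc i..D}. g k * x ^ (k - Suc i))) * x \<in> q"
    using x(1) g xP by (intro q_mult polys_uminus polys_sum polys_mult polys_power)
  then have "(\<Sum>k\<in>{i..D}. g k * x ^ (k - i)) + (- (\<Sum>k\<in>{Suc i..D}. g k * x ^ (k - Suc i))) * x \<in> q"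
    using S q unfolding poly_prime_def by blast
  then show ?thesis unfolding eq by simp
qed

text \<open>Witnesses x, y, z of the strict inclusions satisfy a non-trivial relation on C. Its
  lowest coefficient in x lies in p 1, the lowest coefficient of that in y lies in p 2, and finally
  a non-zero constant would lie in p 3.\<close>

lemma no_long_prime_chain:
  fixes p :: "nat \<Rightarrow> 'k::field mpol set"
  assumes p: "\<And>i. i \<le> 3 \<Longrightarrow> poly_prime r (p i)" and strict: "\<And>i. i < 3 \<Longrightarrow> p i \<subset> p (Suc i)"
    and sub: "dker r a \<subseteq> p 0"
  shows False
proof -
  obtain x y z where x: "x \<in> p 1" "x \<notin> p 0" and y: "y \<in> p 2" "y \<notin> p 1" and z: "z \<in> p 3" "z \<notin> p 2"
    using strict[of 0] strict[of 1] strict[of 2] by (auto simp: eval_nat_numeral)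
  have xP: "x \<in> polys (Suc r)" and yP: "y \<in> polys (Suc r)" and zP: "z \<in> polys (Suc r)"
    using p[of 1] p[of 2] p[of 3] x y z by (auto simp: poly_prime_def)
  obtain D c where c: "\<exists>i\<le>D. \<exists>j\<le>D. \<exists>l\<le>D. c i j l \<noteq> 0" and
    rel: "(\<Sum>i\<le>D. (\<Sum>j\<le>D. (\<Sum>l\<le>D. [:[:c i j l:]:] * par z ^ l) * par y ^ j) * par x ^ i) = 0"
    using three_dependent[of "par z" "par y" "par x"] by blast
  define g3 where "g3 i j = (\<Sum>l\<le>D. Const (c i j l) * z ^ l)" for i j
  define g2 where "g2 i = (\<Sum>j\<le>D. g3 i j * y ^ j)" for i
  define g1 where "g1 = (\<Sum>i\<le>D. g2 i * x ^ i)"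
  have g3P: "g3 i j \<in> polys (Suc r)" for i j unfolding g3_def using zP by (intro polys_sum polys_mult) auto
  have g2P: "g2 i \<in> polys (Suc r)" for i unfolding g2_def using yP g3P by (intro polys_sum polys_mult) auto
  have g1P: "g1 \<in> polys (Suc r)" unfolding g1_def using xP g2P by (intro polys_sum polys_mult) auto
  have "par g1 = 0" using rel by (simp add: g1_def g2_def g3_def)
  \<comment> \<open>The relation only makes \<open>par\<close> vanish; squaring also kills the
    \<epsilon>-part, and the prime p 0 allows the root to be taken.\<close>
  then have "g1 * g1 \<in> dker r a" using g1P by (simp add: dker_def)
  then have "g1 \<in> p 0" using sub p[of 0] g1P unfolding poly_prime_def by blast
  have least: "\<exists>n\<le>D. Q n \<and> (\<forall>k<n. \<not> Q k)" if "\<exists>n\<le>D. Q n" for Q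
    using that exists_least_iff[of "\<lambda>n. n \<le> D \<and> Q n"] by (meson le_trans nat_less_le)
  obtain i where i: "i \<le> D" "\<exists>j\<le>D. \<exists>l\<le>D. c i j l \<noteq> 0" "\<And>k. k < i \<Longrightarrow> \<not> (\<exists>j\<le>D. \<exists>l\<le>D. c k j l \<noteq> 0)"
    using least[OF c] by blast
  have "g2 k = 0" if "k < i" for k
    using i(3)[OF that] by (auto simp: g2_def g3_def intro!: sum.neutral)
  then have 2: "g2 i \<in> p 1"
    using prime_step[where g = g2 and i = i and D = D, OF p[of 0] p[of 1] _ x g2P] i(1) strict[of 0] \<open>g1 \<in> p 0\<close>
    by (auto simp: g1_def)
  obtain j where j: "j \<le> D" "\<exists>l\<le>D. c i j l \<noteq> 0" "\<And>k. k < j \<Longrightarrow> \<not> (\<exists>l\<le>D. c i k l \<noteq> 0)"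
    using least[OF i(2)] by blast
  have "g3 i k = 0" if "k < j" for k
    using j(3)[OF that] by (auto simp: g3_def intro!: sum.neutral)
  then have 3: "g3 i j \<in> p 2"
    using prime_step[where g = "g3 i" and i = j and D = D, OF p[of 1] p[of 2] _ y g3P] j(1) strict[of 1] 2
    by (auto simp: g2_def eval_nat_numeral)
  obtain l where l: "l \<le> D" "c i j l \<noteq> 0" "\<And>k. k < l \<Longrightarrow> c i j k = 0"
    using least[OF j(2)] by blast
  have "Const (c i j k) = 0" if "k < l" for k using l(3)[OF that] by simp
  then have "Const (c i j l) \<in> p 3"
    using prime_step[where g = "\<lambda>k. Const (c i j k)" and i = l and D = D, OF p[of 2] p[of 3] _ z polys_Const] l(1) strict[of 2] 3
    by (auto simp: g3_def eval_nat_numeral)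
  then have "Const (1 / c i j l) * Const (c i j l) \<in> p 3" using p[of 3] unfolding poly_prime_def by auto
  then show False using l p[of 3] by (auto simp: poly_prime_def simp flip: Const_mult)
qed

section \<open>The homogeneous coordinate ring\<close>

text \<open>Elements of the coordinate ring are cosets; this interface replaces them by
  representatives, so that later conditions concern polynomials modulo I.\<close>

locale quotient_presentation = cring A for A (structure) +
  fixes r :: nat and I :: "'k::field mpol set" and h :: "'k mpol \<Rightarrow> 'a"
  assumes carrier_A: "carrier A = h ` polys (Suc r)"
    and h_add: "F \<in> polys (Suc r) \<Longrightarrow> G \<in> polys (Suc r) \<Longrightarrow> h (F + G) = h F \<oplus> h G"
    and h_mult: "F \<in> polys (Suc r) \<Longrightarrow> G \<in> polys (Suc r) \<Longrightarrow> h (F * G) = h F \<otimes> h G"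
    and h_1: "h 1 = \<one>"
    and h_zero_iff: "F \<in> polys (Suc r) \<Longrightarrow> h F = \<zero> \<longleftrightarrow> F \<in> I"
begin

lemma h_closed [simp]: "F \<in> polys (Suc r) \<Longrightarrow> h F \<in> carrier A"
  by (auto simp: carrier_A)

lemma h_hom: "h \<in> ring_hom (poly_ring (Suc r)) A"
  by (auto intro!: ring_hom_memI simp: h_add h_mult h_1)

lemma h_0: "h 0 = \<zero>"
proof -
  have "h 0 \<oplus> h 0 = h 0" by (simp flip: h_add)
  then show ?thesis by (metis add.r_cancel_one h_closed polys_0)
qed

lemma h_diff:
  assumes "F \<in> polys (Suc r)" "G \<in> polys (Suc r)"
  shows "h (F - G) = h F \<ominus> h G"
proof -
  have "h (F - G) \<oplus> h G = h F" using assms by (simp flip: h_add)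
  moreover have "h (F - G) \<oplus> h G \<ominus> h G = h (F - G)" using assms by (simp add: a_minus_def a_assoc r_neg)
  ultimately show ?thesis by simp
qed

lemma h_eq_iff:
  assumes "F \<in> polys (Suc r)" "G \<in> polys (Suc r)"
  shows "h F = h G \<longleftrightarrow> F - G \<in> I"
  using assms h_diff[OF assms] h_zero_iff[of "F - G"] by simp

lemma ideal_preimage: "ideal J A \<Longrightarrow> ideal {F \<in> polys (Suc r). h F \<in> J} (poly_ring (Suc r))"
proof -
  assume J: "ideal J A"
  interpret B: cring "poly_ring (Suc r) :: 'k mpol ring" by (rule cring_poly_ring)
  interpret h: ring_hom_ring "poly_ring (Suc r)" A h by (intro ring_hom_ringI2 B.ring_axioms ring_axioms h_hom)
  show ?thesis using h.ideal_vimage[OF J] by simp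
qed

lemma noetherian: "noetherian_ring A"
proof (rule noetherian_ringI)
  fix J assume J: "ideal J A"
  interpret B: cring "poly_ring (Suc r) :: 'k mpol ring" by (rule cring_poly_ring)
  let ?J = "{F \<in> polys (Suc r). h F \<in> J}"
  obtain T where T: "T \<subseteq> polys (Suc r)" "finite T" "?J = Idl\<^bsub>poly_ring (Suc r)\<^esub> T"
    using noetherian_ring.finetely_gen[OF noetherian_poly_ring ideal_preimage[OF J]] by auto
  have hT: "h ` T \<subseteq> carrier A" using T(1) by auto
  have "?J \<subseteq> {F \<in> polys (Suc r). h F \<in> Idl (h ` T)}" unfolding T(3)
    by (rule B.genideal_minimal[OF ideal_preimage[OF genideal_ideal[OF hT]]]) (use T(1) genideal_self[OF hT] in auto)
  then have "J \<subseteq> Idl (h ` T)" using ideal_subset_carrier[OF J] by (auto simp: carrier_A)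
  moreover have "T \<subseteq> ?J" using B.genideal_self[of T] T(1,3) by auto
  then have "Idl (h ` T) \<subseteq> J" by (intro genideal_minimal[OF J]) blast
  ultimately show "\<exists>T\<subseteq>carrier A. finite T \<and> J = Idl T" using hT T(2) by blast
qed

lemma poly_prime_preimage:
  assumes "primeideal Q A"
  shows "poly_prime r {F \<in> polys (Suc r). h F \<in> Q}"
proof -
  interpret Q: primeideal Q A by fact
  have "\<one> \<notin> Q" using Q.I_notcarr Q.one_imp_carrier by blast
  then show ?thesis
    unfolding poly_prime_def using Q.I_prime Q.a_closed Q.I_l_closed by (auto simp: h_add h_mult h_1)
qed

lemma I_subset_preimage:
  assumes "ideal Q A" "I \<subseteq> polys (Suc r)"
  shows "I \<subseteq> {F \<in> polys (Suc r). h F \<in> Q}"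
proof
  fix F assume F: "F \<in> I"
  then have "F \<in> polys (Suc r)" using assms(2) by blast
  moreover from this have "h F = \<zero>" using F h_zero_iff by blast
  moreover have "\<zero> \<in> Q" using additive_subgroup.zero_closed[OF ideal.axioms(1)[OF assms(1)]] .
  ultimately show "F \<in> {F \<in> polys (Suc r). h F \<in> Q}" by simp
qed

lemma poly_maximal_preimage:
  assumes "maximalideal M A"
  shows "poly_maximal r {F \<in> polys (Suc r). h F \<in> M}"
proof -
  interpret M: maximalideal M A by fact
  have one: "\<one> \<notin> M" using M.I_notcarr M.one_imp_carrier by blast
  have inv: "\<exists>G\<in>polys (Suc r). h (F * G - 1) \<in> M" if F: "F \<in> polys (Suc r)" "h F \<notin> M" for F
  proof -
    let ?J = "{h F \<otimes> i \<oplus> q | i q. i \<in> carrier A \<and> q \<in> M}"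
    have J: "ideal ?J A" using F by (intro ideal_scaled_sum oneideal M.ideal_axioms) auto
    have MJ: "M \<subseteq> ?J"
    proof
      fix q assume "q \<in> M"
      moreover have "q = h F \<otimes> \<zero> \<oplus> q" using M.Icarr[OF \<open>q \<in> M\<close>] F by simp
      ultimately show "q \<in> ?J" by blast
    qed
    have "h F \<in> ?J"
    proof -
      have "h F = h F \<otimes> \<one> \<oplus> \<zero>" using F by simp
      then show ?thesis using M.zero_closed by blast
    qed
    then have "?J = carrier A"
      using M.I_maximal[OF J MJ ideal_subset_carrier[OF J]] F(2) by (elim disjE) simp_all
    then have "\<one> \<in> ?J" by simp
    then obtain b q where "b \<in> carrier A" and q: "q \<in> M" "\<one> = h F \<otimes> b \<oplus> q" by blast
    then obtain G where G: "G \<in> polys (Suc r)" "b = h G" by (auto simp: carrier_A)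
    have c: "h F \<in> carrier A" "h G \<in> carrier A" "q \<in> carrier A" using F G q M.Icarr by auto
    have "h (F * G - 1) = h F \<otimes> h G \<ominus> (h F \<otimes> h G \<oplus> q)"
      using F G q(2) by (simp add: h_diff h_mult h_1)
    also have "\<dots> = \<ominus> q" using c by algebra
    finally show ?thesis using G(1) q(1) by (metis M.a_inv_closed)
  qed
  show ?thesis
    unfolding poly_maximal_def using one M.a_closed M.I_l_closed M.zero_closed inv
    by (auto simp: h_add h_mult h_1 h_0)
qed

lemma h_in_pair_ideal_iff:
  assumes "F \<in> polys (Suc r)" "x \<in> polys (Suc r)" "y \<in> polys (Suc r)"
  shows "h F \<in> Idl {h x, h y} \<longleftrightarrow> F \<in> pair_ideal r I x y"
proof -
  have 1: "h F = h x \<otimes> h G \<oplus> h y \<otimes> h H \<longleftrightarrow> F - x * G - y * H \<in> I"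
    if "G \<in> polys (Suc r)" "H \<in> polys (Suc r)" for G H
    using h_eq_iff[of F "x * G + y * H"] that assms by (simp add: h_add h_mult diff_diff_add)
  have "h F \<in> Idl {h x, h y} \<longleftrightarrow> (\<exists>G\<in>polys (Suc r). \<exists>H\<in>polys (Suc r). h F = h x \<otimes> h G \<oplus> h y \<otimes> h H)"
    using assms by (auto simp: genideal_pair carrier_A)
  also have "\<dots> \<longleftrightarrow> F \<in> pair_ideal r I x y"
    unfolding pair_ideal_def using 1 assms(1) by blast
  finally show ?thesis .
qed

lemma parameters_of_parameter_data:
  assumes M: "M \<subseteq> carrier A" and data: "parameter_data r I {F \<in> polys (Suc r). h F \<in> M}"
  shows "\<exists>x y \<sigma>. x \<in> M \<and> y \<in> M \<and> regular_pair A x y \<and> \<sigma> \<in> carrier A \<and>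
      (\<forall>a\<in>carrier A. a \<in> Idl {x, y} \<or> (\<exists>b\<in>carrier A. a \<otimes> b \<ominus> \<sigma> \<in> Idl {x, y})) \<and>
      (\<forall>s\<in>carrier A - M. s \<otimes> \<sigma> \<notin> Idl {x, y})"
proof -
  let ?P = "polys (Suc r)"
  show ?thesis using data unfolding parameter_data_def
  proof (elim bexE conjE)
    fix x y \<sigma>
    assume x: "x \<in> {F \<in> ?P. h F \<in> M}" and y: "y \<in> {F \<in> ?P. h F \<in> M}" and \<sigma>: "\<sigma> \<in> ?P"
      and nzx: "\<forall>F\<in>?P. x * F \<in> I \<longrightarrow> F \<in> I" and nzy: "\<forall>F\<in>?P. y * F \<in> I \<longrightarrow> F \<in> I"
      and reg: "\<forall>F\<in>?P. \<forall>G\<in>?P. y * F - x * G \<in> I \<longrightarrow> (\<exists>E\<in>?P. F - x * E \<in> I)"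
      and dich: "\<forall>F\<in>?P. F \<in> pair_ideal r I x y \<or> (\<exists>B\<in>?P. F * B - \<sigma> \<in> pair_ideal r I x y)"
      and out: "\<forall>s\<in>?P - {F \<in> ?P. h F \<in> M}. s * \<sigma> \<notin> pair_ideal r I x y"
    have xy: "x \<in> ?P" "h x \<in> M" "y \<in> ?P" "h y \<in> M" using x y by simp_all
    have nonzerodiv: "nonzerodivisor A (h w)" if w: "w \<in> ?P" "\<forall>F\<in>?P. w * F \<in> I \<longrightarrow> F \<in> I" for w
      unfolding nonzerodivisor_def carrier_A using w by (auto simp: h_zero_iff simp flip: h_mult)
    have reg': "\<exists>e\<in>carrier A. h F = h x \<otimes> e" if FG: "F \<in> ?P" "G \<in> ?P" "h y \<otimes> h F = h x \<otimes> h G" for F G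
    proof -
      have "y * F - x * G \<in> I" using FG xy h_eq_iff[of "y * F" "x * G"] by (simp add: h_mult)
      then obtain E where E: "E \<in> ?P" "F - x * E \<in> I" using reg FG(1,2) by blast
      then have "h F = h x \<otimes> h E" using FG xy h_eq_iff[of F "x * E"] by (simp add: h_mult)
      then show ?thesis using h_closed[OF E(1)] by (rule bexI)
    qed
    have "regular_pair A (h x) (h y)"
      unfolding regular_pair_def
    proof (intro conjI ballI impI)
      fix c d assume "c \<in> carrier A" "d \<in> carrier A" and eq: "h y \<otimes> c = h x \<otimes> d"
      then obtain F G where FG: "F \<in> ?P" "c = h F" "G \<in> ?P" "d = h G" unfolding carrier_A by blast
      then show "\<exists>e\<in>carrier A. c = h x \<otimes> e" using reg'[OF FG(1,3)] eq by simp
    qed (simp_all only: h_closed xy nonzerodiv[OF xy(1) nzx] nonzerodiv[OF xy(3) nzy])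
    moreover have "h F \<in> Idl {h x, h y} \<or> (\<exists>b\<in>carrier A. h F \<otimes> b \<ominus> h \<sigma> \<in> Idl {h x, h y})" if F: "F \<in> ?P" for F
    proof (cases "F \<in> pair_ideal r I x y")
      case False
      then obtain B where B: "B \<in> ?P" "F * B - \<sigma> \<in> pair_ideal r I x y" using dich F by blast
      have "h (F * B - \<sigma>) \<in> Idl {h x, h y}" using B F \<sigma> xy h_in_pair_ideal_iff by simp
      then show ?thesis using B(1) F \<sigma> by (auto simp: h_diff h_mult)
    qed (use h_in_pair_ideal_iff F xy in blast)
    moreover have "h s \<otimes> h \<sigma> \<notin> Idl {h x, h y}" if "s \<in> ?P" "h s \<notin> M" for s
      using bspec[OF out, of s] h_in_pair_ideal_iff[of "s * \<sigma>" x y] that \<sigma> xy by (simp add: h_mult)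
    ultimately show ?thesis
      using xy \<sigma> by (intro exI[of _ "h x"] exI[of _ "h y"] exI[of _ "h \<sigma>"]) (auto simp: carrier_A)
  qed
qed

end

lemma quotient_presentation_coordinate_ring:
  fixes I :: "'k::field mpol set"
  assumes I: "ideal I (poly_ring (Suc r))"
  shows "quotient_presentation (coordinate_ring r I) r I ((+>\<^bsub>poly_ring (Suc r)\<^esub>) I)"
proof -
  interpret I: ideal I "poly_ring (Suc r)" by fact
  interpret Q: cring "coordinate_ring r I"
    unfolding coordinate_ring_def by (rule I.quotient_is_cring[OF cring_poly_ring])
  have hom: "((+>\<^bsub>poly_ring (Suc r)\<^esub>) I) \<in> ring_hom (poly_ring (Suc r)) (coordinate_ring r I)"
    unfolding coordinate_ring_def by (rule I.rcos_ring_hom)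
  show ?thesis
  proof unfold_locales
    show "carrier (coordinate_ring r I) = ((+>\<^bsub>poly_ring (Suc r)\<^esub>) I) ` polys (Suc r)"
      by (auto simp: coordinate_ring_def FactRing_def A_RCOSETS_def')
    show "(I +>\<^bsub>poly_ring (Suc r)\<^esub> F = \<zero>\<^bsub>coordinate_ring r I\<^esub>) = (F \<in> I)" if "F \<in> polys (Suc r)" for F
      using that I.a_rcos_const[of F] I.a_rcos_self[of F] by (auto simp: coordinate_ring_def FactRing_def)
  qed (use ring_hom_add[OF hom] ring_hom_mult[OF hom] ring_hom_one[OF hom] in auto)
qed

section \<open>The Gorenstein property at all points of the cone\<close>

context nonzero_map
begin

lemma parameter_data_at_maximal:
  assumes max: "poly_maximal r m" and Im: "I \<subseteq> m"
  shows "parameter_data r I m"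
proof -
  interpret m: max_ideal r m a using assms r by unfold_locales
  show ?thesis
  proof (cases "X 0 \<in> m")
    case False
    then obtain \<kappa> \<eta> where \<kappa>: "\<kappa> \<noteq> 0" and pt: "\<And>i. i \<le> r \<Longrightarrow> X i - Const (\<kappa> * \<eta> ^ i) \<in> m"
      using m.affine_point by blast
    \<comment> \<open>The residues of the variables determine those of all polynomials, so m is the
      kernel of evaluation at z = \<kappa>, s = \<eta>.\<close>
    have val: "F - Const (poly (sp \<kappa> (par F)) \<eta>) \<in> m" if "F \<in> P" for F
      using that
    proof (induction F rule: polys_induct)
      case (Const c)
      then show ?case by simp
    next
      case (add F G)
      have "F + G - Const (poly (sp \<kappa> (par (F + G))) \<eta>) =
          (F - Const (poly (sp \<kappa> (par F)) \<eta>)) + (G - Const (poly (sp \<kappa> (par G)) \<eta>))" by simp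
      then show ?case using m.m_add[OF add(3,4)] by metis
    next
      case (X i F)
      have eq: "poly (sp \<kappa> (par (X i * F))) \<eta> = \<kappa> * \<eta> ^ i * poly (sp \<kappa> (par F)) \<eta>"
        by (simp add: sp_mon2 poly_monom)
      have "X i * F - Const (poly (sp \<kappa> (par (X i * F))) \<eta>) =
          X i * (F - Const (poly (sp \<kappa> (par F)) \<eta>)) +
          Const (poly (sp \<kappa> (par F)) \<eta>) * (X i - Const (\<kappa> * \<eta> ^ i))"
        unfolding eq Const_mult[of "\<kappa> * \<eta> ^ i" "poly (sp \<kappa> (par F)) \<eta>"] by (simp add: algebra_simps)
      moreover have "\<dots> \<in> m" using X pt[of i] by (intro m.m_add m.m_mult) auto
      ultimately show ?case by metis
    qed
    have "F \<in> m \<longleftrightarrow> poly (sp \<kappa> (par F)) \<eta> = 0" if "F \<in> P" for F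
    proof -
      let ?v = "poly (sp \<kappa> (par F)) \<eta>"
      have "F \<in> m \<longleftrightarrow> Const ?v \<in> m"
      proof
        assume "F \<in> m"
        from m.m_diff[OF this val[OF that]] show "Const ?v \<in> m" by simp
      next
        assume "Const ?v \<in> m"
        from m.m_add[OF this val[OF that]] show "F \<in> m" by simp
      qed
      then show ?thesis by (simp add: m.Const_in_m_iff)
    qed
    with \<kappa> show ?thesis by (rule affine_data)
  next
    case True
    then obtain c where "\<And>i. i < r \<Longrightarrow> X i \<in> m" "X r - Const c \<in> m" using m.point_at_infinity by blast
    then show ?thesis
      by (intro infinity_data[of m c]) (use m.m_polys m.m_add m.m_mult m.minors_in_m in auto)
  qed
qed

theorem coordinate_ring_gorenstein:
  shows "krull_dim (coordinate_ring r I) = 2" "cohen_macaulay_ring (coordinate_ring r I)"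
    "gorenstein_ring (coordinate_ring r I)"
proof -
  define A where "A = coordinate_ring r I"
  define h where "h = ((+>\<^bsub>poly_ring (Suc r)\<^esub>) I)"
  interpret h: quotient_presentation A r I h
    unfolding A_def h_def by (rule quotient_presentation_coordinate_ring[OF ideal_dker])
  have IP: "I \<subseteq> P" using dker_polys by blast
  have "n \<le> 2" if Q: "\<forall>i\<le>n. primeideal (Q i) A" "\<forall>i<n. Q i \<subset> Q (Suc i)" for n Q
  proof (rule ccontr)
    assume n: "\<not> n \<le> 2"
    define p where "p i = {F \<in> P. h F \<in> Q i}" for i
    have "p i \<subset> p (Suc i)" if i: "i < 3" for i
    proof -
      obtain b where b: "b \<in> Q (Suc i)" "b \<notin> Q i" "Q i \<subseteq> Q (Suc i)"
        using Q(2)[rule_format, of i] i n psubset_imp_ex_mem[of "Q i" "Q (Suc i)"] by auto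
      have "b \<in> carrier A" using Q(1) i n b(1) by (intro ideal.Icarr[OF primeideal.axioms(1)[of "Q (Suc i)"]]) auto
      then obtain F where "F \<in> P" "b = h F" by (auto simp: h.carrier_A)
      then show ?thesis using b unfolding p_def by blast
    qed
    moreover have "poly_prime r (p i)" if "i \<le> 3" for i
      unfolding p_def using Q(1) that n by (intro h.poly_prime_preimage) auto
    moreover have "I \<subseteq> p 0"
      unfolding p_def using Q(1) IP by (intro h.I_subset_preimage primeideal.axioms(1)) auto
    ultimately show False by (intro no_long_prime_chain[of r p a]) auto
  qed
  then have "krull_dim A \<le> enat 2" by (intro krull_dim_leI) blast
  then have dim: "krull_dim A \<le> 2" by (simp add: numeral_eq_enat)
  have "\<one>\<^bsub>A\<^esub> \<noteq> \<zero>\<^bsub>A\<^esub>"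
    using h.h_zero_iff[of 1] by (simp add: h.h_1 dker_def)
  then have ex: "\<exists>M. maximalideal M A" by (rule h.exists_maximalideal)
  have data: "\<exists>x y \<sigma>. x \<in> M \<and> y \<in> M \<and> regular_pair A x y \<and> \<sigma> \<in> carrier A \<and>
      (\<forall>b\<in>carrier A. b \<in> Idl\<^bsub>A\<^esub> {x, y} \<or> (\<exists>d\<in>carrier A. b \<otimes>\<^bsub>A\<^esub> d \<ominus>\<^bsub>A\<^esub> \<sigma> \<in> Idl\<^bsub>A\<^esub> {x, y})) \<and>
      (\<forall>s\<in>carrier A - M. s \<otimes>\<^bsub>A\<^esub> \<sigma> \<notin> Idl\<^bsub>A\<^esub> {x, y})" if M: "maximalideal M A" for M
  proof (rule h.parameters_of_parameter_data)
    have id: "ideal M A" using M by (rule maximalideal.axioms(1))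
    show "M \<subseteq> carrier A" using id by (rule ideal_subset_carrier)
    show "parameter_data r I {F \<in> polys (Suc r). h F \<in> M}"
      by (rule parameter_data_at_maximal[OF h.poly_maximal_preimage[OF M] h.I_subset_preimage[OF id IP]])
  qed
  show "krull_dim (coordinate_ring r I) = 2" "cohen_macaulay_ring (coordinate_ring r I)"
      "gorenstein_ring (coordinate_ring r I)"
    using gorenstein_criterion[OF h.is_cring h.noetherian dim ex data] by (simp_all add: A_def)
qed

end

text \<open>The coordinate functions witness openness; this whole set serves as the locus of general
  \<mu>.\<close>

lemma zariski_open_nonzero_maps: "zariski_open (r - 1) (nonzero_maps r :: (nat \<Rightarrow> 'k::comm_ring_1) set)"
proof -
  interpret at: coeff_hom "\<lambda>c :: 'k. c" a for a by unfold_locales auto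
  show ?thesis unfolding zariski_open_def nonzero_maps_def
    by (intro exI[of _ "X ` {..<r - 1}"]) auto
qed

theorem theorem4p4:
  fixes r :: nat
  assumes "r \<ge> 2"
  shows
    "(\<forall>a :: nat \<Rightarrow> 'k::{alg_closed_field, field_char_0}. a \<in> nonzero_maps r \<longrightarrow>
        is_curve r (double_structure_ideal r a) \<and>
        has_degree_and_genus r (double_structure_ideal r a) (2 * r) (int r + 1) \<and>
        non_degenerate r (double_structure_ideal r a) \<and>
        arithmetically_cohen_macaulay r (double_structure_ideal r a)) \<and>
     (\<exists>U :: (nat \<Rightarrow> 'k) set. zariski_open (r - 1) U \<and> U \<noteq> {} \<and> U \<subseteq> nonzero_maps r \<and>
        (\<forall>a\<in>U. arithmetically_gorenstein r (double_structure_ideal r a))) \<and>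
     (\<forall>\<alpha> \<beta> :: 'k. (\<alpha>, \<beta>) \<noteq> (0, 0) \<longrightarrow>
        (\<exists>J Z. rational_normal_curve (r - 1) J \<and> cone_over r J Z \<and>
           Z \<subseteq> double_structure_ideal r (\<lambda>i\<in>{..<r - 1}. \<alpha> ^ (r - 2 - i) * \<beta> ^ i)))"
proof (intro conjI allI impI)
  have map: "nonzero_map r a" if "a \<in> nonzero_maps r" for a :: "nat \<Rightarrow> 'k"
    using that assms by unfold_locales (auto simp: nonzero_maps_def)
  fix a :: "nat \<Rightarrow> 'k" assume a: "a \<in> nonzero_maps r"
  interpret nonzero_map r a by (rule map[OF a])
  show "is_curve r (double_structure_ideal r a)" "arithmetically_cohen_macaulay r (double_structure_ideal r a)"
    "non_degenerate r (double_structure_ideal r a)"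
    "has_degree_and_genus r (double_structure_ideal r a) (2 * r) (int r + 1)"
    unfolding double_structure_ideal_eq[OF assms] is_curve_def arithmetically_cohen_macaulay_def
    using coordinate_ring_gorenstein non_degenerate_dker degree_and_genus_dker[OF r nz] by auto
next
  have "arithmetically_gorenstein r (double_structure_ideal r a)" if a: "a \<in> nonzero_maps r" for a :: "nat \<Rightarrow> 'k"
  proof -
    interpret nonzero_map r a using a assms by unfold_locales (auto simp: nonzero_maps_def)
    show ?thesis
      unfolding double_structure_ideal_eq[OF assms] arithmetically_gorenstein_def by (rule coordinate_ring_gorenstein)
  qed
  \<comment> \<open>Non-emptiness: all entries 1, where r \<ge> 2 provides the index 0.\<close>
  moreover have "(\<lambda>i\<in>{..<r - 1}. 1 :: 'k) \<in> nonzero_maps r"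
    using assms by (auto simp: nonzero_maps_def affine_space_def intro!: exI[of _ 0])
  ultimately show "\<exists>U :: (nat \<Rightarrow> 'k) set. zariski_open (r - 1) U \<and> U \<noteq> {} \<and> U \<subseteq> nonzero_maps r \<and>
      (\<forall>a\<in>U. arithmetically_gorenstein r (double_structure_ideal r a))"
    using zariski_open_nonzero_maps by blast
next
  fix \<alpha> \<beta> :: 'k assume "(\<alpha>, \<beta>) \<noteq> (0, 0)"
  then show "\<exists>J Z. rational_normal_curve (r - 1) J \<and> cone_over r J Z \<and>
      Z \<subseteq> double_structure_ideal r (\<lambda>i\<in>{..<r - 1}. \<alpha> ^ (r - 2 - i) * \<beta> ^ i)"
    unfolding double_structure_ideal_eq[OF assms] by (intro cone_contains[OF assms]) auto
qed

end
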